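(* Let $G_0$ and $G_1$ be the order-$k$ de Bruijn graphs of two string collections $\mathcal{C}_0,\mathcal{C}_1$ over $\Sigma=\{1,\dots,\sigma\}$, given by their (variable order or plain) succinct representations, with $n_0$ and $n_1$ nodes and BOSS arrays of lengths $m_0$ and $m_1$; let $n=n_0+n_1$, $m=m_0+m_1$. Then the variable order representation (VO-BOSS) of the order-$k$ de Bruijn graph of $\mathcal{C}_0\cup\mathcal{C}_1$ can be computed in $\mathcal{O}(mk)$ time using $2n$ bits plus $\mathcal{O}(\sigma)$ words of working space.
   Context: Model: word-RAM with word size $w$ and $\sigma=w^{\mathcal{O}(1)}$. Working space means space used in addition to the input and the output (the output includes the LCS values). De Bruijn graph: prepend to each string $k$ copies of a symbol $\$\notin\Sigma$ smaller than all symbols of $\Sigma$; the order-$k$ de Bruijn graph has one node per distinct $k$-mer $v[1,k]$ occurring in the strings and an edge $(u,v)$ labeled $v[k]$ iff some string contains the $(k+1)$-mer $u[1,k]v[k]$. Let $\overleftarrow{v}=v[k]\cdots v[1]$. BOSS representation: nodes ordered $v_1,\dots,v_n$ with $\overleftarrow{v_1}\prec\cdots\prec\overleftarrow{v_n}$; $W_i$ is the sorted sequence of labels of edges leaving $v_i$ (or $\$$ if out-degree $0$); $W=W_1\cdots W_n$; $W^-[i]=1$ iff $W[i]$ is the label of an edge $(u,v)$ where $u$ is the smallest-ranked node with an edge to $v$; $\mathsf{last}[i]=1$ iff $i$ is the last position of some $W_j$. The variable order representation VO-BOSS consists of the BOSS representation together with, for $i=2,\dots,n$, the length of the longest common suffix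 of the $k$-mers of $v_{i-1}$ and $v_i$ (equivalently the longest common prefix of $\overleftarrow{v_{i-1}}$ and $\overleftarrow{v_i}$). *)

theory Defs
  imports Complex_Main "HOL-Library.Sublist" "HOL-Library.List_Lexorder" "HOL-Library.Log_Nat"
begin

unbundle bit_operations_syntax

section \<open>De Bruijn graphs and their BOSS representations\<close>

text \<open>Symbols are natural numbers: \<open>0\<close> is the padding symbol \<open>$\<close>, and the alphabet is
  \<open>{1..\<sigma>}\<close>.\<close>

type_synonym kmer = "nat list"

definition collection :: "nat \<Rightarrow> nat list set \<Rightarrow> bool" where
  "collection \<sigma> C \<longleftrightarrow> finite C \<and> (\<forall>s\<in>C. set s \<subseteq> {1..\<sigma>})"

definition occurs :: "nat \<Rightarrow> nat list set \<Rightarrow> nat list \<Rightarrow> bool" where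
  "occurs k C x \<longleftrightarrow> (\<exists>s\<in>C. sublist x (replicate k 0 @ s))"

record dbg =
  nodes :: "kmer set"
  edges :: "(kmer \<times> kmer) set"

text \<open>The label of an edge \<open>(u, v)\<close> is \<open>last v\<close>. That \<open>v\<close> is \<open>u\<close> shifted by one symbol is
  expressed by \<open>butlast v = tl u\<close>.\<close>

definition de_bruijn :: "nat \<Rightarrow> nat list set \<Rightarrow> dbg" where
  "de_bruijn k C =
    (let V = {v. length v = k \<and> occurs k C v}
     in \<lparr>nodes = V,
         edges = {(u, v). u \<in> V \<and> v \<in> V \<and> butlast v = tl u \<and> occurs k C (u @ [last v])}\<rparr>)"

text \<open>The order on lists is the lexicographic one of \<^theory>\<open>HOL-Library.List_Lexorder\<close>.\<close>

definition node_order :: "dbg \<Rightarrow> kmer list" where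
  "node_order G = map rev (sorted_list_of_set (rev ` nodes G))"

definition out_labels :: "dbg \<Rightarrow> kmer \<Rightarrow> nat list" where
  "out_labels G u =
    (let L = {last v |v. (u, v) \<in> edges G} in if L = {} then [0] else sorted_list_of_set L)"

definition first_in_edge :: "dbg \<Rightarrow> kmer \<Rightarrow> nat \<Rightarrow> bool" where
  "first_in_edge G u a \<longleftrightarrow>
    (\<exists>v. (u, v) \<in> edges G \<and> last v = a \<and> (\<forall>u'. (u', v) \<in> edges G \<longrightarrow> rev u \<le> rev u'))"

definition lcs_length :: "nat list \<Rightarrow> nat list \<Rightarrow> nat" where
  "lcs_length u v = Max {length x |x. suffix x u \<and> suffix x v}"

text \<open>The plain representation has \<open>boss_lcs = None\<close>. In the variable order representation
  \<open>boss_lcs\<close> has one entry per pair of consecutive nodes, hence one less than the number of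
  nodes.\<close>

record boss =
  boss_W :: "nat list"
  boss_Wminus :: "nat list"
  boss_last :: "nat list"
  boss_lcs :: "nat list option"

definition plain_boss :: "dbg \<Rightarrow> boss" where
  "plain_boss G = \<lparr>
    boss_W = concat (map (out_labels G) (node_order G)),
    boss_Wminus =
      concat (map (\<lambda>u. map (\<lambda>a. of_bool (first_in_edge G u a)) (out_labels G u)) (node_order G)),
    boss_last =
      concat (map (\<lambda>u. replicate (length (out_labels G u) - 1) 0 @ [1]) (node_order G)),
    boss_lcs = None\<rparr>"

definition vo_boss :: "dbg \<Rightarrow> boss" where
  "vo_boss G = (plain_boss G)\<lparr>boss_lcs :=
    Some (map (\<lambda>i. lcs_length (node_order G ! (i - 1)) (node_order G ! i))
              [1..<length (node_order G)])\<rparr>"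

definition lcs_array :: "boss \<Rightarrow> nat list" where
  "lcs_array R = (case boss_lcs R of None \<Rightarrow> [] | Some l \<Rightarrow> l)"


section \<open>A word RAM\<close>

text \<open>
  Structured programs over registers holding words of \<open>w\<close> bits and over a memory divided into
  named arrays. A program does not depend on \<open>w\<close>, but it can read the value of \<open>w\<close>. An array of
  field width \<open>b \<le> w\<close> is a packed array of \<open>b\<close>-bit fields: its length times \<open>b\<close> is the number of
  bits it occupies, and a field is accessed by a constant number of word operations (shifts and
  masks), so it is charged unit cost. A store keeps the \<open>b\<close> low bits of the value. Accesses out of
  bounds and stores to read-only arrays have no execution. The registers of a program are the
  finitely many that occur in it.
\<close>

datatype binop = Add | Sub | Mul | Div | Mod | And | Or | Xor | Shl | Shr | Less | Equal

datatype expr = Const nat | Reg nat | Word_Size | Bin binop expr expr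

datatype 's com =
    Skip
  | Assign nat expr
  | Load nat 's expr
  | Store 's expr expr
  | Seq "'s com" "'s com"
  | If expr "'s com" "'s com"
  | While expr "'s com"

type_synonym 's state = "(nat \<Rightarrow> nat) \<times> ('s \<Rightarrow> nat list)"

record 's machine =
  word_size :: nat
  field_width :: "'s \<Rightarrow> nat"
  writable :: "'s \<Rightarrow> bool"

fun apply_binop :: "nat \<Rightarrow> binop \<Rightarrow> nat \<Rightarrow> nat \<Rightarrow> nat" where
  "apply_binop w Add a b = (a + b) mod 2 ^ w"
| "apply_binop w Sub a b = (2 ^ w + a - b) mod 2 ^ w"
| "apply_binop w Mul a b = (a * b) mod 2 ^ w"
| "apply_binop w Div a b = a div b"
| "apply_binop w Mod a b = a mod b"
| "apply_binop w And a b = a AND b"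
| "apply_binop w Or a b = a OR b"
| "apply_binop w Xor a b = a XOR b"
| "apply_binop w Shl a b = take_bit w (push_bit b a)"
| "apply_binop w Shr a b = drop_bit b a"
| "apply_binop w Less a b = of_bool (a < b)"
| "apply_binop w Equal a b = of_bool (a = b)"

fun eval_expr :: "nat \<Rightarrow> (nat \<Rightarrow> nat) \<Rightarrow> expr \<Rightarrow> nat" where
  "eval_expr w r (Const n) = n mod 2 ^ w"
| "eval_expr w r (Reg x) = r x"
| "eval_expr w r Word_Size = w"
| "eval_expr w r (Bin f e1 e2) = apply_binop w f (eval_expr w r e1) (eval_expr w r e2)"

fun expr_cost :: "expr \<Rightarrow> nat" where
  "expr_cost (Bin f e1 e2) = 1 + expr_cost e1 + expr_cost e2"
| "expr_cost _ = 1"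

text \<open>\<open>exec M P s t s'\<close>: on machine \<open>M\<close>, program \<open>P\<close> started in state \<open>s\<close> terminates in state \<open>s'\<close>
  after \<open>t\<close> elementary operations.\<close>

inductive exec :: "'s machine \<Rightarrow> 's com \<Rightarrow> 's state \<Rightarrow> nat \<Rightarrow> 's state \<Rightarrow> bool" for M where
  Skip: "exec M Skip s 1 s"
| Assign: "exec M (Assign x e) (r, h) (1 + expr_cost e) (r(x := eval_expr (word_size M) r e), h)"
| Load: "i = eval_expr (word_size M) r e \<Longrightarrow> i < length (h a) \<Longrightarrow>
    exec M (Load x a e) (r, h) (1 + expr_cost e) (r(x := h a ! i), h)"
| Store: "i = eval_expr (word_size M) r e1 \<Longrightarrow> i < length (h a) \<Longrightarrow> writable M a \<Longrightarrow>
    y = eval_expr (word_size M) r e2 mod 2 ^ field_width M a \<Longrightarrow>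
    exec M (Store a e1 e2) (r, h) (1 + expr_cost e1 + expr_cost e2) (r, h(a := (h a)[i := y]))"
| Seq: "exec M c1 s t1 s1 \<Longrightarrow> exec M c2 s1 t2 s2 \<Longrightarrow> exec M (Seq c1 c2) s (t1 + t2) s2"
| IfTrue: "eval_expr (word_size M) r e \<noteq> 0 \<Longrightarrow> exec M c1 (r, h) t s' \<Longrightarrow>
    exec M (If e c1 c2) (r, h) (1 + expr_cost e + t) s'"
| IfFalse: "eval_expr (word_size M) r e = 0 \<Longrightarrow> exec M c2 (r, h) t s' \<Longrightarrow>
    exec M (If e c1 c2) (r, h) (1 + expr_cost e + t) s'"
| WhileFalse: "eval_expr (word_size M) r e = 0 \<Longrightarrow>
    exec M (While e c) (r, h) (1 + expr_cost e) (r, h)"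
| WhileTrue: "eval_expr (word_size M) r e \<noteq> 0 \<Longrightarrow> exec M c (r, h) t1 s1 \<Longrightarrow>
    exec M (While e c) s1 t2 s2 \<Longrightarrow>
    exec M (While e c) (r, h) (1 + expr_cost e + t1 + t2) s2"


inductive_cases exec_SkipE: "exec M Skip s t s'"
  and exec_AssignE: "exec M (Assign x e) s t s'"
  and exec_LoadE: "exec M (Load x a e) s t s'"
  and exec_StoreE: "exec M (Store a e1 e2) s t s'"
  and exec_SeqE: "exec M (Seq c1 c2) s t s'"
  and exec_IfE: "exec M (If e c1 c2) s t s'"
  and exec_WhileE: "exec M (While e c) s t s'"

lemma exec_deterministic:
  "exec M c s t s' \<Longrightarrow> exec M c s u s'' \<Longrightarrow> u = t \<and> s'' = s'"
proof (induction arbitrary: u s'' rule: exec.induct)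
  case (Skip s)
  then show ?case by (elim exec_SkipE) simp_all
next
  case (Assign x e r h)
  then show ?case by (elim exec_AssignE) simp_all
next
  case (Load i r e h a x)
  from Load.prems Load.hyps show ?case by (elim exec_LoadE) simp_all
next
  case (Store i r e1 h a y e2)
  from Store.prems Store.hyps show ?case by (elim exec_StoreE) simp_all
next
  case (Seq c1 s t1 s1 c2 t2 s2)
  from Seq.prems obtain t1' s1' t2' where "u = t1' + t2'"
    and "exec M c1 s t1' s1'" and "exec M c2 s1' t2' s''"
    by (rule exec_SeqE)
  with Seq.IH(1)[of t1' s1'] Seq.IH(2)[of t2' s''] show ?case by simp
next
  case (IfTrue r e c1 h t s' c2)
  from IfTrue.prems IfTrue.hyps obtain t' where "u = 1 + expr_cost e + t'"
    and "exec M c1 (r, h) t' s''"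
    by (elim exec_IfE) simp_all
  with IfTrue.IH[of t' s''] show ?case by simp
next
  case (IfFalse r e c2 h t s' c1)
  from IfFalse.prems IfFalse.hyps obtain t' where "u = 1 + expr_cost e + t'"
    and "exec M c2 (r, h) t' s''"
    by (elim exec_IfE) simp_all
  with IfFalse.IH[of t' s''] show ?case by simp
next
  case (WhileFalse r e c h)
  from WhileFalse.prems show ?case
    by (rule exec_WhileE) (use WhileFalse.hyps in simp_all)
next
  case (WhileTrue r e c h t1 s1 t2 s2)
  from WhileTrue.prems obtain t1' s1' t2' where "u = 1 + expr_cost e + t1' + t2'"
    and "exec M c (r, h) t1' s1'" and "exec M (While e c) s1' t2' s''"
    by (rule exec_WhileE) (use WhileTrue.hyps in simp_all)
  with WhileTrue.IH(1)[of t1' s1'] WhileTrue.IH(2)[of t2' s''] show ?case by simp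
qed


section \<open>Memory layout for the merging problem\<close>

text \<open>The Boolean index of an input array selects the first (\<open>False\<close>) or second (\<open>True\<close>) graph.\<close>

datatype segment =
    In_W bool | In_Wminus bool | In_last bool | In_lcs bool
  | Out_W | Out_Wminus | Out_last | Out_lcs
  | Work_Bits | Work_Words nat

text \<open>\<open>floorlog 2 x\<close> is the number of bits of the binary representation of \<open>x\<close>. Entries of \<open>W\<close> are
  at most \<open>\<sigma>\<close>, and LCS values of distinct \<open>k\<close>-mers are at most \<open>k - 1\<close>.\<close>

fun merge_width :: "nat \<Rightarrow> nat \<Rightarrow> nat \<Rightarrow> segment \<Rightarrow> nat" where
  "merge_width w k \<sigma> (In_W _) = floorlog 2 \<sigma>"
| "merge_width w k \<sigma> (In_Wminus _) = 1"
| "merge_width w k \<sigma> (In_last _) = 1"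
| "merge_width w k \<sigma> (In_lcs _) = floorlog 2 (k - 1)"
| "merge_width w k \<sigma> Out_W = floorlog 2 \<sigma>"
| "merge_width w k \<sigma> Out_Wminus = 1"
| "merge_width w k \<sigma> Out_last = 1"
| "merge_width w k \<sigma> Out_lcs = floorlog 2 (k - 1)"
| "merge_width w k \<sigma> Work_Bits = 1"
| "merge_width w k \<sigma> (Work_Words _) = w"

fun merge_writable :: "segment \<Rightarrow> bool" where
  "merge_writable (In_W _) = False"
| "merge_writable (In_Wminus _) = False"
| "merge_writable (In_last _) = False"
| "merge_writable (In_lcs _) = False"
| "merge_writable _ = True"

definition merge_machine :: "nat \<Rightarrow> nat \<Rightarrow> nat \<Rightarrow> segment machine" where
  "merge_machine w k \<sigma> =
    \<lparr>word_size = w, field_width = merge_width w k \<sigma>, writable = merge_writable\<rparr>"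

text \<open>Initial memory for inputs \<open>R0\<close>, \<open>R1\<close>. Output arrays have exactly the size of the result \<open>R\<close>;
  they can be read back and overwritten during the computation. The working space consists of
  \<open>2 * n\<close> bits and of \<open>K\<close> arrays of \<open>\<sigma>\<close> words. Everything except the input is zeroed.\<close>

fun merge_memory :: "nat \<Rightarrow> nat \<Rightarrow> nat \<Rightarrow> boss \<Rightarrow> boss \<Rightarrow> boss \<Rightarrow> segment \<Rightarrow> nat list" where
  "merge_memory K \<sigma> n R0 R1 R (In_W b) = boss_W (if b then R1 else R0)"
| "merge_memory K \<sigma> n R0 R1 R (In_Wminus b) = boss_Wminus (if b then R1 else R0)"
| "merge_memory K \<sigma> n R0 R1 R (In_last b) = boss_last (if b then R1 else R0)"
| "merge_memory K \<sigma> n R0 R1 R (In_lcs b) = lcs_array (if b then R1 else R0)"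
| "merge_memory K \<sigma> n R0 R1 R Out_W = replicate (length (boss_W R)) 0"
| "merge_memory K \<sigma> n R0 R1 R Out_Wminus = replicate (length (boss_Wminus R)) 0"
| "merge_memory K \<sigma> n R0 R1 R Out_last = replicate (length (boss_last R)) 0"
| "merge_memory K \<sigma> n R0 R1 R Out_lcs = replicate (length (lcs_array R)) 0"
| "merge_memory K \<sigma> n R0 R1 R Work_Bits = replicate (2 * n) 0"
| "merge_memory K \<sigma> n R0 R1 R (Work_Words j) = (if j < K then replicate \<sigma> 0 else [])"

definition merge_registers :: "nat \<Rightarrow> nat \<Rightarrow> nat \<Rightarrow> nat \<Rightarrow> nat \<Rightarrow> nat \<Rightarrow> nat \<Rightarrow> nat" where
  "merge_registers k \<sigma> n0 n1 m0 m1 =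
    (\<lambda>_. 0)(0 := k, 1 := \<sigma>, 2 := n0, 3 := n1, 4 := m0, 5 := m1)"

text \<open>The result: the arrays in the output area, with the number of nodes and the length of the
  BOSS arrays in registers \<open>0\<close> and \<open>1\<close>.\<close>

definition returns_boss :: "segment state \<Rightarrow> nat \<Rightarrow> boss \<Rightarrow> bool" where
  "returns_boss s n R \<longleftrightarrow>
    R = \<lparr>boss_W = snd s Out_W, boss_Wminus = snd s Out_Wminus, boss_last = snd s Out_last,
         boss_lcs = Some (snd s Out_lcs)\<rparr> \<and>
    fst s 0 = n \<and> fst s 1 = length (boss_W R)"

text \<open>The usual word RAM convention: a word can hold the parameters and the index of any bit of the
  (plain) input, whose BOSS arrays have total length \<open>m\<close>.\<close>

definition word_size_ok :: "nat \<Rightarrow> nat \<Rightarrow> nat \<Rightarrow> nat \<Rightarrow> bool" where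
  "word_size_ok w k \<sigma> m \<longleftrightarrow> k < 2 ^ w \<and> \<sigma> < 2 ^ w \<and> m * (floorlog 2 \<sigma> + 2) < 2 ^ w"

end

theory Submission
  imports Defs "HOL-Library.Product_Lexorder" "HOL-Library.Multiset"
begin

text \<open>
  Reverse all \<open>k\<close>-mers, so that the node order is lexicographic. The nodes of both graphs, sorted
  together by their first \<open>h + 1\<close> symbols, arise from their order by the first \<open>h\<close> symbols by a
  stable counting sort of the edges by label, since every node except \<open>$\<^sup>k\<close> is the target of exactly
  one edge flagged in \<open>W\<^sup>-\<close>. An order of this kind is stored as a bit vector that gives the graph each
  node comes from; the BOSS arrays themselves are only read from left to right. After \<open>k\<close> passes,
  a node that occurs in both graphs occupies two consecutive positions. These are found by running the
  \<open>k\<close> passes twice, with ties broken in favour of either graph: the two bit vectors differ exactly there.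
  With these \<open>2n\<close> bits the BOSS arrays are merged in one scan.

  The LCS values are computed on the merged graph by the same passes, which now maintain a bit
  vector of the boundaries between nodes that differ in their first \<open>h\<close> symbols: pass \<open>h\<close> increments the
  LCS value of every position that is not a boundary.

  A pass may not spend time \<open>\<sigma>\<close>, which can exceed \<open>m\<close>. Only the \<open>d \<le> m\<close> labels that occur are
  visited, after sorting them once in time \<open>O(d)\<close>, which is possible because of \<open>\<sigma> \<le> w\<^sup>c\<close>.
\<close>

text \<open>The \<open>2 * n\<close> bits must hold the old and the new order during a pass, so
  nothing else can be stored per node. This shapes the rest. The bit vector alone determines the
  order, because the nodes of one graph keep their relative order at every stage. The flags of the
  merged graph are found without comparing nodes: the bucket cursors of the counting sort are
  replayed over the merged edges, and the position that an edge receives in the final order shows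
  whether an earlier edge has the same target. The LCS values wait until the merge is complete,
  since then the node order is that of the arrays, no order has to be stored, and both halves are
  free for boundary bits. A block of nodes with a common prefix is named by the position of its
  first node, so that one word per label suffices to compare blocks. Each stage is specified as the
  sorted list for an injective key; a pass is then an equation between two such lists, independent
  of any program.\<close>

section \<open>Positions in filtered lists and in concatenations of flagged blocks\<close>

lemma filter_take_Suc:
  "t < length xs \<Longrightarrow>
    filter P (take (Suc t) xs) = filter P (take t xs) @ (if P (xs ! t) then [xs ! t] else [])"
  by (simp add: take_Suc_conv_app_nth)

lemma filter_nth_count:
  assumes "t < length xs" "P (xs ! t)"
  shows "length (filter P (take t xs)) < length (filter P xs)"
    and "filter P xs ! length (filter P (take t xs)) = xs ! t"
proof -
  have "xs = take t xs @ xs ! t # drop (Suc t) xs" using assms(1) by (rule id_take_nth_drop)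
  then have *: "filter P xs = filter P (take t xs) @ xs ! t # filter P (drop (Suc t) xs)"
    using assms(2) by (metis filter.simps(2) filter_append)
  then show "length (filter P (take t xs)) < length (filter P xs)"
    by (metis length_append less_add_same_cancel1 length_greater_0_conv list.distinct(1))
  show "filter P xs ! length (filter P (take t xs)) = xs ! t" using * by (metis nth_append_length)
qed

lemma filter_nth_index:
  "j < length (filter P xs) \<Longrightarrow>
    \<exists>t<length xs. P (xs ! t) \<and> length (filter P (take t xs)) = j \<and> filter P xs ! j = xs ! t"
proof (induction xs rule: rev_induct)
  case (snoc x xs)
  show ?case
  proof (cases "j < length (filter P xs)")
    case True
    with snoc.IH obtain t where "t < length xs" "P (xs ! t)" "length (filter P (take t xs)) = j"
      "filter P xs ! j = xs ! t" by blast
    then show ?thesis using True by (intro exI[of _ t]) (simp add: nth_append)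
  next
    case False
    with snoc.prems have "P x" "j = length (filter P xs)" by (auto split: if_splits)
    then show ?thesis by (intro exI[of _ "length xs"]) simp
  qed
qed simp

lemma filter_nth_next:
  assumes "length (filter P (take t xs)) < length (filter P xs)"
  obtains s where "t \<le> s" "s < length xs" "P (xs ! s)"
    "filter P xs ! length (filter P (take t xs)) = xs ! s"
    "\<And>i. t \<le> i \<Longrightarrow> i < s \<Longrightarrow> \<not> P (xs ! i)"
proof -
  obtain s where s: "s < length xs" "P (xs ! s)"
    "length (filter P (take s xs)) = length (filter P (take t xs))"
    "filter P xs ! length (filter P (take t xs)) = xs ! s"
    using filter_nth_index[OF assms] by blast
  have mono: "length (filter P (take i xs)) \<le> length (filter P (take j xs))" if "i \<le> j" for i j
  proof -
    have "take j xs = take i xs @ take (j - i) (drop i xs)" using that by (metis le_add_diff_inverse take_add)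
    then show ?thesis by simp
  qed
  have inc: "length (filter P (take i xs)) < length (filter P (take j xs))"
    if "i < j" "i < length xs" "P (xs ! i)" for i j
    using mono[of "Suc i" j] that by (simp add: filter_take_Suc)
  have "t \<le> s" using inc[of s t] s by (metis leI less_irrefl)
  moreover have "\<not> P (xs ! i)" if "t \<le> i" "i < s" for i
    using inc[of i s] mono[of t i] s that by fastforce
  ultimately show thesis using that s by blast
qed

text \<open>Each block carries exactly one flag, at its end, so the flags passed before position
  \<open>t\<close> count the completed blocks. A left-to-right scan of a BOSS array thus knows its
  node by counting the bits of \<open>last\<close>.\<close>

lemma concat_flagged_nth:
  assumes "\<And>x. x \<in> set xs \<Longrightarrow> bl x \<noteq> [] \<and> P (last (bl x)) \<and> (\<forall>y\<in>set (butlast (bl x)). \<not> P y)"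
    and "t < length (concat (map bl xs))"
  shows "length (filter P (take t (concat (map bl xs)))) < length xs \<and>
    concat (map bl xs) ! t \<in> set (bl (xs ! length (filter P (take t (concat (map bl xs))))))"
  using assms
proof (induction xs arbitrary: t)
  case (Cons x xs)
  have x: "bl x \<noteq> []" "P (last (bl x))" "\<And>y. y \<in> set (butlast (bl x)) \<Longrightarrow> \<not> P y"
    using Cons.prems(1)[of x] by auto
  have full: "filter P (bl x) = [last (bl x)]"
    using x by (subst append_butlast_last_id[symmetric, OF x(1)]) (simp add: filter_empty_conv del: append_butlast_last_id)
  show ?case
  proof (cases "t < length (bl x)")
    case True
    then have "take t (bl x) = take t (butlast (bl x))"
      by (simp add: take_butlast)
    then have "filter P (take t (bl x)) = []"
      using x(3) by (auto simp: filter_empty_conv dest: in_set_takeD)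
    then show ?thesis using True by (simp add: nth_append)
  next
    case False
    then obtain u where u: "t = length (bl x) + u" using le_iff_add by (metis leI)
    have "u < length (concat (map bl xs))" using Cons.prems(2) u by simp
    from Cons.IH[OF Cons.prems(1) this] show ?thesis using u full by (simp add: nth_append)
  qed
qed simp

lemma concat_flagged_count:
  assumes "\<And>x. x \<in> set xs \<Longrightarrow> bl x \<noteq> [] \<and> P (last (bl x)) \<and> (\<forall>y\<in>set (butlast (bl x)). \<not> P y)"
  shows "length (filter P (concat (map bl xs))) = length xs"
  using assms
proof (induction xs)
  case (Cons x xs)
  have x: "bl x \<noteq> []" "P (last (bl x))" "\<And>y. y \<in> set (butlast (bl x)) \<Longrightarrow> \<not> P y"
    using Cons.prems(1)[of x] by auto
  have full: "filter P (bl x) = [last (bl x)]"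
    using x by (subst append_butlast_last_id[symmetric, OF x(1)]) (simp add: filter_empty_conv del: append_butlast_last_id)
  have "length (filter P (concat (map bl xs))) = length xs"
    by (rule Cons.IH) (use Cons.prems in auto)
  then show ?case using full by simp
qed simp

section \<open>Stable sorting by counting\<close>

text \<open>The position of the entry \<open>xs ! i\<close> in \<^term>\<open>sort_key f xs\<close>, as found by counting sort.\<close>

definition rank :: "('a \<Rightarrow> 'b::linorder) \<Rightarrow> 'a list \<Rightarrow> nat \<Rightarrow> nat" where
  "rank f xs i = length (filter (\<lambda>x. f x < f (xs ! i)) xs) +
    length (filter (\<lambda>x. f x = f (xs ! i)) (take i xs))"

lemma sorted_three_parts:
  fixes f :: "'a \<Rightarrow> 'b::linorder"
  assumes "sorted (map f ys)"
  shows "ys = filter (\<lambda>y. f y < a) ys @ filter (\<lambda>y. f y = a) ys @ filter (\<lambda>y. a < f y) ys"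
  using assms
proof (induction ys)
  case (Cons y ys)
  consider "f y < a" | "f y = a" | "a < f y" by fastforce
  then show ?case
  proof cases
    case 1
    then show ?thesis using Cons by auto
  next
    case 2
    then have "filter (\<lambda>y. f y < a) ys = []" using Cons.prems by (auto simp: filter_empty_conv)
    then show ?thesis using Cons 2 by auto
  next
    case 3
    then have "\<forall>z\<in>set ys. a < f z" using Cons.prems by auto
    then show ?thesis using 3 by (auto simp: filter_empty_conv filter_id_conv)
  qed
qed simp

text \<open>Stability leaves the entries with key \<open>a\<close> in their original order, between
  the smaller and the larger ones; this is why counting sort needs only the number of smaller keys
  and of earlier equal ones.\<close>

lemma sort_key_parts:
  "sort_key f xs = sort_key f (filter (\<lambda>x. f x < a) xs) @ filter (\<lambda>x. f x = a) xs @
    sort_key f (filter (\<lambda>x. a < f x) xs)"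
  using sorted_three_parts[OF sorted_sort_key, of f xs a]
  by (simp only: sort_key_stable) (simp only: filter_sort)

lemma sort_key_nth_rank:
  assumes "i < length xs"
  shows "rank f xs i < length xs" and "sort_key f xs ! rank f xs i = xs ! i"
proof -
  let ?P = "\<lambda>x. f x = f (xs ! i)"
  have *: "length (filter ?P (take i xs)) < length (filter ?P xs)"
    "filter ?P xs ! length (filter ?P (take i xs)) = xs ! i"
    using filter_nth_count[of i xs ?P] assms by auto
  have eq: "sort_key f xs = sort_key f (filter (\<lambda>x. f x < f (xs ! i)) xs) @ filter ?P xs @
    sort_key f (filter (\<lambda>x. f (xs ! i) < f x) xs)" by (rule sort_key_parts)
  from arg_cong[OF eq, of length] * show "rank f xs i < length xs" by (simp add: rank_def)
  show "sort_key f xs ! rank f xs i = xs ! i"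
    using * by (subst eq) (simp add: rank_def nth_append)
qed

text \<open>Every output position is reached, so knowing what is written for each processed entry
  determines the whole output of a pass.\<close>

lemma rank_surj:
  assumes "p < length xs"
  shows "\<exists>i<length xs. rank f xs i = p"
proof -
  define a where "a = f (sort_key f xs ! p)"
  let ?ys = "sort_key f xs"
  have eq: "?ys = sort_key f (filter (\<lambda>x. f x < a) xs) @ filter (\<lambda>x. f x = a) xs @
    sort_key f (filter (\<lambda>x. a < f x) xs)" by (rule sort_key_parts)
  let ?l = "length (filter (\<lambda>x. f x < a) xs)" and ?m = "length (filter (\<lambda>x. f x = a) xs)"
  have l: "?l \<le> p"
  proof (rule ccontr)
    assume "\<not> ?l \<le> p"
    then have "?ys ! p = sort_key f (filter (\<lambda>x. f x < a) xs) ! p"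
      by (subst eq) (simp add: nth_append)
    moreover have "p < length (sort_key f (filter (\<lambda>x. f x < a) xs))" using \<open>\<not> ?l \<le> p\<close> by simp
    ultimately have "?ys ! p \<in> set (filter (\<lambda>x. f x < a) xs)" using nth_mem by (metis set_sort)
    then show False by (simp add: a_def)
  qed
  moreover have "p - ?l < ?m"
  proof (rule ccontr)
    assume *: "\<not> p - ?l < ?m"
    have len: "length xs = ?l + (?m + length (filter (\<lambda>x. a < f x) xs))"
      using arg_cong[OF eq, of length] by simp
    have "?ys ! p = sort_key f (filter (\<lambda>x. a < f x) xs) ! (p - ?l - ?m)"
      using * l by (subst eq) (simp add: nth_append)
    moreover have "p - ?l - ?m < length (sort_key f (filter (\<lambda>x. a < f x) xs))"
      using * l len assms by simp
    ultimately have "?ys ! p \<in> set (filter (\<lambda>x. a < f x) xs)" using nth_mem by (metis set_sort)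
    then show False by (simp add: a_def)
  qed
  then obtain i where "i < length xs" "f (xs ! i) = a"
    "length (filter (\<lambda>x. f x = a) (take i xs)) = p - ?l"
    using filter_nth_index[of "p - ?l" "\<lambda>x. f x = a" xs] by blast
  with l show ?thesis by (intro exI[of _ i]) (simp add: rank_def)
qed

text \<open>An order \<open>R\<close> reached so far survives as the tie-breaker of a stable sort by
  \<open>f\<close>. This drives the passes over the nodes as well as the digit passes over the
  labels.\<close>

lemma sorted_wrt_sort_key:
  assumes "sorted_wrt R xs"
  shows "sorted_wrt (\<lambda>x y. f x < f y \<or> f x = f y \<and> R x y) (sort_key f xs)"
  using assms
proof (induction xs)
  case (Cons x xs)
  let ?Q = "\<lambda>x y. f x < f y \<or> f x = f y \<and> R x y"
  have ins: "sorted_wrt ?Q (insort_key f x ys)"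
    if "sorted_wrt ?Q ys" "sorted (map f ys)" "\<And>y. y \<in> set ys \<Longrightarrow> R x y" for ys
    using that
  proof (induction ys)
    case (Cons y ys)
    show ?case
    proof (cases "f x \<le> f y")
      case True
      have "f x \<le> f z" if "z \<in> set (y # ys)" for z
        using that Cons.prems(2) True by (auto intro: order_trans)
      then show ?thesis using True Cons.prems by (auto simp: le_less)
    next
      case False
      then show ?thesis using Cons by (auto simp: set_insort_key)
    qed
  qed simp
  show ?case using Cons ins[of "sort_key f xs"] by simp
qed simp

section \<open>De Bruijn graphs with reversed nodes\<close>

lemma take_le_take:
  fixes x y :: "'a::linorder list"
  shows "x \<le> y \<Longrightarrow> take h x \<le> take h y"
proof (induction h arbitrary: x y)
  case (Suc h)
  then show ?case by (cases x; cases y) auto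
qed simp

lemma less_if_take_less:
  fixes x y :: "'a::linorder list"
  shows "take h x < take h y \<Longrightarrow> x < y"
  using take_le_take[of y x h] by force

definition out_syms :: "(nat list \<times> nat) set \<Rightarrow> nat list \<Rightarrow> nat list" where
  "out_syms X x = (let L = {a. (x, a) \<in> X} in if L = {} then [0] else sorted_list_of_set L)"

text \<open>\<open>W\<close>, \<open>W\<^sup>-\<close> and \<open>last\<close> are images of this
  one list under three functions, so all three arrays can be treated by reasoning about pairs of a
  node and a label.\<close>

definition entries :: "nat list set \<Rightarrow> (nat list \<times> nat) set \<Rightarrow> (nat list \<times> nat) list" where
  "entries V X = concat (map (\<lambda>x. map (Pair x) (out_syms X x)) (sorted_list_of_set V))"

text \<open>The flag of \<open>W\<^sup>-\<close>: two edges with the same label have the same target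
  exactly when their reversed sources agree up to the last symbol.\<close>

definition first_edge :: "(nat list \<times> nat) set \<Rightarrow> nat list \<times> nat \<Rightarrow> bool" where
  "first_edge X e \<longleftrightarrow> e \<in> X \<and>
    (\<forall>x. (x, snd e) \<in> X \<longrightarrow> butlast x = butlast (fst e) \<longrightarrow> fst e \<le> x)"

definition last_entry :: "(nat list \<times> nat) set \<Rightarrow> nat list \<times> nat \<Rightarrow> bool" where
  "last_entry X e \<longleftrightarrow> snd e = last (out_syms X (fst e))"

definition target :: "nat list \<times> nat \<Rightarrow> nat list" where
  "target e = snd e # butlast (fst e)"

lemma target_simp: "target (x, a) = a # butlast x"
  by (simp add: target_def)

text \<open>Nodes are reversed, so that the BOSS order on nodes is the lexicographic one, and \<open>(x, a) \<in> X\<close>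
  is an edge with label \<open>a\<close> from \<open>x\<close> to \<^term>\<open>target (x, a)\<close>.\<close>

locale graph =
  fixes k :: nat and V :: "nat list set" and X :: "(nat list \<times> nat) set"
  assumes k_pos: "1 \<le> k" and finite_V: "finite V" and length_V: "x \<in> V \<Longrightarrow> length x = k"
    and edgeD: "(x, a) \<in> X \<Longrightarrow> x \<in> V \<and> a # butlast x \<in> V \<and> 1 \<le> a"
    and ex_pred: "y \<in> V \<Longrightarrow> y \<noteq> replicate k 0 \<Longrightarrow> \<exists>x. (x, hd y) \<in> X \<and> butlast x = tl y"
    and hd_zero: "y \<in> V \<Longrightarrow> hd y = 0 \<Longrightarrow> y = replicate k 0"
    and source: "V \<noteq> {} \<Longrightarrow> replicate k 0 \<in> V"
begin

lemma finite_out: "finite {a. (x, a) \<in> X}"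
proof -
  have "{a. (x, a) \<in> X} \<subseteq> hd ` V" using edgeD by force
  then show ?thesis using finite_V finite_surj by blast
qed

lemma out_syms_nonempty: "out_syms X x \<noteq> []"
  using finite_out[of x] by (auto simp: out_syms_def Let_def sorted_list_of_set_eq_Nil_iff)

lemma strict_sorted_out_syms: "sorted_wrt (<) (out_syms X x)"
  by (simp add: out_syms_def Let_def)

lemma set_out_syms:
  "set (out_syms X x) = (if {a. (x, a) \<in> X} = {} then {0} else {a. (x, a) \<in> X})"
  using finite_out[of x] by (simp add: out_syms_def Let_def)

lemma zero_in_out_syms: "0 \<in> set (out_syms X x) \<longleftrightarrow> {a. (x, a) \<in> X} = {}"
  using edgeD by (fastforce simp: set_out_syms split: if_splits)

lemma in_X_iff: "(x, a) \<in> X \<longleftrightarrow> a \<noteq> 0 \<and> a \<in> set (out_syms X x)"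
  using edgeD[of x a] by (auto simp: set_out_syms)

lemma last_out_syms: "a \<in> set (out_syms X x) \<Longrightarrow> a \<le> last (out_syms X x)"
proof -
  assume a: "a \<in> set (out_syms X x)"
  have eq: "out_syms X x = butlast (out_syms X x) @ [last (out_syms X x)]"
    using out_syms_nonempty by simp
  with strict_sorted_out_syms[of x] have "\<forall>b\<in>set (butlast (out_syms X x)). b < last (out_syms X x)"
    by (metis list.set_intros(1) sorted_wrt_append)
  moreover have "a \<in> set (butlast (out_syms X x)) \<or> a = last (out_syms X x)"
    using a by (subst (asm) eq) (auto simp del: append_butlast_last_id)
  ultimately show ?thesis by auto
qed

lemma set_entries: "set (entries V X) = {(x, a). x \<in> V \<and> a \<in> set (out_syms X x)}"
  using finite_V by (auto simp: entries_def)

lemma X_subset_entries: "X \<subseteq> set (entries V X)"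
  using edgeD in_X_iff by (auto simp: set_entries)

lemma strict_sorted_entries: "sorted_wrt (<) (entries V X)"
proof -
  have "sorted_wrt (<) (concat (map (\<lambda>x. map (Pair x) (out_syms X x)) xs))"
    if "sorted_wrt (<) xs" for xs
    using that
  proof (induction xs)
    case (Cons x xs)
    have "sorted_wrt (<) (map (Pair x) (out_syms X x))"
      using strict_sorted_out_syms[of x] by (auto simp: sorted_wrt_map elim: sorted_wrt_mono_rel[rotated])
    then show ?case using Cons by (auto simp: sorted_wrt_append)
  qed simp
  then show ?thesis by (simp add: entries_def)
qed

lemma flagged_out_syms:
  "map (Pair x) (out_syms X x) \<noteq> [] \<and> last_entry X (last (map (Pair x) (out_syms X x))) \<and>
    (\<forall>e\<in>set (butlast (map (Pair x) (out_syms X x))). \<not> last_entry X e)"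
proof -
  let ?l = "out_syms X x"
  have "?l = butlast ?l @ [last ?l]" using out_syms_nonempty by simp
  then have "distinct (butlast ?l @ [last ?l])"
    using strict_sorted_out_syms strict_sorted_iff by metis
  then have "last ?l \<notin> set (butlast ?l)" by (simp del: append_butlast_last_id)
  then show ?thesis using out_syms_nonempty
    by (auto simp: last_map last_entry_def map_butlast[symmetric])
qed

lemma first_edge_in_X: "first_edge X e \<Longrightarrow> e \<in> X"
  by (simp add: first_edge_def)

lemma first_edge_unique:
  assumes "first_edge X e" "first_edge X e'" "target e = target e'"
  shows "e = e'"
proof -
  obtain x a x' a' where e: "e = (x, a)" "e' = (x', a')" by fastforce
  with assms show ?thesis unfolding first_edge_def target_def
    by simp (metis antisym)
qed

lemma ex_first_edge:
  assumes "(x, a) \<in> X"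
  obtains x' where "first_edge X (x', a)" "butlast x' = butlast x" "x' \<le> x"
proof -
  let ?S = "{x'. (x', a) \<in> X \<and> butlast x' = butlast x}"
  have fin: "finite ?S" using edgeD finite_V by (auto intro: finite_subset[of _ V])
  have ne: "?S \<noteq> {}" using assms by auto
  have "Min ?S \<in> ?S" by (rule Min_in[OF fin ne])
  moreover have "\<And>x'. x' \<in> ?S \<Longrightarrow> Min ?S \<le> x'" using fin by simp
  ultimately show thesis using assms by (intro that[of "Min ?S"]) (auto simp: first_edge_def)
qed

text \<open>Every node but \<open>replicate k 0\<close> has an incoming edge by
  \<open>ex_pred\<close>, and the smallest source among the edges into it carries the flag.\<close>

lemma target_first_edges: "target ` {e. first_edge X e} = V - {replicate k 0}"
proof
  show "target ` {e. first_edge X e} \<subseteq> V - {replicate k 0}"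
    using edgeD k_pos by (fastforce simp: first_edge_def target_def Cons_replicate_eq)
  show "V - {replicate k 0} \<subseteq> target ` {e. first_edge X e}"
  proof
    fix y assume y: "y \<in> V - {replicate k 0}"
    then obtain x where "(x, hd y) \<in> X" "butlast x = tl y" using ex_pred by auto
    then obtain x' where "first_edge X (x', hd y)" "butlast x' = tl y"
      using ex_first_edge by metis
    moreover have "y \<noteq> []" using y length_V[of y] k_pos by auto
    ultimately show "y \<in> target ` {e. first_edge X e}"
      by (intro image_eqI[of _ _ "(x', hd y)"]) (auto simp: target_def)
  qed
qed

lemma take_target: "(x, a) \<in> X \<Longrightarrow> h < k \<Longrightarrow> take (Suc h) (target (x, a)) = a # take h x"
  using edgeD[of x a] length_V[of x] by (simp add: target_def take_butlast)

text \<open>\<open>butlast\<close> is the prefix of length \<open>k - 1\<close>, and taking prefixes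
  is monotone.\<close>

lemma target_le_target:
  assumes "(x, a) \<in> X" "(x', a) \<in> X" "x \<le> x'"
  shows "target (x, a) \<le> target (x', a)"
proof -
  have "length x = k" "length x' = k" using assms edgeD length_V by auto
  then show ?thesis using take_le_take[OF assms(3)] by (simp add: target_def butlast_conv_take)
qed

lemma target_less_target:
  assumes "first_edge X (x, a)" "first_edge X (x', a)" "x < x'"
  shows "target (x, a) < target (x', a)"
  using target_le_target[of x a x'] first_edge_unique[of "(x, a)" "(x', a)"] assms
  by (auto simp: le_less dest: first_edge_in_X)

definition first_edges :: "(nat list \<times> nat) list" where
  "first_edges = filter (first_edge X) (entries V X)"

lemma set_first_edges: "set first_edges = {e. first_edge X e}"
  using X_subset_entries by (auto simp: first_edges_def first_edge_def)

text \<open>A target is the label followed by a prefix of the source, so sorting the flagged edges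
  by label, with ties by source, sorts their targets. The order is strict because flagged edges have
  distinct targets, and the node of zeros comes first because labels are positive.\<close>

lemma sorted_list_of_V:
  assumes "V \<noteq> {}"
  shows "sorted_list_of_set V = replicate k 0 # map target (sort_key snd first_edges)"
proof -
  have "sorted_wrt (<) first_edges"
    unfolding first_edges_def by (rule sorted_wrt_filter[OF strict_sorted_entries])
  from sorted_wrt_sort_key[OF this, of snd]
  have "sorted_wrt (\<lambda>e e'. target e < target e') (sort_key snd first_edges)"
  proof (rule sorted_wrt_mono_rel[rotated])
    fix e e' assume *: "e \<in> set (sort_key snd first_edges)" "e' \<in> set (sort_key snd first_edges)"
      "snd e < snd e' \<or> snd e = snd e' \<and> e < e'"
    obtain x a x' a' where e: "e = (x, a)" "e' = (x', a')" by fastforce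
    show "target e < target e'"
    proof (cases "a < a'")
      case False
      then have "a = a'" "x < x'" using * e by auto
      then show ?thesis using target_less_target[of x a x'] * e by (simp add: set_first_edges)
    qed (simp add: target_def e)
  qed
  moreover have "replicate k 0 < target e" if "first_edge X e" for e
  proof -
    have "k = Suc (k - 1)" using k_pos by simp
    then obtain l where "k = Suc l" by blast
    moreover have "1 \<le> snd e" using edgeD[of "fst e" "snd e"] first_edge_in_X[OF that] by simp
    ultimately show ?thesis by (simp add: target_def)
  qed
  ultimately have "sorted_wrt (<) (replicate k 0 # map target (sort_key snd first_edges))"
    by (auto simp: sorted_wrt_map set_first_edges)
  moreover have "set (replicate k 0 # map target (sort_key snd first_edges)) = V"
    using source[OF assms] target_first_edges by (auto simp: set_first_edges image_def)
  ultimately show ?thesis using finite_V by (intro strict_sorted_equal) auto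
qed

lemma length_first_edges: "V \<noteq> {} \<Longrightarrow> card V = Suc (length first_edges)"
  using arg_cong[OF sorted_list_of_V, of length] by simp

end

section \<open>Sorting the nodes of two graphs\<close>

lemma sorted_wrt_concat_map:
  assumes "sorted_wrt Q xs" and "\<And>x. x \<in> set xs \<Longrightarrow> sorted_wrt R (f x)"
    and "\<And>x y a b. x \<in> set xs \<Longrightarrow> y \<in> set xs \<Longrightarrow> Q x y \<Longrightarrow> a \<in> set (f x) \<Longrightarrow> b \<in> set (f y) \<Longrightarrow> R a b"
  shows "sorted_wrt R (concat (map f xs))"
  using assms
proof (induction xs)
  case (Cons x xs)
  have "sorted_wrt R (concat (map f xs))"
  proof (rule Cons.IH, goal_cases)
    case (3 x' y a b)
    then show ?case using Cons.prems(3)[of x' y a b] by simp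
  qed (use Cons.prems(1,2) in auto)
  moreover have "\<forall>a\<in>set (f x). \<forall>b\<in>set (concat (map f xs)). R a b"
    using Cons.prems(1) Cons.prems(3)[of x] by fastforce
  ultimately show ?case using Cons.prems(2)[of x] by (auto simp: sorted_wrt_append)
qed simp

lemma distinct_if_sorted_wrt:
  assumes "sorted_wrt R xs" "\<And>x. \<not> R x x"
  shows "distinct xs"
  using assms by (induction xs) auto

lemma sorted_wrt_key_unique:
  fixes f :: "'a \<Rightarrow> 'b::linorder"
  assumes "sorted_wrt (\<lambda>p q. f p < f q) xs" "sorted_wrt (\<lambda>p q. f p < f q) ys"
    and "set xs = set ys" and "inj f"
  shows "xs = ys"
proof -
  have "map f xs = map f ys"
    using assms by (intro strict_sorted_equal) (simp_all add: sorted_wrt_map)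
  then show ?thesis using inj_map_eq_map[OF \<open>inj f\<close>] by simp
qed

lemma rank_mono:
  assumes "i \<le> j" "f (xs ! i) = f (xs ! j)"
  shows "rank f xs i \<le> rank f xs j"
proof -
  have "take j xs = take i xs @ take (j - i) (drop i xs)"
    using assms(1) by (metis le_add_diff_inverse take_add)
  then show ?thesis using assms(2) by (simp add: rank_def)
qed

lemma rank_strict_mono:
  assumes "i < j" "j < length xs" "f (xs ! i) = f (xs ! j)"
  shows "rank f xs i < rank f xs j"
proof -
  have "take j xs = take (Suc i) xs @ take (j - Suc i) (drop (Suc i) xs)"
    using assms(1) by (metis Suc_leI le_add_diff_inverse take_add)
  then show ?thesis using assms by (simp add: rank_def take_Suc_conv_app_nth)
qed

locale two_graphs =
  fixes k :: nat and V :: "bool \<Rightarrow> nat list set" and X :: "bool \<Rightarrow> (nat list \<times> nat) set"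
  assumes graph: "graph k (V g) (X g)"
begin

sublocale G: graph k "V g" "X g" for g
  by (rule graph)

abbreviation VU where "VU \<equiv> V False \<union> V True"
abbreviation XU where "XU \<equiv> X False \<union> X True"

lemma in_VU: "x \<in> VU \<longleftrightarrow> (\<exists>g. x \<in> V g)" and in_XU: "e \<in> XU \<longleftrightarrow> (\<exists>g. e \<in> X g)"
  by (auto simp: ex_bool_eq)

sublocale U: graph k VU XU
proof
  show "1 \<le> k" using G.k_pos .
  show "finite VU" using G.finite_V by blast
  show "length x = k" if "x \<in> VU" for x using that G.length_V in_VU by blast
  show "x \<in> VU \<and> a # butlast x \<in> VU \<and> 1 \<le> a" if "(x, a) \<in> XU" for x a
    using that G.edgeD in_VU in_XU by metis
  show "\<exists>x. (x, hd y) \<in> XU \<and> butlast x = tl y" if "y \<in> VU" "y \<noteq> replicate k 0" for y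
    using that G.ex_pred in_VU in_XU by metis
  show "y = replicate k 0" if "y \<in> VU" "hd y = 0" for y using that G.hd_zero in_VU by metis
  show "replicate k 0 \<in> VU" if "VU \<noteq> {}" using that G.source in_VU by blast
qed

definition tagged :: "(bool \<times> nat list) set" where
  "tagged = {(g, x). x \<in> V g}"

text \<open>Stage \<open>h\<close> of the merge: the nodes of both graphs sorted by their first \<open>h\<close> symbols, where
  ties are won by graph \<open>\<tau>\<close>.\<close>

definition key :: "bool \<Rightarrow> nat \<Rightarrow> bool \<times> nat list \<Rightarrow> nat list \<times> bool \<times> nat list" where
  "key \<tau> h p = (take h (snd p), fst p \<noteq> \<tau>, snd p)"

definition stage :: "bool \<Rightarrow> nat \<Rightarrow> (bool \<times> nat list) list" where
  "stage \<tau> h = map (\<lambda>(p, b, x). (b \<noteq> \<tau>, x)) (sorted_list_of_set (key \<tau> h ` tagged))"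

lemma inj_key: "inj (key \<tau> h)"
  by (auto simp: inj_def key_def)

lemma finite_tagged: "finite tagged"
proof -
  have "tagged \<subseteq> UNIV \<times> VU" by (auto simp: tagged_def) (metis (full_types))
  then show ?thesis using U.finite_V by (meson finite_SigmaI finite_UNIV finite_subset)
qed

lemma map_key_stage: "map (key \<tau> h) (stage \<tau> h) = sorted_list_of_set (key \<tau> h ` tagged)"
proof -
  \<comment> \<open>The tie component stores \<open>g \<noteq> \<tau>\<close>; comparing with
    \<open>\<tau>\<close> once more gives back \<open>g\<close>.\<close>
  have "key \<tau> h ((\<lambda>(p, b, x). (b \<noteq> \<tau>, x)) q) = q"
    if "q \<in> set (sorted_list_of_set (key \<tau> h ` tagged))" for q
    using that finite_tagged by (auto simp: key_def)
  then show ?thesis unfolding stage_def by (simp add: map_idI)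
qed

lemma sorted_stage: "sorted_wrt (\<lambda>p q. key \<tau> h p < key \<tau> h q) (stage \<tau> h)"
  using strict_sorted_list_of_set[of "key \<tau> h ` tagged"]
  by (simp add: map_key_stage[symmetric] sorted_wrt_map)

lemma set_stage: "set (stage \<tau> h) = tagged"
proof -
  have "key \<tau> h ` set (stage \<tau> h) = key \<tau> h ` tagged"
    using arg_cong[OF map_key_stage[of \<tau> h], of set] finite_tagged by simp
  then show ?thesis using inj_image_eq_iff[OF inj_key] by blast
qed

lemma stage_unique:
  assumes "sorted_wrt (\<lambda>p q. key \<tau> h p < key \<tau> h q) ys" "set ys = tagged"
  shows "stage \<tau> h = ys"
  by (rule sorted_wrt_key_unique[OF sorted_stage assms(1) _ inj_key]) (simp add: set_stage assms(2))

lemma distinct_stage: "distinct (stage \<tau> h)"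
  using sorted_stage[of \<tau> h] by (rule distinct_if_sorted_wrt) simp

lemma length_stage: "length (stage \<tau> h) = card (V False) + card (V True)"
proof -
  have "tagged = Pair False ` V False \<union> Pair True ` V True"
    by (auto simp: tagged_def image_iff) (metis (full_types))+
  then have "card tagged = card (V False) + card (V True)"
    using G.finite_V by (simp only:) (subst card_Un_disjoint; auto simp: card_image inj_on_def)
  then show ?thesis using distinct_card[OF distinct_stage, of \<tau> h] by (simp add: set_stage)
qed

text \<open>The full node is the last component of the key, so inside one graph sorting by a prefix
  changes nothing. Hence each pass reads the arrays of each graph from left to right, and a node in
  the order is identified by the bit that names its graph.\<close>

lemma filter_stage:
  "filter (\<lambda>p. fst p = g) (stage \<tau> h) = map (Pair g) (sorted_list_of_set (V g))"
proof -
  let ?ys = "filter (\<lambda>p. fst p = g) (stage \<tau> h)"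
  have "sorted_wrt (\<lambda>p q. snd p < snd q) ?ys"
    using sorted_wrt_filter[OF sorted_stage[of \<tau> h], of "\<lambda>p. fst p = g"]
    by (rule sorted_wrt_mono_rel[rotated])
      (auto simp: key_def dest: less_if_take_less)
  then have "sorted_wrt (<) (map snd ?ys)" by (simp add: sorted_wrt_map)
  moreover have "set (map snd ?ys) = V g" by (force simp: set_stage tagged_def)
  ultimately have "map snd ?ys = sorted_list_of_set (V g)"
    using G.finite_V by (intro strict_sorted_equal) auto
  moreover have "map (Pair g) (map snd ?ys) = ?ys" by (auto intro!: map_idI)
  ultimately show ?thesis by metis
qed

lemma stage_0:
  "stage \<tau> 0 = map (Pair \<tau>) (sorted_list_of_set (V \<tau>)) @
    map (Pair (\<not> \<tau>)) (sorted_list_of_set (V (\<not> \<tau>)))"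
proof (rule stage_unique)
  have "sorted_wrt (<) (sorted_list_of_set (V g))" for g by simp
  then show "sorted_wrt (\<lambda>p q. key \<tau> 0 p < key \<tau> 0 q) (map (Pair \<tau>) (sorted_list_of_set (V \<tau>)) @
      map (Pair (\<not> \<tau>)) (sorted_list_of_set (V (\<not> \<tau>))))"
    by (auto simp: sorted_wrt_append sorted_wrt_map key_def)
  show "set (map (Pair \<tau>) (sorted_list_of_set (V \<tau>)) @
      map (Pair (\<not> \<tau>)) (sorted_list_of_set (V (\<not> \<tau>)))) = tagged"
    using G.finite_V by (cases \<tau>) (auto simp: tagged_def image_iff split: if_splits; metis (full_types))+
qed

text \<open>The graphs that own a copy of the source node \<open>replicate k 0\<close>. No edge
  reaches this node, so its copies have to be placed ahead of all buckets, in tie order.\<close>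

definition sources :: "bool \<Rightarrow> bool list" where
  "sources \<tau> = filter (\<lambda>g. V g \<noteq> {}) [\<tau>, \<not> \<tau>]"

definition tagged_out :: "bool \<times> nat list \<Rightarrow> (bool \<times> nat list \<times> nat) list" where
  "tagged_out p = map (Pair (fst p)) (map (Pair (snd p)) (out_syms (X (fst p)) (snd p)))"

definition scan :: "bool \<Rightarrow> nat \<Rightarrow> (bool \<times> nat list \<times> nat) list" where
  "scan \<tau> h = concat (map tagged_out (stage \<tau> h))"

definition rep :: "bool \<times> nat list \<times> nat \<Rightarrow> bool" where
  "rep e \<longleftrightarrow> first_edge (X (fst e)) (snd e)"

definition is_last :: "bool \<times> nat list \<times> nat \<Rightarrow> bool" where
  "is_last e \<longleftrightarrow> last_entry (X (fst e)) (snd e)"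

abbreviation label :: "bool \<times> nat list \<times> nat \<Rightarrow> nat" where
  "label e \<equiv> snd (snd e)"

definition tagged_target :: "bool \<times> nat list \<times> nat \<Rightarrow> bool \<times> nat list" where
  "tagged_target e = (fst e, target (snd e))"

lemma flagged_tagged_out:
  "tagged_out p \<noteq> [] \<and> is_last (last (tagged_out p)) \<and>
    (\<forall>e\<in>set (butlast (tagged_out p)). \<not> is_last e)"
  using G.flagged_out_syms[of "snd p" "fst p"] 
  by (auto simp: tagged_out_def is_last_def last_map map_butlast[symmetric])

text \<open>The scan interleaves two lists that are each read in a fixed order; the tag of an entry
  is all that is required to fetch it.\<close>

lemma filter_scan:
  "filter (\<lambda>e. fst e = g) (scan \<tau> h) = map (Pair g) (entries (V g) (X g))"
proof -
  have "filter (\<lambda>e. fst e = g) (tagged_out p) = (if fst p = g then tagged_out p else [])" for p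
    by (auto simp: tagged_out_def filter_map filter_empty_conv)
  then have "filter (\<lambda>e. fst e = g) (concat (map tagged_out ps)) =
      concat (map tagged_out (filter (\<lambda>p. fst p = g) ps))" for ps
    by (induction ps) auto
  moreover have "concat (map tagged_out (map (Pair g) xs)) =
      map (Pair g) (concat (map (\<lambda>x. map (Pair x) (out_syms (X g) x)) xs))" for xs
    by (induction xs) (auto simp: tagged_out_def)
  ultimately show ?thesis by (simp only: scan_def filter_stage entries_def)
qed

lemma set_scan: "set (scan \<tau> h) = {e. snd e \<in> set (entries (V (fst e)) (X (fst e)))}"
  by (auto simp: scan_def set_stage tagged_def tagged_out_def G.set_entries)

lemma set_rep_scan: "set (filter rep (scan \<tau> h)) = {e. rep e}"
  using subsetD[OF G.X_subset_entries G.first_edge_in_X] by (auto simp: set_scan rep_def)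

lemma length_scan:
  "length (scan \<tau> h) = length (entries (V False) (X False)) + length (entries (V True) (X True))"
proof -
  have "length (scan \<tau> h) = length (filter (\<lambda>e. fst e = False) (scan \<tau> h)) +
      length (filter (\<lambda>e. \<not> fst e = False) (scan \<tau> h))"
    by (rule sum_length_filter_compl[symmetric])
  also have "(\<lambda>e. \<not> fst e = False) = (\<lambda>e::bool \<times> nat list \<times> nat. fst e = True)" by auto
  finally show ?thesis by (simp only: filter_scan length_map)
qed

lemma sorted_scan:
  "sorted_wrt (\<lambda>e e'. key \<tau> h (fst e, fst (snd e)) < key \<tau> h (fst e', fst (snd e')) \<or>
    fst e = fst e' \<and> snd e < snd e') (scan \<tau> h)"
  unfolding scan_def
proof (rule sorted_wrt_concat_map[OF sorted_stage])
  fix p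
  show "sorted_wrt (\<lambda>e e'. key \<tau> h (fst e, fst (snd e)) < key \<tau> h (fst e', fst (snd e')) \<or>
    fst e = fst e' \<and> snd e < snd e') (tagged_out p)"
    using G.strict_sorted_out_syms[of "fst p" "snd p"]
    by (auto simp: tagged_out_def sorted_wrt_map elim!: sorted_wrt_mono_rel[rotated])
qed (auto simp: tagged_out_def)

lemma distinct_scan: "distinct (scan \<tau> h)"
  using sorted_scan[of \<tau> h] by (rule distinct_if_sorted_wrt) simp

lemma tagged_target_rep: "tagged_target ` {e. rep e} = {p \<in> tagged. snd p \<noteq> replicate k 0}"
proof -
  have "(g, y) \<in> tagged_target ` {e. rep e} \<longleftrightarrow> y \<in> target ` {e. first_edge (X g) e}" for g y
    by (auto simp: image_iff tagged_target_def rep_def)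
  then have *: "(g, y) \<in> tagged_target ` {e. rep e} \<longleftrightarrow> (g, y) \<in> {p \<in> tagged. snd p \<noteq> replicate k 0}"
    for g y using G.target_first_edges by (simp add: tagged_def)
  show ?thesis
  proof (rule set_eqI)
    fix p
    show "p \<in> tagged_target ` {e. rep e} \<longleftrightarrow> p \<in> {p \<in> tagged. snd p \<noteq> replicate k 0}"
      by (cases p) (simp only: *)
  qed
qed

lemma source_less_target:
  assumes "(x, a) \<in> X g" "h < k"
  shows "take (Suc h) (replicate k 0) < take (Suc h) (target (x, a))"
proof -
  obtain l where "k = Suc l" using assms by (cases k) auto
  moreover have "1 \<le> a" using G.edgeD[OF assms(1)] by simp
  ultimately show ?thesis by (simp add: target_def)
qed

text \<open>The first \<open>h + 1\<close> symbols of a target are the label and the first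
  \<open>h\<close> symbols of the source. Hence a stable sort by label of the flagged edges, listed
  in the order of stage \<open>h\<close>, orders the targets by \<open>h + 1\<close> symbols and
  keeps the tie rule between the graphs.\<close>

theorem stage_Suc:
  assumes "h < k"
  shows "stage \<tau> (Suc h) = map (\<lambda>g. (g, replicate k 0)) (sources \<tau>) @
    map tagged_target (sort_key label (filter rep (scan \<tau> h)))"
proof (rule stage_unique)
  let ?M = "filter rep (scan \<tau> h)"
  let ?K = "key \<tau> (Suc h)"
  have "sorted_wrt (\<lambda>e e'. ?K (tagged_target e) < ?K (tagged_target e')) (sort_key label ?M)"
    using sorted_wrt_sort_key[OF sorted_wrt_filter[OF sorted_scan[of \<tau> h], of rep], of label]
  proof (rule sorted_wrt_mono_rel[rotated])
    fix e e'
    assume *: "e \<in> set (sort_key label ?M)" "e' \<in> set (sort_key label ?M)"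
      and less: "label e < label e' \<or> label e = label e' \<and>
        (key \<tau> h (fst e, fst (snd e)) < key \<tau> h (fst e', fst (snd e')) \<or>
          fst e = fst e' \<and> snd e < snd e')"
    obtain g x a g' x' a' where e: "e = (g, x, a)" "e' = (g', x', a')" by (metis prod.exhaust)
    have r: "first_edge (X g) (x, a)" "first_edge (X g') (x', a')" using * by (auto simp: e rep_def)
    then have X: "(x, a) \<in> X g" "(x', a') \<in> X g'" using G.first_edge_in_X by blast+
    note t = G.take_target[OF X(1) assms] G.take_target[OF X(2) assms]
    show "?K (tagged_target e) < ?K (tagged_target e')"
    proof (cases "a < a'")
      case True
      then show ?thesis by (simp add: key_def tagged_target_def e t)
    next
      case False
      then have a: "a' = a"
        and "key \<tau> h (g, x) < key \<tau> h (g', x') \<or> g = g' \<and> x < x'" using less by (auto simp: e)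
      moreover have "take h x \<le> take h x'" if "x < x'" using that by (intro take_le_take) simp
      \<comment> \<open>Inside one graph a smaller source also has a smaller key, so both
        alternatives yield the order of the keys.\<close>
      ultimately have l: "key \<tau> h (g, x) < key \<tau> h (g', x')" unfolding key_def less_prod_def' by auto
      show ?thesis
      proof (cases "take h x < take h x' \<or> take h x = take h x' \<and> (g \<noteq> \<tau>) < (g' \<noteq> \<tau>)")
        case True
        then show ?thesis unfolding key_def tagged_target_def e a fst_conv snd_conv t[unfolded a]
          less_prod_simp Cons_less_Cons Cons_le_Cons by (elim disjE conjE) (simp_all only: simp_thms order_refl less_imp_le)
      next
        case False
        \<comment> \<open>Same prefix and same graph: the full targets decide, and they are distinct
          for distinct flagged edges.\<close>
        then have "take h x = take h x'" "g' = g" "x < x'" using l by (auto simp: key_def)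
        then show ?thesis using G.target_less_target[of g x a x'] r
          by (simp add: key_def tagged_target_def e t[unfolded a] a)
      qed
    qed
  qed
  moreover have "?K (g, replicate k 0) < ?K (tagged_target e)" if "rep e" for g e
    using source_less_target[of "fst (snd e)" "snd (snd e)" "fst e" h] that assms G.first_edge_in_X
    by (simp add: rep_def key_def tagged_target_def)
  moreover have "sorted_wrt (\<lambda>g g'. ?K (g, replicate k 0) < ?K (g', replicate k 0)) (sources \<tau>)"
    by (auto simp: sources_def key_def)
  ultimately show "sorted_wrt (\<lambda>p q. ?K p < ?K q) (map (\<lambda>g. (g, replicate k 0)) (sources \<tau>) @
      map tagged_target (sort_key label ?M))"
    by (auto simp: sorted_wrt_append sorted_wrt_map)
  have *: "g \<in> set (sources \<tau>) \<longleftrightarrow> V g \<noteq> {}" for g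
    by (cases \<tau>; cases g) (simp_all add: sources_def)
  have "set (sources \<tau>) = {g. V g \<noteq> {}}" using * by blast
  moreover have "V g \<noteq> {} \<longleftrightarrow> replicate k 0 \<in> V g" for g using G.source by auto
  moreover have "set (map tagged_target (sort_key label ?M)) = tagged_target ` {e. rep e}"
    using set_rep_scan by simp
  ultimately show "set (map (\<lambda>g. (g, replicate k 0)) (sources \<tau>) @
      map tagged_target (sort_key label ?M)) = tagged"
    unfolding tagged_target_rep by (auto simp: tagged_def)
qed

end

section \<open>Copies of a node in the final order\<close>

context two_graphs
begin

lemma stage_scan_nth:
  assumes "t < length (scan \<tau> h)"
  shows "length (filter is_last (take t (scan \<tau> h))) < length (stage \<tau> h)"
    and "stage \<tau> h ! length (filter is_last (take t (scan \<tau> h))) =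
      (fst (scan \<tau> h ! t), fst (snd (scan \<tau> h ! t)))"
proof -
  have *: "length (filter is_last (take t (scan \<tau> h))) < length (stage \<tau> h) \<and>
    scan \<tau> h ! t \<in> set (tagged_out (stage \<tau> h ! length (filter is_last (take t (scan \<tau> h)))))"
    unfolding scan_def
    by (rule concat_flagged_nth) (use assms flagged_tagged_out in \<open>auto simp: scan_def\<close>)
  then show "length (filter is_last (take t (scan \<tau> h))) < length (stage \<tau> h)" by blast
  show "stage \<tau> h ! length (filter is_last (take t (scan \<tau> h))) =
      (fst (scan \<tau> h ! t), fst (snd (scan \<tau> h ! t)))"
    using conjunct2[OF *] by (auto simp: tagged_out_def)
qed

text \<open>A prefix of length \<open>k\<close> is the whole node, so the tie rule only permutes
  tags among equal nodes, and both rules give the same sequence of nodes.\<close>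

lemma map_snd_stage:
  "sorted (map snd (stage \<tau> k))" "map snd (stage \<tau> k) = map snd (stage \<tau>' k)"
proof -
  have take_k: "take k x = x" if "(g, x) \<in> tagged" for g x
    using that G.length_V by (auto simp: tagged_def)
  have sorted: "sorted (map snd (stage \<tau> k))" for \<tau>
    using sorted_stage[of \<tau> k] unfolding sorted_wrt_map
  proof (rule sorted_wrt_mono_rel[rotated])
    fix p q assume "p \<in> set (stage \<tau> k)" "q \<in> set (stage \<tau> k)" "key \<tau> k p < key \<tau> k q"
    then show "snd p \<le> snd q"
      using take_k[of "fst p" "snd p"] take_k[of "fst q" "snd q"] by (auto simp: set_stage key_def)
  qed
  show "sorted (map snd (stage \<tau> k))" by (rule sorted)
  have "mset (map snd (stage \<tau> k)) = image_mset snd (mset_set tagged)" for \<tau>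
    using mset_set_set[OF distinct_stage, of \<tau> k] by (simp add: set_stage)
  then have "mset (map snd (stage \<tau> k)) = mset (map snd (stage \<tau>' k))" by metis
  then show "map snd (stage \<tau> k) = map snd (stage \<tau>' k)"
    using sorted by (metis properties_for_sort sorted_sort_id)
qed

definition node_seq :: "nat list list" where
  "node_seq = map snd (stage False k)"

lemma snd_stage: "p < length (stage \<tau> k) \<Longrightarrow> snd (stage \<tau> k ! p) = node_seq ! p"
  unfolding node_seq_def using map_snd_stage(2)[of \<tau> False] by (metis nth_map)

lemma length_node_seq: "length node_seq = card (V False) + card (V True)"
  by (simp add: node_seq_def length_stage)

lemma sorted_node_seq: "sorted node_seq"
  unfolding node_seq_def by (rule map_snd_stage)

text \<open>For a node \<open>x\<close> this is the index of its first copy in the final order; a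
  second copy, if there is one, is adjacent by \<open>stage_parts\<close>.\<close>

definition position :: "nat list \<Rightarrow> nat" where
  "position x = length (filter (\<lambda>y. y < x) node_seq)"

definition copies :: "bool \<Rightarrow> nat list \<Rightarrow> bool list" where
  "copies \<tau> x = filter (\<lambda>g. x \<in> V g) [\<tau>, \<not> \<tau>]"

lemma stage_parts:
  "\<exists>as bs. stage \<tau> k = as @ map (\<lambda>g. (g, x)) (copies \<tau> x) @ bs \<and> length as = position x \<and>
    (\<forall>p\<in>set as. snd p < x) \<and> (\<forall>p\<in>set bs. x < snd p)"
proof -
  have "filter (\<lambda>p. snd p = x) (stage \<tau> k) = map (\<lambda>g. (g, x)) (copies \<tau> x)"
  proof (rule sorted_wrt_key_unique[where f = "key \<tau> k"])
    show "sorted_wrt (\<lambda>p q. key \<tau> k p < key \<tau> k q) (filter (\<lambda>p. snd p = x) (stage \<tau> k))"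
      by (rule sorted_wrt_filter[OF sorted_stage])
    show "sorted_wrt (\<lambda>p q. key \<tau> k p < key \<tau> k q) (map (\<lambda>g. (g, x)) (copies \<tau> x))"
      by (auto simp: copies_def key_def)
    have "g \<in> set (copies \<tau> x) \<longleftrightarrow> x \<in> V g" for g
      by (cases \<tau>; cases g) (simp_all add: copies_def)
    then show "set (filter (\<lambda>p. snd p = x) (stage \<tau> k)) = set (map (\<lambda>g. (g, x)) (copies \<tau> x))"
      by (auto simp: set_stage tagged_def)
  qed (rule inj_key)
  moreover have "length (filter (\<lambda>p. snd p < x) (stage \<tau> k)) = position x"
    unfolding position_def node_seq_def map_snd_stage(2)[of False \<tau>] by (simp add: filter_map comp_def)
  ultimately show ?thesis
    using sorted_three_parts[OF map_snd_stage(1), of \<tau> x]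
    by (intro exI[of _ "filter (\<lambda>p. snd p < x) (stage \<tau> k)"]
        exI[of _ "filter (\<lambda>p. x < snd p) (stage \<tau> k)"]) auto
qed

lemma stage_position:
  assumes "j < length (copies \<tau> x)"
  shows "position x + j < length (stage \<tau> k)" and "stage \<tau> k ! (position x + j) = (copies \<tau> x ! j, x)"
  using stage_parts[of \<tau> x] assms by (auto simp: nth_append)

lemma position_cases:
  assumes "p < length node_seq"
  obtains j where "j < length (copies \<tau> (node_seq ! p))" "p = position (node_seq ! p) + j"
proof -
  let ?x = "node_seq ! p"
  have p: "p < length (stage \<tau> k)" using assms by (simp add: length_stage length_node_seq)
  obtain as bs where *: "stage \<tau> k = as @ map (\<lambda>g. (g, ?x)) (copies \<tau> ?x) @ bs"
    "length as = position ?x" "\<forall>p\<in>set as. snd p < ?x" "\<forall>p\<in>set bs. ?x < snd p"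
    using stage_parts by blast
  have sp: "snd (stage \<tau> k ! p) = ?x" by (rule snd_stage[OF p])
  have "\<not> p < length as"
  proof
    assume "p < length as"
    then have "stage \<tau> k ! p \<in> set as" using * by (simp add: nth_append)
    then show False using *(3) sp by auto
  qed
  moreover have "p - length as < length (copies \<tau> ?x)"
  proof (rule ccontr)
    assume c: "\<not> p - length as < length (copies \<tau> ?x)"
    then have "stage \<tau> k ! p = bs ! (p - length as - length (copies \<tau> ?x))"
      using * \<open>\<not> p < length as\<close> by (simp add: nth_append)
    moreover have "p - length as - length (copies \<tau> ?x) < length bs"
      using c p \<open>\<not> p < length as\<close> unfolding *(1) by simp
    ultimately have "stage \<tau> k ! p \<in> set bs" by simp
    then show False using *(4) sp by auto
  qed
  ultimately show thesis using that[of "p - length as"] * by simp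
qed

definition repeated :: "nat \<Rightarrow> bool" where
  "repeated p \<longleftrightarrow> 0 < p \<and> node_seq ! (p - 1) = node_seq ! p"

lemma length_copies: "length (copies \<tau> x) = of_bool (x \<in> V False) + of_bool (x \<in> V True)"
  by (cases \<tau>) (auto simp: copies_def)

lemma repeated_position:
  assumes "j < length (copies \<tau> x)"
  shows "repeated (position x + j) \<longleftrightarrow> 0 < j"
proof (cases "j = 0")
  case False
  then have "node_seq ! (position x + j) = x" "node_seq ! (position x + (j - 1)) = x"
    using stage_position[of j \<tau> x] stage_position[of "j - 1" \<tau> x] snd_stage[of _ \<tau>] assms by force+
  then show ?thesis using False by (simp add: repeated_def)
next
  case True
  obtain as bs where *: "stage \<tau> k = as @ map (\<lambda>g. (g, x)) (copies \<tau> x) @ bs"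
    "length as = position x" "\<forall>p\<in>set as. snd p < x"
    using stage_parts by blast
  have "node_seq ! (position x - 1) \<noteq> node_seq ! (position x)" if "0 < position x"
  proof -
    have "stage \<tau> k ! (position x - 1) \<in> set as" using * that by (simp add: nth_append)
    then have "snd (stage \<tau> k ! (position x - 1)) < x" using * by blast
    moreover have "position x - 1 < length (stage \<tau> k)" using * that by simp
    moreover have "position x < length (stage \<tau> k)" "snd (stage \<tau> k ! position x) = x"
      using stage_position[of 0 \<tau> x] assms True by auto
    ultimately show ?thesis using snd_stage[of _ \<tau>] by (metis less_irrefl)
  qed
  then show ?thesis using True by (auto simp: repeated_def)
qed

text \<open>Equal nodes of the two graphs are recognized by the positions where the merges with the
  two tie-breaking rules differ.\<close>

lemma repeated_iff:
  assumes "p < length node_seq"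
  shows "repeated p \<longleftrightarrow> fst (stage False k ! p) \<and> \<not> fst (stage True k ! p)"
proof -
  let ?x = "node_seq ! p"
  obtain j where j: "j < length (copies False ?x)" "p = position ?x + j"
    using position_cases[OF assms] .
  then have j': "j < length (copies True ?x)" by (simp add: length_copies)
  have "stage False k ! p = (copies False ?x ! j, ?x)" "stage True k ! p = (copies True ?x ! j, ?x)"
    using stage_position(2)[OF j(1)] stage_position(2)[OF j'] j(2) by metis+
  moreover have "repeated p \<longleftrightarrow> 0 < j" using repeated_position[OF j(1)] j(2) by simp
  moreover have "copies False ?x ! j \<and> \<not> copies True ?x ! j \<longleftrightarrow> 0 < j"
    using j(1) j' by (auto simp: copies_def nth_Cons' split: if_splits)
  ultimately show ?thesis by simp
qed

lemma copies_ne: "x \<in> VU \<Longrightarrow> 0 < length (copies \<tau> x)"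
  by (auto simp: length_copies)

text \<open>At the first copy of \<open>x\<close>, the run with ties won by the first graph shows
  the second graph only if \<open>x\<close> is absent from the first, and the other run shows it
  exactly if \<open>x\<close> is in the second. So two bits reveal the membership in both
  graphs.\<close>

lemma stage_at_position:
  assumes "x \<in> VU"
  shows "position x < length node_seq"
    and "fst (stage False k ! position x) \<longleftrightarrow> x \<notin> V False"
    and "fst (stage True k ! position x) \<longleftrightarrow> x \<in> V True"
  using stage_position[OF copies_ne[OF assms, of False]] stage_position[OF copies_ne[OF assms, of True]]
    assms by (auto simp: length_stage length_node_seq copies_def)

lemma position_next:
  assumes "x \<in> VU" "x < y" and "\<And>z. z \<in> VU \<Longrightarrow> z < y \<Longrightarrow> z \<le> x"
  shows "position y = position x + length (copies False x)"
proof -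
  obtain as bs where *: "stage False k = as @ map (\<lambda>g. (g, x)) (copies False x) @ bs"
    "length as = position x" "\<forall>p\<in>set as. snd p < x" "\<forall>p\<in>set bs. x < snd p"
    using stage_parts by blast
  have "\<forall>p\<in>set bs. \<not> snd p < y"
  proof
    fix p assume p: "p \<in> set bs"
    then have "p \<in> tagged" using *(1) set_stage[of False k] by auto
    then have "snd p \<in> VU" using in_VU by (auto simp: tagged_def)
    then show "\<not> snd p < y" using assms(3)[of "snd p"] *(4) p by auto
  qed
  then have bs: "filter (\<lambda>p. snd p < y) bs = []" by (simp add: filter_empty_conv)
  have as: "filter (\<lambda>p. snd p < y) as = as" using *(3) assms(2) by (auto simp: filter_id_conv)
  have "position y = length (filter (\<lambda>p. snd p < y) (stage False k))"
    by (simp add: position_def node_seq_def filter_map comp_def)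
  then show ?thesis using as bs *(1,2) assms(2) by (simp add: filter_map comp_def)
qed

lemma position_first:
  assumes "\<And>z. z \<in> VU \<Longrightarrow> y \<le> z"
  shows "position y = 0"
proof -
  have "z \<in> VU" if "z \<in> set node_seq" for z
    using that set_stage[of False k] in_VU by (auto simp: node_seq_def tagged_def)
  then show ?thesis using assms by (force simp: position_def filter_empty_conv)
qed

section \<open>The union of the entries of both graphs\<close>

definition merged :: "(nat list \<times> nat) list" where
  "merged = sorted_list_of_set (set (entries (V False) (X False)) \<union> set (entries (V True) (X True)))"

abbreviation ent :: "bool \<Rightarrow> (nat list \<times> nat) list" where
  "ent g \<equiv> entries (V g) (X g)"

lemma set_merged: "set merged = set (ent False) \<union> set (ent True)"
  by (simp add: merged_def)

lemma sorted_merged: "sorted_wrt (<) merged"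
  by (simp add: merged_def)

lemma in_merged: "e \<in> set merged \<longleftrightarrow> (\<exists>g. e \<in> set (ent g))"
  by (auto simp: set_merged ex_bool_eq)

lemma length_merged: "length merged \<le> length (ent False) + length (ent True)"
proof -
  have "length merged = card (set (ent False) \<union> set (ent True))" by (simp add: merged_def)
  also have "\<dots> \<le> card (set (ent False)) + card (set (ent True))" by (rule card_Un_le)
  also have "\<dots> \<le> length (ent False) + length (ent True)" by (intro add_mono card_length)
  finally show ?thesis .
qed

text \<open>Both input lists are subsequences of the sorted union, so a merge that visits the union
  in order reads each of them from left to right.\<close>

lemma filter_merged: "filter (\<lambda>e. e \<in> set (ent g)) merged = ent g"
proof (rule strict_sorted_equal)
  show "set (filter (\<lambda>e. e \<in> set (ent g)) merged) = set (ent g)" using in_merged by auto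
  show "sorted_wrt (<) (filter (\<lambda>e. e \<in> set (ent g)) merged)"
    by (rule sorted_wrt_filter[OF sorted_merged])
  show "sorted_wrt (<) (ent g)" by (rule G.strict_sorted_entries)
qed

text \<open>An entry \<open>$\<close> of a node without outgoing edges in one graph is dropped if the node has outgoing edges
  in the other graph.\<close>

definition kept :: "nat list \<times> nat \<Rightarrow> bool" where
  "kept e \<longleftrightarrow> snd e \<noteq> 0 \<or> {a. (fst e, a) \<in> XU} = {}"

lemma filter_kept: "filter kept merged = entries VU XU"
proof (rule strict_sorted_equal)
  have "(x, a) \<in> set merged \<and> kept (x, a) \<longleftrightarrow> (x, a) \<in> set (entries VU XU)" for x a
  proof (cases "a = 0")
    case True
    then show ?thesis
      using G.zero_in_out_syms U.zero_in_out_syms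
      by (auto simp: set_merged kept_def G.set_entries U.set_entries)
  next
    case False
    have "(x, a) \<in> set (ent g) \<longleftrightarrow> (x, a) \<in> X g" for g
      using False G.in_X_iff G.edgeD by (auto simp: G.set_entries)
    moreover have "(x, a) \<in> set (entries VU XU) \<longleftrightarrow> (x, a) \<in> XU"
      using False U.in_X_iff U.edgeD unfolding U.set_entries by blast
    ultimately show ?thesis using False by (auto simp: set_merged kept_def)
  qed
  then show "set (filter kept merged) = set (entries VU XU)" by auto
  show "sorted_wrt (<) (filter kept merged)" by (rule sorted_wrt_filter[OF sorted_merged])
  show "sorted_wrt (<) (entries VU XU)" by (rule U.strict_sorted_entries)
qed

text \<open>Whether graph \<open>g\<close> has entries of the same node behind \<open>e\<close>.
  Together with the label this settles both \<open>kept\<close> and the bit of \<open>last\<close>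
  in the union, and inside \<open>g\<close> it is given by the bit of \<open>last\<close>, so an
  entry can be handled without looking ahead.\<close>

definition more :: "bool \<Rightarrow> nat list \<times> nat \<Rightarrow> bool" where
  "more g e \<longleftrightarrow> (\<exists>a>snd e. (fst e, a) \<in> set (ent g))"

lemma more_if_in:
  assumes "e \<in> set (ent g)"
  shows "more g e \<longleftrightarrow> \<not> last_entry (X g) e"
proof -
  obtain x a where e: "e = (x, a)" by fastforce
  have "x \<in> V g" "a \<in> set (out_syms (X g) x)" using assms by (auto simp: e G.set_entries)
  moreover have "last (out_syms (X g) x) \<in> set (out_syms (X g) x)"
    using G.out_syms_nonempty by simp
  ultimately show ?thesis using G.last_out_syms[of _ g x]
    by (auto simp: more_def last_entry_def e G.set_entries le_less) force
qed

text \<open>The symbol \<open>0\<close> is the least label and comes first among the entries of its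
  node; hence it has to be dropped exactly when another entry follows.\<close>

lemma kept_iff_more:
  assumes "e \<in> set merged"
  shows "kept e \<longleftrightarrow> snd e \<noteq> 0 \<or> \<not> more False e \<and> \<not> more True e"
proof (cases "snd e = 0")
  case True
  obtain x where e: "e = (x, 0)" using True by (cases e) auto
  have "more g e \<longleftrightarrow> {a. (x, a) \<in> X g} \<noteq> {}" if "x \<in> V g" for g
    using that G.in_X_iff by (auto simp: more_def e G.set_entries)
  moreover have "\<not> more g e \<and> {a. (x, a) \<in> X g} = {}" if "x \<notin> V g" for g
    using that G.edgeD by (auto simp: more_def e G.set_entries)
  ultimately have "more g e \<longleftrightarrow> {a. (x, a) \<in> X g} \<noteq> {}" for g by blast
  then show ?thesis by (auto simp: kept_def e)
qed (simp add: kept_def)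

lemma last_entry_iff_more:
  assumes "e \<in> set merged" "kept e"
  shows "last_entry XU e \<longleftrightarrow> \<not> more False e \<and> \<not> more True e"
proof -
  obtain x a where e: "e = (x, a)" by fastforce
  have "e \<in> set (filter kept merged)" using assms by simp
  then have "e \<in> set (entries VU XU)" by (simp only: filter_kept)
  then have a: "x \<in> VU" "a \<in> set (out_syms XU x)" by (auto simp: e U.set_entries)
  \<comment> \<open>A label above \<open>a\<close> is nonzero, so its entry is kept and occurs in
    the union exactly if it occurs in one of the graphs.\<close>
  have "(x, b) \<in> set (entries VU XU) \<longleftrightarrow> (\<exists>g. (x, b) \<in> set (ent g))" if "a < b" for b
  proof -
    have "(x, b) \<in> set (entries VU XU) \<longleftrightarrow> (x, b) \<in> set merged \<and> kept (x, b)"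
      by (simp flip: filter_kept)
    then show ?thesis using that by (auto simp: kept_def in_merged)
  qed
  then have "\<And>b. a < b \<Longrightarrow> b \<in> set (out_syms XU x) \<longleftrightarrow> (\<exists>g. (x, b) \<in> set (ent g))"
    using a(1) unfolding U.set_entries by blast
  then have "(\<exists>g. more g e) \<longleftrightarrow> (\<exists>b>a. b \<in> set (out_syms XU x))"
    unfolding more_def e fst_conv snd_conv by blast
  also have "\<dots> \<longleftrightarrow> a \<noteq> last (out_syms XU x)"
    using U.last_out_syms[OF a(2)] U.last_out_syms[of _ x] U.out_syms_nonempty[of x] a(2)
    by (metis last_in_set leD le_less)
  finally show ?thesis by (auto simp: last_entry_def e ex_bool_eq)
qed

section \<open>The flags of the merged graph\<close>

definition rep_tags :: "nat list \<times> nat \<Rightarrow> (bool \<times> nat list \<times> nat) list" where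
  "rep_tags e = map (\<lambda>g. (g, e)) (filter (\<lambda>g. first_edge (X g) e) [False, True])"

text \<open>The flagged edges of both graphs in the order in which the final merge meets them; an
  edge flagged in both graphs appears twice, for the first graph first.\<close>

definition merged_reps :: "(bool \<times> nat list \<times> nat) list" where
  "merged_reps = concat (map rep_tags merged)"

lemma set_merged_reps: "set merged_reps = {e. rep e}"
proof -
  have "(g, e) \<in> set (rep_tags e') \<longleftrightarrow> e = e' \<and> first_edge (X g) e'" for g e e'
    by (cases g) (auto simp: rep_tags_def)
  then have "(g, e) \<in> set merged_reps \<longleftrightarrow> rep (g, e)" for g e
    using subsetD[OF G.X_subset_entries G.first_edge_in_X, of g e]
    by (auto simp: merged_reps_def rep_def in_merged)
  then show ?thesis by auto
qed

lemma sorted_merged_reps: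
  "sorted_wrt (\<lambda>e e'. snd e < snd e' \<or> snd e = snd e' \<and> fst e < fst e') merged_reps"
  unfolding merged_reps_def
  by (rule sorted_wrt_concat_map[OF sorted_merged]) (auto simp: rep_tags_def)

text \<open>The last pass and the final merge visit the flagged edges in different orders. Sorted by
  label, both orders give a sorted list of targets with the same multiset, hence the same list. So
  the bucket cursors can be run again during the merge, and they point at the right nodes.\<close>

lemma node_seq_eq:
  "node_seq = replicate (length (sources False)) (replicate k 0) @
    map (\<lambda>e. target (snd e)) (sort_key label merged_reps)"
proof -
  obtain h where h: "k = Suc h" using G.k_pos by (cases k) auto
  let ?R = "filter rep (scan False h)"
  let ?t = "\<lambda>e::bool \<times> nat list \<times> nat. target (snd e)"
  have rp: "map snd (map (\<lambda>g. (g, replicate k (0::nat))) gs) = replicate (length gs) (replicate k 0)"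
    for gs :: "bool list" by (induction gs) auto
  have "stage False (Suc h) = map (\<lambda>g. (g, replicate k 0)) (sources False) @
      map tagged_target (sort_key label ?R)"
    by (rule stage_Suc) (simp add: h)
  then have st: "stage False k = map (\<lambda>g. (g, replicate k 0)) (sources False) @
      map tagged_target (sort_key label ?R)" by (simp only: h)
  have eq: "node_seq = replicate (length (sources False)) (replicate k 0) @
      map ?t (sort_key label ?R)"
    unfolding node_seq_def st map_append rp by (simp only: map_map comp_def tagged_target_def snd_conv)
  have "sorted (map ?t (sort_key label ?R))"
    using sorted_node_seq unfolding eq sorted_append by blast
  moreover have "sorted (map ?t (sort_key label merged_reps))"
    using sorted_wrt_sort_key[OF sorted_merged_reps, of label] unfolding sorted_wrt_map
  proof (rule sorted_wrt_mono_rel[rotated])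
    fix e e' assume *: "e \<in> set (sort_key label merged_reps)" "e' \<in> set (sort_key label merged_reps)"
      "label e < label e' \<or> label e = label e' \<and> (snd e < snd e' \<or> snd e = snd e' \<and> fst e < fst e')"
    obtain g x a g' x' a' where e: "e = (g, x, a)" "e' = (g', x', a')" by (metis prod.exhaust)
    have "first_edge (X g) (x, a)" "first_edge (X g') (x', a')"
      using *(1,2) set_merged_reps by (auto simp: e rep_def)
    then have "(x, a) \<in> XU" "(x', a') \<in> XU" using G.first_edge_in_X in_XU by blast+
    then show "?t e \<le> ?t e'" using *(3) U.target_le_target[of x a x'] by (auto simp: e target_simp)
  qed
  moreover have "mset ?R = mset merged_reps"
    using set_rep_scan set_merged_reps distinct_scan
      distinct_if_sorted_wrt[OF sorted_merged_reps] by (subst set_eq_iff_mset_eq_distinct[symmetric]) auto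
  then have "mset (map ?t (sort_key label ?R)) = mset (map ?t (sort_key label merged_reps))" by simp
  ultimately have "map ?t (sort_key label ?R) = map ?t (sort_key label merged_reps)"
    by (metis properties_for_sort sorted_sort_id)
  then show ?thesis using eq by simp
qed

definition slot :: "nat \<Rightarrow> nat" where
  "slot s = length (sources False) + rank label merged_reps s"

lemma node_seq_slot:
  assumes "s < length merged_reps"
  shows "slot s < length node_seq" and "node_seq ! slot s = target (snd (merged_reps ! s))"
  using sort_key_nth_rank[OF assms, of label]
  by (simp_all add: slot_def node_seq_eq nth_append)

lemma merged_rep_in_X: "s < length merged_reps \<Longrightarrow> snd (merged_reps ! s) \<in> X (fst (merged_reps ! s))"
  using set_merged_reps nth_mem[of s merged_reps] G.first_edge_in_X by (auto simp: rep_def)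

text \<open>Edges with a common target have the same label, so they occupy their slots in the order
  of the list; copies of a node are adjacent as \<open>node_seq\<close> is sorted.\<close>

lemma repeated_slot:
  assumes s: "s < length merged_reps"
  shows "repeated (slot s) \<longleftrightarrow>
    (\<exists>s'<s. target (snd (merged_reps ! s')) = target (snd (merged_reps ! s)))"
proof
  assume "\<exists>s'<s. target (snd (merged_reps ! s')) = target (snd (merged_reps ! s))"
  then obtain s' where s': "s' < s" "target (snd (merged_reps ! s')) = target (snd (merged_reps ! s))"
    by blast
  then have "slot s' < slot s" using rank_strict_mono[of s' s merged_reps label] s
    by (simp add: slot_def target_def)
  moreover have "node_seq ! slot s' = node_seq ! slot s" using node_seq_slot s s' by simp
  moreover have "node_seq ! slot s' \<le> node_seq ! (slot s - 1)" "node_seq ! (slot s - 1) \<le> node_seq ! slot s"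
    using \<open>slot s' < slot s\<close> node_seq_slot(1)[OF s] sorted_node_seq
    by (auto intro: sorted_nth_mono)
  ultimately show "repeated (slot s)" by (auto simp: repeated_def)
next
  assume r: "repeated (slot s)"
  let ?z = "length (sources False)"
  have eq: "node_seq ! (slot s - 1) = target (snd (merged_reps ! s))"
    using r node_seq_slot(2)[OF s] by (simp add: repeated_def)
  have "1 \<le> label (merged_reps ! s)" using merged_rep_in_X[OF s] G.edgeD by (metis prod.collapse)
  then have "target (snd (merged_reps ! s)) \<noteq> replicate k 0"
    using G.k_pos by (auto simp: target_def Cons_replicate_eq)
  \<comment> \<open>The preceding position holds the same node, which is not the source, so it lies
    in a bucket and is the slot of some edge.\<close>
  then have z: "?z \<le> slot s - 1" using eq by (auto simp: node_seq_eq nth_append split: if_splits)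
  have pos: "0 < slot s" using r by (simp add: repeated_def)
  then have "slot s - 1 - ?z < length merged_reps"
    using node_seq_slot(1)[OF s] z by (auto simp: node_seq_eq)
  then obtain s' where s': "s' < length merged_reps" "rank label merged_reps s' = slot s - 1 - ?z"
    using rank_surj by blast
  then have slot: "slot s' = slot s - 1" using z by (simp add: slot_def)
  then have t: "target (snd (merged_reps ! s')) = target (snd (merged_reps ! s))"
    using node_seq_slot(2)[OF s'(1)] eq by simp
  have "s' < s"
  proof (rule ccontr)
    assume "\<not> s' < s"
    then have "slot s \<le> slot s'" using rank_mono[of s s' label merged_reps] t
      by (simp add: slot_def target_def)
    then show False using slot pos by simp
  qed
  then show "\<exists>s'<s. target (snd (merged_reps ! s')) = target (snd (merged_reps ! s))" using t by blast
qed

text \<open>An edge flagged in the union is flagged in every graph that contains it. Each graph has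
  at most one flagged edge per target, and the smaller of the two comes first among the merged
  edges, where its slot is the first copy of the target.\<close>

theorem first_edge_XU_iff:
  "first_edge XU e \<longleftrightarrow> (\<exists>s<length merged_reps. snd (merged_reps ! s) = e \<and> \<not> repeated (slot s))"
proof
  assume fe: "first_edge XU e"
  then have "e \<in> XU" by (rule U.first_edge_in_X)
  then obtain g where "e \<in> X g" using in_XU by blast
  then have "first_edge (X g) e" using fe in_XU by (auto simp: first_edge_def)
  then have "(g, e) \<in> set merged_reps" by (simp add: set_merged_reps rep_def)
  then have ex: "\<exists>s. s < length merged_reps \<and> snd (merged_reps ! s) = e" by (metis in_set_conv_nth snd_conv)
  \<comment> \<open>If \<open>e\<close> is flagged in both graphs, only its first occurrence can
    have a slot that is not repeated.\<close>
  define s where "s = (LEAST s. s < length merged_reps \<and> snd (merged_reps ! s) = e)"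
  have s: "s < length merged_reps" "snd (merged_reps ! s) = e"
    using LeastI_ex[OF ex] by (simp_all add: s_def)
  have least: "snd (merged_reps ! s') \<noteq> e" if "s' < s" for s'
    using not_less_Least[of s' "\<lambda>s. s < length merged_reps \<and> snd (merged_reps ! s) = e"] that s(1)
    by (auto simp: s_def)
  have "\<not> repeated (slot s)"
  proof
    assume "repeated (slot s)"
    then obtain s' where s': "s' < s" "target (snd (merged_reps ! s')) = target e"
      using repeated_slot s by auto
    have "snd (merged_reps ! s') \<in> XU"
      using merged_rep_in_X[OF order.strict_trans[OF s'(1) s(1)]] in_XU by blast
    moreover have "label (merged_reps ! s') = snd e"
      "butlast (fst (snd (merged_reps ! s'))) = butlast (fst e)"
      using s'(2) by (simp_all add: target_def)
    ultimately have "fst e \<le> fst (snd (merged_reps ! s'))"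
      using fe unfolding first_edge_def by (metis prod.collapse)
    moreover have "snd (merged_reps ! s') \<le> snd (merged_reps ! s)"
      using sorted_wrt_nth_less[OF sorted_merged_reps s'(1) s(1)] by auto
    ultimately have "snd (merged_reps ! s') = e"
      using s(2) s'(2) by (auto simp: target_def less_eq_prod_def intro!: prod_eqI)
    then show False using least s'(1) by blast
  qed
  then show "\<exists>s<length merged_reps. snd (merged_reps ! s) = e \<and> \<not> repeated (slot s)" using s by blast
next
  assume "\<exists>s<length merged_reps. snd (merged_reps ! s) = e \<and> \<not> repeated (slot s)"
  then obtain s where s: "s < length merged_reps" "snd (merged_reps ! s) = e" "\<not> repeated (slot s)"
    by blast
  have XU: "e \<in> XU" using merged_rep_in_X[OF s(1)] s(2) in_XU by blast
  have "fst e \<le> x" if x: "(x, snd e) \<in> XU" "butlast x = butlast (fst e)" for x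
  proof (rule ccontr)
    assume "\<not> fst e \<le> x"
    then have "x < fst e" by simp
    obtain g where "(x, snd e) \<in> X g" using x(1) in_XU by blast
    then obtain x' where x': "first_edge (X g) (x', snd e)" "butlast x' = butlast x" "x' \<le> x"
      using G.ex_first_edge by blast
    then have "(g, x', snd e) \<in> set merged_reps" by (simp add: set_merged_reps rep_def)
    then obtain s' where s': "s' < length merged_reps" "merged_reps ! s' = (g, x', snd e)"
      by (metis in_set_conv_nth)
    have "s' < s"
    proof (rule ccontr)
      assume "\<not> s' < s"
      then have "s = s' \<or> s < s'" by auto
      then have "snd (merged_reps ! s) \<le> snd (merged_reps ! s')"
        using sorted_wrt_nth_less[OF sorted_merged_reps, of s s'] s'(1) by auto
      then show False using \<open>x < fst e\<close> x'(3) s(2) s'(2) by (auto simp: less_eq_prod_def)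
    qed
    then have "repeated (slot s)" using repeated_slot[OF s(1)] s' s(2) x'(2) x(2)
      by (auto simp: target_def)
    then show False using s(3) by blast
  qed
  then show "first_edge XU e" using XU by (simp add: first_edge_def)
qed

end

section \<open>Longest common suffixes\<close>

context graph
begin

abbreviation node_list :: "nat list list" where "node_list \<equiv> sorted_list_of_set V"

definition boundary :: "nat \<Rightarrow> nat \<Rightarrow> bool" where
  "boundary h p \<longleftrightarrow> p = 0 \<or> take h (node_list ! (p - 1)) \<noteq> take h (node_list ! p)"

text \<open>Names the set of nodes with the same first \<open>h\<close> symbols by the position of
  its first member, which fits into one word and can be carried along by a scan.\<close>

definition block :: "nat \<Rightarrow> nat \<Rightarrow> nat" where
  "block h i = (LEAST j. take h (node_list ! j) = take h (node_list ! i))"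

lemma boundary_0: "boundary 0 p \<longleftrightarrow> p = 0"
  by (simp add: boundary_def)

lemma block_le: "block h i \<le> i"
  by (simp add: block_def Least_le)

lemma take_block: "take h (node_list ! block h i) = take h (node_list ! i)"
  unfolding block_def by (rule LeastI[of _ i]) simp

lemma block_eq_iff: "block h i = block h j \<longleftrightarrow> take h (node_list ! i) = take h (node_list ! j)"
  by (metis block_def take_block)

text \<open>The node list is sorted, so nodes with a common prefix are consecutive, and one boundary
  bit per node determines the blocks.\<close>

lemma block_Suc:
  assumes "Suc i < length node_list"
  shows "block h (Suc i) = (if boundary h (Suc i) then Suc i else block h i)"
proof (cases "boundary h (Suc i)")
  case True
  have "block h (Suc i) = Suc i"
  proof (rule ccontr)
    assume "block h (Suc i) \<noteq> Suc i"
    then have le: "block h (Suc i) \<le> i" using block_le[of h "Suc i"] by simp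
    have sorted: "sorted node_list" by simp
    have "node_list ! block h (Suc i) \<le> node_list ! i" "node_list ! i \<le> node_list ! Suc i"
      using le assms by (auto intro!: sorted_nth_mono[OF sorted])
    then have "take h (node_list ! block h (Suc i)) \<le> take h (node_list ! i)"
      "take h (node_list ! i) \<le> take h (node_list ! Suc i)" by (auto intro: take_le_take)
    then show False using take_block[of h "Suc i"] True by (simp add: boundary_def)
  qed
  then show ?thesis using True by simp
next
  case False
  then show ?thesis by (simp add: boundary_def block_def)
qed

lemma entries_nth_node:
  assumes "t < length (entries V X)"
  shows "length (filter (last_entry X) (take t (entries V X))) < length node_list"
    and "node_list ! length (filter (last_entry X) (take t (entries V X))) = fst (entries V X ! t)"
proof -
  have *: "length (filter (last_entry X) (take t (entries V X))) < length node_list \<and>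
    entries V X ! t \<in> set (map (Pair (node_list ! length (filter (last_entry X) (take t (entries V X)))))
      (out_syms X (node_list ! length (filter (last_entry X) (take t (entries V X))))))"
    unfolding entries_def
    by (rule concat_flagged_nth[of _ "\<lambda>x. map (Pair x) (out_syms X x)"])
      (use assms flagged_out_syms in \<open>auto simp: entries_def\<close>)
  then show "length (filter (last_entry X) (take t (entries V X))) < length node_list" by blast
  show "node_list ! length (filter (last_entry X) (take t (entries V X))) = fst (entries V X ! t)"
    using conjunct2[OF *] by auto
qed

lemma count_last_entries: "length (filter (last_entry X) (entries V X)) = card V"
  using concat_flagged_count[of node_list "\<lambda>x. map (Pair x) (out_syms X x)" "last_entry X"]
    flagged_out_syms by (simp add: entries_def)

lemma node_list_rank:
  assumes "s < length first_edges"
  shows "Suc (rank snd first_edges s) < length node_list"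
    and "node_list ! Suc (rank snd first_edges s) = target (first_edges ! s)"
proof -
  have "V \<noteq> {}" using assms set_first_edges first_edge_in_X edgeD
    by (metis empty_iff mem_Collect_eq nth_mem prod.collapse)
  note * = sorted_list_of_V[OF this]
  show "Suc (rank snd first_edges s) < length node_list"
    "node_list ! Suc (rank snd first_edges s) = target (first_edges ! s)"
    using sort_key_nth_rank[OF assms, of snd] unfolding * by simp_all
qed

text \<open>The boundary bit of a node is determined by the blocks of the edge into it and of the
  preceding edge with the same label.\<close>

lemma boundary_Suc:
  assumes h: "h < k" and s: "s < length first_edges"
  shows "boundary (Suc h) (Suc (rank snd first_edges s)) \<longleftrightarrow>
    (let F = filter (\<lambda>e. snd e = snd (first_edges ! s)) (take s first_edges)
     in F = [] \<or> take h (fst (last F)) \<noteq> take h (fst (first_edges ! s)))"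
proof -
  let ?a = "snd (first_edges ! s)" and ?r = "rank snd first_edges s"
  let ?F = "filter (\<lambda>e. snd e = ?a) (take s first_edges)"
  have X: "e \<in> X" if "e \<in> set first_edges" for e using that set_first_edges first_edge_in_X by blast
  have take_tg: "take (Suc h) (target e) = snd e # take h (fst e)" if "e \<in> set first_edges" for e
    using take_target[of "fst e" "snd e" h] X[OF that] h by simp
  have p: "take (Suc h) (node_list ! Suc ?r) = ?a # take h (fst (first_edges ! s))"
    using node_list_rank(2)[OF s] take_tg s by simp
  have "1 \<le> ?a" using X[of "first_edges ! s"] edgeD[of "fst (first_edges ! s)"] s by simp
  show ?thesis
  proof (cases "?F = []")
    case True
    \<comment> \<open>The edge is the first of its bucket: the preceding node is the source or
      starts with a different label.\<close>
    have "take (Suc h) (node_list ! ?r) \<noteq> take (Suc h) (node_list ! Suc ?r)"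
    proof (cases ?r)
      case 0
      have "V \<noteq> {}" using node_list_rank(1)[OF s] finite_V by auto
      then have "node_list ! 0 = replicate k 0" by (simp add: sorted_list_of_V)
      then have "hd (take (Suc h) (node_list ! 0)) = 0" using k_pos by (cases k) auto
      then show ?thesis using p 0 \<open>1 \<le> ?a\<close> by (metis list.sel(1) not_one_le_zero)
    next
      case (Suc q)
      then have "q < length first_edges" using sort_key_nth_rank(1)[OF s, of snd] by simp
      then obtain s' where s': "s' < length first_edges" "rank snd first_edges s' = q"
        using rank_surj by blast
      have "snd (first_edges ! s') \<noteq> ?a"
      proof
        assume eq: "snd (first_edges ! s') = ?a"
        have "s' < s"
        proof (rule ccontr)
          assume "\<not> s' < s"
          then have "?r \<le> q" using rank_mono[of s s' snd first_edges] eq s' by simp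
          then show False using Suc by simp
        qed
        then have "first_edges ! s' \<in> set ?F" using eq s by (auto simp: in_set_conv_nth)
        then show False using True by simp
      qed
      then show ?thesis using node_list_rank(2)[OF s'(1)] take_tg s' Suc p by simp
    qed
    then show ?thesis using True by (simp add: boundary_def)
  next
    case False
    let ?P = "\<lambda>e. snd e = ?a"
    have "last ?F \<in> set ?F" using False by (rule last_in_set)
    then have lF: "last ?F \<in> set first_edges" "snd (last ?F) = ?a" by (auto dest: in_set_takeD)
    obtain s' where s': "s' < s" "first_edges ! s' = last ?F" "length ?F = Suc (length (filter ?P (take s' first_edges)))"
    proof -
      have "length ?F - 1 < length ?F" using False by simp
      from filter_nth_index[OF this] obtain s' where s': "s' < length (take s first_edges)"
        "length (filter ?P (take s' (take s first_edges))) = length ?F - 1"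
        "?F ! (length ?F - 1) = take s first_edges ! s'" by blast
      have "s' < s" using s'(1) by simp
      have "0 < length ?F" using False by blast
      have 1: "first_edges ! s' = last ?F"
        using s'(3) \<open>s' < s\<close> last_conv_nth[OF False] by (simp only: nth_take)
      have "take s' (take s first_edges) = take s' first_edges" using \<open>s' < s\<close> by (simp add: min_def)
      then have "length ?F = Suc (length (filter ?P (take s' first_edges)))"
        using s'(2) \<open>0 < length ?F\<close> by (simp only:)
      then show thesis by (rule that[OF \<open>s' < s\<close> 1])
    qed
    \<comment> \<open>\<open>s'\<close> is the last earlier edge with this label, so nothing lies
      between the two slots.\<close>
    have "rank snd first_edges s = Suc (rank snd first_edges s')"
      using s'(3) s'(2) lF(2) by (simp add: rank_def)
    then have "node_list ! ?r = target (last ?F)" using node_list_rank(2)[of s'] s' s by simp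
    then show ?thesis using False p take_tg[OF lF(1)] lF(2) by (simp add: boundary_def)
  qed
qed

text \<open>Reversal turns common suffixes into common prefixes. The lengths of common prefixes are
  closed downwards, so the largest one is the number of positive ones; each pass can therefore
  contribute its share by an increment.\<close>

lemma lcs_length_nodes:
  assumes "0 < p" "p < length node_list"
  shows "lcs_length (rev (node_list ! (p - 1))) (rev (node_list ! p)) =
    card {h \<in> {1..<k}. \<not> boundary h p}"
proof -
  let ?x = "node_list ! (p - 1)" and ?y = "node_list ! p"
  define S where "S = {h. h < k \<and> take h ?x = take h ?y}"
  have "?x \<in> set node_list" "?y \<in> set node_list" using assms by auto
  then have len: "length ?x = k" "length ?y = k" using finite_V length_V by auto
  have "?x \<noteq> ?y" using assms nth_eq_iff_index_eq[of node_list "p - 1" p] by auto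
  have "{length z |z. suffix z (rev ?x) \<and> suffix z (rev ?y)} = S"
  proof (intro set_eqI iffI)
    fix h assume "h \<in> {length z |z. suffix z (rev ?x) \<and> suffix z (rev ?y)}"
    then obtain z where z: "h = length z" "suffix z (rev ?x)" "suffix z (rev ?y)" by blast
    then have "prefix (rev z) ?x" "prefix (rev z) ?y" by (simp_all add: suffix_to_prefix)
    then have "take h ?x = rev z" "take h ?y = rev z" using z(1) by (auto simp: prefix_def)
    moreover have "h \<le> k" using z(1,2) len suffix_length_le by fastforce
    \<comment> \<open>Two distinct nodes of length \<open>k\<close> cannot agree on \<open>k\<close>
      symbols, which is why the passes stop at \<open>k - 1\<close>.\<close>
    moreover have "h \<noteq> k" using \<open>?x \<noteq> ?y\<close> len calculation by force
    ultimately show "h \<in> S" by (simp add: S_def)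
  next
    fix h assume h: "h \<in> S"
    then have "suffix (rev (take h ?x)) (rev ?x)" "suffix (rev (take h ?x)) (rev ?y)"
      by (simp_all add: suffix_to_prefix S_def take_is_prefix) (metis take_is_prefix)
    moreover have "h = length (rev (take h ?x))" using h len by (simp add: S_def)
    ultimately show "h \<in> {length z |z. suffix z (rev ?x) \<and> suffix z (rev ?y)}" by blast
  qed
  then have "lcs_length (rev ?x) (rev ?y) = Max S" by (simp add: lcs_length_def)
  also have "\<dots> = card {1..Max S}" by simp
  also have "{1..Max S} = {h \<in> {1..<k}. \<not> boundary h p}"
  proof -
    have fin: "finite S" by (simp add: S_def)
    have "0 \<in> S" using k_pos by (simp add: S_def)
    then have Max: "Max S \<in> S" using fin by (intro Max_in) auto
    have "h \<in> S" if "h \<le> Max S" for h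
    proof -
      have "take h (take (Max S) ?x) = take h (take (Max S) ?y)" using Max by (simp add: S_def)
      then show ?thesis using that Max by (simp add: S_def min_def)
    qed
    then have iff: "h \<in> S \<longleftrightarrow> h \<le> Max S" for h using fin Max_ge by blast
    have "{1..Max S} = {h \<in> S. 1 \<le> h}"
    proof (rule set_eqI)
      show "h \<in> {1..Max S} \<longleftrightarrow> h \<in> {h \<in> S. 1 \<le> h}" for h
        unfolding mem_Collect_eq atLeastAtMost_iff using iff[of h] by blast
    qed
    also have "\<dots> = {h \<in> {1..<k}. \<not> boundary h p}" using assms by (auto simp: S_def boundary_def)
    finally show ?thesis .
  qed
  finally show ?thesis .
qed

end

section \<open>The graphs of string collections\<close>

definition rev_nodes :: "nat \<Rightarrow> nat list set \<Rightarrow> nat list set" where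
  "rev_nodes k C = {x. length x = k \<and> occurs k C (rev x)}"

definition rev_edges :: "nat \<Rightarrow> nat list set \<Rightarrow> (nat list \<times> nat) set" where
  "rev_edges k C = {(x, a). length x = k \<and> occurs k C (rev x @ [a])}"

lemma occurs_sublist: "occurs k C y \<Longrightarrow> sublist x y \<Longrightarrow> occurs k C x"
  unfolding occurs_def by (meson sublist_order.order.trans)

lemma rev_edges_D:
  assumes "collection \<sigma> C" "(x, a) \<in> rev_edges k C"
  shows "a \<in> {1..\<sigma>}"
proof -
  obtain s ps ss where s: "s \<in> C" "replicate k 0 @ s = ps @ (rev x @ [a]) @ ss" "length x = k"
    using assms(2) by (auto simp: rev_edges_def occurs_def sublist_def)
  have "(replicate k 0 @ s) ! (length ps + k) = a" unfolding s(2) using s(3) by (simp add: nth_append)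
  moreover have "length ps < length s" using arg_cong[OF s(2), of length] s(3) by simp
  ultimately have "a \<in> set s" by (auto simp: nth_append)
  then show ?thesis using assms(1) s(1) unfolding collection_def by blast
qed

text \<open>The padding has exactly \<open>k\<close> symbols. So a \<open>k\<close>-mer at the very
  beginning is all padding, and any later one ends with a symbol of the string. Hence only one node
  ends in \<open>0\<close>, and every other node has a predecessor one symbol to the left.\<close>

lemma graph_de_bruijn:
  assumes "1 \<le> k" "collection \<sigma> C"
  shows "graph k (rev_nodes k C) (rev_edges k C)"
proof
  have later: "last v \<in> {1..\<sigma>}"
    if "s \<in> C" "replicate k 0 @ s = ps @ v @ ss" "ps \<noteq> []" "length v = k" for s ps v ss
  proof -
    have ne: "v \<noteq> []" using that(4) assms(1) by auto
    have lp: "0 < length ps" using that(3) by simp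
    have "(replicate k 0 @ s) ! (length ps + (k - 1)) = last v"
      unfolding that(2) nth_append_length_plus using that(4) assms(1) ne
      by (simp add: nth_append last_conv_nth)
    moreover have "length ps + (k - 1) - k < length s" "\<not> length ps + (k - 1) < k"
    proof -
      have *: "k + length s = length ps + k + length ss"
        using arg_cong[OF that(2), of length] that(4) by simp
      show "length ps + (k - 1) - k < length s" using * lp assms(1) by arith
      show "\<not> length ps + (k - 1) < k" using lp by arith
    qed
    ultimately have "last v \<in> set s" by (metis length_replicate nth_append nth_mem)
    then show ?thesis using assms(2) that(1) unfolding collection_def by blast
  qed
  have first: "v = replicate k 0" if "replicate k 0 @ s = [] @ v @ ss" "length v = k" for s v ss :: "nat list"
    using arg_cong[OF that(1), of "take k"] that(2) by simp
  show "1 \<le> k" by fact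
  have "rev_nodes k C \<subseteq> (\<Union>s\<in>C. rev ` {x. sublist x (replicate k 0 @ s)})"
    by (force simp: rev_nodes_def occurs_def image_iff)
  moreover have "finite (\<Union>s\<in>C. rev ` {x. sublist x (replicate k 0 @ s)})"
  proof -
    have "finite {x. sublist x y}" for y :: "nat list" by (subst set_sublists_eq[symmetric]) (rule finite_set)
    then show ?thesis using assms(2) unfolding collection_def by (intro finite_UN_I finite_imageI) auto
  qed
  ultimately show "finite (rev_nodes k C)" by (rule finite_subset)
  show "length x = k" if "x \<in> rev_nodes k C" for x using that by (simp add: rev_nodes_def)
  show "x \<in> rev_nodes k C \<and> a # butlast x \<in> rev_nodes k C \<and> 1 \<le> a" if e: "(x, a) \<in> rev_edges k C" for x a
  proof -
    have o: "occurs k C (rev x @ [a])" "length x = k" using e by (auto simp: rev_edges_def)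
    have "sublist (rev x) (rev x @ [a])" by simp
    moreover have "sublist (rev (a # butlast x)) (rev x @ [a])"
    proof -
      have "x \<noteq> []" using o(2) assms(1) by auto
      then have "rev x = last x # rev (butlast x)" by (metis append_butlast_last_id rev_eq_Cons_iff rev_rev_ident)
      then have "rev x @ [a] = [last x] @ rev (a # butlast x)" by simp
      then show ?thesis by (metis sublist_append_rightI sublist_append_leftI)
    qed
    ultimately have "occurs k C (rev x)" "occurs k C (rev (a # butlast x))"
      using occurs_sublist o(1) by blast+
    then show ?thesis using o(2) assms(1) rev_edges_D[OF assms(2) e] by (simp add: rev_nodes_def)
  qed
  show "\<exists>x. (x, hd y) \<in> rev_edges k C \<and> butlast x = tl y"
    if y: "y \<in> rev_nodes k C" "y \<noteq> replicate k 0" for y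
  proof -
    obtain s ps ss where s: "s \<in> C" "replicate k 0 @ s = ps @ rev y @ ss" "length y = k"
      using y(1) by (auto simp: rev_nodes_def occurs_def sublist_def)
    have "ps \<noteq> []"
    proof
      assume "ps = []"
      then have "rev y = replicate k 0" using first[of s "rev y" ss] s by simp
      then show False using y(2) by (metis rev_replicate rev_rev_ident)
    qed
    \<comment> \<open>The symbol just before the occurrence becomes the first symbol of the
      predecessor.\<close>
    then obtain qs b where ps: "ps = qs @ [b]" by (metis append_butlast_last_id)
    have ne: "y \<noteq> []" using s(3) assms(1) by auto
    then have ry: "rev (tl y) @ [hd y] = rev y" by (metis hd_Cons_tl rev.simps(2) list.collapse)
    have "sublist (b # rev y) (replicate k 0 @ s)" unfolding s(2) ps sublist_def by auto
    then have "occurs k C (rev (tl y @ [b]) @ [hd y])" using s(1) ry unfolding occurs_def by auto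
    then have "(tl y @ [b], hd y) \<in> rev_edges k C" using s(3) assms(1) by (simp add: rev_edges_def)
    then show ?thesis by (intro exI[of _ "tl y @ [b]"]) simp
  qed
  show "y = replicate k 0" if y: "y \<in> rev_nodes k C" "hd y = 0" for y
  proof -
    obtain s ps ss where s: "s \<in> C" "replicate k 0 @ s = ps @ rev y @ ss" "length y = k"
      using y(1) by (auto simp: rev_nodes_def occurs_def sublist_def)
    have "y \<noteq> []" using s(3) assms(1) by auto
    then have "last (rev y) = 0" using y(2) by (simp add: last_rev)
    then have "ps = []" using later[of s ps "rev y" ss] s by auto
    then have "rev y = replicate k 0" using first[of s "rev y" ss] s by simp
    then show ?thesis by (metis rev_replicate rev_rev_ident)
  qed
  show "replicate k 0 \<in> rev_nodes k C" if "rev_nodes k C \<noteq> {}"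
    using that by (auto simp: rev_nodes_def occurs_def)
qed

text \<open>An edge of \<open>de_bruijn\<close> is determined by its source and its label, which
  permits the passage from pairs of nodes to pairs of a node and a label.\<close>

lemma de_bruijn_simps:
  assumes "1 \<le> k" "collection \<sigma> C"
  shows "rev ` nodes (de_bruijn k C) = rev_nodes k C"
    and "(u, v) \<in> edges (de_bruijn k C) \<longleftrightarrow>
      (rev u, last v) \<in> rev_edges k C \<and> rev v = last v # butlast (rev u)"
proof -
  interpret graph k "rev_nodes k C" "rev_edges k C" by (rule graph_de_bruijn[OF assms])
  have n: "v \<in> nodes (de_bruijn k C) \<longleftrightarrow> rev v \<in> rev_nodes k C" for v
    by (simp add: de_bruijn_def rev_nodes_def Let_def)
  then show "rev ` nodes (de_bruijn k C) = rev_nodes k C"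
    by (auto simp: image_iff) (metis rev_rev_ident)
  show "(u, v) \<in> edges (de_bruijn k C) \<longleftrightarrow>
      (rev u, last v) \<in> rev_edges k C \<and> rev v = last v # butlast (rev u)"
  proof
    assume "(u, v) \<in> edges (de_bruijn k C)"
    then have *: "u \<in> nodes (de_bruijn k C)" "v \<in> nodes (de_bruijn k C)" "butlast v = tl u"
      "occurs k C (u @ [last v])"
      by (auto simp: de_bruijn_def Let_def)
    then have "length u = k" "length v = k" using n length_V by fastforce+
    then have "v = butlast v @ [last v]" using assms(1) by (metis append_butlast_last_id list.size(3) not_one_le_zero)
    then have "rev v = last v # rev (tl u)" using *(3) by (metis rev.simps(2) rev_append rev_rev_ident rev_singleton_conv append_Cons append_Nil)
    then show "(rev u, last v) \<in> rev_edges k C \<and> rev v = last v # butlast (rev u)"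
      using * \<open>length u = k\<close> by (simp add: rev_edges_def butlast_rev)
  next
    assume *: "(rev u, last v) \<in> rev_edges k C \<and> rev v = last v # butlast (rev u)"
    then have "rev u \<in> rev_nodes k C" "rev v \<in> rev_nodes k C" using * edgeD by metis+
    moreover have "butlast v = tl u"
      using * by (metis butlast_rev butlast_snoc rev.simps(2) rev_rev_ident)
    moreover have "occurs k C (u @ [last v])" using * by (simp add: rev_edges_def)
    ultimately show "(u, v) \<in> edges (de_bruijn k C)" using n
      by (simp add: de_bruijn_def Let_def rev_nodes_def)
  qed
qed

lemma plain_boss_entries:
  assumes "1 \<le> k" "collection \<sigma> C"
  defines "E \<equiv> entries (rev_nodes k C) (rev_edges k C)"
  shows "boss_W (plain_boss (de_bruijn k C)) = map snd E"
    and "boss_Wminus (plain_boss (de_bruijn k C)) = map (\<lambda>e. of_bool (first_edge (rev_edges k C) e)) E"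
    and "boss_last (plain_boss (de_bruijn k C)) = map (\<lambda>e. of_bool (last_entry (rev_edges k C) e)) E"
proof -
  interpret graph k "rev_nodes k C" "rev_edges k C" by (rule graph_de_bruijn[OF assms(1,2)])
  let ?G = "de_bruijn k C" and ?X = "rev_edges k C"
  note ds = de_bruijn_simps[OF assms(1,2)]
  have ol: "out_labels ?G (rev x) = out_syms ?X x" for x
  proof -
    have "{last v |v. (rev x, v) \<in> edges ?G} = {a. (x, a) \<in> ?X}"
    proof (intro set_eqI iffI)
      fix a assume "a \<in> {a. (x, a) \<in> ?X}"
      then have "(rev x, rev (a # butlast x)) \<in> edges ?G" using ds(2)[of "rev x" "rev (a # butlast x)"] by simp
      then show "a \<in> {last v |v. (rev x, v) \<in> edges ?G}" by force
    qed (use ds(2) in auto)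
    then show ?thesis by (simp add: out_labels_def out_syms_def)
  qed
  have fe: "first_in_edge ?G (rev x) a \<longleftrightarrow> first_edge ?X (x, a)" for x a
  proof
    assume "first_in_edge ?G (rev x) a"
    then obtain v where v: "(rev x, v) \<in> edges ?G" "last v = a"
      "\<And>u'. (u', v) \<in> edges ?G \<Longrightarrow> rev (rev x) \<le> rev u'" unfolding first_in_edge_def by blast
    have "rev v = a # butlast x" "(x, a) \<in> ?X" using v ds(2) by auto
    moreover have "x \<le> x'" if "(x', a) \<in> ?X" "butlast x' = butlast x" for x'
      using v(3)[of "rev x'"] ds(2)[of "rev x'" v] that v(2) calculation by simp
    ultimately show "first_edge ?X (x, a)" by (simp add: first_edge_def)
  next
    assume f: "first_edge ?X (x, a)"
    let ?v = "rev (a # butlast x)"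
    have "(rev x, ?v) \<in> edges ?G" using f ds(2)[of "rev x" ?v] by (simp add: first_edge_def)
    moreover have "x \<le> rev u'" if "(u', ?v) \<in> edges ?G" for u'
      using that ds(2)[of u' ?v] f by (simp add: first_edge_def)
    ultimately show "first_in_edge ?G (rev x) a" by (auto simp: first_in_edge_def)
  qed
  have no: "node_order ?G = map rev node_list" by (simp add: node_order_def ds(1))
  show "boss_W (plain_boss ?G) = map snd E"
    by (simp add: plain_boss_def no ol E_def entries_def map_concat comp_def)
  show "boss_Wminus (plain_boss ?G) = map (\<lambda>e. of_bool (first_edge ?X e)) E"
    by (simp add: plain_boss_def no ol fe E_def entries_def map_concat comp_def)
  have "replicate (length (out_syms ?X x) - 1) (0::nat) @ [1] = map (\<lambda>a. of_bool (last_entry ?X (x, a))) (out_syms ?X x)" for x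
  proof -
    let ?l = "out_syms ?X x"
    have l: "?l = butlast ?l @ [last ?l]" using out_syms_nonempty by simp
    have "distinct (butlast ?l @ [last ?l])"
      using strict_sorted_out_syms[of x] l by (metis strict_sorted_iff)
    then have "last ?l \<notin> set (butlast ?l)" by (simp del: append_butlast_last_id)
    then have "map (\<lambda>a. of_bool (last_entry ?X (x, a))) (butlast ?l) = replicate (length ?l - 1) (0::nat)"
      by (intro replicate_eqI) (auto simp: last_entry_def)
    moreover have "map f ?l = map f (butlast ?l @ [last ?l])" for f :: "nat \<Rightarrow> nat"
      by (simp only: l[symmetric])
    ultimately show ?thesis by (simp add: last_entry_def del: append_butlast_last_id)
  qed
  then show "boss_last (plain_boss ?G) = map (\<lambda>e. of_bool (last_entry ?X e)) E"
    by (simp add: plain_boss_def no ol E_def entries_def map_concat comp_def)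
qed

lemma vo_boss_lcs:
  assumes "1 \<le> k" "collection \<sigma> C"
  defines "V \<equiv> rev_nodes k C"
  shows "lcs_array (vo_boss (de_bruijn k C)) =
    map (\<lambda>p. card {h \<in> {1..<k}. \<not> graph.boundary V h p}) [1..<card V]"
    and "card (nodes (de_bruijn k C)) = card V"
proof -
  interpret graph k V "rev_edges k C" unfolding V_def by (rule graph_de_bruijn[OF assms(1,2)])
  have rn: "rev ` nodes (de_bruijn k C) = V" unfolding V_def by (rule de_bruijn_simps(1)[OF assms(1,2)])
  then show "card (nodes (de_bruijn k C)) = card V" using card_image[of rev "nodes (de_bruijn k C)"] by simp
  have no: "node_order (de_bruijn k C) = map rev node_list" by (simp add: node_order_def rn)
  show "lcs_array (vo_boss (de_bruijn k C)) = map (\<lambda>p. card {h \<in> {1..<k}. \<not> boundary h p}) [1..<card V]"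
    using lcs_length_nodes by (auto simp: lcs_array_def vo_boss_def no)
qed

section \<open>Verification of word RAM programs\<close>

abbreviation add_expr :: "expr \<Rightarrow> expr \<Rightarrow> expr" (infixl "+\<^sub>e" 65) where "a +\<^sub>e b \<equiv> Bin Add a b"
abbreviation sub_expr :: "expr \<Rightarrow> expr \<Rightarrow> expr" (infixl "-\<^sub>e" 65) where "a -\<^sub>e b \<equiv> Bin Sub a b"
abbreviation mul_expr :: "expr \<Rightarrow> expr \<Rightarrow> expr" (infixl "*\<^sub>e" 70) where "a *\<^sub>e b \<equiv> Bin Mul a b"
abbreviation div_expr :: "expr \<Rightarrow> expr \<Rightarrow> expr" (infixl "div\<^sub>e" 70) where "a div\<^sub>e b \<equiv> Bin Div a b"
abbreviation mod_expr :: "expr \<Rightarrow> expr \<Rightarrow> expr" (infixl "mod\<^sub>e" 70) where "a mod\<^sub>e b \<equiv> Bin Mod a b"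
abbreviation shl_expr :: "expr \<Rightarrow> expr \<Rightarrow> expr" (infixl "<<\<^sub>e" 60) where "a <<\<^sub>e b \<equiv> Bin Shl a b"
abbreviation shr_expr :: "expr \<Rightarrow> expr \<Rightarrow> expr" (infixl ">>\<^sub>e" 60) where "a >>\<^sub>e b \<equiv> Bin Shr a b"
abbreviation less_expr :: "expr \<Rightarrow> expr \<Rightarrow> expr" (infix "<\<^sub>e" 50) where "a <\<^sub>e b \<equiv> Bin Less a b"
abbreviation equal_expr :: "expr \<Rightarrow> expr \<Rightarrow> expr" (infix "=\<^sub>e" 50) where "a =\<^sub>e b \<equiv> Bin Equal a b"
notation Seq (infixr ";;" 55)

lemma apply_binop_Add: "a + b < 2 ^ w \<Longrightarrow> apply_binop w Add a b = a + b"
  by simp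

lemma apply_binop_Sub: "b \<le> a \<Longrightarrow> a < 2 ^ w \<Longrightarrow> apply_binop w Sub a b = a - b"
proof -
  assume "b \<le> a" "a < 2 ^ w"
  then have "(2::nat) ^ w + a - b = (a - b) + 2 ^ w" by simp
  then show ?thesis using \<open>a < 2 ^ w\<close> by (simp del: add_diff_assoc2)
qed

lemma apply_binop_Mul: "a * b < 2 ^ w \<Longrightarrow> apply_binop w Mul a b = a * b"
  by simp

lemmas apply_binop_simps =
  apply_binop_Add apply_binop_Sub apply_binop_Mul apply_binop.simps(4,5,11,12)

declare apply_binop.simps [simp del]

type_synonym 's assertion = "(nat \<Rightarrow> nat) \<Rightarrow> ('s \<Rightarrow> nat list) \<Rightarrow> bool"

text \<open>Total correctness with a time bound; since \<open>exec\<close> is deterministic, one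
  terminating execution is the execution.\<close>

definition run :: "'s machine \<Rightarrow> 's com \<Rightarrow> 's state \<Rightarrow> nat \<Rightarrow> 's assertion \<Rightarrow> bool" where
  "run M c s T Q \<longleftrightarrow> (\<exists>t r h. exec M c s t (r, h) \<and> t \<le> T \<and> Q r h)"

text \<open>Only for programs without loops, whose running time is bounded by \<open>steps\<close>.\<close>

fun wp :: "'s machine \<Rightarrow> 's com \<Rightarrow> 's assertion \<Rightarrow> 's assertion" where
  "wp M Skip Q r h = Q r h"
| "wp M (Assign x e) Q r h = Q (r(x := eval_expr (word_size M) r e)) h"
| "wp M (Load x a e) Q r h =
    (eval_expr (word_size M) r e < length (h a) \<and>
     Q (r(x := h a ! eval_expr (word_size M) r e)) h)"
| "wp M (Store a e1 e2) Q r h =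
    (eval_expr (word_size M) r e1 < length (h a) \<and> writable M a \<and>
     Q r (h(a := (h a)[eval_expr (word_size M) r e1 :=
       eval_expr (word_size M) r e2 mod 2 ^ field_width M a])))"
| "wp M (Seq c1 c2) Q r h = wp M c1 (wp M c2 Q) r h"
| "wp M (If e c1 c2) Q r h =
    (if eval_expr (word_size M) r e \<noteq> 0 then wp M c1 Q r h else wp M c2 Q r h)"
| "wp M (While e c) Q r h = False"

fun steps :: "'s com \<Rightarrow> nat" where
  "steps Skip = 1"
| "steps (Assign x e) = 1 + expr_cost e"
| "steps (Load x a e) = 1 + expr_cost e"
| "steps (Store a e1 e2) = 1 + expr_cost e1 + expr_cost e2"
| "steps (Seq c1 c2) = steps c1 + steps c2"
| "steps (If e c1 c2) = 1 + expr_cost e + steps c1 + steps c2"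
| "steps (While e c) = 0"

lemma run_mono: "run M c s T Q \<Longrightarrow> T \<le> T' \<Longrightarrow> (\<And>r h. Q r h \<Longrightarrow> Q' r h) \<Longrightarrow> run M c s T' Q'"
  unfolding run_def by (meson order_trans)

lemma run_Seq:
  assumes "run M c1 s T1 Q1" and "\<And>r h. Q1 r h \<Longrightarrow> run M c2 (r, h) T2 Q"
  shows "run M (Seq c1 c2) s (T1 + T2) Q"
  using assms unfolding run_def by (meson exec.Seq add_mono)

lemma run_If:
  assumes "eval_expr (word_size M) r e \<noteq> 0 \<Longrightarrow> run M c1 (r, h) T Q"
    and "eval_expr (word_size M) r e = 0 \<Longrightarrow> run M c2 (r, h) T Q"
  shows "run M (If e c1 c2) (r, h) (1 + expr_cost e + T) Q"
  using assms unfolding run_def by (metis exec.IfTrue exec.IfFalse add_left_mono)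

lemma wp_run: "wp M c Q r h \<Longrightarrow> run M c (r, h) (steps c) Q"
proof (induction c arbitrary: Q r h)
  case Skip
  then show ?case unfolding run_def by (metis exec.Skip order_refl steps.simps(1) wp.simps(1))
next
  case (Assign x e)
  then show ?case by (auto simp: run_def intro!: exI exec.Assign)
next
  case (Load x a e)
  then show ?case by (auto simp: run_def intro!: exI exec.Load)
next
  case (Store a e1 e2)
  then show ?case by (auto simp: run_def intro!: exI exec.Store)
next
  case (Seq c1 c2)
  from Seq.prems have "wp M c1 (wp M c2 Q) r h" by simp
  from Seq.IH(1)[OF this] show ?case
    by (auto intro: run_Seq Seq.IH(2))
next
  case (If e c1 c2)
  have 1: "run M c1 (r, h) (steps c1 + steps c2) Q" if "eval_expr (word_size M) r e \<noteq> 0"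
    by (rule run_mono[OF If.IH(1)]) (use that If.prems in auto)
  have 2: "run M c2 (r, h) (steps c1 + steps c2) Q" if "eval_expr (word_size M) r e = 0"
    by (rule run_mono[OF If.IH(2)]) (use that If.prems in auto)
  show ?case using run_If[of M r e c1 h "steps c1 + steps c2" Q c2] 1 2 by (simp add: add.assoc)
next
  case (While e c)
  then show ?case by simp
qed

fun regs :: "'s com \<Rightarrow> nat set" where
  "regs (Assign x e) = {x}"
| "regs (Load x a e) = {x}"
| "regs (Seq c1 c2) = regs c1 \<union> regs c2"
| "regs (If e c1 c2) = regs c1 \<union> regs c2"
| "regs (While e c) = regs c"
| "regs _ = {}"

fun segs :: "'s com \<Rightarrow> 's set" where
  "segs (Store a e1 e2) = {a}"
| "segs (Seq c1 c2) = segs c1 \<union> segs c2"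
| "segs (If e c1 c2) = segs c1 \<union> segs c2"
| "segs (While e c) = segs c"
| "segs _ = {}"

text \<open>A frame condition read off the syntax. With it, loop invariants mention only what a loop
  changes, and no invariant has to repeat that array lengths are constant.\<close>

definition agree :: "'s com \<Rightarrow> (nat \<Rightarrow> nat) \<Rightarrow> ('s \<Rightarrow> nat list) \<Rightarrow> 's assertion" where
  "agree c r h r' h' \<longleftrightarrow> (\<forall>x. x \<notin> regs c \<longrightarrow> r' x = r x) \<and> (\<forall>a. a \<notin> segs c \<longrightarrow> h' a = h a) \<and>
    (\<forall>a. length (h' a) = length (h a))"

lemma agree_refl: "agree c r h r h"
  by (simp add: agree_def)

lemma agree_trans: "agree c r h r' h' \<Longrightarrow> agree c r' h' r'' h'' \<Longrightarrow> agree c r h r'' h''"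
  by (simp add: agree_def)

lemma exec_agree: "exec M c s t s' \<Longrightarrow> agree c (fst s) (snd s) (fst s') (snd s')"
  by (induction rule: exec.induct) (auto simp: agree_def)

lemma run_agree: "run M c (r, h) T Q \<Longrightarrow> run M c (r, h) T (\<lambda>r' h'. Q r' h' \<and> agree c r h r' h')"
  unfolding run_def using exec_agree by fastforce

lemma agree_reg: "agree c r h r' h' \<Longrightarrow> x \<notin> regs c \<Longrightarrow> r' x = r x"
  and agree_seg: "agree c r h r' h' \<Longrightarrow> a \<notin> segs c \<Longrightarrow> h' a = h a"
  and agree_length: "agree c r h r' h' \<Longrightarrow> length (h' a) = length (h a)"
  by (simp_all add: agree_def)

lemma run_While_upto:
  assumes step: "\<And>i r' h'. i < N \<Longrightarrow> agree c r h r' h' \<Longrightarrow> I i r' h' \<Longrightarrow>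
      eval_expr (word_size M) r' e \<noteq> 0 \<and> run M c (r', h') T (I (Suc i))"
    and exit: "\<And>r' h'. agree c r h r' h' \<Longrightarrow> I N r' h' \<Longrightarrow> eval_expr (word_size M) r' e = 0"
    and init: "I j r1 h1" "agree c r h r1 h1" and "j \<le> N"
  shows "run M (While e c) (r1, h1) ((N - j) * (T + expr_cost e + 1) + expr_cost e + 1)
    (\<lambda>r' h'. I N r' h' \<and> agree c r h r' h')"
  using init \<open>j \<le> N\<close>
proof (induction "N - j" arbitrary: j r1 h1)
  case 0
  then have "j = N" by simp
  with 0 exit[of r1 h1] have "exec M (While e c) (r1, h1) (1 + expr_cost e) (r1, h1)"
    by (intro exec.WhileFalse) auto
  with 0 \<open>j = N\<close> show ?case unfolding run_def by fastforce
next
  case (Suc d)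
  then have "j < N" by simp
  from step[OF this Suc.prems(2,1)] obtain t r2 h2
    where ev: "eval_expr (word_size M) r1 e \<noteq> 0"
      and ex: "exec M c (r1, h1) t (r2, h2)" "t \<le> T" "I (Suc j) r2 h2"
    unfolding run_def by blast
  have ag: "agree c r h r2 h2" using agree_trans[OF Suc.prems(2)] exec_agree[OF ex(1)] by simp
  have "d = N - Suc j" using Suc.hyps(2) by simp
  from Suc.hyps(1)[OF this ex(3) ag] \<open>j < N\<close> obtain t' r3 h3
    where ex': "exec M (While e c) (r2, h2) t' (r3, h3)"
      "t' \<le> (N - Suc j) * (T + expr_cost e + 1) + expr_cost e + 1"
      "I N r3 h3 \<and> agree c r h r3 h3"
    unfolding run_def by auto
  have e: "N - j = Suc (N - Suc j)" using \<open>j < N\<close> by simp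
  have "exec M (While e c) (r1, h1) (1 + expr_cost e + t + t') (r3, h3)"
    by (rule exec.WhileTrue[OF ev ex(1) ex'(1)])
  moreover have "1 + expr_cost e + t + t' \<le> (N - j) * (T + expr_cost e + 1) + expr_cost e + 1"
    using ex(2) ex'(2) unfolding e by simp
  ultimately show ?case using ex'(3) unfolding run_def by blast
qed

lemma run_While:
  assumes "I 0 r h"
    and "\<And>i r' h'. i < N \<Longrightarrow> agree c r h r' h' \<Longrightarrow> I i r' h' \<Longrightarrow>
      eval_expr (word_size M) r' e \<noteq> 0 \<and> run M c (r', h') T (I (Suc i))"
    and "\<And>r' h'. agree c r h r' h' \<Longrightarrow> I N r' h' \<Longrightarrow> eval_expr (word_size M) r' e = 0"
  shows "run M (While e c) (r, h) (N * (T + expr_cost e + 1) + expr_cost e + 1)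
    (\<lambda>r' h'. I N r' h' \<and> agree c r h r' h')"
proof -
  have "run M (While e c) (r, h) ((N - 0) * (T + expr_cost e + 1) + expr_cost e + 1)
    (\<lambda>r' h'. I N r' h' \<and> agree c r h r' h')"
    by (rule run_While_upto) (rule assms agree_refl le0 | assumption)+
  then show ?thesis by (simp only: diff_zero)
qed

lemma merge_machine_simps [simp]:
  "word_size (merge_machine w k \<sigma>) = w"
  "field_width (merge_machine w k \<sigma>) = merge_width w k \<sigma>"
  "writable (merge_machine w k \<sigma>) = merge_writable"
  by (simp_all add: merge_machine_def)

text \<open>\<open>N\<close> counts iterations and is not tied to \<open>x\<close>: in the merging
  loops \<open>x\<close> is a position among the nodes, while the guard counts the entries read so
  far.\<close>

lemma run_for:
  assumes "I 0 (r(x := 0)) h"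
    and "\<And>i r' h'. i < N \<Longrightarrow> agree (Assign x (Const 0);; While e c) r h r' h' \<Longrightarrow> I i r' h' \<Longrightarrow>
      eval_expr (word_size M) r' e \<noteq> 0 \<and> run M c (r', h') T (I (Suc i))"
    and "\<And>r' h'. agree (Assign x (Const 0);; While e c) r h r' h' \<Longrightarrow> I N r' h' \<Longrightarrow>
      eval_expr (word_size M) r' e = 0"
  shows "run M (Assign x (Const 0);; While e c) (r, h) (2 + (N * (T + expr_cost e + 1) + expr_cost e + 1)) (I N)"
proof (rule run_Seq)
  show "run M (Assign x (Const 0)) (r, h) 2 (\<lambda>r' h'. r' = r(x := 0) \<and> h' = h)"
    using wp_run[of M "Assign x (Const 0)" "\<lambda>r' h'. r' = r(x := 0) \<and> h' = h" r h]
    by (simp add: numeral_2_eq_2)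
  fix r1 h1 assume "r1 = r(x := 0) \<and> h1 = h"
  then have eq: "r1 = r(x := 0)" "h1 = h" by auto
  have ag: "agree (Assign x (Const 0);; While e c) r h r' h'" if "agree c r1 h1 r' h'" for r' h'
    using that by (auto simp: agree_def eq)
  have "run M (While e c) (r1, h1) (N * (T + expr_cost e + 1) + expr_cost e + 1)
      (\<lambda>r' h'. I N r' h' \<and> agree c r1 h1 r' h')"
  proof (rule run_While, goal_cases)
    case 1
    show ?case using assms(1) by (simp only: eq)
  next
    case (2 i r' h')
    show ?case by (rule assms(2)[OF 2(1) ag[OF 2(2)] 2(3)])
  next
    case (3 r' h')
    show ?case by (rule assms(3)[OF ag[OF 3(1)] 3(2)])
  qed
  then show "run M (While e c) (r1, h1) (N * (T + expr_cost e + 1) + expr_cost e + 1) (I N)"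
    by (rule run_mono) auto
qed

section \<open>Counting the labels\<close>

definition counted :: "nat \<Rightarrow> nat list \<Rightarrow> nat list \<Rightarrow> nat \<Rightarrow> nat list \<Rightarrow> bool" where
  "counted \<sigma> A D d ys \<longleftrightarrow> length A = \<sigma> \<and> length D = \<sigma> \<and> set ys \<subseteq> {1..\<sigma>} \<and>
    (\<forall>c\<in>{1..\<sigma>}. A ! (c - 1) = count_list ys c) \<and>
    d \<le> \<sigma> \<and> distinct (take d D) \<and> set (take d D) = set ys"

text \<open>The counters start at zero, so a zero counter marks the first occurrence of a label;
  only then is the label listed. This avoids any work proportional to
  \<open>\<sigma>\<close>.\<close>

lemma counted_snoc:
  assumes "counted \<sigma> A D d ys" "c \<in> {1..\<sigma>}"
  shows "A ! (c - 1) \<noteq> 0 \<Longrightarrow> counted \<sigma> (A[c - 1 := A ! (c - 1) + 1]) D d (ys @ [c])"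
    and "A ! (c - 1) = 0 \<Longrightarrow> d < \<sigma> \<and>
      counted \<sigma> (A[c - 1 := A ! (c - 1) + 1]) (D[d := c]) (d + 1) (ys @ [c])"
proof -
  have A: "A ! (c - 1) = count_list ys c" using assms by (simp add: counted_def)
  have upd: "\<forall>b\<in>{1..\<sigma>}. A[c - 1 := A ! (c - 1) + 1] ! (b - 1) = count_list (ys @ [c]) b"
  proof
    fix b assume b: "b \<in> {1..\<sigma>}"
    show "A[c - 1 := A ! (c - 1) + 1] ! (b - 1) = count_list (ys @ [c]) b"
    proof (cases "b = c")
      case False
      then have "b - 1 \<noteq> c - 1" using b assms(2) by auto
      then show ?thesis using False b assms(1) by (simp add: counted_def)
    qed (use assms A in \<open>auto simp: counted_def\<close>)
  qed
  show "counted \<sigma> (A[c - 1 := A ! (c - 1) + 1]) D d (ys @ [c])" if "A ! (c - 1) \<noteq> 0"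
  proof -
    have "c \<in> set ys" using that A by (metis count_list_0_iff)
    then show ?thesis using upd assms unfolding counted_def by auto
  qed
  show "d < \<sigma> \<and> counted \<sigma> (A[c - 1 := A ! (c - 1) + 1]) (D[d := c]) (d + 1) (ys @ [c])"
    if "A ! (c - 1) = 0"
  proof -
    have c: "c \<notin> set ys" using that A by (metis count_list_0_iff)
    have d: "d = card (set ys)" using assms(1) distinct_card[of "take d D"] by (simp add: counted_def)
    \<comment> \<open>The listed labels and \<open>c\<close> are distinct members of
      \<open>{1..\<sigma>}\<close>, so the list still has room.\<close>
    have "insert c (set ys) \<subseteq> {1..\<sigma>}" using assms by (auto simp: counted_def)
    from card_mono[OF _ this] c d have "d < \<sigma>" by simp
    moreover from this have "take (d + 1) (D[d := c]) = take d D @ [c]"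
      using assms(1) by (simp add: counted_def take_Suc_conv_app_nth)
    ultimately show ?thesis using upd assms c unfolding counted_def by auto
  qed
qed

text \<open>Throughout, registers \<open>6\<close> and \<open>7\<close> hold \<open>n\<close> and \<open>m\<close>, register \<open>8\<close> the number of distinct labels,
  \<open>9\<close> the number of nodes \<open>$\<^sup>k\<close>, and \<open>10\<close> the number of completed passes; \<open>22\<close> and \<open>23\<close> hold the numbers of
  nodes and entries of the merged graph. \<open>Work_Words 0\<close> to \<open>2\<close> hold the label counts, the distinct
  labels and the bucket starts of the two input graphs, \<open>Work_Words 3\<close> to \<open>5\<close> those of the merged
  graph, and \<open>Work_Words 8\<close> is the scratch array of radix sort.\<close>

definition count_body :: "segment \<Rightarrow> segment \<Rightarrow> nat \<Rightarrow> segment com" where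
  "count_body W M q =
    Load 15 W (Reg 11);; Load 16 M (Reg 11);;
    If (Reg 16)
      (Load 14 (Work_Words q) (Reg 15 -\<^sub>e Const 1);;
       If (Reg 14) Skip
         (Store (Work_Words (q + 1)) (Reg 8) (Reg 15);; Assign 8 (Reg 8 +\<^sub>e Const 1));;
       Store (Work_Words q) (Reg 15 -\<^sub>e Const 1) (Reg 14 +\<^sub>e Const 1))
      Skip;;
    Assign 11 (Reg 11 +\<^sub>e Const 1)"

definition count_prog :: "segment \<Rightarrow> segment \<Rightarrow> nat \<Rightarrow> nat \<Rightarrow> segment com" where
  "count_prog W M m q =
    Assign 11 (Const 0);; While (Reg 11 <\<^sub>e Reg m) (count_body W M q)"

text \<open>\<open>ys\<close> are the labels counted before, so that the second graph can be counted
  on top of the first one.\<close>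

lemma run_count_prog:
  assumes w: "2 \<le> w" and \<sigma>: "\<sigma> < 2 ^ w"
    and W: "h W = map f es" "h M = map (\<lambda>e. of_bool (P e)) es" "\<And>e. e \<in> set es \<Longrightarrow> P e \<Longrightarrow> f e \<in> {1..\<sigma>}"
    and len: "length ys + length es < 2 ^ w" and m: "r m = length es"
    and fresh: "m \<notin> {8, 11, 14, 15, 16}" "W \<notin> range Work_Words" "M \<notin> range Work_Words"
    and pre: "counted \<sigma> (h (Work_Words q)) (h (Work_Words (q + 1))) (r 8) ys"
  shows "run (merge_machine w k \<sigma>) (count_prog W M m q) (r, h) (100 * length es + 100)
    (\<lambda>r' h'. counted \<sigma> (h' (Work_Words q)) (h' (Work_Words (q + 1))) (r' 8) (ys @ map f (filter P es)))"
proof -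
  let ?M = "merge_machine w k \<sigma>"
  let ?I = "\<lambda>i r' h'. r' 11 = i \<and> counted \<sigma> (h' (Work_Words q)) (h' (Work_Words (q + 1))) (r' 8)
    (ys @ map f (filter P (take i es)))"
  have [simp]: "W \<noteq> Work_Words j" "M \<noteq> Work_Words j" for j using fresh by auto
  have one: "1 mod 2 ^ w = (1::nat)" using w by simp
  let ?L = "Assign 11 (Const 0);; While (Reg 11 <\<^sub>e Reg m) (count_body W M q)"
  have "run ?M ?L (r, h) (2 + (length es * (steps (count_body W M q) + expr_cost (Reg 11 <\<^sub>e Reg m) + 1) +
      expr_cost (Reg 11 <\<^sub>e Reg m) + 1)) (?I (length es))"
  proof (rule run_for, goal_cases)
    case 1
    then show ?case using pre by simp
  next
    case (2 i r' h')
    have eqs: "r' m = length es" "h' W = map f es" "h' M = map (\<lambda>e. of_bool (P e)) es"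
      using agree_reg[OF 2(2), of m] agree_seg[OF 2(2), of W] agree_seg[OF 2(2), of M] fresh m W
      by (auto simp: count_body_def)
    let ?ys = "ys @ map f (filter P (take i es))" and ?c = "f (es ! i)"
    let ?A = "h' (Work_Words q)" and ?D = "h' (Work_Words (q + 1))"
    have I: "r' 11 = i" "counted \<sigma> ?A ?D (r' 8) ?ys" using 2 by auto
    have c: "?c \<in> {1..\<sigma>}" if "P (es ! i)" using W(3)[of "es ! i"] that 2(1) by simp
    note snoc = counted_snoc[OF I(2) c]
    \<comment> \<open>The counter is bounded by the number of labels seen so far, so incrementing it
      does not wrap around.\<close>
    have "count_list ?ys ?c \<le> length ?ys" by (rule count_le_length)
    also have "\<dots> < 2 ^ w - 1"
    proof -
      have "length (filter P (take i es)) \<le> i" by (rule order_trans[OF length_filter_le]) simp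
      then show ?thesis using len 2(1) by simp
    qed
    finally have cl: "count_list ?ys ?c < 2 ^ w - 1" .
    have Ac: "?A ! (?c - 1) = count_list ?ys ?c" "?c - 1 < \<sigma>" "length ?A = \<sigma>" "length ?D = \<sigma>"  if "P (es ! i)"
      using I(2) c[OF that] by (auto simp: counted_def)
    have d: "r' 8 \<le> \<sigma>" using I(2) by (simp add: counted_def)
    have lt: "?c < 2 ^ w" "r' 8 < 2 ^ w" if "P (es ! i)" using c[OF that] \<sigma> d by auto
    have tk: "take (Suc i) es = take i es @ [es ! i]" using 2(1) by (simp add: take_Suc_conv_app_nth)
    have "wp ?M (count_body W M q) (?I (Suc i)) r' h'"
    proof (cases "P (es ! i)")
      case False
      then show ?thesis using eqs I 2(1) len tk w
        by (simp add: count_body_def one apply_binop_simps)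
    next
      case True
      note snoc = snoc[OF True] and Ac = Ac[OF True] and lt = lt[OF True] and c = c[OF True]
      show ?thesis
      proof (cases "?A ! (?c - 1) = 0")
        case zero: True
        then show ?thesis using eqs I 2(1) len tk w True snoc(2)[OF zero] Ac lt \<sigma> c
          by (simp add: count_body_def one apply_binop_simps)
      next
        case nz: False
        then show ?thesis using eqs I 2(1) len tk w True snoc(1)[OF nz] Ac lt \<sigma> cl c
          by (simp add: count_body_def one apply_binop_simps)
      qed
    qed
    then show ?case using eqs I 2(1) by (auto simp: apply_binop_simps intro: wp_run)
  next
    case (3 r' h')
    have "r' m = length es"
      using agree_reg[OF 3(1), of m] fresh m by (auto simp: count_body_def)
    then show ?case using 3 by (simp add: apply_binop_simps)
  qed
  then show ?thesis unfolding count_prog_def by (rule run_mono) (simp_all add: count_body_def)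
qed

section \<open>Sorting the labels\<close>

text \<open>Used with exponent \<open>2 * c\<close> to bound a polynomial in the field width by a
  multiple of the number of labels. Since \<open>f < k * (f div k + 1)\<close> and
  \<open>m + 1 \<le> 2 ^ m\<close>, \<open>f\<close> is at most \<open>k * 2 ^ (f div k)\<close>;
  then raise to the power \<open>k\<close>.\<close>

lemma power_le_exp: "f ^ k \<le> k ^ k * 2 ^ (f::nat)"
proof (cases "k = 0")
  case False
  have "f < k * (f div k + 1)" using False by (metis add.commute mult.commute dividend_less_div_times neq0_conv mult_Suc_right Suc_eq_plus1 add.commute)
  moreover have "m + 1 \<le> 2 ^ m" for m :: nat by (induction m) auto
  ultimately have "f \<le> k * 2 ^ (f div k)"
    by (meson less_imp_le mult_le_mono2 order_trans)
  then have "f ^ k \<le> (k * 2 ^ (f div k)) ^ k" by (rule power_mono) simp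
  also have "\<dots> = k ^ k * 2 ^ (f div k * k)" by (simp add: power_mult_distrib power_mult)
  also have "\<dots> \<le> k ^ k * 2 ^ f" by (intro mult_le_mono2 power_increasing) (simp_all add: div_times_less_eq_dividend)
  finally show ?thesis .
qed simp

section \<open>Arrays of counters packed into one word\<close>

text \<open>A word is used as an array of \<open>b\<close> digits in base \<open>B\<close>.\<close>

definition packed :: "nat \<Rightarrow> nat \<Rightarrow> (nat \<Rightarrow> nat) \<Rightarrow> nat" where
  "packed B b a = (\<Sum>j<b. a j * B ^ j)"

lemma packed_less:
  assumes "\<And>j. j < b \<Longrightarrow> a j < B"
  shows "packed B b a < B ^ b"
  using assms
proof (induction b)
  case (Suc b)
  have "packed B b a < B ^ b" "a b < B" using Suc by auto
  then have "packed B (Suc b) a < B ^ b + a b * B ^ b" by (simp add: packed_def)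
  also have "\<dots> = (a b + 1) * B ^ b" by simp
  also have "\<dots> \<le> B * B ^ b" using \<open>a b < B\<close> by (intro mult_right_mono) auto
  finally show ?case by simp
qed (simp add: packed_def)

lemma packed_digit:
  assumes "\<And>j. j < b \<Longrightarrow> a j < B" "i < b"
  shows "packed B b a div B ^ i mod B = a i"
proof -
  have "0 < B" using assms by (cases B) auto
  have split: "{..<b} = {..<i} \<union> {i} \<union> {Suc i..<b}" using assms(2) by auto
  have "packed B b a = packed B i a + a i * B ^ i + (\<Sum>j\<in>{Suc i..<b}. a j * B ^ j)"
    unfolding packed_def split by (subst sum.union_disjoint, auto)+
  also have "(\<Sum>j\<in>{Suc i..<b}. a j * B ^ j) = (\<Sum>j\<in>{Suc i..<b}. a j * B ^ (j - Suc i)) * B ^ Suc i"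
    unfolding sum_distrib_right
    by (intro sum.cong refl) (simp add: mult.assoc power_add[symmetric] del: power_Suc)
  finally have eq: "packed B b a = packed B i a +
      (a i + (\<Sum>j\<in>{Suc i..<b}. a j * B ^ (j - Suc i)) * B) * B ^ i"
    by (simp add: algebra_simps)
  have "packed B i a < B ^ i" using assms by (intro packed_less) auto
  then have "packed B b a div B ^ i = a i + (\<Sum>j\<in>{Suc i..<b}. a j * B ^ (j - Suc i)) * B"
    unfolding eq using \<open>0 < B\<close> by (simp add: div_mult_self3)
  then show ?thesis using assms by simp
qed

lemma packed_add: "packed B b a + packed B b a' = packed B b (\<lambda>j. a j + a' j)"
  by (simp add: packed_def sum.distrib algebra_simps)

text \<open>Only the lowest \<open>b\<close> fields of a word are specified, because shifted
  summands spill over into the bits above them. As \<open>B ^ b\<close> divides the word modulus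
  \<open>W\<close>, neither this spill nor a wrap-around disturbs the fields.\<close>

lemma packed_word_add:
  assumes "P mod B ^ b = packed B b a" "x mod B ^ b = packed B b a'" "B ^ b dvd W"
    and "\<And>j. j < b \<Longrightarrow> a j + a' j < B"
  shows "(P + x) mod W mod B ^ b = packed B b (\<lambda>j. a j + a' j)"
proof -
  have "(P + x) mod W mod B ^ b = (P mod B ^ b + x mod B ^ b) mod B ^ b"
    using assms(3) by (simp add: mod_mod_cancel mod_add_eq)
  also have "\<dots> = packed B b (\<lambda>j. a j + a' j)"
    using assms packed_less[of b "\<lambda>j. a j + a' j" B] by (simp add: packed_add)
  finally show ?thesis .
qed

lemma packed_word_digit:
  assumes "P mod B ^ b = packed B b a" "\<And>j. j < b \<Longrightarrow> a j < B" "i < b"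
  shows "P div B ^ i mod B = a i"
proof -
  have "P div B ^ i mod B = (P mod B ^ b) div B ^ i mod B"
  proof -
    have 1: "B ^ b = B ^ i * B ^ (b - i)" using assms(3) by (simp flip: power_add)
    have "P mod B ^ b div B ^ i = P div B ^ i mod B ^ (b - i)"
    proof -
      have "0 < B ^ i" using assms(2,3) by (metis gr_zeroI not_less_zero power_eq_0_iff)
      then show ?thesis unfolding 1 mod_mult2_eq by simp
    qed
    moreover have "B dvd B ^ (b - i)" using assms(3) by (simp add: dvd_power)
    ultimately show ?thesis by (simp add: mod_mod_cancel)
  qed
  then show ?thesis using packed_digit[OF assms(2,3)] assms(1) by simp
qed

lemma packed_unit: "j < b \<Longrightarrow> packed B b (\<lambda>i. of_bool (i = j)) = B ^ j"
  by (simp add: packed_def of_bool_def if_distrib[of "\<lambda>x. x * _"] cong: if_cong)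

text \<open>A geometric sum. Read backwards, it yields the word with a one in each field by a single
  division.\<close>

lemma packed_ones: "(B - 1) * packed B b (\<lambda>_. 1) = B ^ b - (1::nat)" if "1 \<le> B"
proof -
  have "(B - 1) * packed B b (\<lambda>_. 1) + 1 = B ^ b"
  proof (induction b)
    case (Suc b)
    have "(B - 1) * packed B (Suc b) (\<lambda>_. 1) + 1 = ((B - 1) * packed B b (\<lambda>_. 1) + 1) + (B - 1) * B ^ b"
      by (simp add: packed_def algebra_simps)
    also have "\<dots> = B ^ Suc b" using Suc that by (simp add: algebra_simps)
    finally show ?case .
  qed (simp add: packed_def)
  then show ?thesis by simp
qed

text \<open>Adding this word increments the counters of all fields from \<open>i\<close> on at once,
  so the fields hold prefix sums, that is bucket starts, without a further loop.\<close>

lemma packed_shift_ones: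
  assumes "i \<le> b" "2 \<le> B"
  shows "packed B b (\<lambda>_. 1) * B ^ i mod B ^ b = packed B b (\<lambda>j. of_bool (i \<le> j))"
proof -
  have "packed B b (\<lambda>_. 1) * B ^ i = (\<Sum>j<b. B ^ (j + i))"
    by (simp add: packed_def sum_distrib_right power_add)
  also have "\<dots> = (\<Sum>j\<in>{i..<b + i}. B ^ j)"
    using sum.shift_bounds_nat_ivl[of "\<lambda>j. B ^ j" 0 i b] by (simp add: lessThan_atLeast0)
  also have "\<dots> = (\<Sum>j\<in>{i..<b}. B ^ j) + (\<Sum>j\<in>{b..<b + i}. B ^ j)"
    using assms by (simp add: sum.atLeastLessThan_concat)
  also have "(\<Sum>j\<in>{b..<b + i}. B ^ j) = (\<Sum>j\<in>{b..<b + i}. B ^ (j - b)) * B ^ b"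
    unfolding sum_distrib_right by (intro sum.cong refl) (simp flip: power_add)
  finally have "packed B b (\<lambda>_. 1) * B ^ i mod B ^ b = (\<Sum>j\<in>{i..<b}. B ^ j) mod B ^ b" by simp
  also have "(\<Sum>j\<in>{i..<b}. B ^ j) = packed B b (\<lambda>j. of_bool (i \<le> j))"
  proof -
    have "{i..<b} = {j \<in> {..<b}. i \<le> j}" by auto
    then have "(\<Sum>j\<in>{i..<b}. B ^ j) = (\<Sum>j\<in>{j \<in> {..<b}. i \<le> j}. B ^ j)" by (simp only:)
    also have "\<dots> = (\<Sum>j<b. if i \<le> j then B ^ j else 0)" by (rule sum.inter_filter) simp
    also have "\<dots> = packed B b (\<lambda>j. of_bool (i \<le> j))"
      unfolding packed_def by (intro sum.cong refl) simp
    finally show ?thesis .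
  qed
  also have "\<dots> mod B ^ b = \<dots>" using assms by (intro mod_less packed_less) auto
  finally show ?thesis .
qed

section \<open>Radix sort with the counters of a pass in one word\<close>

lemma sorted_digit_step:
  fixes b :: nat
  assumes "sorted (map (\<lambda>x. x mod b ^ p) xs)" "0 < b"
  shows "sorted (map (\<lambda>x. x mod b ^ Suc p) (sort_key (\<lambda>x. x div b ^ p mod b) xs))"
proof -
  have "sorted_wrt (\<lambda>x y. x mod b ^ p \<le> y mod b ^ p) xs" using assms by (simp add: sorted_wrt_map)
  from sorted_wrt_sort_key[OF this, of "\<lambda>x. x div b ^ p mod b"]
  have "sorted_wrt (\<lambda>x y. x mod b ^ Suc p \<le> y mod b ^ Suc p) (sort_key (\<lambda>x. x div b ^ p mod b) xs)"
  proof (rule sorted_wrt_mono_rel[rotated])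
    fix x y assume *: "x div b ^ p mod b < y div b ^ p mod b \<or>
      x div b ^ p mod b = y div b ^ p mod b \<and> x mod b ^ p \<le> y mod b ^ p"
    have eq: "z mod b ^ Suc p = b ^ p * (z div b ^ p mod b) + z mod b ^ p" for z
      by (simp add: mod_mult2_eq mult.commute[of b])
    show "x mod b ^ Suc p \<le> y mod b ^ Suc p"
    proof (cases "x div b ^ p mod b < y div b ^ p mod b")
      case True
      have "b ^ p * (x div b ^ p mod b) + x mod b ^ p < b ^ p * (x div b ^ p mod b + 1)"
        using assms(2) by simp
      also have "\<dots> \<le> b ^ p * (y div b ^ p mod b)" using True by (intro mult_le_mono2) simp
      finally show ?thesis unfolding eq by simp
    qed (use * in \<open>simp add: eq del: power_Suc\<close>)
  qed
  then show ?thesis by (simp add: sorted_wrt_map)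
qed

text \<open>The divisions are unfolded into the expression, since \<open>p\<close> is a constant of
  the program, at most \<open>3 * c\<close>; so the cost \<open>1 + 2 * p\<close> is constant for
  fixed \<open>c\<close>.\<close>

fun digit_expr :: "nat \<Rightarrow> expr" where
  "digit_expr 0 = Reg 15"
| "digit_expr (Suc p) = digit_expr p div\<^sub>e Reg 25"

lemma eval_digit_expr: "eval_expr w r (digit_expr p) = r 15 div r 25 ^ p"
  by (induction p) (simp_all add: apply_binop.simps div_mult2_eq[symmetric] mult.commute)

text \<open>Register \<open>24\<close> holds the field width \<open>f\<close>, \<open>25\<close> the
  base \<open>b\<close>, \<open>26\<close> the packed counters and \<open>27\<close> a one in each
  field.\<close>

definition pass_count_body :: "nat \<Rightarrow> nat \<Rightarrow> segment com" where
  "pass_count_body p q =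
    Load 15 (Work_Words q) (Reg 11);;
    Assign 16 (digit_expr p mod\<^sub>e Reg 25);;
    Assign 26 (Reg 26 +\<^sub>e (Reg 27 <<\<^sub>e (Reg 24 *\<^sub>e (Reg 16 +\<^sub>e Const 1))));;
    Assign 11 (Reg 11 +\<^sub>e Const 1)"

definition pass_move_body :: "nat \<Rightarrow> nat \<Rightarrow> segment com" where
  "pass_move_body p q =
    Load 15 (Work_Words q) (Reg 11);;
    Assign 16 (digit_expr p mod\<^sub>e Reg 25);;
    Assign 17 ((Reg 26 >>\<^sub>e (Reg 24 *\<^sub>e Reg 16)) mod\<^sub>e (Const 1 <<\<^sub>e Reg 24));;
    Store (Work_Words 8) (Reg 17) (Reg 15);;
    Assign 26 (Reg 26 +\<^sub>e (Const 1 <<\<^sub>e (Reg 24 *\<^sub>e Reg 16)));;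
    Assign 11 (Reg 11 +\<^sub>e Const 1)"

definition pass_copy_body :: "nat \<Rightarrow> segment com" where
  "pass_copy_body q =
    Load 15 (Work_Words 8) (Reg 11);; Store (Work_Words q) (Reg 11) (Reg 15);;
    Assign 11 (Reg 11 +\<^sub>e Const 1)"

definition pass_prog :: "nat \<Rightarrow> nat \<Rightarrow> segment com" where
  "pass_prog p q =
    Assign 26 (Const 0);;
    (Assign 11 (Const 0);; While (Reg 11 <\<^sub>e Reg 8) (pass_count_body p q));;
    (Assign 11 (Const 0);; While (Reg 11 <\<^sub>e Reg 8) (pass_move_body p q));;
    (Assign 11 (Const 0);; While (Reg 11 <\<^sub>e Reg 8) (pass_copy_body q))"

lemma run_wp: "wp M c Q r h \<Longrightarrow> steps c \<le> T \<Longrightarrow> run M c (r, h) T Q"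
  by (rule run_mono[OF wp_run])

text \<open>\<open>length xs < 2 ^ f\<close> keeps every counter inside its field,
  \<open>f * b \<le> w\<close> makes the \<open>b\<close> counters fit into a word, and
  \<open>f < w\<close> makes \<open>2 ^ f\<close> itself a word.\<close>

locale packed_pass =
  fixes w k \<sigma> f b :: nat and xs :: "nat list"
  assumes w: "2 \<le> w" and f: "1 \<le> f" "f < w" and b: "2 \<le> b" "f * b \<le> w"
    and len: "length xs < 2 ^ f" and words: "\<And>x. x \<in> set xs \<Longrightarrow> x < 2 ^ w"
begin

abbreviation "B \<equiv> (2::nat) ^ f"
abbreviation "M \<equiv> merge_machine w k \<sigma>"

definition digit :: "nat \<Rightarrow> nat \<Rightarrow> nat" where
  "digit p x = x div b ^ p mod b"

lemma digit_less: "digit p x < b"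
  using b by (simp add: digit_def)

lemma two_B: "2 \<le> B"
  using power_increasing[of 1 f "2::nat"] f by simp

lemma B_dvd: "B ^ b dvd 2 ^ w"
  using b by (simp flip: power_mult add: le_imp_power_dvd)

lemma less_w: "x \<le> w \<Longrightarrow> x < 2 ^ w"
  by (rule le_less_trans[OF _ less_exp])

lemma len_word: "length xs + 1 < 2 ^ w"
proof -
  have "length xs + 1 \<le> 2 ^ f" using len by simp
  also have "\<dots> < 2 ^ w" using f by simp
  finally show ?thesis .
qed

lemma f_digit: "f * (digit p x + 1) \<le> w" "f * digit p x < w" "digit p x + 1 < 2 ^ w"
proof -
  have "f * (digit p x + 1) \<le> f * b" using digit_less by (intro mult_le_mono2) (simp add: Suc_le_eq)
  then show *: "f * (digit p x + 1) \<le> w" using b by simp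
  then show "f * digit p x < w" using f by simp
  have "digit p x + 1 \<le> f * (digit p x + 1)"
    using mult_le_mono1[OF f(1), of "digit p x + 1"] by simp
  then show "digit p x + 1 < 2 ^ w" using * less_w by (meson order_trans)
qed

definition regs_ok :: "(nat \<Rightarrow> nat) \<Rightarrow> bool" where
  "regs_ok r \<longleftrightarrow> r 8 = length xs \<and> r 24 = f \<and> r 25 = b \<and> r 27 = packed B b (\<lambda>_. 1)"

lemma run_pass_count:
  assumes "regs_ok r" "r 26 = 0" "length (h (Work_Words q)) = \<sigma>" "length xs \<le> \<sigma>"
    "take (length xs) (h (Work_Words q)) = xs"
  shows "run M (Assign 11 (Const 0);; While (Reg 11 <\<^sub>e Reg 8) (pass_count_body p q)) (r, h)
    (2 + (length xs * (steps (pass_count_body p q) + expr_cost (Reg 11 <\<^sub>e Reg 8) + 1) +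
      expr_cost (Reg 11 <\<^sub>e Reg 8) + 1))
    (\<lambda>r' h'. r' 11 = length xs \<and>
      r' 26 mod B ^ b = packed B b (\<lambda>j. length (filter (\<lambda>x. digit p x < j) (take (length xs) xs))))"
proof (rule run_for, goal_cases)
  case 1
  show ?case using assms(2) by (simp add: packed_def)
next
  case (2 i r' h')
  have eqs: "r' 8 = length xs" "r' 24 = f" "r' 25 = b" "r' 27 = packed B b (\<lambda>_. 1)"
    using agree_reg[OF 2(2)] assms(1) by (simp_all add: pass_count_body_def regs_ok_def)
  have h: "h' (Work_Words q) = h (Work_Words q)"
    using agree_seg[OF 2(2), of "Work_Words q"] by (simp add: pass_count_body_def)
  have x: "h (Work_Words q) ! i = xs ! i" using 2(1) assms(5) by (metis nth_take)
  have I: "r' 11 = i"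
    "r' 26 mod B ^ b = packed B b (\<lambda>j. length (filter (\<lambda>x. digit p x < j) (take i xs)))"
    using 2 by auto
  let ?x = "xs ! i"
  \<comment> \<open>The shift starts at the field after the digit; for the digit
    \<open>b - 1\<close> it moves past all \<open>b\<close> fields and adds nothing to them.\<close>
  have "(packed B b (\<lambda>_. 1) * B ^ (digit p ?x + 1)) mod 2 ^ w mod B ^ b =
      packed B b (\<lambda>j. of_bool (digit p ?x + 1 \<le> j))"
    using packed_shift_ones[of "digit p ?x + 1" b B] digit_less[of p ?x] two_B B_dvd
    by (simp add: mod_mod_cancel Suc_le_eq)
  moreover have "length (filter (\<lambda>x. digit p x < j) (take i xs)) + of_bool (digit p ?x + 1 \<le> j) < B" for j
  proof -
    have "length (filter (\<lambda>x. digit p x < j) (take i xs)) \<le> i"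
      by (rule order_trans[OF length_filter_le]) simp
    then show ?thesis using 2(1) len by (simp add: of_bool_def)
  qed
  ultimately have "(r' 26 + (packed B b (\<lambda>_. 1) * B ^ (digit p ?x + 1)) mod 2 ^ w) mod 2 ^ w mod B ^ b =
      packed B b (\<lambda>j. length (filter (\<lambda>x. digit p x < j) (take i xs)) + of_bool (digit p ?x + 1 \<le> j))"
    by (rule packed_word_add[OF I(2) _ B_dvd])
  also have "(\<lambda>j. length (filter (\<lambda>x. digit p x < j) (take i xs)) + of_bool (digit p ?x + 1 \<le> j)) =
      (\<lambda>j. length (filter (\<lambda>x. digit p x < j) (take (Suc i) xs)))"
    using 2(1) by (auto simp: fun_eq_iff take_Suc_conv_app_nth)
  finally have add: "(r' 26 + take_bit w (push_bit (f * (digit p ?x + 1)) (packed B b (\<lambda>_. 1)))) mod 2 ^ w mod B ^ b =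
      packed B b (\<lambda>j. length (filter (\<lambda>x. digit p x < j) (take (Suc i) xs)))"
    by (simp add: take_bit_eq_mod push_bit_eq_mult power_mult del: power_Suc mult_Suc_right)
  have dig: "r' 15 div r' 25 ^ p mod r' 25 = digit p (r' 15)" if "r' 25 = b" for r'
    using that by (simp add: digit_def)
  have "wp M (pass_count_body p q) (\<lambda>r' h'. r' 11 = Suc i \<and>
      r' 26 mod B ^ b = packed B b (\<lambda>j. length (filter (\<lambda>x. digit p x < j) (take (Suc i) xs)))) r' h'"
    using add eqs I(1) h x 2(1) assms(3,4) f_digit[of p ?x] less_w len_word w
    by (simp add: pass_count_body_def eval_digit_expr apply_binop_simps apply_binop.simps(1,9)
        digit_def[symmetric] del: mult_Suc_right)
  then show ?case using eqs I(1) 2(1) by (auto simp: apply_binop_simps intro: run_wp)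
next
  case (3 r' h')
  have "r' 8 = length xs" using agree_reg[OF 3(1), of 8] assms(1) by (simp add: pass_count_body_def regs_ok_def)
  then show ?case using 3 by (simp add: apply_binop_simps)
qed

lemma run_pass_move:
  assumes "regs_ok r" "length (h (Work_Words q)) = \<sigma>" "length xs \<le> \<sigma>"
    "take (length xs) (h (Work_Words q)) = xs" "length (h (Work_Words 8)) = \<sigma>" "q \<noteq> 8"
    "r 26 mod B ^ b = packed B b (\<lambda>j. length (filter (\<lambda>x. digit p x < j) xs))"
  shows "run M (Assign 11 (Const 0);; While (Reg 11 <\<^sub>e Reg 8) (pass_move_body p q)) (r, h)
    (2 + (length xs * (steps (pass_move_body p q) + expr_cost (Reg 11 <\<^sub>e Reg 8) + 1) +
      expr_cost (Reg 11 <\<^sub>e Reg 8) + 1))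
    (\<lambda>r' h'. r' 11 = length xs \<and>
      r' 26 mod B ^ b = packed B b (\<lambda>j. length (filter (\<lambda>x. digit p x < j) xs) +
        length (filter (\<lambda>x. digit p x = j) (take (length xs) xs))) \<and>
      (\<forall>s<length xs. h' (Work_Words 8) ! rank (digit p) xs s = xs ! s))"
proof (rule run_for, goal_cases)
  case 1
  show ?case using assms(7) by simp
next
  case (2 i r' h')
  have eqs: "r' 8 = length xs" "r' 24 = f" "r' 25 = b"
    using agree_reg[OF 2(2)] assms(1) by (simp_all add: pass_move_body_def regs_ok_def)
  have h: "h' (Work_Words q) = h (Work_Words q)"
    using agree_seg[OF 2(2), of "Work_Words q"] assms(6) by (simp add: pass_move_body_def)
  have x: "h (Work_Words q) ! i = xs ! i" using 2(1) assms(4) by (metis nth_take)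
  let ?a = "\<lambda>i j. length (filter (\<lambda>x. digit p x < j) xs) + length (filter (\<lambda>x. digit p x = j) (take i xs))"
  have I: "r' 11 = i" "r' 26 mod B ^ b = packed B b (?a i)"
    "\<forall>s<i. h' (Work_Words 8) ! rank (digit p) xs s = xs ! s"
    using 2 by auto
  have bound: "?a i j < B" if "i \<le> length xs" for i j
  proof -
    have "length (filter (\<lambda>x. digit p x = j) (take i xs)) \<le> length (filter (\<lambda>x. digit p x = j) xs)"
      by (metis append_take_drop_id filter_append le_add1 length_append)
    moreover have "length (filter (\<lambda>x. digit p x < j) xs) + length (filter (\<lambda>x. digit p x = j) xs) \<le> length xs"
      by (induction xs) auto
    ultimately show ?thesis using len by simp
  qed
  let ?x = "xs ! i"
  have rank: "r' 26 div B ^ digit p ?x mod B = rank (digit p) xs i"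
    using packed_word_digit[OF I(2) bound digit_less[of p ?x]] 2(1) by (simp add: rank_def)
  have rank_lt: "rank (digit p) xs i < length xs" using sort_key_nth_rank 2(1) by blast
  have "(B ^ digit p ?x) mod B ^ b = packed B b (\<lambda>j. of_bool (j = digit p ?x))"
    using packed_unit[OF digit_less[of p ?x], of B] digit_less[of p ?x] two_B by simp
  moreover have a_Suc: "?a i j + of_bool (j = digit p ?x) = ?a (Suc i) j" for j
    using 2(1) by (simp add: take_Suc_conv_app_nth)
  moreover have "?a i j + of_bool (j = digit p ?x) < B" for j
    using bound[of "Suc i" j] 2(1) unfolding a_Suc by simp
  ultimately have "(r' 26 + B ^ digit p ?x) mod 2 ^ w mod B ^ b =
      packed B b (\<lambda>j. ?a i j + of_bool (j = digit p ?x))"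
    by (intro packed_word_add[OF I(2) _ B_dvd])
  then have add: "(r' 26 + B ^ digit p ?x) mod 2 ^ w mod B ^ b = packed B b (?a (Suc i))"
    by (simp only: a_Suc)
  have sh: "take_bit w (push_bit (f * digit p ?x) 1) = B ^ digit p ?x" "take_bit w (push_bit f 1) = B"
    using f_digit(2)[of p ?x] f by (simp_all add: take_bit_eq_mod push_bit_eq_mult power_mult[symmetric])
  have "B ^ digit p ?x < 2 ^ w" using f_digit(2)[of p ?x] by (simp add: power_mult[symmetric])
  then have sh': "take_bit w (B ^ digit p ?x) = B ^ digit p ?x" by (simp add: take_bit_nat_eq_self)
  have xw: "?x < 2 ^ w" using words 2(1) by simp
  have dr: "drop_bit (f * digit p ?x) (r' 26) mod B = rank (digit p) xs i"
    using rank by (simp add: drop_bit_eq_div power_mult)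
  have new: "\<forall>s<Suc i. (h' (Work_Words 8))[rank (digit p) xs i := ?x] ! rank (digit p) xs s = xs ! s"
  proof (intro allI impI)
    fix s assume s: "s < Suc i"
    have len8: "length (h' (Work_Words 8)) = \<sigma>" using agree_length[OF 2(2)] assms(5) by simp
    show "(h' (Work_Words 8))[rank (digit p) xs i := ?x] ! rank (digit p) xs s = xs ! s"
    \<comment> \<open>Equal ranks belong to equal entries, both being the entry of the sorted list
      at that rank, so overwriting is harmless.\<close>
    proof (cases "rank (digit p) xs s = rank (digit p) xs i")
      case True
      then have "xs ! s = ?x"
        using sort_key_nth_rank(2)[of s xs "digit p"] sort_key_nth_rank(2)[of i xs "digit p"] s 2(1) by simp
      then show ?thesis using True rank_lt len8 assms(3) by simp
    next
      case False
      then have "s < i" using s by (metis less_antisym)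
      then show ?thesis using I(3) False by simp
    qed
  qed
  have "length (h' (Work_Words 8)) = \<sigma>" using agree_length[OF 2(2)] assms(5) by simp
  then have "wp M (pass_move_body p q) (\<lambda>r' h'. r' 11 = Suc i \<and> r' 26 mod B ^ b = packed B b (?a (Suc i)) \<and>
      (\<forall>s<Suc i. h' (Work_Words 8) ! rank (digit p) xs s = xs ! s)) r' h'"
    using add eqs I(1) h x 2(1) assms(2,3) f_digit[of p ?x] less_w len_word w sh sh' xw dr rank_lt new
    by (simp add: pass_move_body_def eval_digit_expr apply_binop_simps apply_binop.simps(1,9,10)
        digit_def[symmetric] del: mult_Suc_right push_bit_of_1)
  then show ?case using eqs I(1) 2(1) by (auto simp: apply_binop_simps intro: run_wp)
next
  case (3 r' h')
  have "r' 8 = length xs" using agree_reg[OF 3(1), of 8] assms(1) by (simp add: pass_move_body_def regs_ok_def)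
  then show ?case using 3 by (simp add: apply_binop_simps)
qed

lemma run_pass_copy:
  assumes "regs_ok r" "length (h (Work_Words q)) = \<sigma>" "length xs \<le> \<sigma>"
    "length (h (Work_Words 8)) = \<sigma>" "q \<noteq> 8" "\<And>x. x \<in> set ys \<Longrightarrow> x < 2 ^ w"
    "length ys = length xs" "take (length xs) (h (Work_Words 8)) = ys"
  shows "run M (Assign 11 (Const 0);; While (Reg 11 <\<^sub>e Reg 8) (pass_copy_body q)) (r, h)
    (2 + (length xs * (steps (pass_copy_body q) + expr_cost (Reg 11 <\<^sub>e Reg 8) + 1) +
      expr_cost (Reg 11 <\<^sub>e Reg 8) + 1))
    (\<lambda>r' h'. r' 11 = length xs \<and> take (length xs) (h' (Work_Words q)) = take (length xs) ys)"
proof (rule run_for, goal_cases)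
  case 1
  show ?case by simp
next
  case (2 i r' h')
  have eqs: "r' 8 = length xs" "h' (Work_Words 8) = h (Work_Words 8)" "length (h' (Work_Words q)) = \<sigma>"
    using agree_reg[OF 2(2), of 8] agree_seg[OF 2(2), of "Work_Words 8"] agree_length[OF 2(2)] assms
    by (auto simp: pass_copy_body_def regs_ok_def)
  have y: "h (Work_Words 8) ! i = ys ! i" using 2(1) assms(8) by (metis nth_take)
  have "ys ! i < 2 ^ w" using assms(6,7) 2(1) by simp
  then have "wp M (pass_copy_body q) (\<lambda>r' h'. r' 11 = Suc i \<and>
      take (Suc i) (h' (Work_Words q)) = take (Suc i) ys) r' h'"
    using eqs y 2(1,3) assms(2,3,4,7) w len_word
    by (simp add: pass_copy_body_def apply_binop_simps take_Suc_conv_app_nth)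
  then show ?case using eqs 2(1,3) by (auto simp: apply_binop_simps intro: run_wp)
next
  case (3 r' h')
  have "r' 8 = length xs" using agree_reg[OF 3(1), of 8] assms(1) by (simp add: pass_copy_body_def regs_ok_def)
  then show ?case using 3 by (simp add: apply_binop_simps)
qed

lemma run_pass:
  assumes "regs_ok r" "length (h (Work_Words q)) = \<sigma>" "length xs \<le> \<sigma>"
    "take (length xs) (h (Work_Words q)) = xs" "length (h (Work_Words 8)) = \<sigma>" "q \<noteq> 8"
  shows "run M (pass_prog p q) (r, h) ((100 + 10 * p) * length xs + 100)
    (\<lambda>r' h'. take (length xs) (h' (Work_Words q)) = sort_key (digit p) xs)"
proof -
  let ?A = "Assign 11 (Const 0);; While (Reg 11 <\<^sub>e Reg 8) (pass_count_body p q)"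
  let ?B = "Assign 11 (Const 0);; While (Reg 11 <\<^sub>e Reg 8) (pass_move_body p q)"
  have steps_digit: "expr_cost (digit_expr p) = 1 + 2 * p" for p by (induction p) auto
  have A0: "run M (Assign 26 (Const 0)) (r, h) 2 (\<lambda>r' h'. r' = r(26 := 0) \<and> h' = h)"
    by (rule run_wp) simp_all
  have C: "run M (Assign 11 (Const 0);; While (Reg 11 <\<^sub>e Reg 8) (pass_copy_body q)) (r3, h3)
    (15 * length xs + 15)
    (\<lambda>r' h'. take (length xs) (h' (Work_Words q)) = sort_key (digit p) xs)"
    if *: "regs_ok r3" "length (h3 (Work_Words q)) = \<sigma>" "length (h3 (Work_Words 8)) = \<sigma>"
      "\<forall>s<length xs. h3 (Work_Words 8) ! rank (digit p) xs s = xs ! s" for r3 h3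
  proof -
    have "take (length xs) (h3 (Work_Words 8)) = sort_key (digit p) xs"
    proof (rule nth_equalityI)
      fix i assume i: "i < length (take (length xs) (h3 (Work_Words 8)))"
      then have "i < length xs" by simp
      then obtain s where s: "s < length xs" "rank (digit p) xs s = i" using rank_surj by blast
      then show "take (length xs) (h3 (Work_Words 8)) ! i = sort_key (digit p) xs ! i"
        using *(4) sort_key_nth_rank(2)[OF s(1), of "digit p"] i by auto
    qed (use * assms(3) in simp)
    note run_pass_copy[OF *(1,2) assms(3) *(3) assms(6) _ _ this]
    then show ?thesis
      by (rule run_mono) (use words in \<open>auto simp: pass_copy_body_def\<close>)
  qed
  have Bp: "run M (?B;; (Assign 11 (Const 0);; While (Reg 11 <\<^sub>e Reg 8) (pass_copy_body q))) (r2, h2)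
    ((40 + 5 * p) * length xs + 20 + (15 * length xs + 15))
    (\<lambda>r' h'. take (length xs) (h' (Work_Words q)) = sort_key (digit p) xs)"
    if *: "regs_ok r2" "h2 = h" "r2 26 mod B ^ b = packed B b (\<lambda>j. length (filter (\<lambda>x. digit p x < j) xs))"
    for r2 h2
  proof (rule run_Seq)
    show "run M ?B (r2, h2) ((40 + 5 * p) * length xs + 20) (\<lambda>r' h'.
      (\<forall>s<length xs. h' (Work_Words 8) ! rank (digit p) xs s = xs ! s) \<and> agree ?B r2 h2 r' h')"
      by (rule run_mono[OF run_agree[OF run_pass_move[OF *(1), where q = q and p = p]]])
        (use * assms in \<open>auto simp: pass_move_body_def steps_digit algebra_simps\<close>)
    fix r3 h3
    assume s: "(\<forall>s<length xs. h3 (Work_Words 8) ! rank (digit p) xs s = xs ! s) \<and> agree ?B r2 h2 r3 h3"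
    have "regs_ok r3" using *(1) agree_reg[OF conjunct2[OF s]]
      by (simp add: regs_ok_def pass_move_body_def)
    then show "run M (Assign 11 (Const 0);; While (Reg 11 <\<^sub>e Reg 8) (pass_copy_body q)) (r3, h3)
      (15 * length xs + 15)
      (\<lambda>r' h'. take (length xs) (h' (Work_Words q)) = sort_key (digit p) xs)"
      using C s assms agree_length[OF conjunct2[OF s]] *(2) by auto
  qed
  have Ap: "run M (?A;; ?B;; (Assign 11 (Const 0);; While (Reg 11 <\<^sub>e Reg 8) (pass_copy_body q))) (r1, h1)
    ((40 + 5 * p) * length xs + 20 + ((40 + 5 * p) * length xs + 20 + (15 * length xs + 15)))
    (\<lambda>r' h'. take (length xs) (h' (Work_Words q)) = sort_key (digit p) xs)"
    if *: "r1 = r(26 := 0) \<and> h1 = h" for r1 h1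
  proof (rule run_Seq)
    show "run M ?A (r1, h1) ((40 + 5 * p) * length xs + 20) (\<lambda>r' h'.
      r' 26 mod B ^ b = packed B b (\<lambda>j. length (filter (\<lambda>x. digit p x < j) xs)) \<and> agree ?A r1 h1 r' h')"
      by (rule run_mono[OF run_agree[OF run_pass_count[where q = q and p = p]]])
        (use * assms in \<open>auto simp: regs_ok_def pass_count_body_def steps_digit algebra_simps\<close>)
    fix r2 h2
    assume s: "r2 26 mod B ^ b = packed B b (\<lambda>j. length (filter (\<lambda>x. digit p x < j) xs)) \<and> agree ?A r1 h1 r2 h2"
    have "regs_ok r2" using assms(1) * agree_reg[OF conjunct2[OF s]]
      by (simp add: regs_ok_def pass_count_body_def)
    moreover have "h2 = h" using * conjunct2[OF s] by (auto simp: agree_def pass_count_body_def)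
    ultimately show "run M (?B;; (Assign 11 (Const 0);; While (Reg 11 <\<^sub>e Reg 8) (pass_copy_body q))) (r2, h2)
      ((40 + 5 * p) * length xs + 20 + (15 * length xs + 15))
      (\<lambda>r' h'. take (length xs) (h' (Work_Words q)) = sort_key (digit p) xs)"
      using Bp s by blast
  qed
  show ?thesis unfolding pass_prog_def
    by (rule run_mono[OF run_Seq[OF A0 Ap]]) (auto simp: algebra_simps)
qed

end

fun passes :: "nat \<Rightarrow> nat \<Rightarrow> segment com" where
  "passes 0 q = Skip"
| "passes (Suc p) q = passes p q;; pass_prog p q"

lemma regs_pass_prog: "regs (pass_prog p q) = {11, 15, 16, 17, 26}"
  by (auto simp: pass_prog_def pass_count_body_def pass_move_body_def pass_copy_body_def)

lemma segs_pass_prog: "segs (pass_prog p q) = {Work_Words q, Work_Words 8}"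
  by (auto simp: pass_prog_def pass_count_body_def pass_move_body_def pass_copy_body_def)

lemma regs_passes: "regs (passes n q) \<subseteq> {11, 15, 16, 17, 26}"
  by (induction n) (auto simp: regs_pass_prog)

lemma segs_passes: "segs (passes n q) \<subseteq> {Work_Words q, Work_Words 8}"
  by (induction n) (auto simp: segs_pass_prog)

lemma run_passes:
  assumes pp: "packed_pass w f b xs"
    and r: "r 8 = length xs" "r 24 = f" "r 25 = b" "r 27 = packed (2 ^ f) b (\<lambda>_. 1)"
    and h: "length (h (Work_Words q)) = \<sigma>" "length xs \<le> \<sigma>" "take (length xs) (h (Work_Words q)) = xs"
      "length (h (Work_Words 8)) = \<sigma>" "q \<noteq> 8"
  shows "run (merge_machine w k \<sigma>) (passes n q) (r, h) (n * ((100 + 10 * n) * length xs + 100) + 1)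
    (\<lambda>r' h'. \<exists>ys. length ys = length xs \<and> set ys = set xs \<and> take (length xs) (h' (Work_Words q)) = ys \<and>
      sorted (map (\<lambda>x. x mod b ^ n) ys))"
proof (induction n)
  case 0
  have "sorted (map (\<lambda>x. x mod b ^ 0) xs)" by (simp add: sorted_iff_nth_mono)
  then show ?case by (intro run_wp) (use h in auto)
next
  case (Suc n)
  let ?M = "merge_machine w k \<sigma>"
  have "run ?M (passes (Suc n) q) (r, h)
    ((n * ((100 + 10 * n) * length xs + 100) + 1) + ((100 + 10 * n) * length xs + 100))
    (\<lambda>r' h'. \<exists>ys. length ys = length xs \<and> set ys = set xs \<and> take (length xs) (h' (Work_Words q)) = ys \<and>
      sorted (map (\<lambda>x. x mod b ^ Suc n) ys))"
    unfolding passes.simps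
  proof (rule run_Seq[OF run_agree[OF Suc]])
    fix r1 h1
    assume "(\<exists>ys. length ys = length xs \<and> set ys = set xs \<and> take (length xs) (h1 (Work_Words q)) = ys \<and>
      sorted (map (\<lambda>x. x mod b ^ n) ys)) \<and> agree (passes n q) r h r1 h1"
    then obtain ys where ys: "length ys = length xs" "set ys = set xs"
      "take (length xs) (h1 (Work_Words q)) = ys" "sorted (map (\<lambda>x. x mod b ^ n) ys)"
      and ag: "agree (passes n q) r h r1 h1" by blast
    interpret P: packed_pass w k \<sigma> f b ys
      using pp ys by (simp add: packed_pass_def)
    have x: "x \<notin> regs (passes n q)" if "x \<notin> {11, 15, 16, 17, 26}" for x
      using regs_passes that by blast
    have "P.regs_ok r1"
      using agree_reg[OF ag x] r ys(1) by (simp add: P.regs_ok_def)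
    then have "run ?M (pass_prog n q) (r1, h1) ((100 + 10 * n) * length ys + 100)
        (\<lambda>r' h'. take (length ys) (h' (Work_Words q)) = sort_key (P.digit n) ys)"
      by (rule P.run_pass) (use agree_length[OF ag] h ys in auto)
    then show "run ?M (pass_prog n q) (r1, h1) ((100 + 10 * n) * length xs + 100)
        (\<lambda>r' h'. \<exists>ys. length ys = length xs \<and> set ys = set xs \<and> take (length xs) (h' (Work_Words q)) = ys \<and>
          sorted (map (\<lambda>x. x mod b ^ Suc n) ys))"
    proof (rule run_mono)
      fix r' h'
      assume *: "take (length ys) (h' (Work_Words q)) = sort_key (P.digit n) ys"
      have "sorted (map (\<lambda>x. x mod b ^ Suc n) (sort_key (P.digit n) ys))"
        using sorted_digit_step[OF ys(4)] P.b unfolding P.digit_def[abs_def] by simp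
      then show "\<exists>ys. length ys = length xs \<and> set ys = set xs \<and> take (length xs) (h' (Work_Words q)) = ys \<and>
          sorted (map (\<lambda>x. x mod b ^ Suc n) ys)"
        using * ys by (intro exI[of _ "sort_key (P.digit n) ys"]) simp
    qed (simp add: ys)
  qed
  then show ?case by (rule run_mono) (simp_all add: algebra_simps)
qed

section \<open>Sorting the distinct labels\<close>

definition scan_body :: "nat \<Rightarrow> segment com" where
  "scan_body q =
    Load 14 (Work_Words q) (Reg 11);;
    Assign 11 (Reg 11 +\<^sub>e Const 1);;
    If (Reg 14) (Store (Work_Words (q + 1)) (Reg 8) (Reg 11);; Assign 8 (Reg 8 +\<^sub>e Const 1)) Skip"

definition scan_prog :: "nat \<Rightarrow> segment com" where
  "scan_prog q = Assign 8 (Const 0);; (Assign 11 (Const 0);; While (Reg 11 <\<^sub>e Reg 1) (scan_body q))"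

lemma run_scan_prog:
  assumes w: "2 \<le> w" and \<sigma>: "\<sigma> < 2 ^ w" "r 1 = \<sigma>"
    and len: "length (h (Work_Words q)) = \<sigma>" "length (h (Work_Words (q + 1))) = \<sigma>"
  shows "run (merge_machine w k \<sigma>) (scan_prog q) (r, h) (50 * \<sigma> + 50)
    (\<lambda>r' h'. let S = filter (\<lambda>c. h (Work_Words q) ! (c - 1) \<noteq> 0) [1..<Suc \<sigma>]
      in r' 8 = length S \<and> take (length S) (h' (Work_Words (q + 1))) = S)"
proof -
  let ?M = "merge_machine w k \<sigma>"
  let ?S = "\<lambda>i. filter (\<lambda>c. h (Work_Words q) ! (c - 1) \<noteq> 0) [1..<Suc i]"
  let ?I = "\<lambda>i r' h'. r' 11 = i \<and> r' 8 = length (?S i) \<and> take (length (?S i)) (h' (Work_Words (q + 1))) = ?S i"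
  have 1: "run ?M (Assign 8 (Const 0)) (r, h) 2 (\<lambda>r' h'. r' = r(8 := 0) \<and> h' = h)"
    by (rule run_wp) simp_all
  have 2: "run ?M (Assign 11 (Const 0);; While (Reg 11 <\<^sub>e Reg 1) (scan_body q)) (r1, h1)
    (2 + (\<sigma> * (steps (scan_body q) + expr_cost (Reg 11 <\<^sub>e Reg 1) + 1) + expr_cost (Reg 11 <\<^sub>e Reg 1) + 1))
    (?I \<sigma>)" if eq: "r1 = r(8 := 0) \<and> h1 = h" for r1 h1
  proof (rule run_for, goal_cases)
    case 1
    show ?case using eq by simp
  next
    case (2 i r' h')
    have eqs: "r' 1 = \<sigma>" "h' (Work_Words q) = h (Work_Words q)" "length (h' (Work_Words (q + 1))) = \<sigma>"
      using agree_reg[OF 2(2), of 1] agree_seg[OF 2(2), of "Work_Words q"]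
        agree_length[OF 2(2), of "Work_Words (q + 1)"] eq \<sigma> len by (auto simp: scan_body_def)
    have I: "r' 11 = i" "r' 8 = length (?S i)" "take (length (?S i)) (h' (Work_Words (q + 1))) = ?S i"
      using 2(3) by auto
    have le: "length (?S i) \<le> i" by (rule order_trans[OF length_filter_le]) simp
    have S: "?S (Suc i) = ?S i @ (if h (Work_Words q) ! i \<noteq> 0 then [Suc i] else [])" by simp
    have "wp ?M (scan_body q) (?I (Suc i)) r' h'"
    proof (cases "h (Work_Words q) ! i = 0")
      case True
      then show ?thesis using eqs I(1) I(2,3)[folded One_nat_def] 2(1) len w \<sigma> unfolding S
        by (simp add: scan_body_def apply_binop_simps)
    next
      case False
      have "take (Suc (length (?S i))) ((h' (Work_Words (q + 1)))[length (?S i) := Suc i]) = ?S i @ [Suc i]"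
        using I(3) le 2(1) eqs(3) by (simp add: take_Suc_conv_app_nth del: upt_Suc)
      then show ?thesis using False eqs I(1,2) 2(1) len w \<sigma> le unfolding S
        by (simp add: scan_body_def apply_binop_simps del: upt_Suc)
    qed
    then show ?case using eqs I(1) 2(1) by (auto simp: apply_binop_simps intro: run_wp)
  next
    case (3 r' h')
    have "r' 1 = \<sigma>" using agree_reg[OF 3(1), of 1] eq \<sigma> by (simp add: scan_body_def)
    then show ?case using 3 by (simp add: apply_binop_simps)
  qed
  show ?thesis unfolding scan_prog_def
    by (rule run_mono[OF run_Seq[OF 1 2]]) (auto simp: scan_body_def Let_def)
qed

text \<open>A field of \<open>f = O(log d)\<close> bits can count up to \<open>d\<close>, and a word has \<open>b = w div f\<close> fields. If \<open>b \<ge> f\<close>,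
  radix sort in base \<open>b\<close> is used, where the counters of a pass are the fields of a single word; labels
  have \<open>O(c)\<close> digits. Otherwise \<open>w \<le> f\<^sup>2\<close>, hence \<open>\<sigma> \<le> f ^ (2 * c) = O(d)\<close>, and all labels can be scanned.\<close>

definition sort_prog :: "nat \<Rightarrow> nat \<Rightarrow> segment com" where
  "sort_prog c q =
    (Assign 24 (Const 0);; While ((Const 1 <<\<^sub>e Reg 24) <\<^sub>e (Reg 8 +\<^sub>e Const 1)) (Assign 24 (Reg 24 +\<^sub>e Const 1)));;
    (Assign 24 (Reg 24 +\<^sub>e Const 1);; Assign 25 (Word_Size div\<^sub>e Reg 24));;
    If (Reg 25 <\<^sub>e Reg 24) (scan_prog q)
      (Assign 27 (((Const 1 <<\<^sub>e (Reg 24 *\<^sub>e Reg 25)) -\<^sub>e Const 1) div\<^sub>e ((Const 1 <<\<^sub>e Reg 24) -\<^sub>e Const 1));;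
       passes (3 * c + 1) (q + 1))"

lemma regs_sort_prog: "regs (sort_prog c q) \<subseteq> {8, 11, 14, 15, 16, 17, 24, 25, 26, 27}"
  using regs_passes[of "3 * c + 1" "q + 1"] by (auto simp: sort_prog_def scan_prog_def scan_body_def)

lemma segs_sort_prog: "segs (sort_prog c q) \<subseteq> {Work_Words (q + 1), Work_Words 8}"
  using segs_passes[of "3 * c + 1" "q + 1"] by (auto simp: sort_prog_def scan_prog_def scan_body_def)

text \<open>The first summand pays for \<open>3 * c + 1\<close> passes with digit expressions of
  length linear in \<open>c\<close>, the second for the scan, where \<open>\<sigma>\<close> is at
  most \<open>(2 * c) ^ (2 * c) * 4 * d\<close>.\<close>

definition sort_cost :: "nat \<Rightarrow> nat" where
  "sort_cost c = 1000 * (3 * c + 2) * (3 * c + 2) + 1000 * (2 * c) ^ (2 * c)"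

lemma sorted_list_of_set_eqI:
  "sorted ys \<Longrightarrow> distinct ys \<Longrightarrow> set ys = A \<Longrightarrow> sorted_list_of_set A = ys"
  by (metis List.finite_set sorted_list_of_set.idem_if_sorted_distinct)

lemma run_sort_prog:
  assumes w: "2 \<le> w" and \<sigma>: "\<sigma> < 2 ^ w" "r 1 = \<sigma>" "\<sigma> \<le> w ^ c"
    and cnt: "counted \<sigma> (h (Work_Words q)) (h (Work_Words (q + 1))) (r 8) ys"
    and d: "r 8 < 2 ^ (w - 1)" and h: "length (h (Work_Words 8)) = \<sigma>" "q + 1 \<noteq> 8"
  shows "run (merge_machine w k \<sigma>) (sort_prog c q) (r, h) (sort_cost c * (r 8 + 1))
    (\<lambda>r' h'. r' 8 = r 8 \<and> take (r 8) (h' (Work_Words (q + 1))) = sorted_list_of_set (set ys))"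
proof -
  let ?M = "merge_machine w k \<sigma>"
  let ?A = "h (Work_Words q)" and ?D = "h (Work_Words (q + 1))"
  define d where "d = r 8"
  define N where "N = floorlog 2 d"
  \<comment> \<open>The extra bit keeps \<open>f\<close> positive when \<open>d = 0\<close>, as the
    word size is divided by it.\<close>
  define f where "f = N + 1"
  define b where "b = w div f"
  define xs where "xs = take d ?D"
  have cl: "length ?A = \<sigma>" "length ?D = \<sigma>" "d \<le> \<sigma>" "distinct xs" "set xs = set ys" "set ys \<subseteq> {1..\<sigma>}"
    "\<And>c. c \<in> {1..\<sigma>} \<Longrightarrow> ?A ! (c - 1) = count_list ys c"
    using cnt by (auto simp: counted_def d_def xs_def)
  have lxs: "length xs = d" using cl by (simp add: xs_def)
  have xs': "take d (h (Work_Words (Suc q))) = xs" by (simp add: xs_def)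
  have card: "card (set ys) = d" using distinct_card[OF cl(4)] cl(5) lxs by simp
  have dN: "d < 2 ^ N" unfolding N_def by (rule floorlog_leD) simp_all
  have Nd: "2 ^ i \<le> d" if "i < N" for i
    using floorlog_geD[of "Suc i" 2 d] that by (simp add: N_def)
  have Nw: "N \<le> w - 1" unfolding N_def using d by (intro floorlog_leI) (simp_all add: d_def)
  have dw: "d + 1 < 2 ^ w"
  proof -
    have "2 ^ w = 2 * (2::nat) ^ (w - 1)" using w by (cases w) auto
    then show ?thesis using d d_def by linarith
  qed
  have less_w: "x < 2 ^ w" if "x \<le> w" for x :: nat using that less_exp[of w] by (rule le_less_trans)
  let ?e = "(Const 1 <<\<^sub>e Reg 24) <\<^sub>e (Reg 8 +\<^sub>e Const 1)"
  have loop: "run ?M (Assign 24 (Const 0);; While ?e (Assign 24 (Reg 24 +\<^sub>e Const 1))) (r, h)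
    (2 + (N * (steps (Assign 24 (Reg 24 +\<^sub>e Const 1) :: segment com) + expr_cost ?e + 1) + expr_cost ?e + 1)) (\<lambda>r' h'. r' 24 = N)"
  proof (rule run_for, goal_cases)
    case 1
    show ?case by simp
  next
    case (2 i r' h')
    have "r' 8 = d" using agree_reg[OF 2(2), of 8] by (simp add: d_def)
    moreover have "take_bit w (push_bit i (1::nat)) = 2 ^ i"
      using 2(1) Nw by (simp add: take_bit_eq_mod push_bit_eq_mult)
    moreover have "i + 1 < 2 ^ w" using 2(1) Nw by (intro less_w) simp
    ultimately show ?case using 2 Nd[OF 2(1)] dw w
      by (auto simp: apply_binop_simps apply_binop.simps(9) intro!: run_wp)
  next
    case (3 r' h')
    have "r' 8 = d" using agree_reg[OF 3(1), of 8] by (simp add: d_def)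
    moreover have "take_bit w (push_bit N (1::nat)) = 2 ^ N"
      using Nw w by (simp add: take_bit_eq_mod push_bit_eq_mult)
    ultimately show ?case using 3 dN dw w by (simp add: apply_binop_simps apply_binop.simps(9))
  qed
  let ?A1 = "Assign 24 (Const 0);; While ?e (Assign 24 (Reg 24 +\<^sub>e Const 1))"
  have f: "1 \<le> f" "d < 2 ^ f" "f \<le> w"
    using dN Nw w by (auto simp: f_def)
  have bf: "f * b \<le> w" "b \<le> w" by (auto simp: b_def)
  let ?Q = "\<lambda>r' h'. r' 8 = d \<and> take d (h' (Work_Words (q + 1))) = sorted_list_of_set (set ys)"
  have prep: "run ?M (Assign 24 (Reg 24 +\<^sub>e Const 1);; Assign 25 (Word_Size div\<^sub>e Reg 24)) (r1, h1) 8
    (\<lambda>r' h'. r' = r1(24 := f, 25 := b) \<and> h' = h1)" if "r1 24 = N" for r1 h1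
  proof -
    have "N + 1 < 2 ^ w" using Nw w by (intro less_w) simp
    then show ?thesis by (intro run_wp) (use that w in \<open>simp_all add: apply_binop_simps f_def b_def\<close>)
  qed
  have scan: "run ?M (scan_prog q) (r2, h2) (50 * (2 * c) ^ (2 * c) * 4 * d + 50) ?Q"
    if r2: "r2 1 = \<sigma>" "h2 = h" and "b < f" for r2 h2
  proof -
    \<comment> \<open>Few fields mean a short word: \<open>w < f * f\<close>, so
      \<open>\<sigma> \<le> f ^ (2 * c)\<close>, which is linear in \<open>2 ^ f\<close> and thus in
      \<open>d\<close>.\<close>
    have "w < f * f" using \<open>b < f\<close> f(1) by (simp add: b_def div_less_iff_less_mult)
    then have "w ^ c \<le> (f * f) ^ c" by (intro power_mono) auto
    also have "\<dots> = f ^ (2 * c)" by (simp add: power_mult power2_eq_square)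
    also have "\<dots> \<le> (2 * c) ^ (2 * c) * 2 ^ f" by (rule power_le_exp)
    finally have *: "\<sigma> \<le> (2 * c) ^ (2 * c) * 2 ^ f" using \<sigma>(3) by simp
    \<comment> \<open>For \<open>N = 0\<close> the width is \<open>1\<close> and
      \<open>b = w \<ge> 2\<close>, contrary to \<open>b < f\<close>.\<close>
    have "N \<noteq> 0"
    proof
      assume "N = 0"
      then show False using \<open>b < f\<close> w by (simp add: b_def f_def)
    qed
    then have "2 ^ (N - 1) \<le> d" using Nd[of "N - 1"] by simp
    moreover have "2 ^ f = 4 * (2::nat) ^ (N - 1)" using \<open>N \<noteq> 0\<close> by (cases N) (auto simp: f_def)
    ultimately have "2 ^ f \<le> 4 * d" by simp
    then have "(2 * c) ^ (2 * c) * 2 ^ f \<le> (2 * c) ^ (2 * c) * (4 * d)" by (rule mult_le_mono2)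
    with * have "\<sigma> \<le> (2 * c) ^ (2 * c) * (4 * d)" by (rule order_trans)
    then have \<sigma>d: "\<sigma> \<le> (2 * c) ^ (2 * c) * 4 * d" by (simp only: mult.assoc)
    have "filter (\<lambda>c. ?A ! (c - 1) \<noteq> 0) [1..<Suc \<sigma>] = sorted_list_of_set (set ys)"
    proof (rule sorted_list_of_set_eqI[symmetric])
      have iff: "c \<in> set ys \<longleftrightarrow> c \<in> {1..\<sigma>} \<and> ?A ! (c - 1) \<noteq> 0" for c
        using cl(6) cl(7)[of c] by (metis count_list_0_iff subset_iff)
      show "set (filter (\<lambda>c. ?A ! (c - 1) \<noteq> 0) [1..<Suc \<sigma>]) = set ys"
        by (rule set_eqI) (simp only: iff set_filter mem_Collect_eq set_upt atLeastLessThan_iff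
          atLeastAtMost_iff less_Suc_eq_le)
      have "sorted [1..<Suc \<sigma>]" by (rule sorted_upt)
      then show "sorted (filter (\<lambda>c. ?A ! (c - 1) \<noteq> 0) [1..<Suc \<sigma>])"
        using sorted_wrt_filter by blast
    qed simp
    then have S: "filter (\<lambda>c. ?A ! (c - 1) \<noteq> 0) [1..<Suc \<sigma>] = sorted_list_of_set (set ys)" .
    have "length (sorted_list_of_set (set ys)) = d" using card by simp
    moreover have "run ?M (scan_prog q) (r2, h) (50 * \<sigma> + 50)
      (\<lambda>r' h'. let S = filter (\<lambda>c. ?A ! (c - 1) \<noteq> 0) [1..<Suc \<sigma>]
        in r' 8 = length S \<and> take (length S) (h' (Work_Words (q + 1))) = S)"
      by (rule run_scan_prog[where h = h and q = q]) (use w \<sigma>(1) r2(1) cl(1,2) in auto)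
    ultimately have "run ?M (scan_prog q) (r2, h) (50 * \<sigma> + 50) ?Q" unfolding S Let_def by simp
    moreover have "50 * \<sigma> + 50 \<le> 50 * (2 * c) ^ (2 * c) * 4 * d + 50"
      using mult_le_mono2[OF \<sigma>d, of 50] by (simp only: mult.assoc)
    ultimately show ?thesis unfolding r2(2) by (rule run_mono)
  qed
  have pack: "run ?M (Assign 27 (((Const 1 <<\<^sub>e (Reg 24 *\<^sub>e Reg 25)) -\<^sub>e Const 1) div\<^sub>e ((Const 1 <<\<^sub>e Reg 24) -\<^sub>e Const 1));;
       passes (3 * c + 1) (q + 1)) (r2, h2) (20 + ((3 * c + 1) * ((100 + 10 * (3 * c + 1)) * d + 100) + 1)) ?Q"
    if r2: "r2 8 = d" "r2 24 = f" "r2 25 = b" "h2 = h" and "f \<le> b" for r2 h2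
  proof -
    have b2: "2 \<le> b"
    proof (rule ccontr)
      assume "\<not> 2 \<le> b"
      then have "f = 1" "b = 1" using \<open>f \<le> b\<close> f(1) by auto
      then show False using w by (simp add: b_def)
    qed
    have "f * 2 \<le> f * b" using b2 by simp
    then have fw: "f < w" using bf f(1) by linarith
    have pp: "packed_pass w f b xs"
    proof
      show "x < 2 ^ w" if "x \<in> set xs" for x
      proof -
        have "x \<le> \<sigma>" using that cl(5,6) by auto
        then show ?thesis using \<sigma>(1) by simp
      qed
    qed (use w f fw bf b2 lxs in auto)
    let ?B = "(2::nat) ^ f"
    have "2 \<le> ?B" using power_increasing[of 1 f "2::nat"] f by simp
    have ones: "(?B ^ b - 1) div (?B - 1) = packed ?B b (\<lambda>_. 1)"
    proof -
      have "(?B - 1) * packed ?B b (\<lambda>_. 1) div (?B - 1) = packed ?B b (\<lambda>_. 1)"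
        by (rule nonzero_mult_div_cancel_left) (use \<open>2 \<le> ?B\<close> in simp)
      moreover have "(?B - 1) * packed ?B b (\<lambda>_. 1) = ?B ^ b - 1"
        by (rule packed_ones) (use \<open>2 \<le> ?B\<close> in simp)
      ultimately show ?thesis by (simp only:)
    qed
    have BB: "?B ^ b = 2 ^ (f * b)" by (simp add: power_mult)
    \<comment> \<open>If the fields fill the word exactly, the shifted one vanishes and subtracting
      \<open>1\<close> wraps around to \<open>2 ^ w - 1\<close>, which is still the desired
      value.\<close>
    have 1: "apply_binop w Sub (take_bit w (push_bit (f * b) 1)) 1 = ?B ^ b - 1"
    proof (cases "f * b = w")
      case True
      then show ?thesis using w by (simp add: apply_binop.simps take_bit_eq_mod push_bit_eq_mult BB)
    next
      case False
      then have "f * b < w" using bf by simp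
      then have "take_bit w (push_bit (f * b) (1::nat)) = 2 ^ (f * b)"
        by (simp add: take_bit_eq_mod push_bit_eq_mult)
      then show ?thesis using \<open>f * b < w\<close> by (simp add: apply_binop_Sub BB del: push_bit_of_1)
    qed
    have 2: "apply_binop w Sub (take_bit w (push_bit f 1)) 1 = ?B - 1"
    proof -
      have "take_bit w (push_bit f (1::nat)) = 2 ^ f" using fw by (simp add: take_bit_eq_mod push_bit_eq_mult)
      then show ?thesis using fw by (simp add: apply_binop_Sub del: push_bit_of_1)
    qed
    have fbw: "f * b < 2 ^ w" using less_w[OF bf(1)] .
    have one: "1 mod 2 ^ w = (1::nat)" using w by simp
    have ev: "eval_expr w r2 (((Const 1 <<\<^sub>e (Reg 24 *\<^sub>e Reg 25)) -\<^sub>e Const 1) div\<^sub>e ((Const 1 <<\<^sub>e Reg 24) -\<^sub>e Const 1)) =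
        packed ?B b (\<lambda>_. 1)"
      unfolding eval_expr.simps r2 one apply_binop_Mul[OF fbw] apply_binop.simps(9) 1 2 apply_binop.simps(4)
      by (rule ones)
    let ?S = "Assign 27 (((Const 1 <<\<^sub>e (Reg 24 *\<^sub>e Reg 25)) -\<^sub>e Const 1) div\<^sub>e ((Const 1 <<\<^sub>e Reg 24) -\<^sub>e Const 1)) :: segment com"
    have s: "run ?M ?S (r2, h2) 20 (\<lambda>r' h'. r' = r2(27 := packed ?B b (\<lambda>_. 1)) \<and> h' = h2)"
      by (rule run_wp) (use ev in \<open>simp_all del: eval_expr.simps\<close>)
    have "run ?M (passes (3 * c + 1) (q + 1)) (r3, h3) ((3 * c + 1) * ((100 + 10 * (3 * c + 1)) * d + 100) + 1) ?Q"
      if "r3 = r2(27 := packed ?B b (\<lambda>_. 1)) \<and> h3 = h2" for r3 h3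
    proof -
      have e: "r3 = r2(27 := packed ?B b (\<lambda>_. 1))" "h3 = h" using that r2 by auto
      have "run ?M (passes (3 * c + 1) (q + 1)) (r3, h3) ((3 * c + 1) * ((100 + 10 * (3 * c + 1)) * length xs + 100) + 1)
        (\<lambda>r' h'. (\<exists>zs. length zs = length xs \<and> set zs = set xs \<and> take (length xs) (h' (Work_Words (q + 1))) = zs \<and>
          sorted (map (\<lambda>x. x mod b ^ (3 * c + 1)) zs)) \<and> agree (passes (3 * c + 1) (q + 1)) r3 h3 r' h')"
        by (rule run_agree[OF run_passes[OF pp]])
          (use e r2 lxs cl h xs' in simp_all)
      then show ?thesis
      proof (rule run_mono)
        fix r' h'
        assume *: "(\<exists>zs. length zs = length xs \<and> set zs = set xs \<and> take (length xs) (h' (Work_Words (q + 1))) = zs \<and>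
          sorted (map (\<lambda>x. x mod b ^ (3 * c + 1)) zs)) \<and> agree (passes (3 * c + 1) (q + 1)) r3 h3 r' h'"
        then obtain zs where zs: "length zs = length xs" "set zs = set xs"
          "take (length xs) (h' (Work_Words (q + 1))) = zs" "sorted (map (\<lambda>x. x mod b ^ (3 * c + 1)) zs)" by blast
        \<comment> \<open>From \<open>w < (b + 1) * f\<close> and \<open>f \<le> b\<close> follows
          \<open>w \<le> b ^ 3\<close>, so \<open>3 * c\<close> digits cover all numbers below
          \<open>w ^ c\<close>; one more digit admits \<open>\<sigma> = w ^ c\<close>.\<close>
        have "w = w div f * f + w mod f" by simp
        moreover have "w mod f < f" using f(1) by simp
        ultimately have "w < (b + 1) * f" unfolding b_def add_mult_distrib mult_1 by linarith
        also have "\<dots> \<le> (b + 1) * b" using \<open>f \<le> b\<close> by (rule mult_le_mono2)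
        also have "\<dots> \<le> (b * b) * b"
        proof (rule mult_le_mono1)
          have "b + 1 \<le> 2 * b" using b2 by simp
          also have "\<dots> \<le> b * b" using b2 by simp
          finally show "b + 1 \<le> b * b" .
        qed
        finally have "w \<le> b ^ 3" by (simp add: power3_eq_cube)
        then have "w ^ c \<le> (b ^ 3) ^ c" by (rule power_mono) simp
        then have "w ^ c \<le> b ^ (3 * c)" by (simp only: power_mult)
        moreover have "b ^ (3 * c) < b ^ (3 * c + 1)" using b2 by simp
        ultimately have "\<sigma> < b ^ (3 * c + 1)" using \<sigma>(3) by linarith
        then have "x mod b ^ (3 * c + 1) = x" if "x \<in> set zs" for x
          using that zs(2) cl(5,6) by (intro mod_less) auto
        then have "map (\<lambda>x. x mod b ^ (3 * c + 1)) zs = zs" by (simp add: map_idI)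
        then have "sorted zs" using zs(4) by simp
        moreover have "distinct zs" using zs cl(4) by (metis card_distinct distinct_card)
        ultimately have "sorted_list_of_set (set ys) = zs"
          using zs(2) cl(5) by (intro sorted_list_of_set_eqI) auto
        moreover have "r' 8 = d"
        proof -
          have "8 \<notin> regs (passes (3 * c + 1) (q + 1))" using regs_passes[of "3 * c + 1" "q + 1"] by auto
          then show ?thesis using agree_reg[OF conjunct2[OF *], of 8] e(1) r2(1) by simp
        qed
        ultimately show "r' 8 = d \<and> take d (h' (Work_Words (q + 1))) = sorted_list_of_set (set ys)"
          using zs(3) lxs by simp
      qed (simp add: lxs)
    qed
    then show ?thesis by (rule run_Seq[OF s])
  qed
  define T where "T = 200 * (2 * c) ^ (2 * c) * d + 70 + (3 * c + 1) * ((100 + 10 * (3 * c + 1)) * d + 100)"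
  have branch: "run ?M (If (Reg 25 <\<^sub>e Reg 24) (scan_prog q)
      (Assign 27 (((Const 1 <<\<^sub>e (Reg 24 *\<^sub>e Reg 25)) -\<^sub>e Const 1) div\<^sub>e ((Const 1 <<\<^sub>e Reg 24) -\<^sub>e Const 1));;
       passes (3 * c + 1) (q + 1))) (r2, h2) (1 + expr_cost (Reg 25 <\<^sub>e Reg 24) + T) ?Q"
    if r2: "r2 8 = d" "r2 1 = \<sigma>" "r2 24 = f" "r2 25 = b" "h2 = h" for r2 h2
  proof (rule run_If)
    assume "eval_expr (word_size ?M) r2 (Reg 25 <\<^sub>e Reg 24) \<noteq> 0"
    then have "b < f" using r2 by (simp add: apply_binop_simps split: if_splits)
    from scan[of r2 h2, OF r2(2,5) this] show "run ?M (scan_prog q) (r2, h2) T ?Q"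
      by (rule run_mono) (simp_all add: T_def)
  next
    assume "eval_expr (word_size ?M) r2 (Reg 25 <\<^sub>e Reg 24) = 0"
    then have "f \<le> b" using r2 by (simp add: apply_binop_simps split: if_splits)
    from pack[of r2 h2, OF r2(1,3,4,5) this]
    show "run ?M (Assign 27 (((Const 1 <<\<^sub>e (Reg 24 *\<^sub>e Reg 25)) -\<^sub>e Const 1) div\<^sub>e ((Const 1 <<\<^sub>e Reg 24) -\<^sub>e Const 1));;
       passes (3 * c + 1) (q + 1)) (r2, h2) T ?Q"
      by (rule run_mono) (simp_all add: T_def)
  qed
  have rest: "run ?M ((Assign 24 (Reg 24 +\<^sub>e Const 1);; Assign 25 (Word_Size div\<^sub>e Reg 24));;
    If (Reg 25 <\<^sub>e Reg 24) (scan_prog q)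
      (Assign 27 (((Const 1 <<\<^sub>e (Reg 24 *\<^sub>e Reg 25)) -\<^sub>e Const 1) div\<^sub>e ((Const 1 <<\<^sub>e Reg 24) -\<^sub>e Const 1));;
       passes (3 * c + 1) (q + 1))) (r1, h1) (8 + (1 + expr_cost (Reg 25 <\<^sub>e Reg 24) + T)) ?Q"
    if "r1 24 = N \<and> agree ?A1 r h r1 h1" for r1 h1
  proof (rule run_Seq[OF prep])
    show "r1 24 = N" using that by blast
    have ag: "agree ?A1 r h r1 h1" using that by blast
    have "r1 8 = d" "r1 1 = \<sigma>" "h1 = h"
      using agree_reg[OF ag] ag \<sigma>(2) by (auto simp: d_def agree_def)
    then show "run ?M (If (Reg 25 <\<^sub>e Reg 24) (scan_prog q)
      (Assign 27 (((Const 1 <<\<^sub>e (Reg 24 *\<^sub>e Reg 25)) -\<^sub>e Const 1) div\<^sub>e ((Const 1 <<\<^sub>e Reg 24) -\<^sub>e Const 1));;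
       passes (3 * c + 1) (q + 1))) (r', h') (1 + expr_cost (Reg 25 <\<^sub>e Reg 24) + T) ?Q"
      if "r' = r1(24 := f, 25 := b) \<and> h' = h1" for r' h'
      using that by (intro branch) auto
  qed
  have "N \<le> d"
  proof (cases N)
    case (Suc n)
    have "Suc n \<le> 2 ^ n" using less_exp[of n] by (simp only: Suc_le_eq)
    moreover have "2 ^ n \<le> d" using Nd[of n] Suc by simp
    ultimately show ?thesis using Suc by linarith
  qed simp
  show ?thesis unfolding sort_prog_def
  proof (rule run_mono[OF run_Seq[OF run_agree[OF loop] rest]])
    define n2 where "n2 = (3 * c + 2) * (3 * c + 2) * (d + 1)"
    define pd where "pd = (2 * c) ^ (2 * c) * (d + 1)"
    have "(3 * c + 1) * ((100 + 10 * (3 * c + 1)) * d + 100) \<le> (3 * c + 2) * ((100 * (3 * c + 2)) * (d + 1))"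
      by (intro mult_le_mono) (simp_all add: algebra_simps)
    then have 1: "(3 * c + 1) * ((100 + 10 * (3 * c + 1)) * d + 100) \<le> 100 * n2"
      by (simp add: n2_def algebra_simps)
    have 2: "200 * (2 * c) ^ (2 * c) * d \<le> 200 * pd" by (simp add: pd_def algebra_simps)
    have "2 * 2 \<le> (3 * c + 2) * (3 * c + 2)" by (intro mult_le_mono) auto
    then have 3: "4 * (d + 1) \<le> n2" unfolding n2_def by (intro mult_le_mono1) simp
    have 4: "sort_cost c * (r 8 + 1) = 1000 * n2 + 1000 * pd"
      by (simp only: sort_cost_def n2_def pd_def d_def add_mult_distrib mult.assoc)
    show "2 + (N * (steps (Assign 24 (Reg 24 +\<^sub>e Const 1) :: segment com) + expr_cost ?e + 1) + expr_cost ?e + 1) +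
      (8 + (1 + expr_cost (Reg 25 <\<^sub>e Reg 24) + T)) \<le> sort_cost c * (r 8 + 1)"
      using 1 2 3 \<open>N \<le> d\<close> unfolding 4 T_def by simp
  qed (use d_def in auto)
qed

section \<open>Bucket starts\<close>

definition start_body :: "nat \<Rightarrow> segment com" where
  "start_body q =
    Load 15 (Work_Words (q + 1)) (Reg 11);;
    Store (Work_Words (q + 2)) (Reg 15 -\<^sub>e Const 1) (Reg 14);;
    Load 16 (Work_Words q) (Reg 15 -\<^sub>e Const 1);;
    Assign 14 (Reg 14 +\<^sub>e Reg 16);;
    Assign 11 (Reg 11 +\<^sub>e Const 1)"

definition start_prog :: "nat \<Rightarrow> segment com" where
  "start_prog q = Assign 14 (Reg 9);; (Assign 11 (Const 0);; While (Reg 11 <\<^sub>e Reg 8) (start_body q))"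

lemma count_list_length_filter: "count_list ys c = length (filter (\<lambda>y. y = c) ys)"
  by (induction ys) auto

lemma run_start_prog:
  assumes w: "2 \<le> w" and \<sigma>: "\<sigma> < 2 ^ w"
    and A: "length (h (Work_Words q)) = \<sigma>" "\<And>c. c \<in> {1..\<sigma>} \<Longrightarrow> h (Work_Words q) ! (c - 1) = count_list ys c"
    and S: "r 8 = length S" "take (length S) (h (Work_Words (q + 1))) = S" "S = sorted_list_of_set (set ys)"
      "length (h (Work_Words (q + 1))) = \<sigma>" "set ys \<subseteq> {1..\<sigma>}"
    and h: "length (h (Work_Words (q + 2))) = \<sigma>" and len: "r 9 + length ys < 2 ^ w"
  shows "run (merge_machine w k \<sigma>) (start_prog q) (r, h) (30 * length S + 30)
    (\<lambda>r' h'. \<forall>c\<in>set ys. h' (Work_Words (q + 2)) ! (c - 1) = r 9 + length (filter (\<lambda>y. y < c) ys))"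
proof -
  let ?M = "merge_machine w k \<sigma>"
  let ?cum = "\<lambda>i. r 9 + length (filter (\<lambda>y. y \<in> set (take i S)) ys)"
  have setS: "set S = set ys" and dS: "distinct S" and sS: "sorted_wrt (<) S"
    using S(3) by simp_all
  have lS: "length S \<le> \<sigma>"
  proof -
    have "length S = card (set ys)" using S(3) by simp
    also have "\<dots> \<le> card {1..\<sigma>}" using S(5) by (intro card_mono) auto
    finally show ?thesis by simp
  qed
  have cum_Suc: "?cum (Suc i) = ?cum i + count_list ys (S ! i)" if "i < length S" for i
  proof -
    have "S ! i \<notin> set (take i S)"
      using that dS by (metis distinct_take id_take_nth_drop not_distinct_conv_prefix take_Suc_conv_app_nth)
    then have "length (filter (\<lambda>y. y \<in> set (take i S) \<or> y = S ! i) ys) =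
        length (filter (\<lambda>y. y \<in> set (take i S)) ys) + count_list ys (S ! i)"
      unfolding count_list_length_filter by (induction ys) auto
    then show ?thesis using that by (simp add: take_Suc_conv_app_nth disj_commute insert_iff)
  qed
  have cum_le: "?cum i < 2 ^ w" for i
    using len length_filter_le[of "\<lambda>y. y \<in> set (take i S)" ys] by linarith
  let ?I = "\<lambda>i r' h'. r' 11 = i \<and> r' 14 = ?cum i \<and> (\<forall>j<i. h' (Work_Words (q + 2)) ! (S ! j - 1) = ?cum j)"
  have 1: "run ?M (Assign 14 (Reg 9)) (r, h) 2 (\<lambda>r' h'. r' = r(14 := r 9) \<and> h' = h)"
    by (rule run_wp) simp_all
  have 2: "run ?M (Assign 11 (Const 0);; While (Reg 11 <\<^sub>e Reg 8) (start_body q)) (r1, h1)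
    (2 + (length S * (steps (start_body q) + expr_cost (Reg 11 <\<^sub>e Reg 8) + 1) + expr_cost (Reg 11 <\<^sub>e Reg 8) + 1))
    (?I (length S))" if eq: "r1 = r(14 := r 9) \<and> h1 = h" for r1 h1
  proof (rule run_for, goal_cases)
    case 1
    show ?case using eq by simp
  next
    case (2 i r' h')
    have eqs: "r' 8 = length S" "h' (Work_Words q) = h (Work_Words q)"
      "h' (Work_Words (q + 1)) = h (Work_Words (q + 1))" "length (h' (Work_Words (q + 2))) = \<sigma>"
      using agree_reg[OF 2(2), of 8] agree_seg[OF 2(2), of "Work_Words q"]
        agree_seg[OF 2(2), of "Work_Words (q + 1)"]
        agree_length[OF 2(2), of "Work_Words (q + 2)"] eq S(1) h by (auto simp: start_body_def)
    have I: "r' 11 = i" "r' 14 = ?cum i" "\<forall>j<i. h' (Work_Words (q + 2)) ! (S ! j - 1) = ?cum j"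
      using 2(3) by auto
    have c: "S ! i \<in> {1..\<sigma>}" using 2(1) setS S(5) nth_mem by blast
    have D: "h (Work_Words (q + 1)) ! i = S ! i" using 2(1) S(2) by (metis nth_take)
    have Si: "S ! i < 2 ^ w" using c \<sigma> by auto
    have new: "(h' (Work_Words (q + 2)))[S ! i - 1 := ?cum i] ! (S ! j - 1) = ?cum j" if "j < Suc i" for j
    proof (cases "j = i")
      case False
      then have "j < i" using that by simp
      then have "S ! j \<noteq> S ! i" using dS 2(1) by (simp add: nth_eq_iff_index_eq)
      moreover have "1 \<le> S ! j" using setS S(5) \<open>j < i\<close> 2(1) nth_mem[of j S] by auto
      ultimately have "S ! i - 1 \<noteq> S ! j - 1" using c by auto
      then show ?thesis using I(3) \<open>j < i\<close> by simp
    qed (use c eqs(4) in auto)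
    have i: "i < \<sigma>" using 2(1) lS by simp
    have ci: "S ! i - 1 < \<sigma>" using c by auto
    note Suc_cum = cum_Suc[OF 2(1)] cum_le[of "Suc i"] cum_le[of i]
    have "wp ?M (start_body q) (\<lambda>r' h'. r' 11 = Suc i \<and> r' 14 = ?cum i + count_list ys (S ! i) \<and>
        (\<forall>j<Suc i. h' (Work_Words (q + 2)) ! (S ! j - 1) = ?cum j)) r' h'"
      using eqs I(1,2) i 2(1) S(4) c D w Si Suc_cum A(1) A(2)[OF c] new lS ci \<sigma>
      by (simp add: start_body_def apply_binop_simps)
    then have "wp ?M (start_body q) (?I (Suc i)) r' h'" by (simp only: Suc_cum(1))
    then have "run ?M (start_body q) (r', h') (steps (start_body q)) (?I (Suc i))" by (rule wp_run)
    moreover have "eval_expr (word_size ?M) r' (Reg 11 <\<^sub>e Reg 8) \<noteq> 0"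
      using eqs I(1) 2(1) by (simp add: apply_binop_simps)
    ultimately show ?case by blast
  next
    case (3 r' h')
    have "r' 8 = length S" using agree_reg[OF 3(1), of 8] eq S(1) by (simp add: start_body_def)
    then show ?case using 3 by (simp add: apply_binop_simps)
  qed
  \<comment> \<open>The labels listed before \<open>S ! j\<close> are exactly the smaller ones that
    occur, so the running sum is the bucket start.\<close>
  have cum: "?cum j = r 9 + length (filter (\<lambda>y. y < S ! j) ys)" if "j < length S" for j
  proof -
    have "y \<in> set (take j S) \<longleftrightarrow> y < S ! j" if y: "y \<in> set ys" for y
    proof -
      obtain i where i: "i < length S" "y = S ! i" using y setS by (metis in_set_conv_nth)
      have "S ! i < S ! j \<longleftrightarrow> i < j"
        using sorted_wrt_nth_less[OF sS] i \<open>j < length S\<close> by (metis linorder_neqE_nat order.asym less_irrefl)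
      moreover have "S ! i \<in> set (take j S) \<longleftrightarrow> i < j"
        using i \<open>j < length S\<close> dS by (auto simp: in_set_conv_nth nth_eq_iff_index_eq)
      ultimately show ?thesis using i by simp
    qed
    then show ?thesis by (metis (mono_tags, lifting) filter_cong)
  qed
  show ?thesis unfolding start_prog_def
  proof (rule run_mono[OF run_Seq[OF 1 2]])
    fix r' h'
    assume I: "?I (length S) r' h'"
    show "\<forall>c\<in>set ys. h' (Work_Words (q + 2)) ! (c - 1) = r 9 + length (filter (\<lambda>y. y < c) ys)"
    proof
      fix c assume "c \<in> set ys"
      then obtain j where j: "j < length S" "c = S ! j" using setS by (metis in_set_conv_nth)
      then show "h' (Work_Words (q + 2)) ! (c - 1) = r 9 + length (filter (\<lambda>y. y < c) ys)"
        using I cum[OF j(1)] by simp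
    qed
  qed (simp_all add: start_body_def)
qed

definition finish_prog :: "nat \<Rightarrow> nat \<Rightarrow> segment com" where
  "finish_prog c q = sort_prog c q;; start_prog q"

lemma regs_finish_prog: "regs (finish_prog c q) \<subseteq> {8, 11, 14, 15, 16, 17, 24, 25, 26, 27}"
  using regs_sort_prog[of c q] by (auto simp: finish_prog_def start_prog_def start_body_def)

lemma segs_finish_prog: "segs (finish_prog c q) \<subseteq> {Work_Words (q + 1), Work_Words (q + 2), Work_Words 8}"
  using segs_sort_prog[of c q] by (auto simp: finish_prog_def start_prog_def start_body_def)

text \<open>\<open>D\<close> starts with the \<open>d\<close> distinct labels in order, and \<open>T ! (c - 1)\<close> is the first position of the
  bucket of label \<open>c\<close>. The \<open>z\<close> positions before the buckets are those of the nodes \<open>$\<^sup>k\<close>, which are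
  not targets of edges.\<close>

definition bucketed :: "nat list \<Rightarrow> nat \<Rightarrow> nat list \<Rightarrow> nat list \<Rightarrow> nat \<Rightarrow> bool" where
  "bucketed D d T ys z \<longleftrightarrow> d = length (sorted_list_of_set (set ys)) \<and>
    take d D = sorted_list_of_set (set ys) \<and>
    (\<forall>c\<in>set ys. T ! (c - 1) = z + length (filter (\<lambda>y. y < c) ys))"

lemma run_finish_prog:
  assumes w: "2 \<le> w" and \<sigma>: "\<sigma> < 2 ^ w" "r 1 = \<sigma>" "\<sigma> \<le> w ^ c"
    and cnt: "counted \<sigma> (h (Work_Words q)) (h (Work_Words (q + 1))) (r 8) ys"
    and len: "r 9 + length ys < 2 ^ w" "length ys < 2 ^ (w - 1)"
    and h: "length (h (Work_Words 8)) = \<sigma>" "length (h (Work_Words (q + 2))) = \<sigma>" "q + 2 < 8"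
  shows "run (merge_machine w k \<sigma>) (finish_prog c q) (r, h) ((sort_cost c + 60) * (length ys + 1))
    (\<lambda>r' h'. bucketed (h' (Work_Words (q + 1))) (r' 8) (h' (Work_Words (q + 2))) ys (r 9))"
proof -
  let ?M = "merge_machine w k \<sigma>" and ?S = "sorted_list_of_set (set ys)"
  have d: "r 8 = card (set ys)" "set ys \<subseteq> {1..\<sigma>}"
    using cnt distinct_card[of "take (r 8) (h (Work_Words (q + 1)))"] by (auto simp: counted_def)
  have dl: "r 8 \<le> length ys" unfolding d(1) by (rule card_length)
  have lS: "length ?S = r 8" using d by simp
  have 1: "run ?M (sort_prog c q) (r, h) (sort_cost c * (r 8 + 1)) (\<lambda>r' h'.
      (r' 8 = r 8 \<and> take (r 8) (h' (Work_Words (q + 1))) = ?S) \<and> agree (sort_prog c q) r h r' h')"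
    by (rule run_agree[OF run_sort_prog[where ys = ys]]) (use assms dl in auto)
  have 2: "run ?M (start_prog q) (r1, h1) (30 * length ?S + 30)
    (\<lambda>r' h'. bucketed (h' (Work_Words (q + 1))) (r' 8) (h' (Work_Words (q + 2))) ys (r 9))"
    if s: "(r1 8 = r 8 \<and> take (r 8) (h1 (Work_Words (q + 1))) = ?S) \<and> agree (sort_prog c q) r h r1 h1"
    for r1 h1
  proof -
    have ag: "agree (sort_prog c q) r h r1 h1" using s by blast
    have "9 \<notin> regs (sort_prog c q)" "Work_Words q \<notin> segs (sort_prog c q)"
      using regs_sort_prog[of c q] segs_sort_prog[of c q] h(3) by auto
    then have eqs: "r1 9 = r 9" "h1 (Work_Words q) = h (Work_Words q)"
      using agree_reg[OF ag] agree_seg[OF ag] by auto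
    have "run ?M (start_prog q) (r1, h1) (30 * length ?S + 30)
      (\<lambda>r' h'. (\<forall>c\<in>set ys. h' (Work_Words (q + 2)) ! (c - 1) = r1 9 + length (filter (\<lambda>y. y < c) ys)) \<and>
        agree (start_prog q) r1 h1 r' h')"
    proof (rule run_agree[OF run_start_prog[OF w \<sigma>(1) _ _ _ _ refl _ d(2)]])
      show "length (h1 (Work_Words q)) = \<sigma>" "\<And>c. c \<in> {1..\<sigma>} \<Longrightarrow> h1 (Work_Words q) ! (c - 1) = count_list ys c"
        using cnt eqs by (auto simp: counted_def)
      show "length (h1 (Work_Words (q + 1))) = \<sigma>" "length (h1 (Work_Words (q + 2))) = \<sigma>"
        using cnt h agree_length[OF ag] by (auto simp: counted_def)
    qed (use s lS len eqs in auto)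
    then show ?thesis
    proof (rule run_mono)
      fix r' h'
      assume t: "(\<forall>c\<in>set ys. h' (Work_Words (q + 2)) ! (c - 1) = r1 9 + length (filter (\<lambda>y. y < c) ys)) \<and>
        agree (start_prog q) r1 h1 r' h'"
      then have "r' 8 = r1 8" "h' (Work_Words (q + 1)) = h1 (Work_Words (q + 1))"
        using agree_reg[of "start_prog q" r1 h1 r' h' 8] agree_seg[of "start_prog q" r1 h1 r' h' "Work_Words (q + 1)"]
        by (auto simp: start_prog_def start_body_def)
      then show "bucketed (h' (Work_Words (q + 1))) (r' 8) (h' (Work_Words (q + 2))) ys (r 9)"
        using t s lS eqs by (simp add: bucketed_def)
    qed simp
  qed
  show ?thesis unfolding finish_prog_def
  proof (rule run_mono[OF run_Seq[OF 1 2]])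
    have "sort_cost c * (r 8 + 1) \<le> sort_cost c * (length ys + 1)" using dl by (intro mult_le_mono2) simp
    moreover have "x + (30 * l + 30) \<le> y + 60 * (u + 1)" if "x \<le> y" "l = v" "v \<le> u" for x y l u v :: nat
      using that by simp
    ultimately show "sort_cost c * (r 8 + 1) + (30 * length ?S + 30) \<le> (sort_cost c + 60) * (length ys + 1)"
      unfolding add_mult_distrib[of "sort_cost c"] using lS dl by blast
  qed auto
qed

section \<open>Sorting passes\<close>

lemma run_SeqA:
  assumes "run M c1 (r, h) T1 Q1"
    and "\<And>r' h'. Q1 r' h' \<Longrightarrow> agree c1 r h r' h' \<Longrightarrow> run M c2 (r', h') T2 Q"
  shows "run M (c1;; c2) (r, h) (T1 + T2) Q"
  by (rule run_Seq[OF run_agree[OF assms(1)]]) (use assms(2) in blast)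

lemma run_for_mono:
  assumes "run M (Assign x (Const 0);; While e c) (r, h) T Q"
    and "T \<le> T'" and "\<And>r' h'. Q r' h' \<Longrightarrow> agree (Assign x (Const 0);; While e c) r h r' h' \<Longrightarrow> Q' r' h'"
  shows "run M (Assign x (Const 0);; While e c) (r, h) T' Q'"
  by (rule run_mono[OF run_agree[OF assms(1)] assms(2)]) (use assms(3) in blast)

lemma take_filter:
  assumes "s = length (filter P (take t xs))"
  shows "take s (filter P xs) = filter P (take t xs)"
proof -
  have "filter P xs = filter P (take t xs) @ filter P (drop t xs)"
    by (metis append_take_drop_id filter_append)
  then show ?thesis using assms by simp
qed

text \<open>\<open>Work_Words 6\<close> holds the next free position in the bucket of each label. \<open>Work_Words 7\<close> is
  used only for the LCS values, as the block of the last edge with each label; register \<open>6\<close>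
  is not the index of a block.\<close>

definition reset_body :: "nat \<Rightarrow> segment com" where
  "reset_body q =
    Load 15 (Work_Words (q + 1)) (Reg 11);;
    Load 14 (Work_Words (q + 2)) (Reg 15 -\<^sub>e Const 1);;
    Store (Work_Words 6) (Reg 15 -\<^sub>e Const 1) (Reg 14);;
    Store (Work_Words 7) (Reg 15 -\<^sub>e Const 1) (Reg 6);;
    Assign 11 (Reg 11 +\<^sub>e Const 1)"

definition reset_prog :: "nat \<Rightarrow> segment com" where
  "reset_prog q = Assign 11 (Const 0);; While (Reg 11 <\<^sub>e Reg 8) (reset_body q)"

lemma run_reset_prog:
  assumes w: "2 \<le> w" and \<sigma>: "\<sigma> < 2 ^ w" and b: "bucketed (h (Work_Words (q + 1))) (r 8) (h (Work_Words (q + 2))) ys z"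
    and ys: "set ys \<subseteq> {1..\<sigma>}" and n: "r 6 < 2 ^ w" and len: "z + length ys < 2 ^ w"
    and h: "length (h (Work_Words (q + 1))) = \<sigma>" "length (h (Work_Words (q + 2))) = \<sigma>"
      "length (h (Work_Words 6)) = \<sigma>" "length (h (Work_Words 7)) = \<sigma>" "q + 2 < 6"
  shows "run (merge_machine w k \<sigma>) (reset_prog q) (r, h) (40 * length ys + 40)
    (\<lambda>r' h'. \<forall>c\<in>set ys. h' (Work_Words 6) ! (c - 1) = z + length (filter (\<lambda>y. y < c) ys) \<and>
      h' (Work_Words 7) ! (c - 1) = r 6)"
  unfolding reset_prog_def
proof -
  let ?M = "merge_machine w k \<sigma>"
  define S where "S = sorted_list_of_set (set ys)"
  have S: "r 8 = length S" "take (length S) (h (Work_Words (q + 1))) = S" "set S = set ys" "distinct S"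
    "\<And>c. c \<in> set ys \<Longrightarrow> h (Work_Words (q + 2)) ! (c - 1) = z + length (filter (\<lambda>y. y < c) ys)"
    using b by (auto simp: bucketed_def S_def)
  have lS: "length S \<le> \<sigma>" "length S \<le> length ys"
  proof -
    have "length S = card (set ys)" by (simp add: S_def)
    moreover have "\<dots> \<le> card {1..\<sigma>}" using ys by (intro card_mono) auto
    ultimately show "length S \<le> \<sigma>" "length S \<le> length ys" using card_length[of ys] by auto
  qed
  let ?I = "\<lambda>i (r'::nat \<Rightarrow> nat) h'. r' 11 = i \<and> (\<forall>j<i. h' (Work_Words 6) ! (S ! j - 1) = z + length (filter (\<lambda>y. y < S ! j) ys) \<and>
    h' (Work_Words 7) ! (S ! j - 1) = r 6)"
  have "run ?M (Assign 11 (Const 0);; While (Reg 11 <\<^sub>e Reg 8) (reset_body q)) (r, h)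
    (2 + (length S * (steps (reset_body q) + expr_cost (Reg 11 <\<^sub>e Reg 8) + 1) + expr_cost (Reg 11 <\<^sub>e Reg 8) + 1))
    (?I (length S))"
  proof (rule run_for, goal_cases)
    case 1
    show ?case by simp
  next
    case (2 i r' h')
    have eqs: "r' 8 = length S" "r' 6 = r 6" "h' (Work_Words (q + 1)) = h (Work_Words (q + 1))"
      "h' (Work_Words (q + 2)) = h (Work_Words (q + 2))" "length (h' (Work_Words 6)) = \<sigma>" "length (h' (Work_Words 7)) = \<sigma>"
      using agree_reg[OF 2(2), of 8] agree_reg[OF 2(2), of 6] agree_seg[OF 2(2), of "Work_Words (q + 1)"]
        agree_seg[OF 2(2), of "Work_Words (q + 2)"] agree_length[OF 2(2)] h S(1)
      by (auto simp: reset_body_def)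
    have I: "r' 11 = i" "\<And>j. j < i \<Longrightarrow> h' (Work_Words 6) ! (S ! j - 1) = z + length (filter (\<lambda>y. y < S ! j) ys)"
      "\<And>j. j < i \<Longrightarrow> h' (Work_Words 7) ! (S ! j - 1) = r 6"
      using 2(3) by auto
    have cy: "S ! i \<in> set ys" using 2(1) S(3) nth_mem by blast
    then have c: "S ! i \<in> {1..\<sigma>}" using ys by blast
    have D: "h (Work_Words (q + 1)) ! i = S ! i" using 2(1) S(2) by (metis nth_take)
    have Si: "S ! i < 2 ^ w" "S ! i - 1 < \<sigma>" using c \<sigma> by auto
    have i: "i < \<sigma>" using 2(1) lS by simp
    let ?v = "z + length (filter (\<lambda>y. y < S ! i) ys)"
    have v: "?v < 2 ^ w" using len length_filter_le[of "\<lambda>y. y < S ! i" ys] by linarith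
    have new: "(h' (Work_Words 6))[S ! i - 1 := ?v] ! (S ! j - 1) = z + length (filter (\<lambda>y. y < S ! j) ys) \<and>
        (h' (Work_Words 7))[S ! i - 1 := r 6] ! (S ! j - 1) = r 6" if "j < Suc i" for j
    proof (cases "j = i")
      case False
      then have "j < i" using that by simp
      then have "S ! j \<noteq> S ! i" using S(4) 2(1) by (simp add: nth_eq_iff_index_eq)
      moreover have "1 \<le> S ! j" using S(3) ys \<open>j < i\<close> 2(1) nth_mem[of j S] by auto
      ultimately have "S ! i - 1 \<noteq> S ! j - 1" using c by auto
      then show ?thesis using I(2,3) \<open>j < i\<close> by simp
    qed (use Si eqs in auto)
    have "wp ?M (reset_body q) (?I (Suc i)) r' h'"
      using eqs I(1) i 2(1) c D w Si S(5)[OF cy] new lS \<sigma> v n h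
      by (simp add: reset_body_def apply_binop_simps)
    then show ?case using eqs I(1) 2(1) by (auto simp: apply_binop_simps intro: wp_run)
  next
    case (3 r' h')
    have "r' 8 = length S" using agree_reg[OF 3(1), of 8] S(1) by (simp add: reset_body_def)
    then show ?case using 3 by (simp add: apply_binop_simps)
  qed
  then show "run ?M (Assign 11 (Const 0);; While (Reg 11 <\<^sub>e Reg 8) (reset_body q)) (r, h) (40 * length ys + 40)
    (\<lambda>r' h'. \<forall>c\<in>set ys. h' (Work_Words 6) ! (c - 1) = z + length (filter (\<lambda>y. y < c) ys) \<and>
      h' (Work_Words 7) ! (c - 1) = r 6)"
  proof (rule run_for_mono)
    fix r' h'
    assume I: "?I (length S) r' h'"
    show "\<forall>c\<in>set ys. h' (Work_Words 6) ! (c - 1) = z + length (filter (\<lambda>y. y < c) ys) \<and>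
      h' (Work_Words 7) ! (c - 1) = r 6"
      using I S(3) by (metis in_set_conv_nth)
  qed (use lS in \<open>simp add: reset_body_def\<close>)
qed

text \<open>Register \<open>14\<close> names the graph; each graph has its own read position,
  register \<open>12\<close> for the first and \<open>13\<close> for the second.\<close>

definition fetch_prog :: "segment com" where
  "fetch_prog =
    If (Reg 14)
      (Load 15 (In_W True) (Reg 13);; Load 16 (In_Wminus True) (Reg 13);; Load 17 (In_last True) (Reg 13);;
       Assign 13 (Reg 13 +\<^sub>e Const 1))
      (Load 15 (In_W False) (Reg 12);; Load 16 (In_Wminus False) (Reg 12);; Load 17 (In_last False) (Reg 12);;
       Assign 12 (Reg 12 +\<^sub>e Const 1))"

text \<open>The node index in register \<open>11\<close> advances by the bit of \<open>last\<close>,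
  so all entries of a node are read under the same source bit. The old order is read from the first
  half of \<open>Work_Bits\<close>; the new one is written to the half that starts at
  \<open>n\<close>, the content of register \<open>6\<close>.\<close>

definition merge_pass_body :: "segment com" where
  "merge_pass_body =
    Load 14 Work_Bits (Reg 11);;
    fetch_prog;;
    If (Reg 16)
      (Load 18 (Work_Words 6) (Reg 15 -\<^sub>e Const 1);;
       Store Work_Bits (Reg 6 +\<^sub>e Reg 18) (Reg 14);;
       Store (Work_Words 6) (Reg 15 -\<^sub>e Const 1) (Reg 18 +\<^sub>e Const 1))
      Skip;;
    Assign 11 (Reg 11 +\<^sub>e Reg 17)"

definition merge_pass_loop :: "segment com" where
  "merge_pass_loop = Assign 11 (Const 0);; While ((Reg 12 +\<^sub>e Reg 13) <\<^sub>e Reg 7) merge_pass_body"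

text \<open>Register \<open>20\<close> holds the tie rule \<open>\<tau>\<close>; if both graphs have
  nodes, the two copies of the source node get the bits \<open>\<tau>\<close> and its
  negation.\<close>

definition sources_prog :: "segment com" where
  "sources_prog =
    If (Reg 2)
      (If (Reg 3) (Store Work_Bits (Reg 6) (Reg 20);; Store Work_Bits (Reg 6 +\<^sub>e Const 1) (Const 1 -\<^sub>e Reg 20))
        (Store Work_Bits (Reg 6) (Const 0)))
      (Store Work_Bits (Reg 6) (Const 1))"

definition copy_body :: "segment com" where
  "copy_body = Load 14 Work_Bits (Reg 6 +\<^sub>e Reg 11);; Store Work_Bits (Reg 11) (Reg 14);;
    Assign 11 (Reg 11 +\<^sub>e Const 1)"

definition init_body :: "segment com" where
  "init_body =
    If (Reg 20) (Assign 14 (Reg 11 <\<^sub>e Reg 3)) (Assign 14 ((Reg 11 <\<^sub>e Reg 2) =\<^sub>e Const 0));;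
    Store Work_Bits (Reg 11) (Reg 14);; Assign 11 (Reg 11 +\<^sub>e Const 1)"

definition merge_pass_prog :: "segment com" where
  "merge_pass_prog =
    reset_prog 0;; (Assign 12 (Const 0);; Assign 13 (Const 0);; sources_prog);;
    merge_pass_loop;; (Assign 11 (Const 0);; While (Reg 11 <\<^sub>e Reg 6) copy_body);;
    Assign 10 (Reg 10 +\<^sub>e Const 1)"

definition stages_prog :: "segment com" where
  "stages_prog =
    (Assign 11 (Const 0);; While (Reg 11 <\<^sub>e Reg 6) init_body);;
    (Assign 10 (Const 0);; While (Reg 10 <\<^sub>e Reg 0) merge_pass_prog)"

text \<open>The bound on three times the total length follows from \<open>word_size_ok\<close>, as a
  label takes at least one bit. It covers the indices into both halves of \<open>Work_Bits\<close>
  and sums such as \<open>n + m\<close>.\<close>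

locale merging = two_graphs k V X for k V X +
  fixes w \<sigma> :: nat
  assumes w: "2 \<le> w" and \<sigma>_word: "\<sigma> < 2 ^ w" and k_word: "k < 2 ^ w"
    and label_le: "(x, a) \<in> X g \<Longrightarrow> a \<le> \<sigma>"
    and nonempty: "VU \<noteq> {}"
    and size_word: "3 * (length (ent False) + length (ent True)) < 2 ^ w"
begin

abbreviation M where "M \<equiv> merge_machine w k \<sigma>"

definition n :: nat where "n = card (V False) + card (V True)"
definition m :: nat where "m = length (ent False) + length (ent True)"
definition z :: nat where "z = length (sources False)"

definition all_reps :: "(bool \<times> nat list \<times> nat) list" where
  "all_reps = map (Pair False) (G.first_edges False) @ map (Pair True) (G.first_edges True)"

definition labels :: "nat list" where "labels = map label all_reps"

lemma set_all_reps: "set all_reps = {e. rep e}"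
proof -
  have "(g, e) \<in> set all_reps \<longleftrightarrow> rep (g, e)" for g e
    by (cases g) (auto simp: all_reps_def rep_def G.set_first_edges)
  then show ?thesis by auto
qed

lemma distinct_all_reps: "distinct all_reps"
proof -
  have "distinct (G.first_edges g)" for g
    unfolding G.first_edges_def using G.strict_sorted_entries[of g] distinct_filter strict_sorted_iff by blast
  then show ?thesis by (auto simp: all_reps_def distinct_map inj_on_def)
qed

text \<open>Label counts do not depend on the order in which the flagged edges are listed. So the
  bucket starts are computed once and serve all passes as well as the final merge.\<close>

lemma count_labels:
  assumes "distinct es" "set es = {e. rep e}"
  shows "length (filter (\<lambda>e. P (label e)) es) = length (filter P labels)"
proof -
  have "mset es = mset all_reps"
    using assms distinct_all_reps set_all_reps by (metis set_eq_iff_mset_eq_distinct)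
  then have "mset (filter (\<lambda>e. P (label e)) es) = mset (filter (\<lambda>e. P (label e)) all_reps)" by simp
  from mset_eq_length[OF this] show ?thesis by (simp add: labels_def filter_map comp_def)
qed

lemma label_bounds: "rep e \<Longrightarrow> label e \<in> {1..\<sigma>}"
  using G.first_edge_in_X[of "fst e" "snd e"] G.edgeD[of "fst (snd e)" "label e" "fst e"]
    label_le[of "fst (snd e)" "label e" "fst e"] by (simp add: rep_def)

lemma set_labels: "set labels = label ` {e. rep e}"
  by (simp add: labels_def set_all_reps)

lemma labels_bounds: "set labels \<subseteq> {1..\<sigma>}"
  using label_bounds by (auto simp: set_labels)

lemma length_scan_m: "length (scan \<tau> h) = m"
  by (simp add: length_scan m_def)

lemma length_stage_n: "length (stage \<tau> h) = n"
  by (simp add: length_stage n_def)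

lemma card_le_entries: "card (V g) \<le> length (ent g)"
  using length_filter_le[of "last_entry (X g)" "ent g"] by (simp add: G.count_last_entries)

lemma n_le_m: "n \<le> m"
  using card_le_entries[of False] card_le_entries[of True] by (simp add: n_def m_def)

lemma length_sources: "length (sources \<tau>) = z"
  by (cases \<tau>) (auto simp: z_def sources_def)

lemma length_reps_scan: "h < k \<Longrightarrow> z + length (filter rep (scan \<tau> h)) = n"
  using arg_cong[OF stage_Suc[of h \<tau>], of length] by (simp add: length_stage_n length_sources)

lemma length_labels: "z + length labels = n"
proof -
  have "0 < k" using G.k_pos by simp
  have "length labels = length (filter rep (scan False 0))"
    using count_labels[OF distinct_filter[OF distinct_scan] set_rep_scan, of "\<lambda>_. True"] by simp
  then show ?thesis using length_reps_scan[OF \<open>0 < k\<close>, of False] by simp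
qed

lemma one_le_z: "1 \<le> z" and z_le_n: "z \<le> n"
proof -
  obtain g where "V g \<noteq> {}" using nonempty by blast
  then show "1 \<le> z" by (cases g) (auto simp: z_def sources_def)
  show "z \<le> n" using length_labels by simp
qed

definition bit :: "bool \<Rightarrow> nat \<Rightarrow> nat \<Rightarrow> nat" where
  "bit \<tau> h p = of_bool (fst (stage \<tau> h ! p))"

text \<open>The part of the state that all passes share; \<open>env_agree\<close> carries it past
  any program that writes only working arrays and output arrays.\<close>

definition env :: "(nat \<Rightarrow> nat) \<Rightarrow> (segment \<Rightarrow> nat list) \<Rightarrow> bool" where
  "env r h \<longleftrightarrow> r 0 = k \<and> r 1 = \<sigma> \<and> r 2 = card (V False) \<and> r 3 = card (V True) \<and>
    r 4 = length (ent False) \<and> r 5 = length (ent True) \<and> r 6 = n \<and> r 7 = m \<and>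
    (\<forall>g. h (In_W g) = map snd (ent g) \<and> h (In_Wminus g) = map (\<lambda>e. of_bool (first_edge (X g) e)) (ent g) \<and>
      h (In_last g) = map (\<lambda>e. of_bool (last_entry (X g) e)) (ent g)) \<and>
    bucketed (h (Work_Words 1)) (r 8) (h (Work_Words 2)) labels z \<and>
    length (h Work_Bits) = 2 * n \<and> (\<forall>j<9. length (h (Work_Words j)) = \<sigma>)"

lemma env_agree:
  assumes "env r h" "agree c r h r' h'" "regs c \<inter> {0, 1, 2, 3, 4, 5, 6, 7, 8} = {}"
    and "segs c \<subseteq> {Work_Bits, Work_Words 6, Work_Words 7, Out_W, Out_Wminus, Out_last}"
  shows "env r' h'"
proof -
  have "r' x = r x" if "x \<in> {0, 1, 2, 3, 4, 5, 6, 7, 8}" for x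
    using agree_reg[OF assms(2)] assms(3) that by blast
  moreover have "h' a = h a" if "a \<notin> {Work_Bits, Work_Words 6, Work_Words 7, Out_W, Out_Wminus, Out_last}" for a
    using agree_seg[OF assms(2)] assms(4) that by blast
  ultimately show ?thesis using assms(1) agree_length[OF assms(2)] by (simp add: env_def)
qed

lemma wp_fetch_True:
  assumes "env r h" "r 14 \<noteq> 0" "r 13 = i" "i < length (ent True)" "i + 1 < 2 ^ w"
    and "Q (r(15 := snd (ent True ! i), 16 := of_bool (first_edge (X True) (ent True ! i)),
      17 := of_bool (last_entry (X True) (ent True ! i)), 13 := i + 1)) h"
  shows "wp M fetch_prog Q r h"
proof -
  have "h (In_W True) = map snd (ent True)" "h (In_Wminus True) = map (\<lambda>e. of_bool (first_edge (X True) e)) (ent True)"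
    "h (In_last True) = map (\<lambda>e. of_bool (last_entry (X True) e)) (ent True)"
    using assms(1) by (simp_all add: env_def)
  moreover have "1 mod 2 ^ w = (1::nat)" using w by simp
  ultimately show ?thesis using assms(2-6) by (simp add: fetch_prog_def apply_binop_Add del: One_nat_def)
qed

lemma wp_fetch_False:
  assumes "env r h" "r 14 = 0" "r 12 = i" "i < length (ent False)" "i + 1 < 2 ^ w"
    and "Q (r(15 := snd (ent False ! i), 16 := of_bool (first_edge (X False) (ent False ! i)),
      17 := of_bool (last_entry (X False) (ent False ! i)), 12 := i + 1)) h"
  shows "wp M fetch_prog Q r h"
proof -
  have "h (In_W False) = map snd (ent False)" "h (In_Wminus False) = map (\<lambda>e. of_bool (first_edge (X False) e)) (ent False)"
    "h (In_last False) = map (\<lambda>e. of_bool (last_entry (X False) e)) (ent False)"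
    using assms(1) by (simp_all add: env_def)
  moreover have "1 mod 2 ^ w = (1::nat)" using w by simp
  ultimately show ?thesis using assms(2-6) by (simp add: fetch_prog_def apply_binop_Add del: One_nat_def)
qed

lemma env_upd: "env r h \<Longrightarrow> 8 < x \<Longrightarrow> env (r(x := v)) h"
  by (simp add: env_def)

lemma m_word: "2 * n < 2 ^ w" "m < 2 ^ w" "n + m < 2 ^ w" "3 * m < 2 ^ w"
  using size_word n_le_m by (auto simp: m_def)

lemma nth_ent:
  assumes "t < length (scan \<tau> h)" "fst (scan \<tau> h ! t) = g"
  shows "length (filter (\<lambda>e. fst e = g) (take t (scan \<tau> h))) < length (ent g)"
    and "ent g ! length (filter (\<lambda>e. fst e = g) (take t (scan \<tau> h))) = snd (scan \<tau> h ! t)"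
proof -
  let ?i = "length (filter (\<lambda>e. fst e = g) (take t (scan \<tau> h)))"
  have *: "?i < length (map (Pair g) (ent g))" "map (Pair g) (ent g) ! ?i = scan \<tau> h ! t"
    using filter_nth_count[of t "scan \<tau> h" "\<lambda>e. fst e = g", OF assms] unfolding filter_scan .
  then show i: "?i < length (ent g)" by (simp only: length_map)
  show "ent g ! ?i = snd (scan \<tau> h ! t)" using *(2) unfolding nth_map[OF i] by (metis snd_conv)
qed

text \<open>The cursor of a label has advanced once per earlier flagged edge with that label. Added
  to the bucket start this is the rank in the stable sort, so the bit is written where stage
  \<open>Suc h\<close> has the target.\<close>

lemma rank_scan:
  assumes h: "h < k" and t: "t < length (scan \<tau> h)" "rep (scan \<tau> h ! t)"
  defines "R \<equiv> filter rep (scan \<tau> h)" and "s \<equiv> length (filter rep (take t (scan \<tau> h)))"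
  shows "s < length R" "R ! s = scan \<tau> h ! t"
    and "length (filter (\<lambda>y. y < label (scan \<tau> h ! t)) labels) +
        length (filter (\<lambda>e. rep e \<and> label e = label (scan \<tau> h ! t)) (take t (scan \<tau> h))) = rank label R s"
    and "z + rank label R s < n" "stage \<tau> (Suc h) ! (z + rank label R s) = tagged_target (scan \<tau> h ! t)"
proof -
  show s: "s < length R" "R ! s = scan \<tau> h ! t"
    using filter_nth_count[of t "scan \<tau> h" rep] t by (auto simp: R_def s_def)
  have "take s R = filter rep (take t (scan \<tau> h))"
    unfolding R_def by (rule take_filter) (simp add: s_def)
  moreover have "length (filter (\<lambda>e. label e < a) R) = length (filter (\<lambda>y. y < a) labels)" for a
    unfolding R_def by (rule count_labels[OF distinct_filter[OF distinct_scan] set_rep_scan])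
  ultimately show "length (filter (\<lambda>y. y < label (scan \<tau> h ! t)) labels) +
        length (filter (\<lambda>e. rep e \<and> label e = label (scan \<tau> h ! t)) (take t (scan \<tau> h))) = rank label R s"
    using s(2) by (simp add: rank_def conj_commute)
  note r = sort_key_nth_rank[OF s(1), of label]
  show "z + rank label R s < n" using r(1) length_reps_scan[OF h, of \<tau>] by (simp add: R_def)
  show "stage \<tau> (Suc h) ! (z + rank label R s) = tagged_target (scan \<tau> h ! t)"
    using r s(2) unfolding stage_Suc[OF h] by (simp add: nth_append length_sources R_def[symmetric])
qed

text \<open>Iteration \<open>t\<close> handles entry \<open>t\<close> of
  \<open>scan \<tau> j\<close>, which is stored nowhere: the bit of the current node names the
  graph, and the number of entries already read from that graph gives the entry by
  \<open>filter_scan\<close>.\<close>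

lemma run_merge_pass_loop:
  assumes h: "j < k" and env: "env r h" and r: "r 12 = 0" "r 13 = 0"
    and old: "\<And>p. p < n \<Longrightarrow> h Work_Bits ! p = bit \<tau> j p"
    and src: "\<And>p. p < z \<Longrightarrow> h Work_Bits ! (n + p) = bit \<tau> (Suc j) p"
    and cur: "\<And>c. c \<in> set labels \<Longrightarrow> h (Work_Words 6) ! (c - 1) = z + length (filter (\<lambda>y. y < c) labels)"
  shows "run M merge_pass_loop (r, h) (60 * m + 60)
    (\<lambda>r' h'. \<forall>p<n. h' Work_Bits ! (n + p) = bit \<tau> (Suc j) p)"
proof -
  let ?E = "scan \<tau> j"
  let ?R = "filter rep ?E"
  let ?I = "\<lambda>t (r'::nat \<Rightarrow> nat) h'. r' 11 = length (filter is_last (take t ?E)) \<and>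
    r' 12 = length (filter (\<lambda>e. fst e = False) (take t ?E)) \<and>
    r' 13 = length (filter (\<lambda>e. fst e = True) (take t ?E)) \<and>
    (\<forall>p<n. h' Work_Bits ! p = bit \<tau> j p) \<and> (\<forall>p<z. h' Work_Bits ! (n + p) = bit \<tau> (Suc j) p) \<and>
    (\<forall>c\<in>set labels. h' (Work_Words 6) ! (c - 1) = z + length (filter (\<lambda>y. y < c) labels) +
      length (filter (\<lambda>e. rep e \<and> label e = c) (take t ?E))) \<and>
    (\<forall>s<length (filter rep (take t ?E)). h' Work_Bits ! (n + (z + rank label ?R s)) = bit \<tau> (Suc j) (z + rank label ?R s))"
  let ?L = "Assign 11 (Const 0);; While ((Reg 12 +\<^sub>e Reg 13) <\<^sub>e Reg 7) merge_pass_body"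
  let ?e = "(Reg 12 +\<^sub>e Reg 13) <\<^sub>e Reg 7"
  have sum: "length (filter (\<lambda>e. fst e = False) xs) + length (filter (\<lambda>e. fst e = True) xs) = length xs"
    for xs :: "(bool \<times> nat list \<times> nat) list" by (induction xs) auto
  have pres: "env r' h'" if "agree ?L r h r' h'" for r' h'
    by (rule env_agree[OF env that]) (auto simp: merge_pass_body_def fetch_prog_def)
  have "run M ?L (r, h) (2 + (m * (steps merge_pass_body + expr_cost ?e + 1) + expr_cost ?e + 1)) (?I m)"
  proof (rule run_for, goal_cases)
    case 1
    show ?case using r old src cur by simp
  next
    case (2 t r' h')
    note env' = pres[OF 2(2), unfolded env_def]
    have I: "r' 11 = length (filter is_last (take t ?E))"
      "r' 12 = length (filter (\<lambda>e. fst e = False) (take t ?E))"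
      "r' 13 = length (filter (\<lambda>e. fst e = True) (take t ?E))"
      "\<And>p. p < n \<Longrightarrow> h' Work_Bits ! p = bit \<tau> j p" "\<And>p. p < z \<Longrightarrow> h' Work_Bits ! (n + p) = bit \<tau> (Suc j) p"
      "\<And>c. c \<in> set labels \<Longrightarrow> h' (Work_Words 6) ! (c - 1) = z + length (filter (\<lambda>y. y < c) labels) +
        length (filter (\<lambda>e. rep e \<and> label e = c) (take t ?E))"
      "\<And>s. s < length (filter rep (take t ?E)) \<Longrightarrow>
        h' Work_Bits ! (n + (z + rank label ?R s)) = bit \<tau> (Suc j) (z + rank label ?R s)"
      using 2(3) by auto
    have t: "t < length ?E" using 2(1) by (simp add: length_scan_m)
    let ?x = "?E ! t"
    have I12: "r' 12 + r' 13 = t" unfolding I(2,3) sum using t by simp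
    have tk: "take (Suc t) ?E = take t ?E @ [?x]" using t by (simp add: take_Suc_conv_app_nth)
    note node = stage_scan_nth[OF t]
    have b: "h' Work_Bits ! (r' 11) = of_bool (fst ?x)" "r' 11 < n"
      using I(4)[of "r' 11"] node by (simp_all add: I(1) bit_def length_stage_n)
    have idx: "length (filter is_last (take t ?E)) < n" "n + m < 2 ^ w" "t < m" "m < 2 ^ w" "length (h' Work_Bits) = 2 * n"
      using b(2) I(1) m_word 2(1) env' by auto
    have f12: "length (filter (\<lambda>e. fst e = False) (take t ?E)) \<le> t" "length (filter (\<lambda>e. fst e = True) (take t ?E)) \<le> t"
      using I12 unfolding I(2,3) by auto
    have W6: "length (h' (Work_Words 6)) = \<sigma>" using env' by simp
    define s where "s = length (filter rep (take t ?E))"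
    let ?W = "\<lambda>(r''::nat \<Rightarrow> nat) h''. r'' 11 = length (filter is_last (take t ?E)) \<and> r'' 14 = of_bool (fst ?x) \<and>
      r'' 6 = n \<and>
      r'' 12 = length (filter (\<lambda>e. fst e = False) (take (Suc t) ?E)) \<and>
      r'' 13 = length (filter (\<lambda>e. fst e = True) (take (Suc t) ?E)) \<and>
      r'' 15 = label ?x \<and> r'' 16 = of_bool (rep ?x) \<and> r'' 17 = of_bool (is_last ?x) \<and> h'' = h'"
    have fetch: "wp M fetch_prog Q r1 h'"
      if r1: "r1 = r'(14 := of_bool (fst ?x))" and Q: "\<And>r''. ?W r'' h' \<Longrightarrow> Q r'' h'" for Q r1
    proof -
      have env1: "env r1 h'" unfolding r1 by (rule env_upd[OF pres[OF 2(2)]]) simp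
      show ?thesis
    proof (cases "fst ?x")
      case True
      note e = nth_ent[of t \<tau> j True]
      have e: "length (filter (\<lambda>e. fst e = True) (take t ?E)) < length (ent True)"
        "ent True ! length (filter (\<lambda>e. fst e = True) (take t ?E)) = snd ?x" using e[OF t] True by auto
      have lt: "length (filter (\<lambda>e. fst e = True) (take t ?E)) + 1 < 2 ^ w" using f12(2) idx by linarith
      show ?thesis
      proof (rule wp_fetch_True[OF env1 _ _ e(1) lt])
        show "r1 14 \<noteq> 0" by (simp add: r1 True)
        show "r1 13 = length (filter (\<lambda>e. fst e = True) (take t ?E))" using I(3) by (simp add: r1)
      qed (rule Q, use True I(1,2) e(2) tk env' in \<open>simp add: r1 rep_def is_last_def\<close>)
    next
      case False
      note e = nth_ent[of t \<tau> j False] 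
      have e: "length (filter (\<lambda>e. fst e = False) (take t ?E)) < length (ent False)"
        "ent False ! length (filter (\<lambda>e. fst e = False) (take t ?E)) = snd ?x" using e[OF t] False by auto
      have lt: "length (filter (\<lambda>e. fst e = False) (take t ?E)) + 1 < 2 ^ w" using f12(1) idx by linarith
      show ?thesis
      proof (rule wp_fetch_False[OF env1 _ _ e(1) lt])
        show "r1 14 = 0" by (simp add: r1 False)
        show "r1 12 = length (filter (\<lambda>e. fst e = False) (take t ?E))" using I(2) by (simp add: r1)
      qed (rule Q, use False I(1,3) e(2) tk env' in \<open>simp add: r1 rep_def is_last_def\<close>)
    qed
    qed
    have lastw: "length (filter is_last (take t ?E)) + 1 < 2 ^ w" using idx by linarith
    have "wp M merge_pass_body (?I (Suc t)) r' h'"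
      unfolding merge_pass_body_def wp.simps(3,5)
    proof (intro conjI)
      show "eval_expr (word_size M) r' (Reg 11) < length (h' Work_Bits)" using b idx by simp
      let ?r1 = "r'(14 := h' Work_Bits ! eval_expr (word_size M) r' (Reg 11))"
      show "wp M fetch_prog (wp M (If (Reg 16)
        (Load 18 (Work_Words 6) (Reg 15 -\<^sub>e Const 1);;
         Store Work_Bits (Reg 6 +\<^sub>e Reg 18) (Reg 14);;
         Store (Work_Words 6) (Reg 15 -\<^sub>e Const 1) (Reg 18 +\<^sub>e Const 1))
        Skip) (wp M (Assign 11 (Reg 11 +\<^sub>e Reg 17)) (?I (Suc t)))) ?r1 h'"
      proof (rule fetch)
        show "?r1 = r'(14 := of_bool (fst ?x))" using b by simp
        fix r'' assume W: "?W r'' h'"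
        show "wp M (If (Reg 16)
          (Load 18 (Work_Words 6) (Reg 15 -\<^sub>e Const 1);;
           Store Work_Bits (Reg 6 +\<^sub>e Reg 18) (Reg 14);;
           Store (Work_Words 6) (Reg 15 -\<^sub>e Const 1) (Reg 18 +\<^sub>e Const 1))
          Skip) (wp M (Assign 11 (Reg 11 +\<^sub>e Reg 17)) (?I (Suc t))) r'' h'"
        proof (cases "rep ?x")
          case False
          have "length (filter (\<lambda>e. rep e \<and> label e = c) (take (Suc t) ?E)) =
              length (filter (\<lambda>e. rep e \<and> label e = c) (take t ?E))" for c using False tk by simp
          moreover have "length (filter rep (take (Suc t) ?E)) = s" using False tk by (simp add: s_def)
          ultimately show ?thesis using W False I lastw tk by (simp add: apply_binop_simps s_def)
        next
          case True
          note R = rank_scan[OF h t True, folded s_def]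
          let ?a = "label ?x" and ?p = "z + rank label ?R s"
          have a: "?a \<in> {1..\<sigma>}" "?a < 2 ^ w" "?a - 1 < \<sigma>" "?a \<in> set labels"
            using label_bounds[OF True] \<sigma>_word True by (auto simp: set_labels)
          have cura: "h' (Work_Words 6) ! (?a - 1) = ?p" using I(6)[OF a(4)] R(3) by simp
          have p: "?p < n" "?p + 1 < 2 ^ w" "n + ?p < 2 ^ w" "n + ?p < 2 * n" using R(4) m_word by auto
          have cs: "length (filter (\<lambda>e. rep e \<and> label e = c) (take (Suc t) ?E)) =
              length (filter (\<lambda>e. rep e \<and> label e = c) (take t ?E)) + of_bool (c = ?a)" for c using True tk by auto
          have s: "length (filter rep (take (Suc t) ?E)) = Suc s" using True tk by (simp add: s_def)
          have newcur: "(h' (Work_Words 6))[?a - 1 := ?p + 1] ! (c - 1) = z + length (filter (\<lambda>y. y < c) labels) +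
              length (filter (\<lambda>e. rep e \<and> label e = c) (take (Suc t) ?E))" if "c \<in> set labels" for c
          proof (cases "c = ?a")
            case True
            then show ?thesis using cs[of c] a W6 R(3) by simp
          next
            case False
            moreover have "1 \<le> c" using that labels_bounds by auto
            ultimately have "c - 1 \<noteq> ?a - 1" using a(1) by auto
            then show ?thesis using cs[of c] False I(6)[OF that] by simp
          qed
          have bit: "bit \<tau> (Suc j) ?p = of_bool (fst ?x)" by (simp add: bit_def R(5) tagged_target_def)
          have newbit: "(h' Work_Bits)[n + ?p := of_bool (fst ?x)] ! (n + (z + rank label ?R s')) = bit \<tau> (Suc j) (z + rank label ?R s')"
            if "s' < Suc s" for s'
          \<comment> \<open>Equal slots require the same bit of the next stage, so it does not
            matter which edge wrote last.\<close>
          proof (cases "rank label ?R s' = rank label ?R s")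
            case True
            then show ?thesis using bit p idx by simp
          next
            case False
            then have "s' < s" using that by (metis less_antisym)
            then show ?thesis using False I(7)[of s'] by (simp add: s_def)
          qed
          have old': "(h' Work_Bits)[n + ?p := of_bool (fst ?x)] ! q = bit \<tau> j q" if "q < n" for q
            using that I(4) by simp
          have src': "(h' Work_Bits)[n + ?p := of_bool (fst ?x)] ! (n + q) = bit \<tau> (Suc j) q" if "q < z" for q
            using that I(5) by simp
          show ?thesis using W True lastw tk cura a p newcur newbit s old' src' idx W6 w
            by (auto simp: apply_binop_simps)
        qed
      qed
    qed
    then have "run M merge_pass_body (r', h') (steps merge_pass_body) (?I (Suc t))" by (rule wp_run)
    moreover have "eval_expr (word_size M) r' ?e \<noteq> 0" using I12 idx env' by (simp add: apply_binop_simps)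
    ultimately show ?case by blast
  next
    case (3 r' h')
    have "r' 12 + r' 13 = m" using 3(2) sum[of ?E] by (simp add: length_scan_m)
    then show ?case using pres[OF 3(1)] m_word by (simp add: apply_binop_simps env_def)
  qed
  then show ?thesis unfolding merge_pass_loop_def
  proof (rule run_for_mono)
    fix r' h'
    assume I: "?I m r' h'"
    show "\<forall>p<n. h' Work_Bits ! (n + p) = bit \<tau> (Suc j) p"
    proof (intro allI impI)
      fix p assume p: "p < n"
      show "h' Work_Bits ! (n + p) = bit \<tau> (Suc j) p"
      proof (cases "p < z")
        case False
        \<comment> \<open>The positions before \<open>z\<close> hold the source nodes; every other
          one is the slot of some flagged edge.\<close>
        then have "p - z < length ?R" using p length_reps_scan[OF h, of \<tau>] by simp
        then obtain s where "s < length ?R" "rank label ?R s = p - z" using rank_surj by blast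
        then show ?thesis using I False by (auto simp: length_scan_m)
      qed (use I in simp)
    qed
  qed (simp add: merge_pass_body_def fetch_prog_def)
qed

end

section \<open>The final stages for both tie-breaking rules\<close>

definition save_body :: "segment com" where
  "save_body =
    Load 14 Work_Bits (Reg 11);;
    If (Reg 11 <\<^sub>e Reg 21) (Store Out_last (Reg 11) (Reg 14)) (Store Out_Wminus (Reg 11 -\<^sub>e Reg 21) (Reg 14));;
    Assign 11 (Reg 11 +\<^sub>e Const 1)"

definition restore_body :: "segment com" where
  "restore_body =
    If (Reg 11 <\<^sub>e Reg 21) (Load 14 Out_last (Reg 11)) (Load 14 Out_Wminus (Reg 11 -\<^sub>e Reg 21));;
    Store Work_Bits (Reg 6 +\<^sub>e Reg 11) (Reg 14);;
    Assign 11 (Reg 11 +\<^sub>e Const 1)"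

text \<open>The second run of the passes needs all of \<open>Work_Bits\<close>, so the result of the first one is kept in
  the output arrays, of which \<open>Out_last\<close> and \<open>Out_Wminus\<close> have at least \<open>max n\<^sub>0 n\<^sub>1\<close> entries each.\<close>

definition two_stages_prog :: "segment com" where
  "two_stages_prog =
    Assign 20 (Const 1);; stages_prog;;
    Assign 21 (Reg 2);; If (Reg 2 <\<^sub>e Reg 3) (Assign 21 (Reg 3)) Skip;;
    (Assign 11 (Const 0);; While (Reg 11 <\<^sub>e Reg 6) save_body);;
    Assign 20 (Const 0);; stages_prog;;
    (Assign 11 (Const 0);; While (Reg 11 <\<^sub>e Reg 6) restore_body)"

context merging
begin

lemma n_pos: "1 \<le> n" and m_pos: "1 \<le> m"
  using one_le_z z_le_n n_le_m by auto

lemma bit_sources: "j < k \<Longrightarrow> p < z \<Longrightarrow> bit \<tau> (Suc j) p = of_bool (sources \<tau> ! p)"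
  by (simp add: bit_def stage_Suc nth_append length_sources)

lemma bit_0: "p < n \<Longrightarrow> bit \<tau> 0 p = (if \<tau> then of_bool (p < card (V True)) else of_bool (\<not> p < card (V False)))"
  using G.finite_V by (auto simp: bit_def stage_0 nth_append n_def)

lemma one_mod: "1 mod 2 ^ w = (1::nat)"
  using w by simp

lemma card_V_pos: "0 < card (V g) \<longleftrightarrow> V g \<noteq> {}"
  using G.finite_V by (simp add: card_gt_0_iff)

lemma run_sources_prog:
  assumes j: "j < k" and env: "env r h" and r: "r 20 = of_bool \<tau>"
  shows "run M (Assign 12 (Const 0);; Assign 13 (Const 0);; sources_prog) (r, h) 30
    (\<lambda>r' h'. r' 12 = 0 \<and> r' 13 = 0 \<and> (\<forall>p<n. h' Work_Bits ! p = h Work_Bits ! p) \<and>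
      (\<forall>p<z. h' Work_Bits ! (n + p) = bit \<tau> (Suc j) p))"
proof (rule run_wp)
  have e: "r 2 = card (V False)" "r 3 = card (V True)" "r 6 = n" "length (h Work_Bits) = 2 * n"
    using env by (simp_all add: env_def)
  note bs = bit_sources[OF j]
  have nw: "n + 1 < 2 ^ w" using m_word n_pos by linarith
  show "wp M (Assign 12 (Const 0);; Assign 13 (Const 0);; sources_prog)
    (\<lambda>r' h'. r' 12 = 0 \<and> r' 13 = 0 \<and> (\<forall>p<n. h' Work_Bits ! p = h Work_Bits ! p) \<and>
      (\<forall>p<z. h' Work_Bits ! (n + p) = bit \<tau> (Suc j) p)) r h"
  proof (cases "V False = {}")
    case True
    then have "V True \<noteq> {}" using nonempty by blast
    then have "sources \<tau> = [True]" "z = 1" using True by (cases \<tau>; auto simp: sources_def z_def)+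
    then show ?thesis using e True bs n_pos w by (simp add: sources_prog_def apply_binop_simps)
  next
    case False
    then have F: "0 < card (V False)" using card_V_pos by simp
    show ?thesis
    proof (cases "V True = {}")
      case True
      then have "sources \<tau> = [False]" "z = 1" using False by (cases \<tau>; auto simp: sources_def z_def)+
      then show ?thesis using e F True bs n_pos w by (simp add: sources_prog_def apply_binop_simps)
    next
      case T: False
      then have T': "0 < card (V True)" using card_V_pos by simp
      have s: "sources \<tau> = [\<tau>, \<not> \<tau>]" "z = 2" using False T by (cases \<tau>; auto simp: sources_def z_def)+
      have "2 \<le> n" using F T' by (simp add: n_def)
      moreover have "p < 2 \<longleftrightarrow> p = 0 \<or> p = 1" for p :: nat by auto
      ultimately show ?thesis using e F T' bs s r w nw
        by (cases \<tau>) (auto simp: sources_prog_def apply_binop_simps nth_Cons' nth_list_update)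
    qed
  qed
qed (simp add: sources_prog_def)

lemma run_copy_loop:
  assumes env: "env r h" and b: "\<And>p. p < n \<Longrightarrow> h Work_Bits ! (n + p) = bit \<tau> j p"
  shows "run M (Assign 11 (Const 0);; While (Reg 11 <\<^sub>e Reg 6) copy_body) (r, h) (20 * n + 20)
    (\<lambda>r' h'. \<forall>p<n. h' Work_Bits ! p = bit \<tau> j p)"
proof -
  let ?L = "Assign 11 (Const 0);; While (Reg 11 <\<^sub>e Reg 6) copy_body"
  let ?I = "\<lambda>i (r'::nat \<Rightarrow> nat) h'. r' 11 = i \<and> (\<forall>p<i. h' Work_Bits ! p = bit \<tau> j p) \<and>
    (\<forall>p<n. h' Work_Bits ! (n + p) = bit \<tau> j p)"
  have pres: "env r' h'" if "agree ?L r h r' h'" for r' h'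
    by (rule env_agree[OF env that]) (auto simp: copy_body_def)
  have "run M ?L (r, h) (2 + (n * (steps copy_body + expr_cost (Reg 11 <\<^sub>e Reg 6) + 1) + expr_cost (Reg 11 <\<^sub>e Reg 6) + 1)) (?I n)"
  proof (rule run_for[where I = ?I and N = n], goal_cases)
    case 1
    then show ?case using b by simp
  next
    case (2 i r' h')
    have e: "r' 6 = n" "length (h' Work_Bits) = 2 * n" using pres[OF 2(2)] by (simp_all add: env_def)
    have I: "r' 11 = i" "\<And>p. p < i \<Longrightarrow> h' Work_Bits ! p = bit \<tau> j p" "\<And>p. p < n \<Longrightarrow> h' Work_Bits ! (n + p) = bit \<tau> j p"
      using 2(3) by auto
    have lt: "n + i < 2 ^ w" "i + 1 < 2 ^ w" "n + i < 2 * n" "i < 2 * n" using 2(1) m_word by auto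
    have v: "bit \<tau> j i mod 2 = bit \<tau> j i" by (simp add: bit_def)
    have "wp M copy_body (?I (Suc i)) r' h'" using e I lt 2(1) w v
      by (simp add: copy_body_def apply_binop_simps nth_list_update)
    then show ?case using e I(1) 2(1) by (auto simp: apply_binop_simps intro: wp_run)
  next
    case (3 r' h')
    then show ?case using pres[OF 3(1)] by (simp add: apply_binop_simps env_def)
  qed
  then show ?thesis by (rule run_mono) (auto simp: copy_body_def)
qed

lemma run_init_loop:
  assumes env: "env r h" and r: "r 20 = of_bool \<tau>"
  shows "run M (Assign 11 (Const 0);; While (Reg 11 <\<^sub>e Reg 6) init_body) (r, h) (30 * n + 20)
    (\<lambda>r' h'. \<forall>p<n. h' Work_Bits ! p = bit \<tau> 0 p)"
proof -
  let ?L = "Assign 11 (Const 0);; While (Reg 11 <\<^sub>e Reg 6) init_body"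
  let ?I = "\<lambda>i (r'::nat \<Rightarrow> nat) h'. r' 11 = i \<and> (\<forall>p<i. h' Work_Bits ! p = bit \<tau> 0 p)"
  have pres: "env r' h'" if "agree ?L r h r' h'" for r' h'
    by (rule env_agree[OF env that]) (auto simp: init_body_def)
  have "run M ?L (r, h) (2 + (n * (steps init_body + expr_cost (Reg 11 <\<^sub>e Reg 6) + 1) + expr_cost (Reg 11 <\<^sub>e Reg 6) + 1)) (?I n)"
  proof (rule run_for, goal_cases)
    case 1
    then show ?case by simp
  next
    case (2 i r' h')
    have e: "r' 6 = n" "r' 2 = card (V False)" "r' 3 = card (V True)" "length (h' Work_Bits) = 2 * n"
      using pres[OF 2(2)] by (simp_all add: env_def)
    have t: "r' 20 = of_bool \<tau>" using agree_reg[OF 2(2), of 20] r by (simp add: init_body_def)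
    have I: "r' 11 = i" "\<And>p. p < i \<Longrightarrow> h' Work_Bits ! p = bit \<tau> 0 p" using 2(3) by auto
    have lt: "i + 1 < 2 ^ w" "i < 2 * n" using 2(1) m_word by auto
    have "wp M init_body (?I (Suc i)) r' h'"
      using e t I lt 2(1) w bit_0[OF 2(1), of \<tau>]
      by (cases \<tau>) (auto simp: init_body_def apply_binop_simps nth_list_update less_Suc_eq)
    then show ?case using e I(1) 2(1) by (auto simp: apply_binop_simps intro: wp_run)
  next
    case (3 r' h')
    then show ?case using pres[OF 3(1)] by (simp add: apply_binop_simps env_def)
  qed
  then show ?thesis by (rule run_mono) (auto simp: init_body_def)
qed

lemma env_reset:
  assumes "env r h"
  shows "run M (reset_prog 0) (r, h) (40 * m + 40)
    (\<lambda>r' h'. \<forall>c\<in>set labels. h' (Work_Words 6) ! (c - 1) = z + length (filter (\<lambda>y. y < c) labels))"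
proof (rule run_mono[OF run_reset_prog[OF w \<sigma>_word _ labels_bounds]])
  show "bucketed (h (Work_Words (0 + 1))) (r 8) (h (Work_Words (0 + 2))) labels z" using assms by (simp add: env_def numeral_2_eq_2)
  show "r 6 < 2 ^ w" "z + length labels < 2 ^ w" using assms m_word length_labels by (simp_all add: env_def)
  show "40 * length labels + 40 \<le> 40 * m + 40" using length_labels n_le_m by simp
qed (use assms in \<open>auto simp: env_def numeral_2_eq_2\<close>)

lemma run_merge_pass_prog:
  assumes j: "j < k" and env: "env r h" and r: "r 20 = of_bool \<tau>" "r 10 = j"
    and old: "\<And>p. p < n \<Longrightarrow> h Work_Bits ! p = bit \<tau> j p"
  shows "run M merge_pass_prog (r, h) (300 * m)
    (\<lambda>r' h'. r' 10 = Suc j \<and> (\<forall>p<n. h' Work_Bits ! p = bit \<tau> (Suc j) p))"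
proof -
  let ?C = "Assign 11 (Const 0);; While (Reg 11 <\<^sub>e Reg 6) copy_body"
  let ?S = "Assign 12 (Const 0);; Assign 13 (Const 0);; sources_prog"
  have "run M merge_pass_prog (r, h) ((40 * m + 40) + (30 + ((60 * m + 60) + ((20 * n + 20) + 4))))
    (\<lambda>r' h'. r' 10 = Suc j \<and> (\<forall>p<n. h' Work_Bits ! p = bit \<tau> (Suc j) p))"
    unfolding merge_pass_prog_def
  proof (rule run_SeqA[OF env_reset[OF env]])
    fix r1 h1
    assume 1: "\<forall>c\<in>set labels. h1 (Work_Words 6) ! (c - 1) = z + length (filter (\<lambda>y. y < c) labels)"
      and a1: "agree (reset_prog 0) r h r1 h1"
    have env1: "env r1 h1" by (rule env_agree[OF env a1]) (auto simp: reset_prog_def reset_body_def)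
    have r1: "r1 20 = of_bool \<tau>" "r1 10 = j" and w1: "h1 Work_Bits = h Work_Bits"
      using agree_reg[OF a1] agree_seg[OF a1] r by (simp_all add: reset_prog_def reset_body_def)
    show "run M (?S;; merge_pass_loop;; ?C;; Assign 10 (Reg 10 +\<^sub>e Const 1)) (r1, h1)
      (30 + ((60 * m + 60) + ((20 * n + 20) + 4)))
      (\<lambda>r' h'. r' 10 = Suc j \<and> (\<forall>p<n. h' Work_Bits ! p = bit \<tau> (Suc j) p))"
    proof (rule run_SeqA[OF run_sources_prog[OF j env1 r1(1)]])
      fix r2 h2
      assume 2: "r2 12 = 0 \<and> r2 13 = 0 \<and> (\<forall>p<n. h2 Work_Bits ! p = h1 Work_Bits ! p) \<and>
        (\<forall>p<z. h2 Work_Bits ! (n + p) = bit \<tau> (Suc j) p)" and a2: "agree ?S r1 h1 r2 h2"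
      have env2: "env r2 h2" by (rule env_agree[OF env1 a2]) (auto simp: sources_prog_def)
      have r2: "r2 10 = j" and w2: "h2 (Work_Words 6) = h1 (Work_Words 6)"
        using agree_reg[OF a2] agree_seg[OF a2] r1 by (simp_all add: sources_prog_def)
      show "run M (merge_pass_loop;; ?C;; Assign 10 (Reg 10 +\<^sub>e Const 1)) (r2, h2)
        ((60 * m + 60) + ((20 * n + 20) + 4))
        (\<lambda>r' h'. r' 10 = Suc j \<and> (\<forall>p<n. h' Work_Bits ! p = bit \<tau> (Suc j) p))"
      proof (rule run_SeqA[OF run_merge_pass_loop[OF j env2, where \<tau> = \<tau>]])
        fix r3 h3
        assume 3: "\<forall>p<n. h3 Work_Bits ! (n + p) = bit \<tau> (Suc j) p" and a3: "agree merge_pass_loop r2 h2 r3 h3"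
        have env3: "env r3 h3"
          by (rule env_agree[OF env2 a3]) (auto simp: merge_pass_loop_def merge_pass_body_def fetch_prog_def)
        have r3: "r3 10 = j" using agree_reg[OF a3, of 10] r2
          by (simp add: merge_pass_loop_def merge_pass_body_def fetch_prog_def)
        show "run M (?C;; Assign 10 (Reg 10 +\<^sub>e Const 1)) (r3, h3) ((20 * n + 20) + 4)
          (\<lambda>r' h'. r' 10 = Suc j \<and> (\<forall>p<n. h' Work_Bits ! p = bit \<tau> (Suc j) p))"
        proof (rule run_SeqA[OF run_copy_loop[OF env3, where \<tau> = \<tau> and j = "Suc j"]])
          fix r4 h4
          assume 4: "\<forall>p<n. h4 Work_Bits ! p = bit \<tau> (Suc j) p" and a4: "agree ?C r3 h3 r4 h4"
          have "r4 10 = j" using agree_reg[OF a4, of 10] r3 by (simp add: copy_body_def)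
          moreover have "j + 1 < 2 ^ w" using j k_word by simp
          ultimately show "run M (Assign 10 (Reg 10 +\<^sub>e Const 1)) (r4, h4) 4
            (\<lambda>r' h'. r' 10 = Suc j \<and> (\<forall>p<n. h' Work_Bits ! p = bit \<tau> (Suc j) p))"
            by (intro run_wp) (use 4 w in \<open>simp_all add: apply_binop_simps\<close>)
        qed (use 3 in auto)
      qed (use 1 2 old w1 w2 in auto)
    qed
  qed
  then show ?thesis
  proof (rule run_mono)
    show "(40 * m + 40) + (30 + ((60 * m + 60) + ((20 * n + 20) + 4))) \<le> 300 * m"
      using n_le_m m_pos by linarith
  qed auto
qed

lemma m_le_mk: "m \<le> m * k" "k \<le> m * k" "1 \<le> m * k"
  using m_pos G.k_pos by (auto simp: mult_le_mono[of 1 m 1 k, simplified])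

lemma agree_stages:
  assumes "env r h" "agree stages_prog r h r' h'"
  shows "env r' h'" "r' 21 = r 21" "h' Out_last = h Out_last" "h' Out_Wminus = h Out_Wminus"
proof -
  note defs = stages_prog_def init_body_def merge_pass_prog_def reset_prog_def reset_body_def
    sources_prog_def merge_pass_loop_def merge_pass_body_def fetch_prog_def copy_body_def
  show "env r' h'" by (rule env_agree[OF assms]) (auto simp: defs)
  show "r' 21 = r 21" "h' Out_last = h Out_last" "h' Out_Wminus = h Out_Wminus"
    using agree_reg[OF assms(2), of 21] agree_seg[OF assms(2)] by (simp_all add: defs)
qed

lemma run_stages_prog:
  assumes env: "env r h" and r: "r 20 = of_bool \<tau>"
  shows "run M stages_prog (r, h) (400 * (m * k)) (\<lambda>r' h'. \<forall>p<n. h' Work_Bits ! p = bit \<tau> k p)"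
proof -
  let ?I0 = "Assign 11 (Const 0);; While (Reg 11 <\<^sub>e Reg 6) init_body"
  let ?L = "Assign 10 (Const 0);; While (Reg 10 <\<^sub>e Reg 0) merge_pass_prog"
  let ?J = "\<lambda>j (r'::nat \<Rightarrow> nat) h'. r' 10 = j \<and> (\<forall>p<n. h' Work_Bits ! p = bit \<tau> j p)"
  have "run M stages_prog (r, h) ((30 * n + 20) +
      (2 + (k * (300 * m + expr_cost (Reg 10 <\<^sub>e Reg 0) + 1) + expr_cost (Reg 10 <\<^sub>e Reg 0) + 1)))
    (?J k)"
    unfolding stages_prog_def
  proof (rule run_SeqA[OF run_init_loop[OF env r]])
    fix r1 h1
    assume 1: "\<forall>p<n. h1 Work_Bits ! p = bit \<tau> 0 p" and a1: "agree ?I0 r h r1 h1"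
    have env1: "env r1 h1" by (rule env_agree[OF env a1]) (auto simp: init_body_def)
    have r1: "r1 20 = of_bool \<tau>" using agree_reg[OF a1, of 20] r by (simp add: init_body_def)
    note defs = merge_pass_prog_def reset_prog_def reset_body_def sources_prog_def merge_pass_loop_def
      merge_pass_body_def fetch_prog_def copy_body_def
    have pres: "env r' h'" "r' 20 = of_bool \<tau>" if "agree ?L r1 h1 r' h'" for r' h'
    proof -
      show "env r' h'" by (rule env_agree[OF env1 that]) (auto simp: defs)
      show "r' 20 = of_bool \<tau>" using agree_reg[OF that, of 20] r1 by (simp add: defs)
    qed
    show "run M ?L (r1, h1)
      (2 + (k * (300 * m + expr_cost (Reg 10 <\<^sub>e Reg 0) + 1) + expr_cost (Reg 10 <\<^sub>e Reg 0) + 1)) (?J k)"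
    proof (rule run_for[where I = ?J and N = k], goal_cases)
      case 1
      show ?case using \<open>\<forall>p<n. h1 Work_Bits ! p = bit \<tau> 0 p\<close> by simp
    next
      case (2 j r' h')
      have "r' 0 = k" using pres(1)[OF 2(2)] by (simp add: env_def)
      then show ?case
        using run_merge_pass_prog[OF 2(1) pres[OF 2(2)]] 2(1,3) by (simp add: apply_binop_simps)
    next
      case (3 r' h')
      then show ?case using pres(1)[OF 3(1)] by (simp add: apply_binop_simps env_def)
    qed
  qed
  then show ?thesis
  proof (rule run_mono)
    have T: "k * (300 * m + expr_cost (Reg 10 <\<^sub>e Reg 0) + 1) = 300 * (m * k) + 4 * k"
      by (simp add: algebra_simps)
    show "(30 * n + 20) + (2 + (k * (300 * m + expr_cost (Reg 10 <\<^sub>e Reg 0) + 1) + expr_cost (Reg 10 <\<^sub>e Reg 0) + 1))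
      \<le> 400 * (m * k)"
      unfolding T using m_le_mk n_le_m by (simp only: expr_cost.simps)
  qed auto
qed

definition half :: nat where
  "half = max (card (V False)) (card (V True))"

definition saved :: "(segment \<Rightarrow> nat list) \<Rightarrow> nat \<Rightarrow> bool" where
  "saved h i \<longleftrightarrow> (\<forall>p<i. (if p < half then h Out_last ! p
    else h Out_Wminus ! (p - half)) = bit True k p)"

lemma max_card: "half \<le> card VU" "n \<le> 2 * half"
  using G.finite_V by (auto simp: n_def half_def intro!: card_mono)

lemma run_save_loop:
  assumes env: "env r h" and r: "r 21 = half"
    and b: "\<And>p. p < n \<Longrightarrow> h Work_Bits ! p = bit True k p"
    and len: "card VU \<le> length (h Out_last)" "card VU \<le> length (h Out_Wminus)"
  shows "run M (Assign 11 (Const 0);; While (Reg 11 <\<^sub>e Reg 6) save_body) (r, h) (40 * n + 20) (\<lambda>r' h'. saved h' n)"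
proof -
  let ?L = "Assign 11 (Const 0);; While (Reg 11 <\<^sub>e Reg 6) save_body"
  let ?I = "\<lambda>i (r'::nat \<Rightarrow> nat) h'. r' 11 = i \<and> saved h' i"
  let ?c = half
  have pres: "env r' h'" if "agree ?L r h r' h'" for r' h'
    by (rule env_agree[OF env that]) (auto simp: save_body_def)
  have "run M ?L (r, h) (2 + (n * (steps save_body + expr_cost (Reg 11 <\<^sub>e Reg 6) + 1) + expr_cost (Reg 11 <\<^sub>e Reg 6) + 1)) (?I n)"
  proof (rule run_for[where I = ?I and N = n], goal_cases)
    case 1
    then show ?case by (simp add: saved_def)
  next
    case (2 i r' h')
    have e: "r' 6 = n" "length (h' Work_Bits) = 2 * n" using pres[OF 2(2)] by (simp_all add: env_def)
    have r': "r' 21 = ?c" "h' Work_Bits = h Work_Bits"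
      using agree_reg[OF 2(2), of 21] agree_seg[OF 2(2), of Work_Bits] r by (simp_all add: save_body_def)
    have l: "?c \<le> length (h' Out_last)" "?c \<le> length (h' Out_Wminus)"
      using len max_card(1) agree_length[OF 2(2)] by auto
    have I: "r' 11 = i" "saved h' i" using 2(3) by auto
    have lt: "i + 1 < 2 ^ w" "i < 2 * n" using 2(1) m_word by auto
    have v: "bit True k i mod 2 = bit True k i" by (simp add: bit_def)
    have "wp M save_body (?I (Suc i)) r' h'"
    proof (cases "i < ?c")
      case True
      then have "saved (h'(Out_last := (h' Out_last)[i := bit True k i])) (Suc i)"
        using I(2) l by (auto simp: saved_def nth_list_update less_Suc_eq)
      then show ?thesis using True e r' I(1) l b[OF 2(1)] lt w v by (simp add: save_body_def apply_binop_simps)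
    next
      case False
      then have ic: "i - ?c < length (h' Out_Wminus)" using l 2(1) max_card(2) by linarith
      have "saved (h'(Out_Wminus := (h' Out_Wminus)[i - ?c := bit True k i])) (Suc i)"
        unfolding saved_def
      proof (intro allI impI)
        fix p assume p: "p < Suc i"
        show "(if p < ?c then (h'(Out_Wminus := (h' Out_Wminus)[i - ?c := bit True k i])) Out_last ! p
          else (h'(Out_Wminus := (h' Out_Wminus)[i - ?c := bit True k i])) Out_Wminus ! (p - ?c)) = bit True k p"
        proof (cases "p = i")
          case True
          then show ?thesis using False ic by simp
        next
          case pi: False
          then have "p < i" using p by simp
          then have "\<not> p < ?c \<Longrightarrow> i - ?c \<noteq> p - ?c" using False by linarith
          then show ?thesis using I(2) \<open>p < i\<close> by (auto simp: saved_def)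
        qed
      qed
      then show ?thesis using False e r' I(1) ic b[OF 2(1)] lt w v m_word
        by (simp add: save_body_def apply_binop_simps)
    qed
    then show ?case using e I(1) 2(1) by (auto simp: apply_binop_simps intro: wp_run)
  next
    case (3 r' h')
    then show ?case using pres[OF 3(1)] by (simp add: apply_binop_simps env_def)
  qed
  then show ?thesis by (rule run_mono) (auto simp: save_body_def)
qed

lemma run_restore_loop:
  assumes env: "env r h" and r: "r 21 = half"
    and b: "\<And>p. p < n \<Longrightarrow> h Work_Bits ! p = bit False k p" and sv: "saved h n"
    and len: "card VU \<le> length (h Out_last)" "card VU \<le> length (h Out_Wminus)"
  shows "run M (Assign 11 (Const 0);; While (Reg 11 <\<^sub>e Reg 6) restore_body) (r, h) (40 * n + 20)
    (\<lambda>r' h'. \<forall>p<n. h' Work_Bits ! p = bit False k p \<and> h' Work_Bits ! (n + p) = bit True k p)"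
proof -
  let ?L = "Assign 11 (Const 0);; While (Reg 11 <\<^sub>e Reg 6) restore_body"
  let ?I = "\<lambda>i (r'::nat \<Rightarrow> nat) h'. r' 11 = i \<and> (\<forall>p<n. h' Work_Bits ! p = bit False k p) \<and>
    (\<forall>p<i. h' Work_Bits ! (n + p) = bit True k p)"
  let ?c = half
  have pres: "env r' h'" if "agree ?L r h r' h'" for r' h'
    by (rule env_agree[OF env that]) (auto simp: restore_body_def)
  have "run M ?L (r, h) (2 + (n * (steps restore_body + expr_cost (Reg 11 <\<^sub>e Reg 6) + 1) + expr_cost (Reg 11 <\<^sub>e Reg 6) + 1)) (?I n)"
  proof (rule run_for[where I = ?I and N = n], goal_cases)
    case 1
    then show ?case using b by simp
  next
    case (2 i r' h')
    have e: "r' 6 = n" "length (h' Work_Bits) = 2 * n" using pres[OF 2(2)] by (simp_all add: env_def)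
    have r': "r' 21 = ?c" "h' Out_last = h Out_last" "h' Out_Wminus = h Out_Wminus"
      using agree_reg[OF 2(2), of 21] agree_seg[OF 2(2)] r by (simp_all add: restore_body_def)
    have I: "r' 11 = i" "\<And>p. p < n \<Longrightarrow> h' Work_Bits ! p = bit False k p"
      "\<And>p. p < i \<Longrightarrow> h' Work_Bits ! (n + p) = bit True k p" using 2(3) by auto
    have lt: "i + 1 < 2 ^ w" "n + i < 2 ^ w" "n + i < 2 * n" using 2(1) m_word by auto
    have v: "bit True k i mod 2 = bit True k i" by (simp add: bit_def)
    have s: "(if i < ?c then h Out_last ! i else h Out_Wminus ! (i - ?c)) = bit True k i"
      using sv 2(1) by (simp add: saved_def)
    have "wp M restore_body (?I (Suc i)) r' h'"
    proof (cases "i < ?c")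
      case True
      have "i < length (h Out_last)" using True len max_card(1) by linarith
      then show ?thesis using True s e r' I lt w v
        by (simp add: restore_body_def apply_binop_simps nth_list_update less_Suc_eq)
    next
      case False
      have "i - ?c < length (h Out_Wminus)" using False 2(1) len max_card by linarith
      then show ?thesis using False s e r' I lt w v
        by (simp add: restore_body_def apply_binop_simps nth_list_update less_Suc_eq)
    qed
    then show ?case using e I(1) 2(1) by (auto simp: apply_binop_simps intro: wp_run)
  next
    case (3 r' h')
    then show ?case using pres[OF 3(1)] by (simp add: apply_binop_simps env_def)
  qed
  then show ?thesis by (rule run_mono) (auto simp: restore_body_def)
qed

lemma run_two_stages_prog:
  assumes env: "env r h"
    and len: "card VU \<le> length (h Out_last)" "card VU \<le> length (h Out_Wminus)"
  shows "run M two_stages_prog (r, h) (1100 * (m * k))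
    (\<lambda>r' h'. env r' h' \<and> (\<forall>p<n. h' Work_Bits ! p = bit False k p \<and> h' Work_Bits ! (n + p) = bit True k p))"
proof -
  let ?c = half
  let ?P = "Assign 21 (Reg 2);; If (Reg 2 <\<^sub>e Reg 3) (Assign 21 (Reg 3)) Skip"
  let ?S = "Assign 11 (Const 0);; While (Reg 11 <\<^sub>e Reg 6) save_body"
  let ?R = "Assign 11 (Const 0);; While (Reg 11 <\<^sub>e Reg 6) restore_body"
  let ?T = "\<lambda>(r'::nat \<Rightarrow> nat) h'. env r' h' \<and> (\<forall>p<n. h' Work_Bits ! p = bit False k p \<and> h' Work_Bits ! (n + p) = bit True k p)"
  have "run M two_stages_prog (r, h) (2 + (400 * (m * k) + (2 + (10 + ((40 * n + 20) + (2 + (400 * (m * k) + (40 * n + 20)))))))) ?T"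
    unfolding two_stages_prog_def
  proof (rule run_SeqA)
    show "run M (Assign 20 (Const 1)) (r, h) 2 (\<lambda>r' h'. r' 20 = 1)"
      by (rule run_wp) (use w in simp_all)
    fix r1 h1 assume 1: "r1 20 = 1" and a1: "agree (Assign 20 (Const 1)) r h r1 h1"
    have env1: "env r1 h1" by (rule env_agree[OF env a1]) auto
    note l1 = agree_length[OF a1]
    show "run M (stages_prog;; Assign 21 (Reg 2);; If (Reg 2 <\<^sub>e Reg 3) (Assign 21 (Reg 3)) Skip;; ?S;;
        Assign 20 (Const 0);; stages_prog;; ?R) (r1, h1)
      (400 * (m * k) + (2 + (10 + ((40 * n + 20) + (2 + (400 * (m * k) + (40 * n + 20))))))) ?T"
    proof (rule run_SeqA[OF run_stages_prog[OF env1, where \<tau> = True]])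
      fix r2 h2 assume 2: "\<forall>p<n. h2 Work_Bits ! p = bit True k p" and a2: "agree stages_prog r1 h1 r2 h2"
      note s2 = agree_stages[OF env1 a2] and l2 = agree_length[OF a2]
      show "run M (Assign 21 (Reg 2);; If (Reg 2 <\<^sub>e Reg 3) (Assign 21 (Reg 3)) Skip;; ?S;;
        Assign 20 (Const 0);; stages_prog;; ?R) (r2, h2)
        (2 + (10 + ((40 * n + 20) + (2 + (400 * (m * k) + (40 * n + 20)))))) ?T"
      proof (rule run_SeqA)
        show "run M (Assign 21 (Reg 2)) (r2, h2) 2 (\<lambda>r' h'. r' = r2(21 := r2 2) \<and> h' = h2)"
          by (rule run_wp) simp_all
        fix r3 h3 assume 3: "r3 = r2(21 := r2 2) \<and> h3 = h2"
        have c: "r2 2 = card (V False)" "r2 3 = card (V True)" using s2(1) by (simp_all add: env_def)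
        show "run M (If (Reg 2 <\<^sub>e Reg 3) (Assign 21 (Reg 3)) Skip;; ?S;;
          Assign 20 (Const 0);; stages_prog;; ?R) (r3, h3)
          (10 + ((40 * n + 20) + (2 + (400 * (m * k) + (40 * n + 20))))) ?T"
        proof (rule run_SeqA)
          show "run M (If (Reg 2 <\<^sub>e Reg 3) (Assign 21 (Reg 3)) Skip) (r3, h3) 10
            (\<lambda>r' h'. r' = r2(21 := ?c) \<and> h' = h2)"
            by (rule run_wp) (use 3 c in \<open>auto simp: apply_binop_simps half_def max_def\<close>)
          fix r4 h4 assume 4: "r4 = r2(21 := ?c) \<and> h4 = h2"
          have env4: "env r4 h4" using env_upd[OF s2(1), of 21 ?c] 4 by simp
          have len4: "card VU \<le> length (h4 Out_last)" "card VU \<le> length (h4 Out_Wminus)"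
            using len 4 l1 l2 by simp_all
          show "run M (?S;; Assign 20 (Const 0);; stages_prog;; ?R) (r4, h4)
            ((40 * n + 20) + (2 + (400 * (m * k) + (40 * n + 20)))) ?T"
          proof (rule run_SeqA[OF run_save_loop[OF env4 _ _ len4]])
            fix r5 h5 assume 5: "saved h5 n" and a5: "agree ?S r4 h4 r5 h5"
            have env5: "env r5 h5" by (rule env_agree[OF env4 a5]) (auto simp: save_body_def)
            have r5: "r5 21 = ?c" using agree_reg[OF a5, of 21] 4 by (simp add: save_body_def)
            note l5 = agree_length[OF a5]
            show "run M (Assign 20 (Const 0);; stages_prog;; ?R) (r5, h5) (2 + (400 * (m * k) + (40 * n + 20))) ?T"
            proof (rule run_SeqA)
              show "run M (Assign 20 (Const 0)) (r5, h5) 2 (\<lambda>r' h'. r' = r5(20 := 0) \<and> h' = h5)"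
                by (rule run_wp) simp_all
              fix r6 h6 assume 6: "r6 = r5(20 := 0) \<and> h6 = h5"
              have env6: "env r6 h6" using env_upd[OF env5, of 20 0] 6 by simp
              show "run M (stages_prog;; ?R) (r6, h6) (400 * (m * k) + (40 * n + 20)) ?T"
              proof (rule run_SeqA[OF run_stages_prog[OF env6, where \<tau> = False]])
                fix r7 h7 assume 7: "\<forall>p<n. h7 Work_Bits ! p = bit False k p" and a7: "agree stages_prog r6 h6 r7 h7"
                note s7 = agree_stages[OF env6 a7] and l7 = agree_length[OF a7]
                have "saved h7 n = saved h6 n" unfolding saved_def s7(3,4) ..
                then have "saved h7 n" using 5 6 by simp
                moreover have "card VU \<le> length (h7 Out_last)" "card VU \<le> length (h7 Out_Wminus)"
                  using len4 l5 l7 6 by simp_all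
                moreover have "r7 21 = ?c" using s7(2) 6 r5 by simp
                ultimately have "run M ?R (r7, h7) (40 * n + 20)
                  (\<lambda>r' h'. (\<forall>p<n. h' Work_Bits ! p = bit False k p \<and> h' Work_Bits ! (n + p) = bit True k p) \<and>
                    agree ?R r7 h7 r' h')"
                  using 7 by (intro run_agree run_restore_loop[OF s7(1)]) auto
                then show "run M ?R (r7, h7) (40 * n + 20) ?T"
                proof (rule run_mono)
                  fix r' h'
                  assume *: "(\<forall>p<n. h' Work_Bits ! p = bit False k p \<and> h' Work_Bits ! (n + p) = bit True k p) \<and>
                    agree ?R r7 h7 r' h'"
                  have "env r' h'" by (rule env_agree[OF s7(1) conjunct2[OF *]]) (auto simp: restore_body_def)
                  then show "?T r' h'" using * by blast
                qed simp
              qed (use 6 in simp)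
            qed
          qed (use 4 2 in auto)
        qed
      qed
    qed (use 1 in simp)
  qed
  then show ?thesis
  proof (rule run_mono)
    show "2 + (400 * (m * k) + (2 + (10 + ((40 * n + 20) + (2 + (400 * (m * k) + (40 * n + 20))))))) \<le> 1100 * (m * k)"
      using m_le_mk n_le_m by linarith
  qed auto
qed

end

section \<open>Merging the BOSS arrays\<close>

context two_graphs
begin

definition consumed :: "bool \<Rightarrow> nat \<Rightarrow> nat" where
  "consumed g t = length (filter (\<lambda>e. e \<in> set (ent g)) (take t merged))"

lemma consumed_Suc:
  "t < length merged \<Longrightarrow> consumed g (Suc t) = consumed g t + of_bool (merged ! t \<in> set (ent g))"
  by (simp add: consumed_def take_Suc_conv_app_nth)

lemma consumed_full: "consumed g (length merged) = length (ent g)"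
  by (simp add: consumed_def filter_merged)

lemma consumed_less: "t < length merged \<Longrightarrow> merged ! t \<in> set (ent g) \<Longrightarrow> consumed g t < length (ent g)"
  using filter_nth_count(1)[of t merged "\<lambda>e. e \<in> set (ent g)"] by (simp add: consumed_def filter_merged)

lemma consumed_le: "consumed g t \<le> length (ent g)"
proof -
  have "length (filter P (take t xs)) \<le> length (filter P xs)" for P and xs :: "(nat list \<times> nat) list"
    by (metis append_take_drop_id filter_append le_add1 length_append)
  then show ?thesis using filter_merged[of g] by (metis consumed_def)
qed

lemma merged_less_iff:
  assumes "i < length merged" "j < length merged"
  shows "merged ! i < merged ! j \<longleftrightarrow> i < j" and "merged ! i \<le> merged ! j \<longleftrightarrow> i \<le> j"
proof -
  show *: "merged ! i < merged ! j \<longleftrightarrow> i < j"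
    using sorted_wrt_nth_less[OF sorted_merged] assms by (metis linorder_neqE_nat order.asym less_irrefl)
  show "merged ! i \<le> merged ! j \<longleftrightarrow> i \<le> j"
    using sorted_wrt_nth_less[OF sorted_merged, of j i] assms * by (metis leD leI le_less linorder_not_le)
qed

lemma ent_in_merged: "e \<in> set (ent g) \<Longrightarrow> \<exists>i<length merged. merged ! i = e"
  using in_merged by (metis in_set_conv_nth)

text \<open>The state of graph \<open>g\<close> before \<open>e\<close> is handled, as
  \<open>more\<close> is the state after it.\<close>

definition active :: "bool \<Rightarrow> nat list \<times> nat \<Rightarrow> bool" where
  "active g e \<longleftrightarrow> (\<exists>a\<ge>snd e. (fst e, a) \<in> set (ent g))"

lemma active_iff: "active g e \<longleftrightarrow> e \<in> set (ent g) \<or> more g e"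
  by (cases e) (auto simp: active_def more_def le_less)

text \<open>All unread entries of graph \<open>g\<close> are at or behind position \<open>t\<close>
  of the union. If one of them belongs to the current node, so does the first, and comparing labels
  is enough to tell whether it is the current entry.\<close>

lemma head_entry:
  assumes t: "t < length merged" and act: "active g (merged ! t)"
  shows "consumed g t < length (ent g)"
    and "fst (ent g ! consumed g t) = fst (merged ! t)"
    and "snd (merged ! t) \<le> snd (ent g ! consumed g t)"
    and "snd (ent g ! consumed g t) = snd (merged ! t) \<longleftrightarrow> merged ! t \<in> set (ent g)"
    and "merged ! t \<in> set (ent g) \<Longrightarrow> ent g ! consumed g t = merged ! t"
proof -
  let ?P = "\<lambda>e. e \<in> set (ent g)"
  obtain a where a: "snd (merged ! t) \<le> a" "(fst (merged ! t), a) \<in> set (ent g)"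
    using act by (auto simp: active_def)
  obtain i where i: "i < length merged" "merged ! i = (fst (merged ! t), a)" using ent_in_merged[OF a(2)] by blast
  have "merged ! t \<le> merged ! i" using i(2) a(1) by (simp add: less_eq_prod_def)
  then have ti: "t \<le> i" using merged_less_iff(2)[OF t i(1)] by simp
  have Pi: "?P (merged ! i)" using i(2) a(2) by simp
  have "length (filter ?P (take t merged)) \<le> length (filter ?P (take i merged))"
  proof -
    have "take i merged = take t merged @ take (i - t) (drop t merged)" using ti by (metis le_add_diff_inverse take_add)
    then show ?thesis by simp
  qed
  also have "\<dots> < length (filter ?P merged)" by (rule filter_nth_count(1)[of i merged ?P, OF i(1) Pi])
  finally have lt: "length (filter ?P (take t merged)) < length (filter ?P merged)" .
  then show c: "consumed g t < length (ent g)" by (simp add: consumed_def filter_merged)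
  obtain s where s: "t \<le> s" "s < length merged" "?P (merged ! s)"
    "filter ?P merged ! length (filter ?P (take t merged)) = merged ! s"
    "\<And>i. t \<le> i \<Longrightarrow> i < s \<Longrightarrow> \<not> ?P (merged ! i)" using filter_nth_next[OF lt] by blast
  have h: "ent g ! consumed g t = merged ! s" using s(4) by (simp add: consumed_def filter_merged)
  have si: "s \<le> i" using s(5)[OF ti] Pi by (metis leI)
  have ts: "merged ! t \<le> merged ! s" using merged_less_iff(2)[OF t s(2)] s(1) by simp
  have "merged ! s \<le> merged ! i" using merged_less_iff(2)[OF s(2) i(1)] si by simp
  then have "fst (merged ! s) \<le> fst (merged ! t)" using i(2) by (auto simp: less_eq_prod_def)
  moreover have "fst (merged ! t) \<le> fst (merged ! s)" using ts by (auto simp: less_eq_prod_def)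
  ultimately have f: "fst (merged ! s) = fst (merged ! t)" by simp
  then show "fst (ent g ! consumed g t) = fst (merged ! t)" using h by simp
  show le: "snd (merged ! t) \<le> snd (ent g ! consumed g t)" using ts f h by (auto simp: less_eq_prod_def)
  show e: "merged ! t \<in> set (ent g) \<Longrightarrow> ent g ! consumed g t = merged ! t"
  proof -
    assume "merged ! t \<in> set (ent g)"
    then have "\<not> t < s" using s(5)[of t] by blast
    then show "ent g ! consumed g t = merged ! t" using s(1) h by simp
  qed
  show "snd (ent g ! consumed g t) = snd (merged ! t) \<longleftrightarrow> merged ! t \<in> set (ent g)"
    using e f h s(3) by (metis prod_eqI)
qed

text \<open>Entries of one node are consecutive in the union, so an unfinished node continues with
  the next entry, and the state left behind by one entry is the state before the next.\<close>

lemma same_node: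
  assumes t: "Suc t < length merged" and m: "more g' (merged ! t)"
  shows "fst (merged ! Suc t) = fst (merged ! t)" and "active g (merged ! Suc t) \<longleftrightarrow> more g (merged ! t)"
proof -
  have step: "merged ! t < merged ! Suc t" using merged_less_iff(1)[of t "Suc t"] t by simp
  have later: "merged ! Suc t \<le> e" if e: "e \<in> set (ent g)" "merged ! t < e" for e g
  proof -
    obtain i where i: "i < length merged" "merged ! i = e" using ent_in_merged[OF e(1)] by blast
    then have "t < i" using merged_less_iff(1)[of t i] e(2) t by simp
    then show ?thesis using merged_less_iff(2)[of "Suc t" i] i t by simp
  qed
  obtain a where a: "snd (merged ! t) < a" "(fst (merged ! t), a) \<in> set (ent g')" using m by (auto simp: more_def)
  have "merged ! Suc t \<le> (fst (merged ! t), a)" by (rule later[OF a(2)]) (use a(1) in \<open>simp add: less_prod_def\<close>)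
  then show f: "fst (merged ! Suc t) = fst (merged ! t)" using step by (auto simp: less_eq_prod_def less_prod_def)
  then have s: "snd (merged ! t) < snd (merged ! Suc t)" using step by (auto simp: less_prod_def)
  show "active g (merged ! Suc t) \<longleftrightarrow> more g (merged ! t)"
  proof
    assume "active g (merged ! Suc t)"
    then show "more g (merged ! t)" using f s unfolding active_def more_def by (metis less_le_trans)
  next
    assume "more g (merged ! t)"
    then obtain b where b: "snd (merged ! t) < b" "(fst (merged ! t), b) \<in> set (ent g)" by (auto simp: more_def)
    have "merged ! Suc t \<le> (fst (merged ! t), b)" by (rule later[OF b(2)]) (use b(1) in \<open>simp add: less_prod_def\<close>)
    then have "snd (merged ! Suc t) \<le> b" using f by (auto simp: less_eq_prod_def)
    then show "active g (merged ! Suc t)" using f b(2) by (auto simp: active_def)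
  qed
qed

lemma fst_merged_in: "t < length merged \<Longrightarrow> fst (merged ! t) \<in> VU"
proof -
  assume "t < length merged"
  then have "merged ! t \<in> set merged" by simp
  then obtain g where "merged ! t \<in> set (ent g)" using in_merged by blast
  then have "fst (merged ! t) \<in> V g" by (auto simp: G.set_entries)
  then show ?thesis using in_VU by blast
qed

lemma node_entry:
  assumes "x \<in> V g"
  obtains a where "(x, a) \<in> set (ent g)"
proof -
  have "hd (out_syms (X g) x) \<in> set (out_syms (X g) x)" using G.out_syms_nonempty by simp
  then have "(x, hd (out_syms (X g) x)) \<in> set (ent g)" using assms by (simp add: G.set_entries)
  then show thesis by (rule that)
qed

lemma first_node:
  assumes "0 < length merged"
  shows "position (fst (merged ! 0)) = 0" and "active g (merged ! 0) \<longleftrightarrow> fst (merged ! 0) \<in> V g"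
proof -
  have least: "merged ! 0 \<le> e" if "e \<in> set (ent g)" for e g
    using ent_in_merged[OF that] merged_less_iff(2)[OF assms] by auto
  show "position (fst (merged ! 0)) = 0"
  proof (rule position_first)
    fix z assume "z \<in> VU"
    then obtain g where "z \<in> V g" using in_VU by blast
    then obtain a where "(z, a) \<in> set (ent g)" by (rule node_entry)
    from least[OF this] show "fst (merged ! 0) \<le> z" by (auto simp: less_eq_prod_def)
  qed
  show "active g (merged ! 0) \<longleftrightarrow> fst (merged ! 0) \<in> V g"
  proof
    assume "fst (merged ! 0) \<in> V g"
    then obtain a where a: "(fst (merged ! 0), a) \<in> set (ent g)" by (rule node_entry)
    from least[OF this] have "snd (merged ! 0) \<le> a" by (auto simp: less_eq_prod_def)
    then show "active g (merged ! 0)" using a by (auto simp: active_def)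
  qed (auto simp: active_def G.set_entries)
qed

text \<open>When neither graph has further entries, the next entry opens a new node with its
  smallest label, so a graph is active exactly if it owns the node. No node is skipped, as every
  node has an entry.\<close>

lemma next_node:
  assumes t: "Suc t < length merged" and m: "\<And>g. \<not> more g (merged ! t)"
  defines "x \<equiv> fst (merged ! t)" and "y \<equiv> fst (merged ! Suc t)"
  shows "position y = position x + length (copies False x)"
    and "active g (merged ! Suc t) \<longleftrightarrow> y \<in> V g"
proof -
  have step: "merged ! t < merged ! Suc t" using merged_less_iff(1)[of t "Suc t"] t by simp
  have xy: "x < y"
  proof (rule ccontr)
    assume "\<not> x < y"
    then have "fst (merged ! Suc t) = fst (merged ! t)" "snd (merged ! t) < snd (merged ! Suc t)"
      using step by (auto simp: x_def y_def less_prod_def)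
    moreover obtain g where "merged ! Suc t \<in> set (ent g)" using in_merged t nth_mem by blast
    ultimately have "more g (merged ! t)" unfolding more_def by (metis prod.collapse)
    then show False using m by blast
  qed
  have dich: "e \<le> merged ! t \<or> merged ! Suc t \<le> e" if e: "e \<in> set (ent g)" for e g
  proof -
    obtain i where i: "i < length merged" "merged ! i = e" using ent_in_merged[OF e] by blast
    then show ?thesis using merged_less_iff(2)[of i t] merged_less_iff(2)[of "Suc t" i] t by (cases "i \<le> t") auto
  qed
  show "position y = position x + length (copies False x)"
  proof (rule position_next[OF _ xy])
    show "x \<in> VU" using fst_merged_in[of t] t by (simp add: x_def)
    fix z assume z: "z \<in> VU" "z < y"
    then obtain g where "z \<in> V g" using in_VU by blast
    then obtain a where a: "(z, a) \<in> set (ent g)" by (rule node_entry)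
    have "\<not> merged ! Suc t \<le> (z, a)" using z(2) by (auto simp: y_def less_eq_prod_def)
    then have "(z, a) \<le> merged ! t" using dich[OF a] by blast
    then show "z \<le> x" by (auto simp: x_def less_eq_prod_def)
  qed
  show "active g (merged ! Suc t) \<longleftrightarrow> y \<in> V g"
  proof
    assume "y \<in> V g"
    then obtain a where a: "(y, a) \<in> set (ent g)" by (rule node_entry)
    have "\<not> (y, a) \<le> merged ! t" using xy by (auto simp: x_def less_eq_prod_def)
    then have "merged ! Suc t \<le> (y, a)" using dich[OF a] by blast
    then have "snd (merged ! Suc t) \<le> a" by (auto simp: y_def less_eq_prod_def)
    then show "active g (merged ! Suc t)" using a by (auto simp: active_def y_def)
  qed (auto simp: active_def y_def G.set_entries)
qed

definition reps_before :: "nat \<Rightarrow> (bool \<times> nat list \<times> nat) list" where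
  "reps_before t = concat (map rep_tags (take t merged))"

lemma reps_before_Suc: "t < length merged \<Longrightarrow> reps_before (Suc t) = reps_before t @ rep_tags (merged ! t)"
  by (simp add: reps_before_def take_Suc_conv_app_nth)

lemma merged_reps_split:
  assumes "t < length merged"
  obtains rest where "merged_reps = reps_before t @ rep_tags (merged ! t) @ rest"
proof -
  have "merged = take t merged @ merged ! t # drop (Suc t) merged" using assms by (rule id_take_nth_drop)
  then have "merged_reps = concat (map rep_tags (take t merged @ merged ! t # drop (Suc t) merged))"
    unfolding merged_reps_def by (rule arg_cong)
  then show thesis using that by (simp add: reps_before_def)
qed

lemma take_merged_reps: "t < length merged \<Longrightarrow> take (length (reps_before t)) merged_reps = reps_before t"
  by (erule merged_reps_split) simp

lemma merged_reps_nth: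
  assumes "t < length merged" "i < length (rep_tags (merged ! t))"
  shows "length (reps_before t) + i < length merged_reps"
    and "merged_reps ! (length (reps_before t) + i) = rep_tags (merged ! t) ! i"
proof -
  obtain rest where sp: "merged_reps = reps_before t @ rep_tags (merged ! t) @ rest"
    using merged_reps_split[OF assms(1)] .
  show "length (reps_before t) + i < length merged_reps" using assms(2) by (simp add: sp)
  show "merged_reps ! (length (reps_before t) + i) = rep_tags (merged ! t) ! i"
    unfolding sp nth_append_length_plus using assms(2) by (simp add: nth_append)
qed

lemma distinct_merged: "distinct merged"
  by (simp add: merged_def)

text \<open>The occurrences of an edge in \<open>merged_reps\<close> are adjacent, since the union
  lists each entry once; \<open>first_edge_XU_iff\<close> can therefore be decided while the entry
  is handled.\<close>

lemma first_edge_merged: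
  assumes t: "t < length merged"
  shows "first_edge XU (merged ! t) \<longleftrightarrow>
    (\<exists>i<length (rep_tags (merged ! t)). \<not> repeated (slot (length (reps_before t) + i)))"
proof -
  let ?e = "merged ! t" and ?l = "length (reps_before t)"
  obtain rest where sp: "merged_reps = reps_before t @ rep_tags ?e @ rest" using merged_reps_split[OF t] .
  have snd_tags: "snd p = e" if "p \<in> set (rep_tags e)" for p e using that by (auto simp: rep_tags_def)
  have "?l \<le> s \<and> s < ?l + length (rep_tags ?e)" if s: "s < length merged_reps" "snd (merged_reps ! s) = ?e" for s
  proof -
    have d: "merged = take t merged @ ?e # drop (Suc t) merged" using t by (rule id_take_nth_drop)
    then have nin: "?e \<notin> set (take t merged)" "?e \<notin> set (drop (Suc t) merged)"
      using distinct_merged by (metis distinct_append disjoint_insert(1) distinct.simps(2) list.simps(15))+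
    have rest: "rest = concat (map rep_tags (drop (Suc t) merged))"
      using sp unfolding merged_reps_def reps_before_def by (subst (asm) d) simp
    have "\<not> s < ?l"
    proof
      assume "s < ?l"
      then have "merged_reps ! s \<in> set (reps_before t)" by (simp add: sp nth_append)
      then obtain e where "e \<in> set (take t merged)" "merged_reps ! s \<in> set (rep_tags e)"
        unfolding reps_before_def set_concat set_map by blast
      then show False using nin(1) s(2) snd_tags by metis
    qed
    moreover have "\<not> ?l + length (rep_tags ?e) \<le> s"
    proof
      assume *: "?l + length (rep_tags ?e) \<le> s"
      then obtain u where u: "s = ?l + length (rep_tags ?e) + u" using le_Suc_ex by blast
      then have "merged_reps ! s = rest ! u" by (simp add: sp nth_append)
      moreover have "u < length rest" using s(1) u by (simp add: sp)
      ultimately have "merged_reps ! s \<in> set rest" by simp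
      then obtain e where "e \<in> set (drop (Suc t) merged)" "merged_reps ! s \<in> set (rep_tags e)"
        unfolding rest set_concat set_map by blast
      then show False using nin(2) s(2) snd_tags by metis
    qed
    ultimately show ?thesis by simp
  qed
  note range = this
  show ?thesis
  proof
    assume "first_edge XU ?e"
    then obtain s where s: "s < length merged_reps" "snd (merged_reps ! s) = ?e" "\<not> repeated (slot s)"
      using first_edge_XU_iff by blast
    with range[OF s(1,2)] show "\<exists>i<length (rep_tags ?e). \<not> repeated (slot (?l + i))"
      by (intro exI[of _ "s - ?l"]) auto
  next
    assume "\<exists>i<length (rep_tags ?e). \<not> repeated (slot (?l + i))"
    then obtain i where i: "i < length (rep_tags ?e)" "\<not> repeated (slot (?l + i))" by blast
    note nth = merged_reps_nth[OF t i(1)]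
    then have "snd (merged_reps ! (?l + i)) = ?e" using snd_tags i(1) by simp
    then show "first_edge XU ?e" using first_edge_XU_iff nth(1) i(2) by blast
  qed
qed

lemma rep_tags_cases:
  "length (rep_tags e) = of_bool (first_edge (X False) e) + of_bool (first_edge (X True) e)"
  by (simp add: rep_tags_def)

end

section \<open>The merging scan\<close>

definition next_node_prog :: "segment com" where
  "next_node_prog =
    If (Reg 20) Skip (If (Reg 21) Skip
      (Load 20 Work_Bits (Reg 11);; Assign 20 (Const 1 -\<^sub>e Reg 20);;
       Load 21 Work_Bits (Reg 6 +\<^sub>e Reg 11);; Assign 11 (Reg 11 +\<^sub>e (Reg 20 +\<^sub>e Reg 21))))"

definition head_prog :: "segment com" where
  "head_prog =
    If (Reg 20)
      (Load 15 (In_W False) (Reg 12);;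
       If (Reg 21) (Load 16 (In_W True) (Reg 13);; If (Reg 16 <\<^sub>e Reg 15) (Assign 15 (Reg 16)) Skip) Skip)
      (Load 15 (In_W True) (Reg 13))"

text \<open>Register \<open>19\<close> collects the flag of the merged graph: it is set unless the
  slot is repeated, that is unless the first bit is \<open>1\<close> and the second
  \<open>0\<close>. The cursor advances also for a flag that gets dropped, since its edge occupies a
  slot.\<close>

definition take_prog :: "bool \<Rightarrow> nat \<Rightarrow> nat \<Rightarrow> segment com" where
  "take_prog g d e =
    If (Reg d)
      (Load 16 (In_W g) (Reg e);;
       If (Reg 16 =\<^sub>e Reg 15)
        (Load 16 (In_Wminus g) (Reg e);;
         If (Reg 16)
          (Load 14 (Work_Words 6) (Reg 15 -\<^sub>e Const 1);;
           Store (Work_Words 6) (Reg 15 -\<^sub>e Const 1) (Reg 14 +\<^sub>e Const 1);;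
           Load 16 Work_Bits (Reg 14);; Load 17 Work_Bits (Reg 6 +\<^sub>e Reg 14);;
           If (Reg 16) (If (Reg 17) (Assign 19 (Const 1)) Skip) (Assign 19 (Const 1)))
          Skip;;
         Load 16 (In_last g) (Reg e);; Assign d (Const 1 -\<^sub>e Reg 16);; Assign e (Reg e +\<^sub>e Const 1))
        Skip)
      Skip"

text \<open>Register \<open>17\<close> becomes the bit of \<open>last\<close>: neither graph has
  further entries of the node. The sum in the guard is a disjunction, so label \<open>0\<close> is
  written only for a node without any other entry.\<close>

definition emit_prog :: "segment com" where
  "emit_prog =
    If (Reg 20) (Assign 17 (Const 0)) (If (Reg 21) (Assign 17 (Const 0)) (Assign 17 (Const 1)));;
    If ((Const 0 <\<^sub>e Reg 15) +\<^sub>e Reg 17)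
      (Store Out_W (Reg 23) (Reg 15);; Store Out_Wminus (Reg 23) (Reg 19);; Store Out_last (Reg 23) (Reg 17);;
       Assign 23 (Reg 23 +\<^sub>e Const 1);; Assign 22 (Reg 22 +\<^sub>e Reg 17))
      Skip"

definition merge_body :: "segment com" where
  "merge_body =
    next_node_prog;; head_prog;; Assign 19 (Const 0);; take_prog False 20 12;; take_prog True 21 13;; emit_prog"

definition merge_prog :: "segment com" where
  "merge_prog =
    reset_prog 0;;
    (Assign 12 (Const 0);; Assign 13 (Const 0);; Assign 20 (Const 0);; Assign 21 (Const 0);;
     Assign 22 (Const 0);; Assign 23 (Const 0));;
    (Assign 11 (Const 0);; While ((Reg 12 +\<^sub>e Reg 13) <\<^sub>e Reg 7) merge_body)"

lemma less_power_floorlog: "1 \<le> x \<Longrightarrow> y \<le> x \<Longrightarrow> y < 2 ^ floorlog 2 x"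
  using floorlog_bounds[of x 2] by auto

context merging
begin

definition zbits :: "(segment \<Rightarrow> nat list) \<Rightarrow> bool" where
  "zbits h \<longleftrightarrow> (\<forall>p<n. h Work_Bits ! p = bit False k p \<and> h Work_Bits ! (n + p) = bit True k p)"

lemma one_less_W: "1 < (2::nat) ^ w"
  using power_strict_increasing[of 0 w "2::nat"] w by simp

lemma length_node_seq_n: "length node_seq = n"
  by (simp add: length_node_seq n_def)

lemma zbits_repeated:
  assumes "zbits h" "p < n"
  shows "repeated p \<longleftrightarrow> h Work_Bits ! p \<noteq> 0 \<and> h Work_Bits ! (n + p) = 0"
  using assms repeated_iff[of p] by (simp add: zbits_def bit_def length_node_seq_n)

text \<open>The value of register \<open>11\<close>: it moves past the copies of a node when the
  node is opened, not when it is finished.\<close>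

definition node_end :: "nat \<Rightarrow> nat" where
  "node_end t = (if t = 0 then 0 else position (fst (merged ! (t - 1))) + length (copies False (fst (merged ! (t - 1)))))"

text \<open>The two bits at the first copy of a node reveal its membership by
  \<open>stage_at_position\<close>, the first one negated. Their sum after this negation is the
  number of copies, by which the position advances.\<close>

lemma wp_next_node:
  assumes t: "t < length merged" and env: "env r h" and zb: "zbits h"
    and r: "r 20 = of_bool (0 < t \<and> more False (merged ! (t - 1)))" "r 21 = of_bool (0 < t \<and> more True (merged ! (t - 1)))"
      "r 11 = node_end t"
    and Q: "\<And>r'. (\<And>y. y \<notin> {11, 20, 21} \<Longrightarrow> r' y = r y) \<Longrightarrow> r' 20 = of_bool (active False (merged ! t)) \<Longrightarrow>
      r' 21 = of_bool (active True (merged ! t)) \<Longrightarrow> r' 11 = node_end (Suc t) \<Longrightarrow> Q r' h"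
  shows "wp M next_node_prog Q r h"
proof (cases "\<exists>g. 0 < t \<and> more g (merged ! (t - 1))")
  case True
  then obtain g t' where g: "t = Suc t'" "more g (merged ! t')" by (cases t) auto
  note same = same_node[OF t[unfolded g(1)] g(2)]
  have "node_end (Suc t) = node_end t" using same(1) by (simp add: node_end_def g(1))
  moreover have "r 20 \<noteq> 0 \<or> r 21 \<noteq> 0" using r(1,2) g by (cases g) auto
  ultimately have "Q r h" using r same(2) g(1) by (intro Q) auto
  then show ?thesis using \<open>r 20 \<noteq> 0 \<or> r 21 \<noteq> 0\<close> by (auto simp: next_node_prog_def)
next
  case False
  let ?x = "fst (merged ! t)"
  have r0: "r 20 = 0" "r 21 = 0" using r(1,2) False by auto
  have x: "?x \<in> VU" by (rule fst_merged_in[OF t])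
  have pos: "node_end t = position ?x" and act: "active g (merged ! t) \<longleftrightarrow> ?x \<in> V g" for g
  proof -
    show "node_end t = position ?x"
    proof (cases t)
      case 0
      then show ?thesis using first_node(1) t by (simp add: node_end_def)
    next
      case (Suc t')
      then have "\<And>g. \<not> more g (merged ! t')" using False by auto
      then show ?thesis using next_node(1)[of t'] t Suc by (simp add: node_end_def)
    qed
    show "active g (merged ! t) \<longleftrightarrow> ?x \<in> V g"
    proof (cases t)
      case 0
      then show ?thesis using first_node(2) t by simp
    next
      case (Suc t')
      then have "\<And>g. \<not> more g (merged ! t')" using False by auto
      then show ?thesis using next_node(2)[of t'] t Suc by simp
    qed
  qed
  have p: "position ?x < n" using stage_at_position(1)[OF x] by (simp add: length_node_seq_n)
  have b: "h Work_Bits ! position ?x = of_bool (?x \<notin> V False)" "h Work_Bits ! (n + position ?x) = of_bool (?x \<in> V True)"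
    using zb p stage_at_position(2,3)[OF x] by (simp_all add: zbits_def bit_def)
  have e: "r 6 = n" "length (h Work_Bits) = 2 * n" using env by (simp_all add: env_def)
  have len: "length (copies False ?x) = of_bool (?x \<in> V False) + of_bool (?x \<in> V True)" by (rule length_copies)
  have ne: "node_end (Suc t) = position ?x + length (copies False ?x)" by (simp add: node_end_def)
  have pw: "position ?x < 2 * n" "n + position ?x < 2 * n" "n + position ?x < 2 ^ w" "position ?x + 2 < 2 ^ w" "(2::nat) < 2 ^ w"
  proof -
    show "position ?x < 2 * n" "n + position ?x < 2 * n" "n + position ?x < 2 ^ w" using p m_word by auto
    have "3 * n < 2 ^ w" using m_word n_le_m by linarith
    then show "position ?x + 2 < 2 ^ w" "(2::nat) < 2 ^ w" using p by linarith+
  qed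
  have arith: "apply_binop w Add (of_bool A) (of_bool B) = of_bool A + of_bool B"
    "apply_binop w Add (position ?x) (of_bool A + of_bool B) = position ?x + (of_bool A + of_bool B)" for A B
    using pw by (auto simp: apply_binop_Add of_bool_def)
  have sub: "apply_binop w Sub 1 (of_bool (?x \<notin> V False)) = of_bool (?x \<in> V False)"
    using pw by (auto simp: apply_binop_Sub)
  have "Q (r(20 := of_bool (?x \<in> V False), 21 := of_bool (?x \<in> V True),
      11 := position ?x + (of_bool (?x \<in> V False) + of_bool (?x \<in> V True)))) h"
    by (rule Q) (use act ne len in auto)
  then show ?thesis
    using r0 r(3) pos b e pw one_mod unfolding next_node_prog_def
    by (simp add: arith sub apply_binop_Add fun_upd_twist[of 20 11] fun_upd_twist[of 20 21] fun_upd_twist[of 21 11]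
        del: One_nat_def)
qed

lemma active_some: "t < length merged \<Longrightarrow> active False (merged ! t) \<or> active True (merged ! t)"
proof -
  assume "t < length merged"
  then have "merged ! t \<in> set merged" by simp
  then obtain g where "merged ! t \<in> set (ent g)" using in_merged by blast
  then have "active g (merged ! t)" using active_iff by blast
  then show ?thesis by (cases g) auto
qed

text \<open>The current entry belongs to some graph, and each active graph has its next entry at or
  behind it, so the smaller of the available labels is the current one.\<close>

lemma wp_head:
  assumes t: "t < length merged" and env: "env r h"
    and r: "r 20 = of_bool (active False (merged ! t))" "r 21 = of_bool (active True (merged ! t))"
      "r 12 = consumed False t" "r 13 = consumed True t"
    and Q: "\<And>r'. (\<And>y. y \<notin> {15, 16} \<Longrightarrow> r' y = r y) \<Longrightarrow> r' 15 = snd (merged ! t) \<Longrightarrow> Q r' h"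
  shows "wp M head_prog Q r h"
proof -
  let ?e = "merged ! t"
  have W: "h (In_W False) = map snd (ent False)" "h (In_W True) = map snd (ent True)" using env by (simp_all add: env_def)
  note hd = head_entry[OF t]
  have some: "?e \<in> set (ent False) \<or> ?e \<in> set (ent True)"
    using t in_merged[of ?e] nth_mem[OF t] by (simp add: ex_bool_eq) blast
  have act: "?e \<in> set (ent g) \<Longrightarrow> active g ?e" for g by (simp add: active_iff)
  show ?thesis
  proof (cases "active False ?e")
    case F: True
    note hF = hd[OF F]
    show ?thesis
    proof (cases "active True ?e")
      case T: True
      note hT = hd[OF T]
      show ?thesis
      proof (cases "snd (ent True ! consumed True t) < snd (ent False ! consumed False t)")
        case True
        then have "snd (ent True ! consumed True t) = snd ?e" using hF(3,4) hT(3,4) some by auto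
        then have "Q (r(15 := snd (ent False ! consumed False t), 16 := snd ?e, 15 := snd ?e)) h"
          by (intro Q) auto
        then show ?thesis using True F T r W hF(1) hT(1) \<open>snd (ent True ! consumed True t) = snd ?e\<close>
          by (simp add: head_prog_def apply_binop_simps)
      next
        case False
        then have "snd (ent False ! consumed False t) = snd ?e" using hF(3,4) hT(3,4) some by auto
        then have "Q (r(15 := snd ?e, 16 := snd (ent True ! consumed True t))) h"
          by (intro Q) auto
        then show ?thesis using False F T r W hF(1) hT(1) \<open>snd (ent False ! consumed False t) = snd ?e\<close>
          by (simp add: head_prog_def apply_binop_simps)
      qed
    next
      case T: False
      then have "snd (ent False ! consumed False t) = snd ?e" using hF(4) some act by blast
      moreover from this have "Q (r(15 := snd ?e)) h" by (intro Q) auto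
      ultimately show ?thesis using F T r W hF(1) by (simp add: head_prog_def)
    qed
  next
    case F: False
    then have T: "active True ?e" using active_some[OF t] by blast
    note hT = hd[OF T]
    have "snd (ent True ! consumed True t) = snd ?e" using hT(4) some act F by blast
    moreover from this have "Q (r(15 := snd ?e)) h" by (intro Q) auto
    ultimately show ?thesis using F T r W hT(1) by (simp add: head_prog_def)
  qed
qed

lemma wp_take:
  assumes t: "t < length merged" and env: "env r h" and zb: "zbits h"
    and de: "d = (if g then 21 else 20)" "er = (if g then 13 else 12)"
    and r: "r d = of_bool (active g (merged ! t))" "r er = consumed g t" "r 15 = snd (merged ! t)"
    and rep: "first_edge (X g) (merged ! t) \<Longrightarrow>
      s < length merged_reps \<and> h (Work_Words 6) ! (snd (merged ! t) - 1) = slot s"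
    and Q: "\<And>r'. (\<And>y. y \<notin> {14, 16, 17, 19, d, er} \<Longrightarrow> r' y = r y) \<Longrightarrow> r' d = of_bool (more g (merged ! t)) \<Longrightarrow>
      r' er = consumed g (Suc t) \<Longrightarrow>
      r' 19 = (if first_edge (X g) (merged ! t) \<and> \<not> repeated (slot s) then 1 else r 19) \<Longrightarrow>
      Q r' (if first_edge (X g) (merged ! t)
        then h(Work_Words 6 := (h (Work_Words 6))[snd (merged ! t) - 1 := slot s + 1]) else h)"
  shows "wp M (take_prog g d er) Q r h"
proof -
  let ?e = "merged ! t" and ?i = "consumed g t"
  have W: "h (In_W g) = map snd (ent g)" "h (In_Wminus g) = map (\<lambda>e. of_bool (first_edge (X g) e)) (ent g)"
    "h (In_last g) = map (\<lambda>e. of_bool (last_entry (X g) e)) (ent g)"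
    "r 6 = n" "length (h Work_Bits) = 2 * n" "length (h (Work_Words 6)) = \<sigma>"
    using env by (simp_all add: env_def)
  have fe: "first_edge (X g) ?e \<Longrightarrow> ?e \<in> set (ent g)"
    using subsetD[OF G.X_subset_entries G.first_edge_in_X] by blast
  have neq: "d \<noteq> 14" "d \<noteq> 15" "d \<noteq> 16" "d \<noteq> 17" "d \<noteq> 19" "d \<noteq> er" "er \<noteq> 14" "er \<noteq> 15" "er \<noteq> 16" "er \<noteq> 17"
    "er \<noteq> 19" "er \<noteq> d" "d \<noteq> 6" "er \<noteq> 6" using de by auto
  show ?thesis
  proof (cases "active g ?e")
    case False
    then have ne: "?e \<notin> set (ent g)" "\<not> more g ?e" using active_iff by auto
    then have nfe: "\<not> first_edge (X g) ?e" using fe by blast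
    have "Q r h" using Q[of r] r False nfe ne consumed_Suc[OF t, of g] by simp
    then show ?thesis using False r(1) by (simp add: take_prog_def)
  next
    case act: True
    note hd = head_entry[OF t act]
    show ?thesis
    proof (cases "?e \<in> set (ent g)")
      case False
      then have more: "more g ?e" using act active_iff by blast
      have nfe: "\<not> first_edge (X g) ?e" using fe False by blast
      have "Q (r(16 := snd (ent g ! ?i))) h"
        using Q[of "r(16 := snd (ent g ! ?i))"] r False nfe act more consumed_Suc[OF t, of g] neq by simp
      then show ?thesis using False r act W hd(1,4) neq by (simp add: take_prog_def apply_binop_simps)
    next
      case True
      note e = hd(5)[OF True]
      have more: "more g ?e \<longleftrightarrow> \<not> last_entry (X g) ?e" by (rule more_if_in[OF True])
      have cs: "consumed g (Suc t) = ?i + 1" using consumed_Suc[OF t, of g] True by simp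
      have iw: "?i + 1 < 2 ^ w"
      proof -
        have "length (ent g) \<le> m" by (cases g) (simp_all add: m_def)
        moreover have "m + n < 2 ^ w" using m_word by linarith
        ultimately show ?thesis using hd(1) n_pos by linarith
      qed
      have sub: "apply_binop w Sub 1 (of_bool (last_entry (X g) ?e)) = of_bool (more g ?e)"
        using more one_less_W by (cases "last_entry (X g) ?e") (simp_all add: apply_binop_Sub del: One_nat_def)
      show ?thesis
      proof (cases "first_edge (X g) ?e")
        case False
        have "Q (r(16 := of_bool (last_entry (X g) ?e), d := of_bool (more g ?e), er := ?i + 1)) h"
          using Q[of "r(16 := of_bool (last_entry (X g) ?e), d := of_bool (more g ?e), er := ?i + 1)"]
            False cs neq by auto
        then show ?thesis using False r act W hd(1) e neq iw one_mod sub
          by (simp add: take_prog_def apply_binop.simps(12) apply_binop_Add del: One_nat_def)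
      next
        case fe: True
        let ?a = "snd ?e"
        have "rep (g, ?e)" using fe by (simp add: rep_def)
        from label_bounds[OF this] have a: "?a \<in> {1..\<sigma>}" by simp
        then have a': "apply_binop w Sub ?a 1 = ?a - 1" "?a - 1 < \<sigma>" using \<sigma>_word by (auto simp: apply_binop_Sub)
        have s: "s < length merged_reps" "h (Work_Words 6) ! (?a - 1) = slot s" using rep[OF fe] by auto
        have p: "slot s < n" using node_seq_slot(1)[OF s(1)] by (simp add: length_node_seq_n)
        have pw: "slot s + 1 < 2 ^ w" "n + slot s < 2 ^ w" "slot s < 2 * n" "n + slot s < 2 * n" using p m_word by auto
        note rp = zbits_repeated[OF zb p]
        let ?h = "h(Work_Words 6 := (h (Work_Words 6))[?a - 1 := slot s + 1])"
        have Q': "Q (r'(16 := of_bool (last_entry (X g) ?e), d := of_bool (more g ?e), er := ?i + 1)) ?h"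
          if "\<And>y. y \<notin> {14, 16, 17, 19} \<Longrightarrow> r' y = r y" "r' 19 = (if \<not> repeated (slot s) then 1 else r 19)" for r'
          using Q[of "r'(16 := of_bool (last_entry (X g) ?e), d := of_bool (more g ?e), er := ?i + 1)"]
            that fe cs neq by auto
        show ?thesis
        proof (cases "repeated (slot s)")
          case True
          then have b: "h Work_Bits ! slot s \<noteq> 0" "h Work_Bits ! (n + slot s) = 0" using rp by auto
          show ?thesis
            using fe r act W hd(1) e neq iw one_mod sub a' s(2) pw b True
              Q'[of "r(16 := h Work_Bits ! slot s, 14 := slot s, 17 := h Work_Bits ! (n + slot s))"]
            by (simp add: take_prog_def apply_binop.simps(12) apply_binop_Add fun_upd_twist[of 16 14]
                fun_upd_twist[of 16 17] fun_upd_twist[of 14 17] del: One_nat_def)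
        next
          case False
          show ?thesis
          proof (cases "h Work_Bits ! slot s = 0")
            case True
            then show ?thesis
              using fe r act W hd(1) e neq iw one_mod sub a' s(2) pw False
                Q'[of "r(16 := h Work_Bits ! slot s, 14 := slot s, 17 := h Work_Bits ! (n + slot s), 19 := 1)"]
              by (simp add: take_prog_def apply_binop.simps(12) apply_binop_Add fun_upd_twist[of 16 14]
                  fun_upd_twist[of 16 17] fun_upd_twist[of 14 17] fun_upd_twist[of 16 19] fun_upd_twist[of 14 19] fun_upd_twist[of 17 19]
                  del: One_nat_def)
          next
            case b: False
            then have "h Work_Bits ! (n + slot s) \<noteq> 0" using rp False by simp
            then show ?thesis
              using fe r act W hd(1) e neq iw one_mod sub a' s(2) pw False b
                Q'[of "r(16 := h Work_Bits ! slot s, 14 := slot s, 17 := h Work_Bits ! (n + slot s), 19 := 1)"]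
              by (simp add: take_prog_def apply_binop.simps(12) apply_binop_Add fun_upd_twist[of 16 14]
                  fun_upd_twist[of 16 17] fun_upd_twist[of 14 17] fun_upd_twist[of 16 19] fun_upd_twist[of 14 19] fun_upd_twist[of 17 19]
                  del: One_nat_def)
          qed
        qed
      qed
    qed
  qed
qed

end

context merging
begin

abbreviation EU where "EU \<equiv> entries VU XU"

definition kept_before :: "nat \<Rightarrow> nat" where
  "kept_before t = length (filter kept (take t merged))"

lemma kept_before_Suc: "t < length merged \<Longrightarrow> kept_before (Suc t) = kept_before t + of_bool (kept (merged ! t))"
  by (simp add: kept_before_def take_Suc_conv_app_nth)

lemma nth_EU: "t < length merged \<Longrightarrow> kept (merged ! t) \<Longrightarrow> kept_before t < length EU \<and> EU ! kept_before t = merged ! t"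
  using filter_nth_count[of t merged kept] by (simp add: kept_before_def filter_kept)

lemma kept_before_length: "kept_before (length merged) = length EU"
  by (simp add: kept_before_def filter_kept)

definition emitted :: "(segment \<Rightarrow> nat list) \<Rightarrow> nat \<Rightarrow> bool" where
  "emitted h j \<longleftrightarrow> (\<forall>i<j. h Out_W ! i = snd (EU ! i) \<and> h Out_Wminus ! i = of_bool (first_edge XU (EU ! i)) \<and>
    h Out_last ! i = of_bool (last_entry XU (EU ! i)))"

definition cursors :: "(segment \<Rightarrow> nat list) \<Rightarrow> (bool \<times> nat list \<times> nat) list \<Rightarrow> bool" where
  "cursors h es \<longleftrightarrow> (\<forall>c\<in>set labels. h (Work_Words 6) ! (c - 1) = z + length (filter (\<lambda>y. y < c) labels) +
    length (filter (\<lambda>e. label e = c) es))"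

text \<open>The bucket starts depend only on the set of flagged edges, so those computed for the
  passes also fit the order of \<open>merged_reps\<close>.\<close>

lemma slot_cursor:
  assumes "s < length merged_reps" "take s merged_reps = es" "merged_reps ! s = e" "cursors h es"
  shows "h (Work_Words 6) ! (label e - 1) = slot s" and "label e \<in> set labels" and "label e \<in> {1..\<sigma>}"
proof -
  have e: "rep e" using assms(1,3) set_merged_reps nth_mem by auto
  then show l: "label e \<in> set labels" by (auto simp: set_labels)
  show "label e \<in> {1..\<sigma>}" by (rule label_bounds[OF e])
  have "distinct merged_reps" using sorted_merged_reps by (rule distinct_if_sorted_wrt) simp
  then have "length (filter (\<lambda>e'. label e' < label e) merged_reps) = length (filter (\<lambda>y. y < label e) labels)"
    by (rule count_labels[OF _ set_merged_reps])
  then show "h (Work_Words 6) ! (label e - 1) = slot s"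
    using assms l by (simp add: cursors_def slot_def z_def rank_def)
qed

lemma cursors_upd:
  assumes "cursors h es" "label e \<in> {1..\<sigma>}" "length (h (Work_Words 6)) = \<sigma>" "label e \<in> set labels"
    and "h (Work_Words 6) ! (label e - 1) = v"
  shows "cursors (h(Work_Words 6 := (h (Work_Words 6))[label e - 1 := v + 1])) (es @ [e])"
  unfolding cursors_def
proof
  fix c assume c: "c \<in> set labels"
  show "(h(Work_Words 6 := (h (Work_Words 6))[label e - 1 := v + 1])) (Work_Words 6) ! (c - 1) =
    z + length (filter (\<lambda>y. y < c) labels) + length (filter (\<lambda>e. label e = c) (es @ [e]))"
  proof (cases "c = label e")
    case True
    then show ?thesis using assms by (auto simp: cursors_def)
  next
    case False
    moreover have "1 \<le> c" using c labels_bounds by auto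
    ultimately have "c - 1 \<noteq> label e - 1" using assms(2) by auto
    then show ?thesis using False assms(1) c by (simp add: cursors_def)
  qed
qed

lemma label_merged_le: "t < length merged \<Longrightarrow> snd (merged ! t) \<le> \<sigma>"
proof -
  assume t: "t < length merged"
  then obtain g where e: "merged ! t \<in> set (ent g)" using in_merged[of "merged ! t"] by auto
  obtain x a where xa: "merged ! t = (x, a)" by fastforce
  show ?thesis
  proof (cases "a = 0")
    case False
    then have "(x, a) \<in> X g" using e xa G.in_X_iff by (simp add: G.set_entries)
    then show ?thesis using label_le xa by simp
  qed (simp add: xa)
qed

lemma wp_emit:
  assumes t: "t < length merged" and sig: "1 \<le> \<sigma>"
    and r: "r 20 = of_bool (more False (merged ! t))" "r 21 = of_bool (more True (merged ! t))"
      "r 15 = snd (merged ! t)" "r 19 = of_bool (first_edge XU (merged ! t))" "r 23 = kept_before t"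
      "r 22 = length (filter (last_entry XU) (take (kept_before t) EU))"
    and em: "emitted h (kept_before t)" and len: "length (h Out_W) = length EU" "length (h Out_Wminus) = length EU"
      "length (h Out_last) = length EU" "length EU + 1 < 2 ^ w"
    and Q: "\<And>r' h'. (\<And>y. y \<notin> {17, 22, 23} \<Longrightarrow> r' y = r y) \<Longrightarrow> r' 23 = kept_before (Suc t) \<Longrightarrow>
      r' 22 = length (filter (last_entry XU) (take (kept_before (Suc t)) EU)) \<Longrightarrow> emitted h' (kept_before (Suc t)) \<Longrightarrow>
      (\<And>a. a \<notin> {Out_W, Out_Wminus, Out_last} \<Longrightarrow> h' a = h a) \<Longrightarrow> Q r' h'"
  shows "wp M emit_prog Q r h"
proof -
  let ?e = "merged ! t" and ?j = "kept_before t"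
  let ?done = "\<not> more False ?e \<and> \<not> more True ?e"
  have in_merged: "?e \<in> set merged" using t by simp
  have kept: "kept ?e \<longleftrightarrow> snd ?e \<noteq> 0 \<or> ?done" by (rule kept_iff_more[OF in_merged])
  have le: "snd ?e \<le> \<sigma>" by (rule label_merged_le[OF t])
  have two: "2 < (2::nat) ^ w" using power_strict_increasing[of 1 w "2::nat"] w
    by (cases "w = 2") (auto simp: less_le)
  have kc: "apply_binop w Add (of_bool (0 < snd ?e)) (of_bool ?done) \<noteq> 0 \<longleftrightarrow> kept ?e"
    using kept two by (auto simp: apply_binop_Add of_bool_def)
  have "r(17 := of_bool ?done) = r(17 := if r 20 \<noteq> 0 then 0 else if r 21 \<noteq> 0 then 0 else 1)"
    using r(1,2) by simp
  then have start: "wp M emit_prog Q r h \<longleftrightarrow> (if kept ?e then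
      wp M (Store Out_W (Reg 23) (Reg 15);; Store Out_Wminus (Reg 23) (Reg 19);; Store Out_last (Reg 23) (Reg 17);;
        Assign 23 (Reg 23 +\<^sub>e Const 1);; Assign 22 (Reg 22 +\<^sub>e Reg 17)) Q (r(17 := of_bool ?done)) h
      else Q (r(17 := of_bool ?done)) h)"
    using kc r(1,2,3) one_mod unfolding emit_prog_def
    by (cases "more False ?e"; cases "more True ?e") (simp_all add: apply_binop.simps(11) del: One_nat_def)
  show ?thesis
  proof (cases "kept ?e")
    case False
    then have "kept_before (Suc t) = ?j" using kept_before_Suc[OF t] by simp
    moreover from this have "Q (r(17 := of_bool ?done)) h" using r em by (intro Q) auto
    ultimately show ?thesis using start False by simp
  next
    case True
    have j: "?j < length EU" "EU ! ?j = ?e" using nth_EU[OF t True] by auto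
    have last: "last_entry XU ?e \<longleftrightarrow> ?done" by (rule last_entry_iff_more[OF in_merged True])
    have kS: "kept_before (Suc t) = ?j + 1" using kept_before_Suc[OF t] True by simp
    have tk: "take (?j + 1) EU = take ?j EU @ [?e]" using j by (simp add: take_Suc_conv_app_nth)
    have "snd ?e < 2 ^ floorlog 2 \<sigma>" by (rule less_power_floorlog[OF sig le])
    then have md: "snd ?e mod 2 ^ floorlog 2 \<sigma> = snd ?e" by simp
    let ?h = "h(Out_W := (h Out_W)[?j := snd ?e], Out_Wminus := (h Out_Wminus)[?j := of_bool (first_edge XU ?e)],
      Out_last := (h Out_last)[?j := of_bool ?done])"
    have "emitted ?h (kept_before (Suc t))"
      using em j len last unfolding kS emitted_def by (auto simp: nth_list_update less_Suc_eq)
    moreover have cnt: "length (filter (last_entry XU) (take ?j EU)) \<le> length EU"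
      by (rule order_trans[OF length_filter_le]) simp
    ultimately have "Q (r(17 := of_bool ?done, 23 := ?j + 1,
        22 := length (filter (last_entry XU) (take ?j EU)) + of_bool ?done)) ?h"
      using r kS tk last by (intro Q) auto
    moreover have "apply_binop w Add (length (filter (last_entry XU) (take ?j EU))) (of_bool ?done) =
        length (filter (last_entry XU) (take ?j EU)) + of_bool ?done"
      using cnt len(4) by (simp add: apply_binop_Add)
    moreover have "apply_binop w Add ?j 1 = ?j + 1" using j len(4) by (simp add: apply_binop_Add)
    ultimately show ?thesis
      unfolding start using True r j len md one_mod by (simp del: One_nat_def)
  qed
qed

definition merge_inv :: "nat \<Rightarrow> (nat \<Rightarrow> nat) \<Rightarrow> (segment \<Rightarrow> nat list) \<Rightarrow> bool" where
  "merge_inv t r h \<longleftrightarrow> r 11 = node_end t \<and> r 12 = consumed False t \<and> r 13 = consumed True t \<and>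
    r 20 = of_bool (0 < t \<and> more False (merged ! (t - 1))) \<and> r 21 = of_bool (0 < t \<and> more True (merged ! (t - 1))) \<and>
    r 22 = length (filter (last_entry XU) (take (kept_before t) EU)) \<and> r 23 = kept_before t \<and>
    zbits h \<and> cursors h (reps_before t) \<and> emitted h (kept_before t)"

lemma consumed_sum_less:
  assumes "t < length merged"
  shows "consumed False t + consumed True t < m"
proof -
  have "merged ! t \<in> set merged" using assms by simp
  then obtain g where "merged ! t \<in> set (ent g)" using in_merged by blast
  from consumed_less[OF assms this] consumed_le[of "\<not> g" t] show ?thesis by (cases g) (auto simp: m_def)
qed

lemma wp_merge_body:
  assumes t: "t < length merged" and sig: "1 \<le> \<sigma>" and env: "env r h" and inv: "merge_inv t r h"
    and len: "length (h Out_W) = length EU" "length (h Out_Wminus) = length EU" "length (h Out_last) = length EU"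
  shows "wp M merge_body (merge_inv (Suc t)) r h"
proof -
  let ?e = "merged ! t" and ?l = "length (reps_before t)"
  let ?F = "first_edge (X False) ?e" and ?T = "first_edge (X True) ?e"
  have I: "r 11 = node_end t" "r 12 = consumed False t" "r 13 = consumed True t"
    "r 20 = of_bool (0 < t \<and> more False (merged ! (t - 1)))" "r 21 = of_bool (0 < t \<and> more True (merged ! (t - 1)))"
    "r 22 = length (filter (last_entry XU) (take (kept_before t) EU))" "r 23 = kept_before t"
    "zbits h" "cursors h (reps_before t)" "emitted h (kept_before t)"
    using inv by (simp_all add: merge_inv_def)
  have W6: "length (h (Work_Words 6)) = \<sigma>" using env by (simp add: env_def)
  have EU_word: "length EU + 1 < 2 ^ w"
  proof -
    have "length EU \<le> length merged" using length_filter_le[of kept merged] by (simp add: filter_kept)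
    then have "length EU \<le> m" using length_merged by (simp add: m_def)
    then show ?thesis using m_word n_pos by linarith
  qed
  have tags: "rep_tags ?e = (if ?F then [(False, ?e)] else []) @ (if ?T then [(True, ?e)] else [])"
    by (simp add: rep_tags_def)
  \<comment> \<open>An edge flagged in both graphs uses two consecutive places of
    \<open>merged_reps\<close>, the first of them for the first graph.\<close>
  define sT where "sT = ?l + of_bool ?F"
  define h1 where "h1 = (if ?F then h(Work_Words 6 := (h (Work_Words 6))[snd ?e - 1 := slot ?l + 1]) else h)"
  define h2 where "h2 = (if ?T then h1(Work_Words 6 := (h1 (Work_Words 6))[snd ?e - 1 := slot sT + 1]) else h1)"
  have nth: "?l + i < length merged_reps" "merged_reps ! (?l + i) = rep_tags ?e ! i" if "i < length (rep_tags ?e)" for i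
    using merged_reps_nth[OF t that] by auto
  have tkl: "take ?l merged_reps = reps_before t" by (rule take_merged_reps[OF t])
  have F: "?l < length merged_reps \<and> h (Work_Words 6) ! (snd ?e - 1) = slot ?l \<and>
      snd ?e \<in> set labels \<and> snd ?e \<in> {1..\<sigma>}" if "?F"
  proof -
    have "?l < length merged_reps" "merged_reps ! ?l = (False, ?e)" using nth[of 0] that tags by auto
    then show ?thesis using slot_cursor[OF _ tkl _ I(9), of "(False, ?e)"] by simp
  qed
  have cur1: "cursors h1 (reps_before t @ (if ?F then [(False, ?e)] else []))"
    using cursors_upd[OF I(9), of "(False, ?e)" "slot ?l"] F W6 I(9) by (auto simp: h1_def)
  have W61: "length (h1 (Work_Words 6)) = \<sigma>" using W6 by (simp add: h1_def)
  have T: "sT < length merged_reps \<and> h1 (Work_Words 6) ! (snd ?e - 1) = slot sT \<and>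
      snd ?e \<in> set labels \<and> snd ?e \<in> {1..\<sigma>}" if "?T"
  proof -
    have s: "sT < length merged_reps" "merged_reps ! sT = (True, ?e)"
      using nth[of "of_bool ?F"] that tags by (auto simp: sT_def)
    have "take sT merged_reps = reps_before t @ (if ?F then [(False, ?e)] else [])"
    proof (cases "?F")
      case True
      have "merged_reps ! ?l = (False, ?e)" using nth[of 0] True tags by auto
      then show ?thesis using True F tkl by (simp add: sT_def take_Suc_conv_app_nth)
    qed (simp add: sT_def tkl)
    from slot_cursor[OF s(1) this s(2) cur1] s(1) show ?thesis by simp
  qed
  have cur2: "cursors h2 (reps_before (Suc t))"
    unfolding reps_before_Suc[OF t] tags
    using cursors_upd[OF cur1, of "(True, ?e)" "slot sT"] T W61 cur1 by (auto simp: h2_def)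
  have fe: "first_edge XU ?e \<longleftrightarrow> (?F \<and> \<not> repeated (slot ?l)) \<or> (?T \<and> \<not> repeated (slot sT))"
    unfolding first_edge_merged[OF t] rep_tags_cases sT_def
    by (auto simp: of_bool_def less_Suc_eq split: if_splits) 
  have h1s: "h1 a = h a" "h2 a = h a" if "a \<noteq> Work_Words 6" for a using that by (simp_all add: h1_def h2_def)
  have zb: "zbits h1" "zbits h2" using I(8) by (simp_all add: zbits_def h1s)
  have env1: "env r' h1" if "\<And>y. y < 9 \<Longrightarrow> r' y = r y" for r'
    using env that W61 by (auto simp: env_def h1_def nth_list_update)
  have em2: "emitted h2 (kept_before t)" using I(10) by (simp add: emitted_def h1s)
  show ?thesis unfolding merge_body_def wp.simps(2,5)
  proof (rule wp_next_node[OF t env I(8,4,5,1)])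
    fix r1 assume r1: "\<And>y. y \<notin> {11, 20, 21} \<Longrightarrow> r1 y = r y" "r1 20 = of_bool (active False ?e)"
      "r1 21 = of_bool (active True ?e)" "r1 11 = node_end (Suc t)"
    have e1: "env r1 h" using env r1(1) by (simp add: env_def)
    show "wp M head_prog (\<lambda>r h. wp M (take_prog False 20 12) (wp M (take_prog True 21 13)
        (wp M emit_prog (merge_inv (Suc t)))) (r(19 := eval_expr (word_size M) r (Const 0))) h) r1 h"
    proof (rule wp_head[OF t e1 r1(2,3)])
      fix r2 assume r2: "\<And>y. y \<notin> {15, 16} \<Longrightarrow> r2 y = r1 y" "r2 15 = snd ?e"
      let ?r2 = "r2(19 := eval_expr (word_size M) r2 (Const 0))"
      have e2: "env ?r2 h" using e1 r2(1) by (simp add: env_def)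
      show "wp M (take_prog False 20 12) (wp M (take_prog True 21 13) (wp M emit_prog (merge_inv (Suc t)))) ?r2 h"
      proof (rule wp_take[OF t e2 I(8), where s = ?l and g = False and d = 20 and er = 12, folded h1_def])
        fix r3 assume r3: "\<And>y. y \<notin> {14, 16, 17, 19, 20, 12} \<Longrightarrow> r3 y = ?r2 y" "r3 20 = of_bool (more False ?e)"
          "r3 12 = consumed False (Suc t)" "r3 19 = (if ?F \<and> \<not> repeated (slot ?l) then 1 else ?r2 19)"
        have e3: "env r3 h1" by (rule env1) (use r1(1) r2(1) r3(1) in auto)
        show "wp M (take_prog True 21 13) (wp M emit_prog (merge_inv (Suc t))) r3 h1"
        proof (rule wp_take[OF t e3 zb(1), where s = sT and g = True and d = 21 and er = 13, folded h2_def])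
          fix r4 assume r4: "\<And>y. y \<notin> {14, 16, 17, 19, 21, 13} \<Longrightarrow> r4 y = r3 y" "r4 21 = of_bool (more True ?e)"
            "r4 13 = consumed True (Suc t)" "r4 19 = (if ?T \<and> \<not> repeated (slot sT) then 1 else r3 19)"
          have vals: "r4 20 = of_bool (more False ?e)" "r4 15 = snd ?e" "r4 23 = kept_before t"
            "r4 22 = length (filter (last_entry XU) (take (kept_before t) EU))" "r4 19 = of_bool (first_edge XU ?e)"
            "r4 11 = node_end (Suc t)" "r4 12 = consumed False (Suc t)"
            using r4 r3 r2 r1 I(6,7) fe by auto
          show "wp M emit_prog (merge_inv (Suc t)) r4 h2"
          proof (rule wp_emit[OF t sig vals(1) r4(2) vals(2,5,3,4) em2])
            fix r5 h5 assume r5: "\<And>y. y \<notin> {17, 22, 23} \<Longrightarrow> r5 y = r4 y" "r5 23 = kept_before (Suc t)"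
              "r5 22 = length (filter (last_entry XU) (take (kept_before (Suc t)) EU))" "emitted h5 (kept_before (Suc t))"
              "\<And>a. a \<notin> {Out_W, Out_Wminus, Out_last} \<Longrightarrow> h5 a = h2 a"
            have "zbits h5" "cursors h5 (reps_before (Suc t))"
              using zb(2) cur2 r5(5) by (simp_all add: zbits_def cursors_def)
            then show "merge_inv (Suc t) r5 h5"
              using r5 vals r4(2,3) by (simp add: merge_inv_def)
          qed (use len EU_word h1s in auto)
        qed (use T r1 r2 r3 I(3) in auto)
      qed (use F r1 r2 I(2) in auto)
    qed (use r1 I(2,3) in auto)
  qed
qed

lemma merge_segs: "regs merge_body \<inter> {0, 1, 2, 3, 4, 5, 6, 7, 8} = {}"
    "segs merge_body \<subseteq> {Work_Words 6, Out_W, Out_Wminus, Out_last}"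
  by (auto simp: merge_body_def next_node_prog_def head_prog_def take_prog_def emit_prog_def)

lemma run_merge_prog:
  assumes env: "env r h" and sig: "1 \<le> \<sigma>" and zb: "zbits h"
    and len: "length (h Out_W) = length EU" "length (h Out_Wminus) = length EU" "length (h Out_last) = length EU"
  shows "run M merge_prog (r, h) (300 * m)
    (\<lambda>r' h'. r' 22 = card VU \<and> r' 23 = length EU \<and> h' Out_W = map snd EU \<and>
      h' Out_Wminus = map (\<lambda>e. of_bool (first_edge XU e)) EU \<and> h' Out_last = map (\<lambda>e. of_bool (last_entry XU e)) EU)"
proof -
  let ?S = "Assign 12 (Const 0);; Assign 13 (Const 0);; Assign 20 (Const 0);; Assign 21 (Const 0);;
     Assign 22 (Const 0);; Assign 23 (Const 0) :: segment com"
  let ?e = "(Reg 12 +\<^sub>e Reg 13) <\<^sub>e Reg 7"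
  let ?L = "Assign 11 (Const 0);; While ?e merge_body"
  let ?N = "length merged"
  have "run M merge_prog (r, h) ((40 * m + 40) + (12 + (2 + (?N * (steps merge_body + expr_cost ?e + 1) + expr_cost ?e + 1))))
    (\<lambda>r' h'. merge_inv ?N r' h' \<and> (\<forall>a. length (h' a) = length (h a)))"
    unfolding merge_prog_def
  proof (rule run_SeqA[OF env_reset[OF env]])
    fix r1 h1
    assume 1: "\<forall>c\<in>set labels. h1 (Work_Words 6) ! (c - 1) = z + length (filter (\<lambda>y. y < c) labels)"
      and a1: "agree (reset_prog 0) r h r1 h1"
    have env1: "env r1 h1" by (rule env_agree[OF env a1]) (auto simp: reset_prog_def reset_body_def)
    have w1: "h1 Work_Bits = h Work_Bits" "\<And>a. length (h1 a) = length (h a)"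
      using agree_seg[OF a1, of Work_Bits] agree_length[OF a1] by (auto simp: reset_prog_def reset_body_def)
    show "run M (?S;; ?L) (r1, h1) (12 + (2 + (?N * (steps merge_body + expr_cost ?e + 1) + expr_cost ?e + 1)))
      (\<lambda>r' h'. merge_inv ?N r' h' \<and> (\<forall>a. length (h' a) = length (h a)))"
    proof (rule run_SeqA)
      show "run M ?S (r1, h1) 12 (\<lambda>r' h'. r' 12 = 0 \<and> r' 13 = 0 \<and> r' 20 = 0 \<and> r' 21 = 0 \<and> r' 22 = 0 \<and> r' 23 = 0 \<and> h' = h1)"
        by (rule run_wp) simp_all
      fix r2 h2
      assume 2: "r2 12 = 0 \<and> r2 13 = 0 \<and> r2 20 = 0 \<and> r2 21 = 0 \<and> r2 22 = 0 \<and> r2 23 = 0 \<and> h2 = h1"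
        and a2: "agree ?S r1 h1 r2 h2"
      have env2: "env r2 h2" by (rule env_agree[OF env1 a2]) auto
      have pres: "env r' h'" if "agree ?L r2 h2 r' h'" for r' h'
        by (rule env_agree[OF env2 that]) (use merge_segs in auto)
      have l2: "length (h' a) = length (h a)" if "agree ?L r2 h2 r' h'" for r' h' a
        using agree_length[OF that, of a] w1(2) 2 by simp
      have "run M ?L (r2, h2) (2 + (?N * (steps merge_body + expr_cost ?e + 1) + expr_cost ?e + 1)) (merge_inv ?N)"
      proof (rule run_for[where I = merge_inv and N = ?N], goal_cases)
        case 1
        show ?case using 2 \<open>\<forall>c\<in>set labels. h1 (Work_Words 6) ! (c - 1) = _\<close> zb w1(1)
          by (simp add: merge_inv_def node_end_def consumed_def kept_before_def zbits_def cursors_def reps_before_def emitted_def)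
      next
        case (2 t r' h')
        note p = pres[OF 2(2)]
        have "wp M merge_body (merge_inv (Suc t)) r' h'"
          by (rule wp_merge_body[OF 2(1) sig p 2(3)]) (use l2[OF 2(2)] len in auto)
        moreover have "eval_expr (word_size M) r' ?e \<noteq> 0"
          using p 2(3) consumed_sum_less[OF 2(1)] m_word by (simp add: env_def merge_inv_def apply_binop_simps)
        ultimately show ?case by (blast intro: wp_run)
      next
        case (3 r' h')
        have "r' 12 + r' 13 = m" using 3(2) by (simp add: merge_inv_def consumed_full m_def)
        then show ?case using pres[OF 3(1)] m_word by (simp add: env_def apply_binop_simps)
      qed
      then show "run M ?L (r2, h2) (2 + (?N * (steps merge_body + expr_cost ?e + 1) + expr_cost ?e + 1))
        (\<lambda>r' h'. merge_inv ?N r' h' \<and> (\<forall>a. length (h' a) = length (h a)))"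
        by (rule run_for_mono) (use l2 in auto)
    qed
  qed
  then show ?thesis
  proof (rule run_mono)
    have "?N \<le> m" using length_merged by (simp add: m_def)
    then show "(40 * m + 40) + (12 + (2 + (?N * (steps merge_body + expr_cost ?e + 1) + expr_cost ?e + 1))) \<le> 300 * m"
      using m_pos by (simp add: merge_body_def next_node_prog_def head_prog_def take_prog_def emit_prog_def)
    fix r' h'
    assume *: "merge_inv ?N r' h' \<and> (\<forall>a. length (h' a) = length (h a))"
    then have em: "emitted h' (length EU)" and r': "r' 23 = length EU" "r' 22 = length (filter (last_entry XU) EU)"
      by (auto simp: merge_inv_def kept_before_length)
    have "r' 22 = card VU" using r'(2) U.count_last_entries by simp
    moreover have "h' Out_W = map snd EU" "h' Out_Wminus = map (\<lambda>e. of_bool (first_edge XU e)) EU"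
      "h' Out_last = map (\<lambda>e. of_bool (last_entry XU e)) EU"
      using em * len by (auto intro!: nth_equalityI simp: emitted_def)
    ultimately show "r' 22 = card VU \<and> r' 23 = length EU \<and> h' Out_W = map snd EU \<and>
      h' Out_Wminus = map (\<lambda>e. of_bool (first_edge XU e)) EU \<and> h' Out_last = map (\<lambda>e. of_bool (last_entry XU e)) EU"
      using r'(1) by blast
  qed
qed

end

section \<open>Computing the LCS values\<close>

text \<open>Register \<open>13\<close> holds the start of the current block, register
  \<open>19\<close> that of the last flagged edge with the same label. A boundary arises where they
  differ; comparing the result of the equality with \<open>0\<close> negates it.\<close>

definition boundary_body :: "segment com" where
  "boundary_body =
    Load 14 Work_Bits (Reg 11);; If (Reg 14) (Assign 13 (Reg 11)) Skip;;
    Load 15 Out_W (Reg 12);; Load 16 Out_Wminus (Reg 12);; Load 17 Out_last (Reg 12);;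
    If (Reg 16)
      (Load 18 (Work_Words 6) (Reg 15 -\<^sub>e Const 1);;
       Load 19 (Work_Words 7) (Reg 15 -\<^sub>e Const 1);;
       Store Work_Bits (Reg 6 +\<^sub>e Reg 18) ((Reg 19 =\<^sub>e Reg 13) =\<^sub>e Const 0);;
       Store (Work_Words 6) (Reg 15 -\<^sub>e Const 1) (Reg 18 +\<^sub>e Const 1);;
       Store (Work_Words 7) (Reg 15 -\<^sub>e Const 1) (Reg 13))
      Skip;;
    Assign 12 (Reg 12 +\<^sub>e Const 1);;
    Assign 11 (Reg 11 +\<^sub>e Reg 17)"

definition boundary_loop :: "segment com" where
  "boundary_loop = Assign 12 (Const 0);; While (Reg 12 <\<^sub>e Reg 23) boundary_body"

text \<open>The LCS value of node \<open>i\<close> is stored at index \<open>i - 1\<close>; the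
  first node is always a boundary, so the subtraction never starts from \<open>0\<close>.\<close>

definition update_body :: "segment com" where
  "update_body =
    Load 14 Work_Bits (Reg 6 +\<^sub>e Reg 11);; Store Work_Bits (Reg 11) (Reg 14);;
    If (Reg 14) Skip
      (Load 15 Out_lcs (Reg 11 -\<^sub>e Const 1);; Store Out_lcs (Reg 11 -\<^sub>e Const 1) (Reg 15 +\<^sub>e Const 1));;
    Assign 11 (Reg 11 +\<^sub>e Const 1)"

definition update_loop :: "segment com" where
  "update_loop = Assign 11 (Const 0);; While (Reg 11 <\<^sub>e Reg 22) update_body"

text \<open>No edge leads to the first node, so its boundary bit is set by hand.\<close>

definition lcs_pass_prog :: "segment com" where
  "lcs_pass_prog =
    reset_prog 3;;
    (Store Work_Bits (Reg 6) (Const 1);; Assign 11 (Const 0);; Assign 13 (Const 0));;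
    boundary_loop;; update_loop;; Assign 10 (Reg 10 +\<^sub>e Const 1)"

definition first_boundaries_loop :: "segment com" where
  "first_boundaries_loop = Assign 11 (Const 0);; While (Reg 11 <\<^sub>e Reg 22)
    (Store Work_Bits (Reg 11) (Reg 11 =\<^sub>e Const 0);; Assign 11 (Reg 11 +\<^sub>e Const 1))"

text \<open>The passes compute the boundaries for \<open>1\<close> to \<open>k - 1\<close> symbols;
  distinct nodes always differ within \<open>k\<close> symbols, so these suffice.\<close>

definition lcs_loop :: "segment com" where
  "lcs_loop = Assign 10 (Const 0);; While ((Reg 10 +\<^sub>e Const 1) <\<^sub>e Reg 0) lcs_pass_prog"

definition lcs_prog :: "nat \<Rightarrow> segment com" where
  "lcs_prog c =
    (Assign 8 (Const 0);; Assign 9 (Const 1));; count_prog Out_W Out_Wminus 23 3;; finish_prog c 3;;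
    first_boundaries_loop;; lcs_loop"

text \<open>\<open>N\<close> is the number of nodes of both inputs and fixes the middle of
  \<open>Work_Bits\<close>; the merged graph may have fewer nodes. As block starts are below
  \<open>card V \<le> N\<close>, the value \<open>N\<close> can stand for the absence of an earlier
  edge.\<close>

locale lcs_machine = graph k V X for k V X +
  fixes w \<sigma> N :: nat
  assumes w: "2 \<le> w" and \<sigma>_word: "\<sigma> < 2 ^ w" and k_word: "k < 2 ^ w"
    and label_le: "(x, a) \<in> X \<Longrightarrow> a \<le> \<sigma>"
    and nonempty: "V \<noteq> {}"
    and card_le: "card V \<le> N" and N_word: "2 * N < 2 ^ w"
    and size_word: "2 * length (entries V X) < 2 ^ w"
begin

abbreviation M where "M \<equiv> merge_machine w k \<sigma>"
abbreviation E where "E \<equiv> entries V X"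

definition labels :: "nat list" where "labels = map snd first_edges"

definition lenv :: "(nat \<Rightarrow> nat) \<Rightarrow> (segment \<Rightarrow> nat list) \<Rightarrow> bool" where
  "lenv r h \<longleftrightarrow> r 0 = k \<and> r 1 = \<sigma> \<and> r 6 = N \<and> r 22 = card V \<and> r 23 = length E \<and>
    h Out_W = map snd E \<and> h Out_Wminus = map (\<lambda>e. of_bool (first_edge X e)) E \<and>
    h Out_last = map (\<lambda>e. of_bool (last_entry X e)) E \<and>
    bucketed (h (Work_Words 4)) (r 8) (h (Work_Words 5)) labels 1 \<and>
    length (h (Work_Words 4)) = \<sigma> \<and> length (h (Work_Words 5)) = \<sigma> \<and>
    length (h (Work_Words 6)) = \<sigma> \<and> length (h (Work_Words 7)) = \<sigma> \<and>
    length (h Work_Bits) = 2 * N \<and> length (h Out_lcs) = card V - 1"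

lemma lenv_agree:
  assumes "lenv r h" "agree c r h r' h'" "regs c \<inter> {0, 1, 6, 8, 22, 23} = {}"
    and "segs c \<subseteq> {Work_Bits, Work_Words 6, Work_Words 7, Out_lcs}"
  shows "lenv r' h'"
proof -
  have "r' x = r x" if "x \<in> {0, 1, 6, 8, 22, 23}" for x
    using agree_reg[OF assms(2), of x] assms(3) that by blast
  moreover have "h' a = h a" if "a \<notin> {Work_Bits, Work_Words 6, Work_Words 7, Out_lcs}" for a
    using agree_seg[OF assms(2), of a] assms(4) that by blast
  moreover note agree_length[OF assms(2)]
  ultimately show ?thesis using assms(1) by (simp add: lenv_def)
qed

lemma one_mod: "1 mod 2 ^ w = (1::nat)"
  using w by simp

lemma length_node_list: "length node_list = card V"
  by simp

lemma card_V: "card V = Suc (length first_edges)"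
  by (rule length_first_edges[OF nonempty])

lemma card_V_le: "card V \<le> length E"
  using length_filter_le[of "last_entry X" E] by (simp add: count_last_entries)

lemma nth_first_edges:
  assumes "t < length E" "first_edge X (E ! t)"
  defines "s \<equiv> length (filter (first_edge X) (take t E))"
  shows "s < length first_edges" "first_edges ! s = E ! t" "take s first_edges = filter (first_edge X) (take t E)"
  using filter_nth_count[OF assms(1), of "first_edge X"] assms(2) take_filter[of s "first_edge X" t E]
  by (simp_all add: s_def first_edges_def)

lemma labels_bounds: "set labels \<subseteq> {1..\<sigma>}"
proof
  fix y assume "y \<in> set labels"
  then obtain x where "(x, y) \<in> X" using set_first_edges first_edge_in_X by (force simp: labels_def)
  then show "y \<in> {1..\<sigma>}" using edgeD label_le by auto
qed

definition node_index :: "nat \<Rightarrow> nat" where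
  "node_index t = length (filter (last_entry X) (take t E))"

definition firsts :: "nat \<Rightarrow> nat \<Rightarrow> (nat list \<times> nat) list" where
  "firsts c t = filter (\<lambda>e. snd e = c) (filter (first_edge X) (take t E))"

lemma node_index_Suc: "t < length E \<Longrightarrow> node_index (Suc t) = node_index t + of_bool (last_entry X (E ! t))"
  by (simp add: node_index_def take_Suc_conv_app_nth)

lemma firsts_Suc: "t < length E \<Longrightarrow>
    firsts c (Suc t) = firsts c t @ (if first_edge X (E ! t) \<and> snd (E ! t) = c then [E ! t] else [])"
  by (simp add: firsts_def take_Suc_conv_app_nth)

lemma node_index_less: "t < length E \<Longrightarrow> node_index t < card V"
  and nth_node_index: "t < length E \<Longrightarrow> node_list ! node_index t = fst (E ! t)"
  using entries_nth_node[of t] length_node_list by (simp_all add: node_index_def)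

lemma block_boundary:
  assumes "i < card V"
  shows "block h i = (if boundary h i then i else block h (i - 1))"
  using assms block_Suc[of "i - 1" h] block_le[of h 0] length_node_list by (cases i) auto

text \<open>The stored block is described through some index \<open>i\<close> of the source of the
  last edge, so that \<open>block_eq_iff\<close> turns equality of words into equality of
  prefixes.\<close>

definition pass_inv :: "nat \<Rightarrow> nat \<Rightarrow> (nat \<Rightarrow> nat) \<Rightarrow> (segment \<Rightarrow> nat list) \<Rightarrow> bool" where
  "pass_inv j t r h \<longleftrightarrow> r 12 = t \<and> r 11 = node_index t \<and>
    r 13 = (if t = 0 then 0 else block j (node_index (t - 1))) \<and>
    (\<forall>p<card V. h Work_Bits ! p = of_bool (boundary j p)) \<and>
    h Work_Bits ! N = 1 \<and>
    (\<forall>s<length (filter (first_edge X) (take t E)). h Work_Bits ! (N + Suc (rank snd first_edges s)) =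
      of_bool (boundary (Suc j) (Suc (rank snd first_edges s)))) \<and>
    (\<forall>c\<in>set labels. h (Work_Words 6) ! (c - 1) = 1 + length (filter (\<lambda>y. y < c) labels) + length (firsts c t) \<and>
      (if firsts c t = [] then h (Work_Words 7) ! (c - 1) = N
       else \<exists>i<card V. h (Work_Words 7) ! (c - 1) = block j i \<and> node_list ! i = fst (last (firsts c t))))"

lemma wp_boundary_body:
  assumes j: "j < k" and t: "t < length E" and env: "lenv r h" and inv: "pass_inv j t r h"
  shows "wp M boundary_body (pass_inv j (Suc t)) r h"
proof -
  let ?e = "E ! t" and ?i = "node_index t"
  have I: "r 12 = t" "r 11 = ?i" "r 13 = (if t = 0 then 0 else block j (node_index (t - 1)))"
    "\<And>p. p < card V \<Longrightarrow> h Work_Bits ! p = of_bool (boundary j p)" "h Work_Bits ! N = 1"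
    "\<And>s. s < length (filter (first_edge X) (take t E)) \<Longrightarrow> h Work_Bits ! (N + Suc (rank snd first_edges s)) =
      of_bool (boundary (Suc j) (Suc (rank snd first_edges s)))"
    "\<And>c. c \<in> set labels \<Longrightarrow> h (Work_Words 6) ! (c - 1) = 1 + length (filter (\<lambda>y. y < c) labels) + length (firsts c t)"
    "\<And>c. c \<in> set labels \<Longrightarrow> if firsts c t = [] then h (Work_Words 7) ! (c - 1) = N
       else \<exists>i<card V. h (Work_Words 7) ! (c - 1) = block j i \<and> node_list ! i = fst (last (firsts c t))"
    using inv unfolding pass_inv_def by blast+
  have e: "r 6 = N" "h Out_W = map snd E" "h Out_Wminus = map (\<lambda>e. of_bool (first_edge X e)) E"
    "h Out_last = map (\<lambda>e. of_bool (last_entry X e)) E" "length (h (Work_Words 6)) = \<sigma>" "length (h (Work_Words 7)) = \<sigma>"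
    "length (h Work_Bits) = 2 * N"
    using env by (simp_all add: lenv_def)
  have i: "?i < card V" by (rule node_index_less[OF t])
  have b: "h Work_Bits ! ?i = of_bool (boundary j ?i)" by (rule I(4)[OF i])
  \<comment> \<open>An entry advances the node by at most one, so without a boundary the block
    remembered from the preceding entry is still the current one.\<close>
  have old: "r 13 = block j ?i" if "\<not> boundary j ?i"
  proof -
    have "?i \<noteq> 0" using that by (auto simp: boundary_def)
    then obtain t' where t': "t = Suc t'" by (cases t) (auto simp: node_index_def)
    then have "?i = node_index t' \<or> ?i = Suc (node_index t')" using node_index_Suc[of t'] t by auto
    then show ?thesis using I(3) t' block_boundary[OF i, of j] that by auto
  qed
  have cur: "(if boundary j ?i then ?i else r 13) = block j ?i"
    using block_boundary[OF i, of j] old by simp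
  let ?r1 = "r(14 := of_bool (boundary j ?i), 13 := block j ?i, 15 := snd ?e, 16 := of_bool (first_edge X ?e),
    17 := of_bool (last_entry X ?e))"
  let ?P2 = "Assign 12 (Reg 12 +\<^sub>e Const 1);; Assign 11 (Reg 11 +\<^sub>e Reg 17) :: segment com"
  let ?P1 = "Load 18 (Work_Words 6) (Reg 15 -\<^sub>e Const 1);; Load 19 (Work_Words 7) (Reg 15 -\<^sub>e Const 1);;
       Store Work_Bits (Reg 6 +\<^sub>e Reg 18) ((Reg 19 =\<^sub>e Reg 13) =\<^sub>e Const 0);;
       Store (Work_Words 6) (Reg 15 -\<^sub>e Const 1) (Reg 18 +\<^sub>e Const 1);;
       Store (Work_Words 7) (Reg 15 -\<^sub>e Const 1) (Reg 13)"
  have step: "wp M (If (Reg 14) (Assign 13 (Reg 11)) Skip) Q (r(14 := of_bool (boundary j ?i))) h \<longleftrightarrow>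
      Q (r(14 := of_bool (boundary j ?i), 13 := block j ?i)) h" for Q
    using cur I(2) fun_upd_triv[of "r(14 := 0)" 13] by (cases "boundary j ?i") auto
  have start: "wp M (If (Reg 16) ?P1 Skip) (wp M ?P2 (pass_inv j (Suc t))) ?r1 h \<Longrightarrow> ?thesis"
    using I(1,2) b i e t card_le
    unfolding boundary_body_def wp.simps(5)
    by (simp add: step del: wp.simps(6) One_nat_def)
  have sums: "apply_binop w Add t 1 = Suc t"
    "apply_binop w Add ?i (of_bool (last_entry X ?e)) = node_index (Suc t)"
    using t size_word i card_V_le node_index_Suc[OF t] by (auto simp: apply_binop_Add)
  have fin: "wp M ?P2 (pass_inv j (Suc t)) r' h' \<longleftrightarrow> pass_inv j (Suc t) (r'(12 := Suc t, 11 := node_index (Suc t))) h'"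
    if "r' 12 = t" "r' 11 = ?i" "r' 17 = of_bool (last_entry X ?e)" for r' h'
    using that sums one_mod by (simp del: One_nat_def)
  show ?thesis
  proof (rule start, cases "first_edge X ?e")
    case False
    then have f: "firsts c (Suc t) = firsts c t" for c by (simp add: firsts_Suc[OF t])
    have f': "filter (first_edge X) (take (Suc t) E) = filter (first_edge X) (take t E)"
      using False t by (simp add: take_Suc_conv_app_nth)
    have "pass_inv j (Suc t) (?r1(12 := Suc t, 11 := node_index (Suc t))) h"
      using inv unfolding pass_inv_def f f' by (simp split del: if_split) blast
    then show "wp M (If (Reg 16) ?P1 Skip) (wp M ?P2 (pass_inv j (Suc t))) ?r1 h"
      using False fin[of ?r1 h] I(1,2) by simp
  next
    case True
    let ?a = "snd ?e"
    define s where "s = length (filter (first_edge X) (take t E))"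
    have s: "s < length first_edges" "first_edges ! s = ?e" "take s first_edges = filter (first_edge X) (take t E)"
      using nth_first_edges[OF t True] by (simp_all add: s_def)
    have fa: "firsts ?a t = filter (\<lambda>e. snd e = snd (first_edges ! s)) (take s first_edges)"
      by (simp add: firsts_def s(2,3))
    have al: "?a \<in> set labels" using s(1,2) nth_mem[OF s(1)] by (auto simp: labels_def)
    then have a: "?a \<in> {1..\<sigma>}" using labels_bounds by blast
    have w6: "h (Work_Words 6) ! (?a - 1) = Suc (rank snd first_edges s)"
      unfolding I(7)[OF al] by (simp add: rank_def fa s(2) labels_def filter_map comp_def)
    have rk: "Suc (rank snd first_edges s) < card V" using node_list_rank(1)[OF s(1)] length_node_list by simp
    let ?R = "Suc (rank snd first_edges s)" and ?L = "h (Work_Words 7) ! (?a - 1)"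
    \<comment> \<open>The condition of \<open>boundary_Suc\<close> in terms of the stored word: its
      initial value \<open>N\<close> differs from every block, as does the block of an edge whose
      source has another prefix.\<close>
    have bd: "boundary (Suc j) ?R \<longleftrightarrow> ?L \<noteq> block j ?i"
    proof -
      have 1: "boundary (Suc j) ?R \<longleftrightarrow> firsts ?a t = [] \<or> take j (fst (last (firsts ?a t))) \<noteq> take j (fst ?e)"
        using boundary_Suc[OF j s(1)] by (simp add: Let_def fa s(2))
      show ?thesis
      proof (cases "firsts ?a t = []")
        case True
        then have "?L = N" using I(8)[OF al] by simp
        moreover have "block j ?i < N" using block_le[of j ?i] i card_le by linarith
        ultimately show ?thesis using 1 True by simp
      next
        case False
        then obtain i' where i': "?L = block j i'" "node_list ! i' = fst (last (firsts ?a t))" using I(8)[OF al] by auto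
        have "block j i' = block j ?i \<longleftrightarrow> take j (fst (last (firsts ?a t))) = take j (fst ?e)"
          using block_eq_iff[of j i' ?i] nth_node_index[OF t] i'(2) by simp
        then show ?thesis using 1 False i'(1) by simp
      qed
    qed
    let ?r2 = "?r1(18 := ?R, 19 := ?L)"
    let ?h = "h(Work_Bits := (h Work_Bits)[N + ?R := of_bool (boundary (Suc j) ?R)],
      Work_Words 6 := (h (Work_Words 6))[?a - 1 := ?R + 1], Work_Words 7 := (h (Work_Words 7))[?a - 1 := block j ?i])"
    have bits: "N + ?R < 2 * N" "N + ?R < 2 ^ w" "?R + 1 < 2 ^ w" "block j ?i < 2 ^ w"
      using rk card_le N_word block_le[of j ?i] i by auto
    have sub: "apply_binop w Sub ?a 1 = ?a - 1" "?a - 1 < \<sigma>" using a \<sigma>_word by (auto simp: apply_binop_Sub)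
    have cmp: "apply_binop w Equal (apply_binop w Equal ?L (block j ?i)) 0 = of_bool (boundary (Suc j) ?R)"
      using bd by (simp add: apply_binop.simps)
    have "wp M ?P1 (wp M ?P2 (pass_inv j (Suc t))) ?r1 h \<longleftrightarrow> wp M ?P2 (pass_inv j (Suc t)) ?r2 ?h"
      using e w6 sub bits one_mod cmp by (simp add: apply_binop_Add del: One_nat_def)
    also have "\<dots> \<longleftrightarrow> pass_inv j (Suc t) (?r2(12 := Suc t, 11 := node_index (Suc t))) ?h"
      by (rule fin) (use I(1,2) in auto)
    also have "\<dots>"
    proof -
      have cnt: "length (filter (first_edge X) (take (Suc t) E)) = Suc s"
        using True t by (simp add: take_Suc_conv_app_nth s_def)
      have A: "?h Work_Bits ! p = of_bool (boundary j p)" if "p < card V" for p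
        using that card_le I(4) by simp
      have B: "?h Work_Bits ! (N + Suc (rank snd first_edges s')) = of_bool (boundary (Suc j) (Suc (rank snd first_edges s')))"
        if "s' < Suc s" for s'
      proof (cases "rank snd first_edges s' = rank snd first_edges s")
        case True
        then show ?thesis using e(7) bits(1) by simp
      next
        case False
        then have "s' < s" using that by (cases "s' = s") auto
        then show ?thesis using False I(6)[of s'] by (simp add: s_def)
      qed
      have C: "?h (Work_Words 6) ! (c - 1) = 1 + length (filter (\<lambda>y. y < c) labels) + length (firsts c (Suc t)) \<and>
          (if firsts c (Suc t) = [] then ?h (Work_Words 7) ! (c - 1) = N
           else \<exists>i<card V. ?h (Work_Words 7) ! (c - 1) = block j i \<and> node_list ! i = fst (last (firsts c (Suc t))))"
        if c: "c \<in> set labels" for c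
      proof (cases "c = ?a")
        case True
        have f: "firsts c (Suc t) = firsts c t @ [?e]" using True \<open>first_edge X ?e\<close> by (simp add: firsts_Suc[OF t])
        have "\<exists>i<card V. block j ?i = block j i \<and> node_list ! i = fst ?e" using i nth_node_index[OF t] by blast
        then show ?thesis using True f I(7)[OF c] w6 e(5,6) sub(2) by simp
      next
        case False
        have f: "firsts c (Suc t) = firsts c t" using False by (simp add: firsts_Suc[OF t])
        have "1 \<le> c" using c labels_bounds by auto
        then have "c - 1 \<noteq> ?a - 1" using False a by auto
        then show ?thesis using f I(7,8)[OF c] by (cases "firsts c t = []") simp_all
      qed
      show ?thesis
        unfolding pass_inv_def cnt
        by (intro conjI) (rule allI impI ballI A B C | assumption | simp add: I(5))+
    qed
    finally show "wp M (If (Reg 16) ?P1 Skip) (wp M ?P2 (pass_inv j (Suc t))) ?r1 h" using True by simp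
  qed
qed

definition bounded_bits :: "nat \<Rightarrow> (segment \<Rightarrow> nat list) \<Rightarrow> bool" where
  "bounded_bits j h \<longleftrightarrow> (\<forall>p<card V. h Work_Bits ! p = of_bool (boundary j p))"

definition lcs_upto :: "nat \<Rightarrow> nat \<Rightarrow> nat" where
  "lcs_upto j p = card {g \<in> {1..j}. \<not> boundary g p}"

lemma lcs_upto_Suc: "lcs_upto (Suc j) p = lcs_upto j p + of_bool (\<not> boundary (Suc j) p)"
proof -
  have "{g \<in> {1..Suc j}. \<not> boundary g p} =
      (if boundary (Suc j) p then {g \<in> {1..j}. \<not> boundary g p} else insert (Suc j) {g \<in> {1..j}. \<not> boundary g p})"
    by (auto simp: le_Suc_eq)
  then show ?thesis by (simp add: lcs_upto_def)
qed

lemma lcs_upto_le: "lcs_upto j p \<le> j"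
  unfolding lcs_upto_def by (rule order_trans[OF card_mono[of "{1..j}"]]) auto

definition lcs_done :: "nat \<Rightarrow> (segment \<Rightarrow> nat list) \<Rightarrow> bool" where
  "lcs_done j h \<longleftrightarrow> (\<forall>p<card V. 0 < p \<longrightarrow> h Out_lcs ! (p - 1) = lcs_upto j p)"

lemma run_boundary_loop:
  assumes j: "j < k" and env: "lenv r h" and r: "r 11 = 0" "r 13 = 0"
    and bits: "bounded_bits j h" "h Work_Bits ! N = 1"
    and cur: "\<forall>c\<in>set labels. h (Work_Words 6) ! (c - 1) = 1 + length (filter (\<lambda>y. y < c) labels) \<and>
      h (Work_Words 7) ! (c - 1) = N"
  shows "run M boundary_loop (r, h) (70 * length E + 70)
    (\<lambda>r' h'. \<forall>p<card V. h' Work_Bits ! (N + p) = of_bool (boundary (Suc j) p))"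
proof -
  let ?N = "length E"
  have "run M boundary_loop (r, h) (2 + (?N * (steps boundary_body + expr_cost (Reg 12 <\<^sub>e Reg 23) + 1) +
      expr_cost (Reg 12 <\<^sub>e Reg 23) + 1)) (pass_inv j ?N)"
    unfolding boundary_loop_def
  proof (rule run_for[where I = "pass_inv j" and N = ?N], goal_cases)
    case 1
    show ?case using r bits cur by (simp add: pass_inv_def node_index_def firsts_def bounded_bits_def)
  next
    case (2 t r' h')
    have env': "lenv r' h'" by (rule lenv_agree[OF env 2(2)]) (auto simp: boundary_body_def)
    show ?case using wp_boundary_body[OF j 2(1) env' 2(3)] 2 env'
      by (auto simp: pass_inv_def lenv_def apply_binop_simps intro: wp_run)
  next
    case (3 r' h')
    have "lenv r' h'" by (rule lenv_agree[OF env 3(1)]) (auto simp: boundary_body_def)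
    then show ?case using 3(2) by (simp add: pass_inv_def lenv_def apply_binop_simps)
  qed
  then show ?thesis
  proof (rule run_mono)
    fix r' h' assume I: "pass_inv j ?N r' h'"
    show "\<forall>p<card V. h' Work_Bits ! (N + p) = of_bool (boundary (Suc j) p)"
    proof (intro allI impI)
      fix p assume p: "p < card V"
      show "h' Work_Bits ! (N + p) = of_bool (boundary (Suc j) p)"
      proof (cases p)
        case 0
        then show ?thesis using I by (simp add: pass_inv_def boundary_def)
      next
        case (Suc q)
        then have "q < length first_edges" using p card_V by simp
        then obtain s where "s < length first_edges" "rank snd first_edges s = q" using rank_surj by blast
        then show ?thesis using I Suc by (auto simp: pass_inv_def first_edges_def)
      qed
    qed
  qed (simp add: boundary_body_def)
qed

lemma run_update_loop:
  assumes j: "Suc j < k" and env: "lenv r h" and lcs: "lcs_done j h"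
    and new: "\<And>p. p < card V \<Longrightarrow> h Work_Bits ! (N + p) = of_bool (boundary (Suc j) p)"
  shows "run M update_loop (r, h) (50 * card V + 50) (\<lambda>r' h'. bounded_bits (Suc j) h' \<and> lcs_done (Suc j) h')"
proof -
  let ?N = "card V"
  let ?I = "\<lambda>i (r'::nat \<Rightarrow> nat) h'. r' 11 = i \<and> (\<forall>p<i. h' Work_Bits ! p = of_bool (boundary (Suc j) p)) \<and>
    (\<forall>p<?N. h' Work_Bits ! (N + p) = of_bool (boundary (Suc j) p)) \<and>
    (\<forall>p<?N. 0 < p \<longrightarrow> h' Out_lcs ! (p - 1) = lcs_upto (if p < i then Suc j else j) p)"
  have "run M update_loop (r, h) (2 + (?N * (steps update_body + expr_cost (Reg 11 <\<^sub>e Reg 22) + 1) +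
      expr_cost (Reg 11 <\<^sub>e Reg 22) + 1)) (?I ?N)"
    unfolding update_loop_def
  proof (rule run_for[where I = ?I and N = ?N], goal_cases)
    case 1
    show ?case using new lcs by (simp add: lcs_done_def)
  next
    case (2 i r' h')
    have env': "lenv r' h'" by (rule lenv_agree[OF env 2(2)]) (auto simp: update_body_def)
    then have e: "r' 6 = N" "r' 22 = ?N" "length (h' Work_Bits) = 2 * N" "length (h' Out_lcs) = ?N - 1"
      by (simp_all add: lenv_def)
    have I: "r' 11 = i" "\<And>p. p < i \<Longrightarrow> h' Work_Bits ! p = of_bool (boundary (Suc j) p)"
      "\<And>p. p < ?N \<Longrightarrow> h' Work_Bits ! (N + p) = of_bool (boundary (Suc j) p)"
      "\<And>p. p < ?N \<Longrightarrow> 0 < p \<Longrightarrow> h' Out_lcs ! (p - 1) = lcs_upto (if p < i then Suc j else j) p"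
      using 2(3) by simp_all
    have i: "N + i < 2 * N" "i < 2 * N" "N + i < 2 ^ w" "i + 1 < 2 ^ w" "i < ?N" using 2(1) card_le N_word by auto
    let ?h = "h'(Work_Bits := (h' Work_Bits)[i := of_bool (boundary (Suc j) i)])"
    have bits: "(\<forall>p<Suc i. ?h Work_Bits ! p = of_bool (boundary (Suc j) p)) \<and>
      (\<forall>p<?N. ?h Work_Bits ! (N + p) = of_bool (boundary (Suc j) p))"
      using I(2,3) i e(3) card_le by (auto simp: less_Suc_eq)
    have "wp M update_body (?I (Suc i)) r' h'"
    proof (cases "boundary (Suc j) i")
      case True
      then have "?I (Suc i) (r'(14 := 1, 11 := i + 1)) ?h"
        using bits I(4) lcs_upto_Suc[of j i] by (auto simp: less_Suc_eq)
      then show ?thesis using True e I(1,3) i one_mod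
        by (simp add: update_body_def apply_binop_Add del: One_nat_def)
    next
      case False
      then have i0: "0 < i" by (auto simp: boundary_def)
      have old: "h' Out_lcs ! (i - 1) = lcs_upto j i" using I(4)[of i] i0 i by simp
      have "lcs_upto j i + 1 < k" using lcs_upto_le[of j i] j by simp
      \<comment> \<open>At most \<open>j\<close> passes have counted so far and
        \<open>Suc j < k\<close>, so the incremented value fits into a field for
        \<open>k - 1\<close>.\<close>
      then have small: "lcs_upto j i + 1 < 2 ^ w" "lcs_upto j i + 1 < 2 ^ floorlog 2 (k - 1)"
        using k_word less_power_floorlog[of "k - 1" "lcs_upto j i + 1"] j by auto
      have sub: "apply_binop w Sub i 1 = i - 1" using i0 i by (simp add: apply_binop_Sub)
      have il: "i - 1 < ?N - 1" using i0 i by simp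
      let ?h2 = "?h(Out_lcs := (h' Out_lcs)[i - 1 := lcs_upto j i + 1])"
      have "?I (Suc i) (r'(14 := 0, 15 := lcs_upto j i, 11 := i + 1)) ?h2"
      proof -
        have "?h2 Out_lcs ! (p - 1) = lcs_upto (if p < Suc i then Suc j else j) p" if "p < ?N" "0 < p" for p
        proof (cases "p = i")
          case True
          then show ?thesis using il e(4) False by (simp add: lcs_upto_Suc)
        next
          case False
          then have "i - 1 \<noteq> p - 1" using i0 that(2) by arith
          then show ?thesis using I(4)[OF that] False by (simp add: less_Suc_eq)
        qed
        then show ?thesis using bits by simp
      qed
      then show ?thesis using False e I(1,3) i one_mod small sub il old
        by (simp add: update_body_def apply_binop_Add del: One_nat_def)
    qed
    then have "run M update_body (r', h') (steps update_body) (?I (Suc i))" by (rule wp_run)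
    moreover have "eval_expr (word_size M) r' (Reg 11 <\<^sub>e Reg 22) \<noteq> 0"
      using e I(1) 2(1) by (simp add: apply_binop_simps)
    ultimately show ?case by blast
  next
    case (3 r' h')
    have "lenv r' h'" by (rule lenv_agree[OF env 3(1)]) (auto simp: update_body_def)
    then show ?case using 3(2) by (simp add: lenv_def apply_binop_simps)
  qed
  then show ?thesis
    by (rule run_mono) (auto simp: update_body_def bounded_bits_def lcs_done_def)
qed

lemma labels_length: "Suc (length labels) = card V"
  by (simp add: labels_def card_V)

lemma run_lcs_pass_prog:
  assumes j: "Suc j < k" and env: "lenv r h" and r: "r 10 = j"
    and bits: "bounded_bits j h" and lcs: "lcs_done j h"
  shows "run M lcs_pass_prog (r, h) (400 * length E)
    (\<lambda>r' h'. r' 10 = Suc j \<and> bounded_bits (Suc j) h' \<and> lcs_done (Suc j) h')"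
proof -
  let ?S = "Store Work_Bits (Reg 6) (Const 1);; Assign 11 (Const 0);; Assign 13 (Const 0) :: segment com"
  let ?C = "\<lambda>h. \<forall>c\<in>set labels. h (Work_Words 6) ! (c - 1) = 1 + length (filter (\<lambda>y. y < c) labels) \<and>
      h (Work_Words 7) ! (c - 1) = N"
  let ?T = "(40 * length labels + 40) + (9 + ((70 * length E + 70) + ((50 * card V + 50) + 4)))"
  have N: "0 < N" using card_V card_le by simp
  have "run M lcs_pass_prog (r, h) ?T (\<lambda>r' h'. r' 10 = Suc j \<and> bounded_bits (Suc j) h' \<and> lcs_done (Suc j) h')"
    unfolding lcs_pass_prog_def
  proof (rule run_SeqA)
    have b: "bucketed (h (Work_Words (3 + 1))) (r 8) (h (Work_Words (3 + 2))) labels 1" using env by (simp add: lenv_def)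
    show "run M (reset_prog 3) (r, h) (40 * length labels + 40) (\<lambda>r' h'. ?C h')"
      using run_reset_prog[where q = 3 and h = h and r = r, OF w \<sigma>_word b labels_bounds] env N_word labels_length card_le by (simp add: lenv_def)
    fix r1 h1
    assume c1: "?C h1" and a1: "agree (reset_prog 3) r h r1 h1"
    have e1: "lenv r1 h1" by (rule lenv_agree[OF env a1]) (auto simp: reset_prog_def reset_body_def)
    have eq1: "r1 10 = j" "h1 Work_Bits = h Work_Bits" "h1 Out_lcs = h Out_lcs"
      using agree_reg[OF a1, of 10] agree_seg[OF a1, of Work_Bits] agree_seg[OF a1, of Out_lcs] r
      by (auto simp: reset_prog_def reset_body_def)
    show "run M (?S;; boundary_loop;; update_loop;; Assign 10 (Reg 10 +\<^sub>e Const 1)) (r1, h1)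
      (9 + ((70 * length E + 70) + ((50 * card V + 50) + 4)))
      (\<lambda>r' h'. r' 10 = Suc j \<and> bounded_bits (Suc j) h' \<and> lcs_done (Suc j) h')"
    proof (rule run_SeqA)
      have "wp M ?S (\<lambda>r' h'. r' 11 = 0 \<and> r' 13 = 0 \<and> h' = h1(Work_Bits := (h1 Work_Bits)[N := 1])) r1 h1"
        using e1 N one_mod by (simp add: lenv_def)
      then show "run M ?S (r1, h1) 9 (\<lambda>r' h'. r' 11 = 0 \<and> r' 13 = 0 \<and> h' = h1(Work_Bits := (h1 Work_Bits)[N := 1]))"
        by (rule run_wp) simp
      fix r2 h2
      assume 2: "r2 11 = 0 \<and> r2 13 = 0 \<and> h2 = h1(Work_Bits := (h1 Work_Bits)[N := 1])" and a2: "agree ?S r1 h1 r2 h2"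
      have e2: "lenv r2 h2" by (rule lenv_agree[OF e1 a2]) auto
      have r2: "r2 10 = j" using agree_reg[OF a2, of 10] eq1 by simp
      show "run M (boundary_loop;; update_loop;; Assign 10 (Reg 10 +\<^sub>e Const 1)) (r2, h2)
        ((70 * length E + 70) + ((50 * card V + 50) + 4))
        (\<lambda>r' h'. r' 10 = Suc j \<and> bounded_bits (Suc j) h' \<and> lcs_done (Suc j) h')"
      proof (rule run_SeqA[OF run_boundary_loop[OF _ e2]])
        show "j < k" using j by simp
        show "r2 11 = 0" "r2 13 = 0" using 2 by auto
        show "bounded_bits j h2" using 2 eq1 bits card_le by (simp add: bounded_bits_def)
        show "h2 Work_Bits ! N = 1" using 2 e1 N by (simp add: lenv_def)
        show "?C h2" using 2 c1 by simp
        fix r3 h3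
        assume new: "\<forall>p<card V. h3 Work_Bits ! (N + p) = of_bool (boundary (Suc j) p)"
          and a3: "agree boundary_loop r2 h2 r3 h3"
        have e3: "lenv r3 h3" by (rule lenv_agree[OF e2 a3]) (auto simp: boundary_loop_def boundary_body_def)
        have eq3: "r3 10 = j" "h3 Out_lcs = h Out_lcs"
          using agree_reg[OF a3, of 10] agree_seg[OF a3, of Out_lcs] r2 2 eq1
          by (auto simp: boundary_loop_def boundary_body_def)
        show "run M (update_loop;; Assign 10 (Reg 10 +\<^sub>e Const 1)) (r3, h3) ((50 * card V + 50) + 4)
          (\<lambda>r' h'. r' 10 = Suc j \<and> bounded_bits (Suc j) h' \<and> lcs_done (Suc j) h')"
        proof (rule run_SeqA[OF run_update_loop[OF j e3]])
          show "lcs_done j h3" using lcs eq3 by (simp add: lcs_done_def)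
          show "\<And>p. p < card V \<Longrightarrow> h3 Work_Bits ! (N + p) = of_bool (boundary (Suc j) p)" using new by blast
          fix r4 h4
          assume 4: "bounded_bits (Suc j) h4 \<and> lcs_done (Suc j) h4" and a4: "agree update_loop r3 h3 r4 h4"
          have "r4 10 = j" using agree_reg[OF a4, of 10] eq3 by (auto simp: update_loop_def update_body_def)
          then show "run M (Assign 10 (Reg 10 +\<^sub>e Const 1)) (r4, h4) 4
            (\<lambda>r' h'. r' 10 = Suc j \<and> bounded_bits (Suc j) h' \<and> lcs_done (Suc j) h')"
            by (intro run_wp) (use 4 j k_word one_mod in \<open>simp_all add: apply_binop_Add\<close>)
        qed
      qed
    qed
  qed
  then show ?thesis
    by (rule run_mono) (use card_V_le labels_length in linarith)+
qed

lemma run_first_boundaries_loop: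
  assumes env: "lenv r h"
  shows "run M first_boundaries_loop (r, h) (20 * card V + 20) (\<lambda>r' h'. bounded_bits 0 h')"
proof -
  let ?b = "Store Work_Bits (Reg 11) (Reg 11 =\<^sub>e Const 0);; Assign 11 (Reg 11 +\<^sub>e Const 1) :: segment com"
  let ?I = "\<lambda>i (r'::nat \<Rightarrow> nat) h'. r' 11 = i \<and> (\<forall>p<i. h' Work_Bits ! p = of_bool (boundary 0 p))"
  let ?N = "card V"
  have "run M first_boundaries_loop (r, h) (2 + (?N * (steps ?b + expr_cost (Reg 11 <\<^sub>e Reg 22) + 1) +
      expr_cost (Reg 11 <\<^sub>e Reg 22) + 1)) (?I ?N)"
    unfolding first_boundaries_loop_def
  proof (rule run_for[where I = ?I and N = ?N], goal_cases)
    case 1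
    show ?case by simp
  next
    case (2 i r' h')
    have "lenv r' h'" by (rule lenv_agree[OF env 2(2)]) auto
    then have e: "r' 22 = ?N" "length (h' Work_Bits) = 2 * N" by (simp_all add: lenv_def)
    have i: "i < 2 * N" "i + 1 < 2 ^ w" using 2(1) card_le N_word by auto
    have "wp M ?b (?I (Suc i)) r' h'"
      using 2(3) e i one_mod
      by (auto simp: apply_binop_Add apply_binop.simps(12) boundary_0 less_Suc_eq simp del: One_nat_def)
    then have "run M ?b (r', h') (steps ?b) (?I (Suc i))" by (rule wp_run)
    moreover have "eval_expr (word_size M) r' (Reg 11 <\<^sub>e Reg 22) \<noteq> 0"
      using e 2(1,3) by (simp add: apply_binop_simps)
    ultimately show ?case by blast
  next
    case (3 r' h')
    have "lenv r' h'" by (rule lenv_agree[OF env 3(1)]) auto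
    then show ?case using 3(2) by (simp add: lenv_def apply_binop_simps)
  qed
  then show ?thesis by (rule run_mono) (auto simp: bounded_bits_def)
qed

lemma run_lcs_loop:
  assumes env: "lenv r h" and bits: "bounded_bits 0 h" and lcs: "lcs_done 0 h"
  shows "run M lcs_loop (r, h) (500 * (length E * k)) (\<lambda>r' h'. lcs_done (k - 1) h')"
proof -
  let ?I = "\<lambda>j (r'::nat \<Rightarrow> nat) h'. r' 10 = j \<and> bounded_bits j h' \<and> lcs_done j h'"
  let ?e = "(Reg 10 +\<^sub>e Const 1) <\<^sub>e Reg 0"
  have "run M lcs_loop (r, h) (2 + ((k - 1) * (400 * length E + expr_cost ?e + 1) + expr_cost ?e + 1)) (?I (k - 1))"
    unfolding lcs_loop_def
  proof (rule run_for[where I = ?I and N = "k - 1"], goal_cases)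
    case 1
    show ?case using bits lcs by simp
  next
    case (2 j r' h')
    note defs = lcs_pass_prog_def reset_prog_def reset_body_def boundary_loop_def boundary_body_def update_loop_def update_body_def
    have env': "lenv r' h'" by (rule lenv_agree[OF env 2(2)]) (auto simp: defs)
    have j: "Suc j < k" using 2(1) by simp
    have "run M lcs_pass_prog (r', h') (400 * length E) (?I (Suc j))"
      by (rule run_lcs_pass_prog[OF j env']) (use 2(3) in auto)
    moreover have "eval_expr (word_size M) r' ?e \<noteq> 0"
      using env' 2(3) j k_word one_mod by (simp add: lenv_def apply_binop_simps del: One_nat_def)
    ultimately show ?case by blast
  next
    case (3 r' h')
    note defs = lcs_pass_prog_def reset_prog_def reset_body_def boundary_loop_def boundary_body_def update_loop_def update_body_def
    have "lenv r' h'" by (rule lenv_agree[OF env 3(1)]) (auto simp: defs)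
    then show ?case using 3(2) k_pos k_word one_mod by (simp add: lenv_def apply_binop_simps del: One_nat_def)
  qed
  then show ?thesis
  proof (rule run_mono)
    have "1 \<le> length E" using card_V_le card_V by simp
    obtain k' where k': "k = Suc k'" using k_pos by (cases k) auto
    have "k' * (400 * length E + 6) \<le> k' * (500 * length E)" using \<open>1 \<le> length E\<close> by (intro mult_le_mono2) simp
    moreover have "500 * (length E * k) = k' * (500 * length E) + 500 * length E" by (simp add: k' algebra_simps)
    moreover have "2 + ((k - 1) * (400 * length E + expr_cost ?e + 1) + expr_cost ?e + 1) = k' * (400 * length E + 6) + 8"
      by (simp add: k' algebra_simps)
    ultimately show "2 + ((k - 1) * (400 * length E + expr_cost ?e + 1) + expr_cost ?e + 1) \<le> 500 * (length E * k)"
      using \<open>1 \<le> length E\<close> by linarith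
  qed simp
qed

lemma run_lcs_prog:
  assumes \<sigma>: "\<sigma> \<le> w ^ c"
    and r: "r 0 = k" "r 1 = \<sigma>" "r 6 = N" "r 22 = card V" "r 23 = length E"
    and h: "h Out_W = map snd E" "h Out_Wminus = map (\<lambda>e. of_bool (first_edge X e)) E"
      "h Out_last = map (\<lambda>e. of_bool (last_entry X e)) E" "h Out_lcs = replicate (card V - 1) 0"
      "length (h Work_Bits) = 2 * N" "h (Work_Words 3) = replicate \<sigma> 0" "\<And>j. j \<in> {4..8} \<Longrightarrow> length (h (Work_Words j)) = \<sigma>"
  shows "run M (lcs_prog c) (r, h) ((sort_cost c + 1000) * (length E * k))
    (\<lambda>r' h'. h' Out_lcs = map (\<lambda>p. card {g \<in> {1..<k}. \<not> boundary g p}) [1..<card V])"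
proof -
  let ?A = "Assign 8 (Const 0);; Assign 9 (Const 1) :: segment com"
  let ?e = "length E"
  let ?T = "4 + ((100 * ?e + 100) + ((sort_cost c + 60) * (length labels + 1) + ((20 * card V + 20) + 500 * (?e * k))))"
  note fb = regs_finish_prog[of c 3] segs_finish_prog[of c 3]
  have labels_word: "length labels < 2 ^ (w - 1)" "1 + length labels < 2 ^ w"
  proof -
    have "2 ^ w = 2 * (2::nat) ^ (w - 1)" using w by (simp add: power_eq_if)
    then show "length labels < 2 ^ (w - 1)" using size_word card_V_le labels_length by linarith
    show "1 + length labels < 2 ^ w" using size_word card_V_le labels_length by linarith
  qed
  have "run M (lcs_prog c) (r, h) ?T (\<lambda>r' h'. lcs_done (k - 1) h' \<and> length (h' Out_lcs) = card V - 1)"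
    unfolding lcs_prog_def
  proof (rule run_SeqA)
    show "run M ?A (r, h) 4 (\<lambda>r' h'. r' = r(8 := 0, 9 := 1) \<and> h' = h)"
      by (rule run_wp) (use one_mod in simp_all)
    fix r1 h1 assume 1: "r1 = r(8 := 0, 9 := 1) \<and> h1 = h"
    show "run M (count_prog Out_W Out_Wminus 23 3;; finish_prog c 3;; first_boundaries_loop;; lcs_loop) (r1, h1)
      ((100 * ?e + 100) + ((sort_cost c + 60) * (length labels + 1) + ((20 * card V + 20) + 500 * (?e * k))))
      (\<lambda>r' h'. lcs_done (k - 1) h' \<and> length (h' Out_lcs) = card V - 1)"
    proof (rule run_SeqA)
      have "counted \<sigma> (h1 (Work_Words 3)) (h1 (Work_Words (3 + 1))) (r1 8) []"
        using 1 h(6) h(7)[of 4] by (auto simp: counted_def)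
      moreover have "snd e \<in> {1..\<sigma>}" if "first_edge X e" for e
        using first_edge_in_X[of e] that edgeD[of "fst e" "snd e"] label_le[of "fst e" "snd e"] by simp
      ultimately show "run M (count_prog Out_W Out_Wminus 23 3) (r1, h1) (100 * ?e + 100)
        (\<lambda>r' h'. counted \<sigma> (h' (Work_Words 3)) (h' (Work_Words (3 + 1))) (r' 8) ([] @ map snd (filter (first_edge X) E)))"
        by (intro run_count_prog) (use 1 r h w \<sigma>_word size_word in auto)
      fix r2 h2
      assume c2: "counted \<sigma> (h2 (Work_Words 3)) (h2 (Work_Words (3 + 1))) (r2 8) ([] @ map snd (filter (first_edge X) E))"
        and a2: "agree (count_prog Out_W Out_Wminus 23 3) r1 h1 r2 h2"
      note cp = count_prog_def count_body_def
      have r2: "r2 x = r1 x" if "x \<in> {0, 1, 6, 9, 22, 23}" for x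
        by (rule agree_reg[OF a2]) (use that in \<open>auto simp: cp\<close>)
      have h2: "h2 a = h a" if "a \<in> {Out_W, Out_Wminus, Out_last, Out_lcs}" for a
        using agree_seg[OF a2, of a] that 1 by (auto simp: cp)
      have l2: "length (h2 a) = length (h a)" for a using agree_length[OF a2] 1 by simp
      show "run M (finish_prog c 3;; first_boundaries_loop;; lcs_loop) (r2, h2)
        ((sort_cost c + 60) * (length labels + 1) + ((20 * card V + 20) + 500 * (?e * k)))
        (\<lambda>r' h'. lcs_done (k - 1) h' \<and> length (h' Out_lcs) = card V - 1)"
      proof (rule run_SeqA[OF run_finish_prog[where ys = labels]])
        show "2 \<le> w" "\<sigma> < 2 ^ w" "\<sigma> \<le> w ^ c" by (fact w \<sigma>_word \<sigma>)+
        show "r2 1 = \<sigma>" using r2[of 1] 1 r by simp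
        show "counted \<sigma> (h2 (Work_Words 3)) (h2 (Work_Words (3 + 1))) (r2 8) labels"
          using c2 by (simp add: labels_def first_edges_def)
        show "r2 9 + length labels < 2 ^ w" "length labels < 2 ^ (w - 1)" using r2[of 9] 1 labels_word by simp_all
        show "length (h2 (Work_Words 8)) = \<sigma>" "length (h2 (Work_Words (3 + 2))) = \<sigma>" using l2 h(7)[of 8] h(7)[of 5] by simp_all
        show "3 + 2 < (8::nat)" by simp
        fix r3 h3
        assume b3: "bucketed (h3 (Work_Words (3 + 1))) (r3 8) (h3 (Work_Words (3 + 2))) labels (r2 9)"
          and a3: "agree (finish_prog c 3) r2 h2 r3 h3"
        have r3: "r3 x = r x" if "x \<in> {0, 1, 6, 22, 23}" for x
        proof -
          have "x \<notin> regs (finish_prog c 3)" using fb(1) that by auto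
          then show ?thesis using agree_reg[OF a3, of x] r2[of x] that 1 by auto
        qed
        have h3: "h3 a = h a" if "a \<in> {Out_W, Out_Wminus, Out_last, Out_lcs}" for a
        proof -
          have "a \<notin> segs (finish_prog c 3)" using fb(2) that by auto
          then show ?thesis using agree_seg[OF a3, of a] h2[OF that] by simp
        qed
        have l3: "length (h3 a) = length (h a)" for a using agree_length[OF a3] l2 by simp
        have e3: "lenv r3 h3"
          using r3 h3 l3 r h b3 r2[of 9] 1 by (simp add: lenv_def)
        show "run M (first_boundaries_loop;; lcs_loop) (r3, h3) ((20 * card V + 20) + 500 * (?e * k))
          (\<lambda>r' h'. lcs_done (k - 1) h' \<and> length (h' Out_lcs) = card V - 1)"
        proof (rule run_SeqA[OF run_first_boundaries_loop[OF e3]])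
          fix r4 h4
          assume b4: "bounded_bits 0 h4" and a4: "agree first_boundaries_loop r3 h3 r4 h4"
          have e4: "lenv r4 h4" by (rule lenv_agree[OF e3 a4]) (auto simp: first_boundaries_loop_def)
          have "h4 Out_lcs = h Out_lcs" using agree_seg[OF a4, of Out_lcs] h3[of Out_lcs] by (simp add: first_boundaries_loop_def)
          then have "lcs_done 0 h4" using h(4) by (simp add: lcs_done_def lcs_upto_def)
          from run_agree[OF run_lcs_loop[OF e4 b4 this]]
          show "run M lcs_loop (r4, h4) (500 * (?e * k)) (\<lambda>r' h'. lcs_done (k - 1) h' \<and> length (h' Out_lcs) = card V - 1)"
            by (rule run_mono) (use e4 in \<open>auto dest!: agree_length[where a = Out_lcs] simp: lenv_def\<close>)
        qed
      qed
    qed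
  qed
  then show ?thesis
  proof (rule run_mono)
    have "1 \<le> ?e" "?e \<le> ?e * k" using card_V_le card_V k_pos by auto
    moreover have "(sort_cost c + 60) * (length labels + 1) \<le> (sort_cost c + 60) * (?e * k)"
      using labels_length card_V_le \<open>?e \<le> ?e * k\<close> by (intro mult_le_mono2) linarith
    moreover have "(sort_cost c + 1000) * (?e * k) = (sort_cost c + 60) * (?e * k) + 940 * (?e * k)"
      by (simp add: add_mult_distrib)
    ultimately show "?T \<le> (sort_cost c + 1000) * (?e * k)" using card_V_le by linarith
    fix r' h'
    assume *: "lcs_done (k - 1) h' \<and> length (h' Out_lcs) = card V - 1"
    have "{1..k - 1} = {1..<k}" using k_pos by auto
    then have "h' Out_lcs ! i = card {g \<in> {1..<k}. \<not> boundary g (Suc i)}" if "i < card V - 1" for i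
      using *[THEN conjunct1, unfolded lcs_done_def, rule_format, of "Suc i"] that by (simp add: lcs_upto_def)
    then show "h' Out_lcs = map (\<lambda>p. card {g \<in> {1..<k}. \<not> boundary g p}) [1..<card V]"
      using * by (intro nth_equalityI) auto
  qed
qed

end

section \<open>The whole program\<close>

text \<open>Register \<open>9\<close> becomes the number of copies of the source node, one for each
  graph with nodes; this is where the first bucket starts.\<close>

definition merge_boss_prog :: "nat \<Rightarrow> segment com" where
  "merge_boss_prog c =
    (Assign 6 (Reg 2 +\<^sub>e Reg 3);; Assign 7 (Reg 4 +\<^sub>e Reg 5);;
     Assign 9 ((Const 0 <\<^sub>e Reg 2) +\<^sub>e (Const 0 <\<^sub>e Reg 3)));;
    count_prog (In_W False) (In_Wminus False) 4 0;; count_prog (In_W True) (In_Wminus True) 5 0;;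
    finish_prog c 0;; two_stages_prog;; merge_prog;; lcs_prog c;;
    (Assign 0 (Reg 22);; Assign 1 (Reg 23))"

lemma regs_lcs_prog: "regs (lcs_prog c) \<inter> {22, 23} = {}"
  and segs_lcs_prog: "segs (lcs_prog c) \<inter> {Out_W, Out_Wminus, Out_last} = {}"
  using regs_finish_prog[of c 3] segs_finish_prog[of c 3]
  by (auto simp: lcs_prog_def count_prog_def count_body_def first_boundaries_loop_def lcs_loop_def lcs_pass_prog_def
      reset_prog_def reset_body_def boundary_loop_def boundary_body_def update_loop_def update_body_def)

lemma regs_stage_merge_progs:
    "x \<in> {0, 1, 6} \<Longrightarrow> x \<notin> regs two_stages_prog" "x \<in> {0, 1, 6} \<Longrightarrow> x \<notin> regs merge_prog"
  and segs_stage_merge_progs: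
    "a \<in> {Out_lcs, Work_Words 3} \<Longrightarrow> a \<notin> segs two_stages_prog"
    "a \<in> {Out_lcs, Work_Words 3} \<Longrightarrow> a \<notin> segs merge_prog"
  by (auto simp: two_stages_prog_def stages_prog_def init_body_def merge_pass_prog_def reset_prog_def reset_body_def
      sources_prog_def merge_pass_loop_def merge_pass_body_def fetch_prog_def copy_body_def save_body_def restore_body_def
      merge_prog_def merge_body_def next_node_prog_def head_prog_def take_prog_def emit_prog_def)

context merging
begin

lemma length_EU_le: "length EU \<le> m"
proof -
  have "length EU \<le> length merged" using length_filter_le[of kept merged] by (simp add: filter_kept)
  then show ?thesis using length_merged by (simp add: m_def)
qed

sublocale lcs: lcs_machine k VU XU w \<sigma> n
proof
  show "2 \<le> w" "\<sigma> < 2 ^ w" "k < 2 ^ w" "VU \<noteq> {}" by (fact w \<sigma>_word k_word nonempty)+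
  show "a \<le> \<sigma>" if "(x, a) \<in> XU" for x a using that label_le by auto
  show "card VU \<le> n" by (simp add: n_def card_Un_le)
  show "2 * n < 2 ^ w" by (rule m_word(1))
  show "2 * length (entries VU XU) < 2 ^ w" using length_EU_le m_word(4) by linarith
qed

lemma z_eq: "z = of_bool (0 < card (V False)) + of_bool (0 < card (V True))"
  using card_V_pos by (auto simp: z_def sources_def of_bool_def)

lemma run_merge_boss_prog:
  assumes sig: "1 \<le> \<sigma>" and \<sigma>: "\<sigma> \<le> w ^ c"
    and r: "r = merge_registers k \<sigma> (card (V False)) (card (V True)) (length (ent False)) (length (ent True))"
    and h: "\<And>g. h (In_W g) = map snd (ent g)" "\<And>g. h (In_Wminus g) = map (\<lambda>e. of_bool (first_edge (X g) e)) (ent g)"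
      "\<And>g. h (In_last g) = map (\<lambda>e. of_bool (last_entry (X g) e)) (ent g)"
      "length (h Out_W) = length EU" "length (h Out_Wminus) = length EU" "length (h Out_last) = length EU"
      "h Out_lcs = replicate (card VU - 1) 0" "length (h Work_Bits) = 2 * n" "\<And>j. j < 9 \<Longrightarrow> h (Work_Words j) = replicate \<sigma> 0"
  shows "run M (merge_boss_prog c) (r, h) ((2 * sort_cost c + 4000) * (m * k))
    (\<lambda>r' h'. r' 0 = card VU \<and> r' 1 = length EU \<and> h' Out_W = map snd EU \<and>
      h' Out_Wminus = map (\<lambda>e. of_bool (first_edge XU e)) EU \<and> h' Out_last = map (\<lambda>e. of_bool (last_entry XU e)) EU \<and>
      h' Out_lcs = map (\<lambda>p. card {g \<in> {1..<k}. \<not> U.boundary g p}) [1..<card VU])"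
    (is "run M _ _ _ ?Q")
proof -
  let ?A = "Assign 6 (Reg 2 +\<^sub>e Reg 3);; Assign 7 (Reg 4 +\<^sub>e Reg 5);;
     Assign 9 ((Const 0 <\<^sub>e Reg 2) +\<^sub>e (Const 0 <\<^sub>e Reg 3)) :: segment com"
  let ?C0 = "count_prog (In_W False) (In_Wminus False) 4 0" and ?C1 = "count_prog (In_W True) (In_Wminus True) 5 0"
  let ?T6 = "(sort_cost c + 1000) * (length EU * k) + 4"
  let ?T4 = "1100 * (m * k) + (300 * m + ?T6)"
  let ?T2 = "(100 * length (ent True) + 100) + ((sort_cost c + 60) * (length labels + 1) + ?T4)"
  let ?T1 = "(100 * length (ent False) + 100) + ?T2"
  let ?y0 = "map snd (G.first_edges False)" and ?y1 = "map snd (G.first_edges True)"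
  have labels_eq: "labels = ?y0 @ ?y1" by (simp add: labels_def all_reps_def comp_def)
  have labels_word: "length labels < 2 ^ (w - 1)"
  proof -
    have "2 ^ w = 2 * (2::nat) ^ (w - 1)" using w by (simp add: power_eq_if)
    then show ?thesis using m_word(1) length_labels one_le_z by linarith
  qed
  have lab: "snd e \<in> {1..\<sigma>}" if "first_edge (X g) e" for g e
    using label_bounds[of "(g, e)"] that by (simp add: rep_def)
  have sources: "apply_binop w Add (of_bool (0 < card (V False))) (of_bool (0 < card (V True))) = z"
    using one_less_W w z_eq z_le_n m_word(1) by (simp add: apply_binop_Add)
  have r0: "r 2 = card (V False)" "r 3 = card (V True)" "r 4 = length (ent False)" "r 5 = length (ent True)"
    by (simp_all add: r merge_registers_def)
  have sums: "apply_binop w Add (card (V False)) (card (V True)) = n"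
    "apply_binop w Add (length (ent False)) (length (ent True)) = m"
    using m_word by (simp_all add: apply_binop_Add n_def m_def)
  have "run M (merge_boss_prog c) (r, h) (16 + ?T1) ?Q"
    unfolding merge_boss_prog_def
  proof (rule run_SeqA)
    show "run M ?A (r, h) 16 (\<lambda>r' h'. r' = r(6 := n, 7 := m, 9 := z) \<and> h' = h)"
      by (rule run_wp) (simp_all add: r0 sums sources apply_binop.simps(11))
    fix r1 h1 assume 1: "r1 = r(6 := n, 7 := m, 9 := z) \<and> h1 = h"
    have r1: "r1 0 = k" "r1 1 = \<sigma>" "r1 2 = card (V False)" "r1 3 = card (V True)" "r1 4 = length (ent False)"
      "r1 5 = length (ent True)" "r1 6 = n" "r1 7 = m" "r1 8 = 0" "r1 9 = z"
      using 1 r by (simp_all add: merge_registers_def)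
    show "run M (?C0;; ?C1;; finish_prog c 0;; two_stages_prog;; merge_prog;; lcs_prog c;;
      (Assign 0 (Reg 22);; Assign 1 (Reg 23))) (r1, h1) ?T1 ?Q"
    proof (rule run_SeqA)
      have "counted \<sigma> (h1 (Work_Words 0)) (h1 (Work_Words (0 + 1))) (r1 8) []"
        using 1 h(9)[of 0] h(9)[of 1] r1(9) by (auto simp: counted_def)
      then show "run M ?C0 (r1, h1) (100 * length (ent False) + 100) (\<lambda>r' h'.
          counted \<sigma> (h' (Work_Words 0)) (h' (Work_Words (0 + 1))) (r' 8) ([] @ map snd (filter (first_edge (X False)) (ent False))))"
        by (intro run_count_prog) (use 1 r1 h(1,2) w \<sigma>_word m_word(2) lab in \<open>auto simp: m_def\<close>)
      fix r2 h2
      assume c2: "counted \<sigma> (h2 (Work_Words 0)) (h2 (Work_Words (0 + 1))) (r2 8)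
          ([] @ map snd (filter (first_edge (X False)) (ent False)))"
        and a2: "agree ?C0 r1 h1 r2 h2"
      have r2: "r2 x = r1 x" if "x \<in> {0, 1, 2, 3, 4, 5, 6, 7, 9}" for x
        by (rule agree_reg[OF a2]) (use that in \<open>auto simp: count_prog_def count_body_def\<close>)
      have h2: "h2 a = h a" if "a \<notin> {Work_Words 0, Work_Words 1}" for a
        using agree_seg[OF a2, of a] that 1 by (auto simp: count_prog_def count_body_def)
      have l2: "length (h2 a) = length (h a)" for a using agree_length[OF a2] 1 by simp
      show "run M (?C1;; finish_prog c 0;; two_stages_prog;; merge_prog;; lcs_prog c;;
        (Assign 0 (Reg 22);; Assign 1 (Reg 23))) (r2, h2) ?T2 ?Q"
      proof (rule run_SeqA)
        have "length ?y0 + length (ent True) < 2 ^ w"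
        proof -
          have "length ?y0 \<le> length (ent False)" by (simp add: G.first_edges_def)
          then show ?thesis using m_word(2) by (simp add: m_def)
        qed
        then show "run M ?C1 (r2, h2) (100 * length (ent True) + 100) (\<lambda>r' h'.
            counted \<sigma> (h' (Work_Words 0)) (h' (Work_Words (0 + 1))) (r' 8) (?y0 @ map snd (filter (first_edge (X True)) (ent True))))"
          by (intro run_count_prog) (use c2 r1 r2 h2 h(1,2) w \<sigma>_word lab in \<open>auto simp: G.first_edges_def\<close>)
        fix r3 h3
        assume c3: "counted \<sigma> (h3 (Work_Words 0)) (h3 (Work_Words (0 + 1))) (r3 8)
            (?y0 @ map snd (filter (first_edge (X True)) (ent True)))"
          and a3: "agree ?C1 r2 h2 r3 h3"
        have r3: "r3 x = r1 x" if "x \<in> {0, 1, 2, 3, 4, 5, 6, 7, 9}" for x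
          unfolding r2[OF that, symmetric]
          by (rule agree_reg[OF a3]) (use that in \<open>auto simp: count_prog_def count_body_def\<close>)
        have h3: "h3 a = h a" if "a \<notin> {Work_Words 0, Work_Words 1}" for a
          using agree_seg[OF a3, of a] h2[OF that] that by (auto simp: count_prog_def count_body_def)
        have l3: "length (h3 a) = length (h a)" for a using agree_length[OF a3] l2 by simp
        show "run M (finish_prog c 0;; two_stages_prog;; merge_prog;; lcs_prog c;;
          (Assign 0 (Reg 22);; Assign 1 (Reg 23))) (r3, h3) ((sort_cost c + 60) * (length labels + 1) + ?T4) ?Q"
        proof (rule run_SeqA[OF run_finish_prog[where ys = labels]])
          show "2 \<le> w" "\<sigma> < 2 ^ w" "\<sigma> \<le> w ^ c" by (fact w \<sigma>_word \<sigma>)+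
          show "r3 1 = \<sigma>" using r3[of 1] r1 by simp
          show "counted \<sigma> (h3 (Work_Words 0)) (h3 (Work_Words (0 + 1))) (r3 8) labels"
            using c3 by (simp add: labels_eq G.first_edges_def)
          show "r3 9 + length labels < 2 ^ w" using r3[of 9] r1 length_labels m_word(1) by simp
          show "length labels < 2 ^ (w - 1)" by (rule labels_word)
          show "length (h3 (Work_Words 8)) = \<sigma>" "length (h3 (Work_Words (0 + 2))) = \<sigma>"
            using l3 h(9)[of 8] h(9)[of 2] by (simp_all add: numeral_2_eq_2)
          show "0 + 2 < (8::nat)" by simp
          fix r4 h4
          assume b4: "bucketed (h4 (Work_Words (0 + 1))) (r4 8) (h4 (Work_Words (0 + 2))) labels (r3 9)"
            and a4: "agree (finish_prog c 0) r3 h3 r4 h4"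
          have r4: "r4 x = r1 x" if "x \<in> {0, 1, 2, 3, 4, 5, 6, 7}" for x
          proof -
            have "x \<notin> regs (finish_prog c 0)" using regs_finish_prog[of c 0] that by auto
            then show ?thesis using agree_reg[OF a4, of x] r3[of x] that by auto
          qed
          have h4: "h4 a = h a" if "a \<notin> {Work_Words 0, Work_Words 1, Work_Words 2, Work_Words 8}" for a
          proof -
            have "a \<notin> segs (finish_prog c 0)" using segs_finish_prog[of c 0] that by (auto simp: numeral_2_eq_2)
            then show ?thesis using agree_seg[OF a4, of a] h3[of a] that by auto
          qed
          have l4: "length (h4 a) = length (h a)" for a using agree_length[OF a4] l3 by simp
          have e4: "env r4 h4"
            using r4 h4 l4 r1 h b4 r3[of 9] by (simp add: env_def numeral_2_eq_2)
          have VU_EU: "card VU \<le> length EU" by (rule lcs.card_V_le)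
          show "run M (two_stages_prog;; merge_prog;; lcs_prog c;; (Assign 0 (Reg 22);; Assign 1 (Reg 23)))
            (r4, h4) ?T4 ?Q"
          proof (rule run_SeqA[OF run_two_stages_prog[OF e4]])
            show "card VU \<le> length (h4 Out_last)" "card VU \<le> length (h4 Out_Wminus)"
              using VU_EU l4 h(5,6) by simp_all
            fix r5 h5
            assume 5: "env r5 h5 \<and> (\<forall>p<n. h5 Work_Bits ! p = bit False k p \<and> h5 Work_Bits ! (n + p) = bit True k p)"
              and a5: "agree two_stages_prog r4 h4 r5 h5"
            have r5: "r5 x = r1 x" if "x \<in> {0, 1, 6}" for x
              using agree_reg[OF a5, of x] regs_stage_merge_progs(1)[OF that] r4[of x] that by auto
            have h5: "h5 a = h a" if "a \<in> {Out_lcs, Work_Words 3}" for a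
              using agree_seg[OF a5, of a] segs_stage_merge_progs(1)[OF that] h4[of a] that by auto
            have l5: "length (h5 a) = length (h a)" for a using agree_length[OF a5] l4 by simp
            show "run M (merge_prog;; lcs_prog c;; (Assign 0 (Reg 22);; Assign 1 (Reg 23)))
              (r5, h5) (300 * m + ?T6) ?Q"
            proof (rule run_SeqA[OF run_merge_prog])
              show "env r5 h5" "zbits h5" "1 \<le> \<sigma>" using 5 sig by (auto simp: zbits_def)
              show "length (h5 Out_W) = length EU" "length (h5 Out_Wminus) = length EU" "length (h5 Out_last) = length EU"
                using l5 h by simp_all
              fix r6 h6
              assume 6: "r6 22 = card VU \<and> r6 23 = length EU \<and> h6 Out_W = map snd EU \<and>
                  h6 Out_Wminus = map (\<lambda>e. of_bool (first_edge XU e)) EU \<and> h6 Out_last = map (\<lambda>e. of_bool (last_entry XU e)) EU"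
                and a6: "agree merge_prog r5 h5 r6 h6"
              have r6: "r6 x = r1 x" if "x \<in> {0, 1, 6}" for x
                using agree_reg[OF a6, of x] regs_stage_merge_progs(2)[OF that] r5[OF that] by simp
              have h6: "h6 a = h a" if "a \<in> {Out_lcs, Work_Words 3}" for a
                using agree_seg[OF a6, of a] segs_stage_merge_progs(2)[OF that] h5[OF that] by simp
              have l6: "length (h6 a) = length (h a)" for a using agree_length[OF a6] l5 by simp
              show "run M (lcs_prog c;; (Assign 0 (Reg 22);; Assign 1 (Reg 23))) (r6, h6) ?T6 ?Q"
              proof (rule run_SeqA[OF lcs.run_lcs_prog[OF \<sigma>]])
                show "r6 0 = k" "r6 1 = \<sigma>" "r6 6 = n" "r6 22 = card VU" "r6 23 = length EU"
                  "h6 Out_W = map snd EU" "h6 Out_Wminus = map (\<lambda>e. of_bool (first_edge XU e)) EU"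
                  "h6 Out_last = map (\<lambda>e. of_bool (last_entry XU e)) EU"
                  using 6 r6 r1 by simp_all
                show "h6 Out_lcs = replicate (card VU - 1) 0" "length (h6 Work_Bits) = 2 * n"
                  "h6 (Work_Words 3) = replicate \<sigma> 0" using h6 l6 h by simp_all
                show "length (h6 (Work_Words j)) = \<sigma>" if "j \<in> {4..8}" for j using l6 h(9)[of j] that by simp
                fix r7 h7
                assume 7: "h7 Out_lcs = map (\<lambda>p. card {g \<in> {1..<k}. \<not> U.boundary g p}) [1..<card VU]"
                  and a7: "agree (lcs_prog c) r6 h6 r7 h7"
                have "r7 22 = r6 22" "r7 23 = r6 23" "h7 Out_W = h6 Out_W" "h7 Out_Wminus = h6 Out_Wminus" "h7 Out_last = h6 Out_last"
                  using agree_reg[OF a7, of 22] agree_reg[OF a7, of 23] agree_seg[OF a7, of Out_W]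
                    agree_seg[OF a7, of Out_Wminus] agree_seg[OF a7, of Out_last] regs_lcs_prog[of c] segs_lcs_prog[of c]
                  by auto
                then show "run M (Assign 0 (Reg 22);; Assign 1 (Reg 23)) (r7, h7) 4 ?Q"
                  by (intro run_wp) (use 6 7 in simp_all)
              qed
            qed
          qed
        qed
      qed
    qed
  qed
  then show ?thesis
  proof (rule run_mono)
    note mk = m_le_mk
    have "(sort_cost c + 60) * (length labels + 1) \<le> (sort_cost c + 60) * (m * k)"
      using length_labels one_le_z n_le_m mk(1) by (intro mult_le_mono2) linarith
    moreover have "(sort_cost c + 1000) * (length EU * k) \<le> (sort_cost c + 1000) * (m * k)"
      using length_EU_le by (intro mult_le_mono2 mult_le_mono1)
    moreover have "(2 * sort_cost c + 4000) * (m * k) =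
        (sort_cost c + 60) * (m * k) + (sort_cost c + 1000) * (m * k) + 2940 * (m * k)"
      by (simp add: algebra_simps)
    moreover have "length (ent False) + length (ent True) = m" by (simp add: m_def)
    ultimately show "16 + ?T1 \<le> (2 * sort_cost c + 4000) * (m * k)" using mk by linarith
  qed
qed

end

section \<open>De Bruijn graphs of two collections as an instance\<close>

lemma two_graphs_de_bruijn:
  assumes "1 \<le> k" "collection \<sigma> C0" "collection \<sigma> C1"
  shows "two_graphs k (\<lambda>g. rev_nodes k (if g then C1 else C0)) (\<lambda>g. rev_edges k (if g then C1 else C0))"
proof (rule two_graphs.intro)
  fix g
  have "collection \<sigma> (if g then C1 else C0)" using assms by simp
  with assms(1) show "graph k (rev_nodes k (if g then C1 else C0)) (rev_edges k (if g then C1 else C0))"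
    by (rule graph_de_bruijn)
qed

lemma rev_nodes_Un: "rev_nodes k (C0 \<union> C1) = rev_nodes k C0 \<union> rev_nodes k C1"
  and rev_edges_Un: "rev_edges k (C0 \<union> C1) = rev_edges k C0 \<union> rev_edges k C1"
  by (auto simp: rev_nodes_def rev_edges_def occurs_def)

lemma rev_nodes_nonempty: "C \<noteq> {} \<Longrightarrow> rev_nodes k C \<noteq> {}"
proof -
  assume "C \<noteq> {}"
  then have "replicate k 0 \<in> rev_nodes k C" by (auto simp: rev_nodes_def occurs_def)
  then show ?thesis by blast
qed

lemma input_boss_simps:
  assumes "R \<in> {plain_boss G, vo_boss G}"
  shows "boss_W R = boss_W (plain_boss G)" "boss_Wminus R = boss_Wminus (plain_boss G)"
    "boss_last R = boss_last (plain_boss G)"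
  using assms by (auto simp: vo_boss_def)

theorem theorem3:
  fixes c :: nat
  shows "\<exists>(P :: segment com) (K :: nat).
    \<forall>(w :: nat) (k :: nat) (\<sigma> :: nat) (C0 :: nat list set) (C1 :: nat list set)
      (G0 :: dbg) (G1 :: dbg) (G :: dbg) (R0 :: boss) (R1 :: boss)
      (n0 :: nat) (n1 :: nat) (m0 :: nat) (m1 :: nat) (n :: nat) (m :: nat).
      1 \<le> k \<longrightarrow> 1 \<le> \<sigma> \<longrightarrow> \<sigma> \<le> w ^ c \<longrightarrow>
      collection \<sigma> C0 \<longrightarrow> collection \<sigma> C1 \<longrightarrow> C0 \<union> C1 \<noteq> {} \<longrightarrow>
      G0 = de_bruijn k C0 \<longrightarrow> G1 = de_bruijn k C1 \<longrightarrow> G = de_bruijn k (C0 \<union> C1) \<longrightarrow>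
      R0 \<in> {plain_boss G0, vo_boss G0} \<longrightarrow> R1 \<in> {plain_boss G1, vo_boss G1} \<longrightarrow>
      n0 = card (nodes G0) \<longrightarrow> n1 = card (nodes G1) \<longrightarrow>
      m0 = length (boss_W R0) \<longrightarrow> m1 = length (boss_W R1) \<longrightarrow>
      n = n0 + n1 \<longrightarrow> m = m0 + m1 \<longrightarrow>
      word_size_ok w k \<sigma> m \<longrightarrow>
      (\<exists>t s. exec (merge_machine w k \<sigma>) P
               (merge_registers k \<sigma> n0 n1 m0 m1, merge_memory K \<sigma> n R0 R1 (vo_boss G)) t s \<and>
             t \<le> K * (m * k) \<and>
             returns_boss s (card (nodes G)) (vo_boss G))"
proof (rule exI[of _ "merge_boss_prog c"], rule exI[of _ "2 * sort_cost c + 4000"], intro allI impI, goal_cases)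
  case (1 w k \<sigma> C0 C1 G0 G1 G R0 R1 n0 n1 m0 m1 n m)
  define V where "V g = rev_nodes k (if g then C1 else C0)" for g
  define X where "X g = rev_edges k (if g then C1 else C0)" for g
  \<comment> \<open>One constant serves twice: as the factor of \<open>m * k\<close> in the running
    time and as the number of work arrays, which has to be at least \<open>9\<close>.\<close>
  let ?K = "2 * sort_cost c + 4000"
  interpret two_graphs k V X unfolding V_def X_def by (rule two_graphs_de_bruijn) (use 1 in auto)
  have C: "collection \<sigma> (C0 \<union> C1)" using 1 by (auto simp: collection_def)
  have VU: "VU = rev_nodes k (C0 \<union> C1)" "XU = rev_edges k (C0 \<union> C1)"
    by (simp_all add: V_def X_def rev_nodes_Un rev_edges_Un)
  have R: "boss_W (if g then R1 else R0) = map snd (ent g)"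
    "boss_Wminus (if g then R1 else R0) = map (\<lambda>e. of_bool (first_edge (X g) e)) (ent g)"
    "boss_last (if g then R1 else R0) = map (\<lambda>e. of_bool (last_entry (X g) e)) (ent g)" for g
  proof -
    have "collection \<sigma> (if g then C1 else C0)" using 1 by simp
    note plain = plain_boss_entries[OF 1(1) this, folded V_def X_def]
    have "(if g then R1 else R0) \<in> {plain_boss (de_bruijn k (if g then C1 else C0)), vo_boss (de_bruijn k (if g then C1 else C0))}"
      using 1(7,8,10,11) by (cases g) simp_all
    note input = input_boss_simps[OF this]
    show "boss_W (if g then R1 else R0) = map snd (ent g)"
      "boss_Wminus (if g then R1 else R0) = map (\<lambda>e. of_bool (first_edge (X g) e)) (ent g)"
      "boss_last (if g then R1 else R0) = map (\<lambda>e. of_bool (last_entry (X g) e)) (ent g)"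
      by (simp_all only: input plain)
  qed
  have sizes: "n0 = card (V False)" "n1 = card (V True)" "m0 = length (ent False)" "m1 = length (ent True)"
    using vo_boss_lcs(2)[OF 1(1,4)] vo_boss_lcs(2)[OF 1(1,5)] 1(7,8,12,13,14,15) R(1)[of False] R(1)[of True]
    by (simp_all add: V_def)
  have VU_ne: "VU \<noteq> {}" using rev_nodes_nonempty[OF 1(6)] by (simp add: VU)
  \<comment> \<open>A label takes at least one bit, so \<open>word_size_ok\<close> leaves room for
    \<open>3 * m\<close>.\<close>
  have "1 \<le> floorlog 2 \<sigma>" using 1(2) by (simp add: floorlog_def)
  then have "m * 3 \<le> m * (floorlog 2 \<sigma> + 2)" by (intro mult_le_mono2) simp
  then have "m * 3 < 2 ^ w"
    using 1(18)[unfolded word_size_ok_def, THEN conjunct2, THEN conjunct2] by (rule le_less_trans)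
  then have m3: "3 * (length (ent False) + length (ent True)) < 2 ^ w"
    using 1(17) sizes by (simp add: mult.commute)
  have m1: "1 \<le> length (ent False) + length (ent True)"
  proof -
    obtain x g where "x \<in> V g" using VU_ne by blast
    then obtain a where "(x, a) \<in> set (ent g)" by (rule node_entry)
    then have "1 \<le> length (ent g)" by (cases "ent g") auto
    then show ?thesis by (cases g) auto
  qed
  \<comment> \<open>There is a node, hence an entry; so \<open>3 \<le> 3 * m < 2 ^ w\<close>, which
    rules out smaller words.\<close>
  have w: "2 \<le> w"
  proof (rule ccontr)
    assume "\<not> 2 \<le> w"
    then have "2 ^ w \<le> (2::nat) ^ 1" by (intro power_increasing) auto
    moreover have "3 * 1 \<le> 3 * (length (ent False) + length (ent True))" using m1 by (rule mult_le_mono2)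
    ultimately have "3 * 1 < (2::nat) ^ 1" using m3 by (meson le_less_trans less_le_trans)
    then show False by simp
  qed
  interpret mg: merging k V X w \<sigma>
  proof
    show "2 \<le> w" "VU \<noteq> {}" "3 * (length (ent False) + length (ent True)) < 2 ^ w" by fact+
    show "\<sigma> < 2 ^ w" "k < 2 ^ w" using 1(18) by (simp_all add: word_size_ok_def)
    show "a \<le> \<sigma>" if "(x, a) \<in> X g" for x a g
      using rev_edges_D[of \<sigma> "if g then C1 else C0" x a k] that 1(4,5) by (auto simp: X_def split: if_splits)
  qed
  note boss = plain_boss_entries[OF 1(1) C, folded VU 1(9)]
  note lcs = vo_boss_lcs[OF 1(1) C, folded VU 1(9)]
  let ?h = "merge_memory ?K \<sigma> n R0 R1 (vo_boss G)"
  have vo: "boss_W (vo_boss G) = boss_W (plain_boss G)" "boss_Wminus (vo_boss G) = boss_Wminus (plain_boss G)"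
    "boss_last (vo_boss G) = boss_last (plain_boss G)" "boss_lcs (vo_boss G) = Some (lcs_array (vo_boss G))"
    by (simp_all add: vo_boss_def lcs_array_def)
  have "run mg.M (merge_boss_prog c) (merge_registers k \<sigma> n0 n1 m0 m1, ?h) (?K * (mg.m * k))
    (\<lambda>r' h'. r' 0 = card VU \<and> r' 1 = length mg.EU \<and> h' Out_W = map snd mg.EU \<and>
      h' Out_Wminus = map (\<lambda>e. of_bool (first_edge XU e)) mg.EU \<and> h' Out_last = map (\<lambda>e. of_bool (last_entry XU e)) mg.EU \<and>
      h' Out_lcs = map (\<lambda>p. card {g \<in> {1..<k}. \<not> U.boundary g p}) [1..<card VU])"
  proof (rule mg.run_merge_boss_prog)
    show "1 \<le> \<sigma>" "\<sigma> \<le> w ^ c" by fact+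
    show "merge_registers k \<sigma> n0 n1 m0 m1 =
        merge_registers k \<sigma> (card (V False)) (card (V True)) (length (ent False)) (length (ent True))" by (simp only: sizes)
    show "?h (In_W g) = map snd (ent g)" "?h (In_Wminus g) = map (\<lambda>e. of_bool (first_edge (X g) e)) (ent g)"
      "?h (In_last g) = map (\<lambda>e. of_bool (last_entry (X g) e)) (ent g)" for g
      by (simp_all only: merge_memory.simps R)
    show "length (?h Out_W) = length mg.EU" "length (?h Out_Wminus) = length mg.EU" "length (?h Out_last) = length mg.EU"
      by (simp_all only: merge_memory.simps vo boss length_map length_replicate)
    show "?h Out_lcs = replicate (card VU - 1) 0"
      by (simp only: merge_memory.simps lcs length_map length_upt)
    show "length (?h Work_Bits) = 2 * mg.n"
      by (simp only: merge_memory.simps length_replicate 1(16) sizes mg.n_def)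
    show "?h (Work_Words j) = replicate \<sigma> 0" if "j < 9" for j using that by simp
  qed
  then obtain t r' h' where ex: "exec (merge_machine w k \<sigma>) (merge_boss_prog c) (merge_registers k \<sigma> n0 n1 m0 m1, ?h) t (r', h')"
    "t \<le> ?K * (mg.m * k)"
    and r': "r' 0 = card VU" "r' 1 = length mg.EU"
    and h': "h' Out_W = map snd mg.EU" "h' Out_Wminus = map (\<lambda>e. of_bool (first_edge XU e)) mg.EU"
      "h' Out_last = map (\<lambda>e. of_bool (last_entry XU e)) mg.EU"
      "h' Out_lcs = map (\<lambda>p. card {g \<in> {1..<k}. \<not> U.boundary g p}) [1..<card VU]"
    unfolding run_def by blast
  have lcs_eq: "boss_lcs (vo_boss G) = Some (h' Out_lcs)" by (simp only: vo(4) lcs(1) h'(4))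
  have "returns_boss (r', h') (card (nodes G)) (vo_boss G)"
    unfolding returns_boss_def
  proof (intro conjI)
    show "vo_boss G = \<lparr>boss_W = snd (r', h') Out_W, boss_Wminus = snd (r', h') Out_Wminus,
        boss_last = snd (r', h') Out_last, boss_lcs = Some (snd (r', h') Out_lcs)\<rparr>"
      by (rule boss.equality) (simp_all add: vo(1-3) boss h'(1-3) lcs_eq)
    show "fst (r', h') 0 = card (nodes G)" "fst (r', h') 1 = length (boss_W (vo_boss G))"
      by (simp_all only: fst_conv r' lcs(2) vo(1) boss(1) length_map)
  qed
  moreover have "mg.m = m" using sizes 1(17) by (simp add: mg.m_def)
  ultimately show ?case using ex by blast
qed

end
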